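(* Let $\mathcal W=[0,1]^{d_w}$, $1\le d_w<\infty$, and $B\in(0,\infty)$. Suppose that $Y|X,W\sim\mathcal N(X\beta_0+\eta_0(W),\sigma_{01}^2)$ and $X|W\sim\mathcal N(m_{02}(W),\sigma_{02}^2)$, where $\beta_0\in(-B,B)$, $\eta_0\in C^{\alpha_{0,\eta}}([0,1]^{d_w})\cap H^{\alpha_{0,\eta}}([0,1]^{d_w})$ with $\alpha_{0,\eta}>0$, $m_{02}\in C^{\alpha_{0,2}}([0,1]^{d_w})\cap H^{\alpha_{0,2}}([0,1]^{d_w})$ with $\alpha_{0,2}>0$, and $\sigma_{01}^2,\sigma_{02}^2\in(0,\infty)$ are known. Suppose that Bayesian inference is based on the model $$Y_i\,|\,\{(X_i,W_i')'\}_{i=1}^n,\beta,\eta\ \overset{ind}{\sim}\ \mathcal N(X_i\beta+\eta(W_i),\sigma_{01}^2),\quad i=1,\dots,n,\qquad\beta\sim\Pi_{\mathcal B},\ \eta\sim\Pi_{\mathcal H},\ \beta\text{ and }\eta\text{ independent},$$ with $\Pi_{\mathcal B}$ the uniform distribution over $\mathcal B=[-B,B]$ and $\Pi_{\mathcal H}$ the law of a centered Matérn Gaussian process on $[0,1]^{d_w}$ with regularity parameter $\alpha_\eta>0$. If $$\alpha_\eta>\frac{d_w}2,\quad\alpha_{0,\eta}>\frac{\alpha_\eta}2+\frac{d_w}4,\quad\alpha_{0,2}>\frac{\alpha_\eta}2+\frac{d_w}4,$$ then the marginal posterior of $\beta$ satisfies, for $P_{0,W}^\infty$-almost every fixed realization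 $\{w_i\}_{i\ge1}$ of $\{W_i\}_{i\ge1}$, as $n\to\infty$, $$\left\|\Pi(\beta\in\cdot\,|\,\{(Y_i,X_i,w_i')'\}_{i=1}^n)-\mathcal N\left(\beta_0+\frac{\tilde\Delta_{n,0}}{\sqrt n},\frac1n\tilde I_n(m_0)^{-1}\right)\right\|_{TV}\to0\quad\text{in }P_{0,YX|W}^{(n)}\text{-probability},$$ where $$\tilde I_n(m_0)=\frac1n\sum_{i=1}^n\left(\frac{X_i-m_{02}(w_i)}{\sigma_{01}}\right)^2,\qquad \tilde\ell_n(\beta_0,m_0)=\frac1{\sigma_{01}^2}\sum_{i=1}^n(Y_i-m_{01}(w_i)-(X_i-m_{02}(w_i))\beta_0)(X_i-m_{02}(w_i)),$$ and $\tilde\Delta_{n,0}=\tilde I_n(m_0)^{-1}n^{-1/2}\tilde\ell_n(\beta_0,m_0)$.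
   Context: Data. $(Y,X,W')'$ has law $P_0$, $Y,X$ real-valued, $W\in[0,1]^{d_w}$. The sequence $\{(Y_i,X_i,W_i')'\}_{i\ge1}$ is i.i.d. from $P_0$; $P_{0,W}^\infty$ is the law of $\{W_i\}_{i\ge1}$. For a fixed realization $\{w_i\}$, $P_{0,YX|W}^{(n)}=\bigotimes_{i=1}^nP_{0,YX|w_i}$, where $P_{0,YX|w}$ is the conditional law of $(Y,X)'$ given $W=w$. $m_{01}(W)=E_{P_0}[Y|W]$ (so $m_{01}=\eta_0+\beta_0m_{02}$), $m_{02}(W)=E_{P_0}[X|W]$, $m_0=(m_{01},m_{02})$. Posterior. The posterior of $(\beta,\eta)$ is proportional to $\prod_{i=1}^n\exp\left(-\frac1{2\sigma_{01}^2}(Y_i-X_i\beta-\eta(W_i))^2\right)d\Pi_{\mathcal B}(\beta)\,d\Pi_{\mathcal H}(\eta)$, and $\Pi(\beta\in\cdot|\text{data})$ is its $\beta$-marginal. $\|P-Q\|_{TV}=\sup_A|P(A)-Q(A)|$. Matérn process. The centered Matérn Gaussian process with regularity $\alpha>0$ on $[0,1]^{d_w}$ is the centered Gaussian process with covariance $\kappa_\alpha(w_s,w_t)=\int_{\mathbb R^{d_w}}\exp(-i\lambda'(w_s-w_t))(1+\|\lambda\|_2^2)^{-\alpha-d_w/2}\,d\lambda$ (with continuous sample paths). Function spaces. $C^\alpha([0,1]^{d_w})$ is the Hölder space of functions that are $\lfloor\alpha\rfloor$-times continuously differentiable with $\lfloor\alpha\rfloor$th derivatives $(\alpha-\lfloor\alpha\rfloor)$-Lipschitz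 (Hölder). $H^\alpha([0,1]^{d_w})$ is the Sobolev space of functions on $[0,1]^{d_w}$ that can be extended to a function $f$ on $\mathbb R^{d_w}$ with Fourier transform $\hat f$ satisfying $\int_{\mathbb R^{d_w}}|\hat f(\lambda)|^2(1+\|\lambda\|_2^2)^\alpha\,d\lambda<\infty$. *)

theory Defs
  imports "HOL-Probability.Probability"
begin

text \<open>The second parameter is the variance; variance 0 gives the point mass.\<close>

definition normal_law :: "real \<Rightarrow> real \<Rightarrow> real measure" where
  "normal_law m v =
     (if v = 0 then return borel m else density lborel (\<lambda>x. ennreal (normal_density m (sqrt v) x)))"

text \<open>The kernel \<open>K\<close> is a version of the regular conditional law under \<open>M\<close> of the
  \<open>S\<close>-valued variable \<open>Z\<close> given the \<open>T\<close>-valued variable \<open>U\<close>.\<close>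

definition cond_law ::
  "'a measure \<Rightarrow> 'b measure \<Rightarrow> ('a \<Rightarrow> 'b) \<Rightarrow> 'c measure \<Rightarrow> ('a \<Rightarrow> 'c) \<Rightarrow> ('c \<Rightarrow> 'b measure) \<Rightarrow> bool"
  where
  "cond_law M S Z T U K \<longleftrightarrow>
     Z \<in> measurable M S \<and> U \<in> measurable M T \<and> K \<in> measurable T (prob_algebra S) \<and>
     (\<forall>A\<in>sets T. \<forall>B\<in>sets S.
        emeasure M {\<omega>\<in>space M. U \<omega> \<in> A \<and> Z \<omega> \<in> B} =
        (\<integral>\<^sup>+u\<in>A. emeasure (K u) B \<partial>distr M T U))"

text \<open>\<open>m\<close> is a version of the function \<open>u \<mapsto> E[Z | U = u]\<close>.\<close>

definition regression_function ::
  "'a measure \<Rightarrow> ('a \<Rightarrow> real) \<Rightarrow> 'c measure \<Rightarrow> ('a \<Rightarrow> 'c) \<Rightarrow> ('c \<Rightarrow> real) \<Rightarrow> bool" where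
  "regression_function M Z T U m \<longleftrightarrow>
     integrable M Z \<and> U \<in> measurable M T \<and> m \<in> borel_measurable T \<and>
     (AE \<omega> in M. m (U \<omega>) = real_cond_exp M (vimage_algebra (space M) U T) Z \<omega>)"

abbreviation unit_cube :: "(real ^ 'd) set" where
  "unit_cube \<equiv> cbox 0 1"

abbreviation cube_borel :: "(real ^ 'd) measure" where
  "cube_borel \<equiv> restrict_space borel unit_cube"

text \<open>\<open>k\<close>-times continuously differentiable on \<open>S\<close> with \<open>\<gamma>\<close>-Hoelder derivatives of order \<open>k\<close>.
  On a convex set with nonempty interior the gradient \<open>g\<close>, taken relative to \<open>S\<close>, is unique.
  For \<open>\<gamma> = 0\<close> the Hoelder condition is boundedness of the oscillation (\<open>0 powr 0 = 0\<close>),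
  which is automatic on a compact set.\<close>

primrec Ck_hoelder :: "nat \<Rightarrow> real \<Rightarrow> (real ^ 'd) set \<Rightarrow> (real ^ 'd \<Rightarrow> real) \<Rightarrow> bool" where
  "Ck_hoelder 0 \<gamma> S f \<longleftrightarrow>
     continuous_on S f \<and> (\<exists>L. \<forall>x\<in>S. \<forall>y\<in>S. \<bar>f x - f y\<bar> \<le> L * dist x y powr \<gamma>)"
| "Ck_hoelder (Suc k) \<gamma> S f \<longleftrightarrow>
     (\<exists>g. (\<forall>x\<in>S. (f has_derivative (\<lambda>h. g x \<bullet> h)) (at x within S)) \<and>
          (\<forall>j. Ck_hoelder k \<gamma> S (\<lambda>x. g x $ j)))"

definition hoelder_space :: "real \<Rightarrow> (real ^ 'd \<Rightarrow> real) set" where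
  "hoelder_space \<alpha> = {f. Ck_hoelder (nat \<lfloor>\<alpha>\<rfloor>) (\<alpha> - of_int \<lfloor>\<alpha>\<rfloor>) unit_cube f}"

text \<open>The Fourier transform of a square-integrable function is the \<open>L\<^sup>2\<close>-limit of the
  transforms of its truncations to balls (no normalising constant).\<close>

definition truncated_fourier :: "(real ^ 'd \<Rightarrow> real) \<Rightarrow> real \<Rightarrow> real ^ 'd \<Rightarrow> complex" where
  "truncated_fourier f R l = (LINT x:cball 0 R|lborel. cis (- (l \<bullet> x)) * complex_of_real (f x))"

definition is_fourier_L2 :: "(real ^ 'd \<Rightarrow> real) \<Rightarrow> (real ^ 'd \<Rightarrow> complex) \<Rightarrow> bool" where
  "is_fourier_L2 f fhat \<longleftrightarrow>
     f \<in> borel_measurable borel \<and> integrable lborel (\<lambda>x. (f x)\<^sup>2) \<and>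
     fhat \<in> borel_measurable borel \<and>
     ((\<lambda>R. \<integral>\<^sup>+l. ennreal ((cmod (fhat l - truncated_fourier f R l))\<^sup>2) \<partial>lborel) \<longlongrightarrow> 0) at_top"

definition sobolev_space :: "real \<Rightarrow> (real ^ 'd \<Rightarrow> real) set" where
  "sobolev_space \<alpha> =
     {f. \<exists>F Fhat. (\<forall>x\<in>unit_cube. F x = f x) \<and> is_fourier_L2 F Fhat \<and>
           (\<integral>\<^sup>+l. ennreal ((cmod (Fhat l))\<^sup>2 * (1 + (norm l)\<^sup>2) powr \<alpha>) \<partial>lborel) < \<infinity>}"

text \<open>Continuous functions on the cube (extended by \<open>undefined\<close> outside) with the
  \<open>\<sigma>\<close>-algebra generated by the point evaluations.\<close>

definition path_space :: "(real ^ 'd \<Rightarrow> real) measure" where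
  "path_space =
     restrict_space (\<Pi>\<^sub>M w\<in>unit_cube. (borel :: real measure)) {f. continuous_on unit_cube f}"

definition gaussian_process :: "('t \<Rightarrow> real) measure \<Rightarrow> 't set \<Rightarrow> bool" where
  "gaussian_process M T \<longleftrightarrow>
     prob_space M \<and> (\<forall>t\<in>T. (\<lambda>f. f t) \<in> borel_measurable M) \<and>
     (\<forall>S a. finite S \<and> S \<subseteq> T \<longrightarrow>
        (\<exists>m v. v \<ge> 0 \<and> distr M borel (\<lambda>f. \<Sum>s\<in>S. a s * f s) = normal_law m v))"

definition centered_gaussian_process ::
  "('t \<Rightarrow> real) measure \<Rightarrow> 't set \<Rightarrow> ('t \<Rightarrow> 't \<Rightarrow> real) \<Rightarrow> bool" where
  "centered_gaussian_process M T \<kappa> \<longleftrightarrow>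
     gaussian_process M T \<and>
     (\<forall>t\<in>T. (LINT f|M. f t) = 0) \<and>
     (\<forall>s\<in>T. \<forall>t\<in>T. (LINT f|M. f s * f t) = \<kappa> s t)"

text \<open>The integral is real by symmetry in \<open>l\<close>.\<close>

definition matern_kernel :: "real \<Rightarrow> real ^ 'd \<Rightarrow> real ^ 'd \<Rightarrow> real" where
  "matern_kernel \<alpha> s t =
     Re (LINT l|lborel. cis (- (l \<bullet> (s - t))) *
           complex_of_real ((1 + (norm l)\<^sup>2) powr (- \<alpha> - real CARD('d) / 2)))"

definition matern_prior :: "real \<Rightarrow> (real ^ 'd \<Rightarrow> real) measure \<Rightarrow> bool" where
  "matern_prior \<alpha> M \<longleftrightarrow>
     sets M = sets path_space \<and>
     centered_gaussian_process M unit_cube (matern_kernel \<alpha>)"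

definition posterior :: "'p measure \<Rightarrow> ('p \<Rightarrow> real) \<Rightarrow> 'p measure" where
  "posterior M L = density M (\<lambda>\<theta>. ennreal (L \<theta>) / (\<integral>\<^sup>+\<theta>'. ennreal (L \<theta>') \<partial>M))"

abbreviation obs_Y :: "real \<times> real \<times> 'w \<Rightarrow> real" where
  "obs_Y \<equiv> (\<lambda>(y, x, w). y)"

abbreviation obs_X :: "real \<times> real \<times> 'w \<Rightarrow> real" where
  "obs_X \<equiv> (\<lambda>(y, x, w). x)"

abbreviation obs_W :: "real \<times> real \<times> 'w \<Rightarrow> 'w" where
  "obs_W \<equiv> (\<lambda>(y, x, w). w)"

text \<open>From here on, \<open>d i = (Y, X)\<close> and \<open>w i = W\<close> for observation \<open>i\<close>; observations are
  numbered from 0, so a sample of size \<open>n\<close> has the indices \<open>i < n\<close>.\<close>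

definition plm_likelihood ::
  "real \<Rightarrow> nat \<Rightarrow> (nat \<Rightarrow> real \<times> real) \<Rightarrow> (nat \<Rightarrow> 'w) \<Rightarrow> real \<times> ('w \<Rightarrow> real) \<Rightarrow> real" where
  "plm_likelihood \<sigma> n d w = (\<lambda>(\<beta>, \<eta>).
     \<Prod>i<n. exp (- (1 / (2 * \<sigma>\<^sup>2)) * (fst (d i) - snd (d i) * \<beta> - \<eta> (w i))\<^sup>2))"

definition beta_posterior ::
  "real \<Rightarrow> real measure \<Rightarrow> ('w \<Rightarrow> real) measure \<Rightarrow>
     nat \<Rightarrow> (nat \<Rightarrow> real \<times> real) \<Rightarrow> (nat \<Rightarrow> 'w) \<Rightarrow> real measure" where
  "beta_posterior \<sigma> prior\<beta> prior\<eta> n d w =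
     distr (posterior (prior\<beta> \<Otimes>\<^sub>M prior\<eta>) (plm_likelihood \<sigma> n d w)) borel fst"

definition information ::
  "real \<Rightarrow> ('w \<Rightarrow> real) \<Rightarrow> nat \<Rightarrow> (nat \<Rightarrow> real \<times> real) \<Rightarrow> (nat \<Rightarrow> 'w) \<Rightarrow> real" where
  "information \<sigma> m2 n d w = 1 / real n * (\<Sum>i<n. ((snd (d i) - m2 (w i)) / \<sigma>)\<^sup>2)"

definition score ::
  "real \<Rightarrow> real \<Rightarrow> ('w \<Rightarrow> real) \<Rightarrow> ('w \<Rightarrow> real) \<Rightarrow>
     nat \<Rightarrow> (nat \<Rightarrow> real \<times> real) \<Rightarrow> (nat \<Rightarrow> 'w) \<Rightarrow> real" where
  "score \<sigma> \<beta> m1 m2 n d w =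
     1 / \<sigma>\<^sup>2 * (\<Sum>i<n. (fst (d i) - m1 (w i) - (snd (d i) - m2 (w i)) * \<beta>) *
                        (snd (d i) - m2 (w i)))"

definition efficient_shift ::
  "real \<Rightarrow> real \<Rightarrow> ('w \<Rightarrow> real) \<Rightarrow> ('w \<Rightarrow> real) \<Rightarrow>
     nat \<Rightarrow> (nat \<Rightarrow> real \<times> real) \<Rightarrow> (nat \<Rightarrow> 'w) \<Rightarrow> real" where
  "efficient_shift \<sigma> \<beta> m1 m2 n d w =
     inverse (information \<sigma> m2 n d w) * (1 / sqrt (real n)) * score \<sigma> \<beta> m1 m2 n d w"

definition tv_dist :: "'a measure \<Rightarrow> 'a measure \<Rightarrow> real" where
  "tv_dist P Q = (SUP A\<in>sets P. \<bar>measure P A - measure Q A\<bar>)"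

text \<open>The outer measure is the probability itself on measurable events; using it avoids that a
  nonmeasurable event would count as having probability 0.\<close>

definition tendsto_zero_in_prob :: "(nat \<Rightarrow> 'a measure) \<Rightarrow> (nat \<Rightarrow> 'a \<Rightarrow> real) \<Rightarrow> bool" where
  "tendsto_zero_in_prob P T \<longleftrightarrow>
     (\<forall>\<epsilon>>0. (\<lambda>n. outer_measure_of (P n) {\<omega>\<in>space (P n). \<bar>T n \<omega>\<bar> > \<epsilon>}) \<longlonglongrightarrow> 0)"

end

theory Submission
  imports Defs "HOL-Complex_Analysis.Complex_Analysis"
begin

text \<open>Let \<open>K\<close> be the prior covariance matrix of \<open>\<eta>\<close> at the design points, \<open>R = \<sigma>\<^sup>2 (\<sigma>\<^sup>2 I + K)\<^sup>-\<^sup>1\<close> with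
  \<open>\<sigma> = \<sigma>\<^sub>0\<^sub>1\<close>, and \<open>S = I - R\<close>. A Cameron--Martin shift shows that the likelihood, integrated over \<open>\<eta>\<close>, is
  the exponential of a quadratic polynomial in \<open>\<beta>\<close>, so that for every fixed sample the marginal posterior
  of \<open>\<beta>\<close> is a normal law conditioned on \<open>[-B, B]\<close>, of precision \<open>X' R X / \<sigma>\<^sup>2\<close>. Write \<open>v = X - m\<close>,
  where \<open>m\<close> is the regression function of \<open>X\<close>, and \<open>e = Y - X \<beta>\<^sub>0 - \<eta>\<^sub>0\<close>. The target has precision
  \<open>v' v / \<sigma>\<^sup>2\<close> and centre \<open>\<beta>\<^sub>0 + v' e / v' v\<close>. By second moments the deviations of the posterior
  parameters are negligible as soon as \<open>tr S = o(n)\<close>, and \<open>f' R f = o(\<surd>n)\<close> for \<open>f = m\<close> and \<open>f = \<eta>\<^sub>0\<close>; the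
  bias is the product \<open>m' R \<eta>\<^sub>0\<close>, which Cauchy--Schwarz makes \<open>o(\<surd>n)\<close>.

  The trace bound only uses continuity of the Matern kernel. For the other one, \<open>f' R f\<close> is the minimum of
  \<open>|f - h|\<^sup>2 + \<sigma>\<^sup>2 \<parallel>h\<parallel>\<^sup>2\<close> over the reproducing kernel space. With \<open>h\<close> a smoothing of \<open>f\<close> at scale \<open>\<delta>\<close>, the
  Hoelder condition gives \<open>|f - h| = O(\<surd>n \<delta>\<^sup>a)\<close> with \<open>a\<close> the regularity of \<open>f\<close>, and the Sobolev condition gives
  \<open>\<parallel>h\<parallel> = O(\<delta>\<^sup>-\<^sup>b)\<close> with \<open>b = max 0 (\<alpha> + d/2 - a)\<close>, \<open>\<alpha>\<close> being
  the regularity of the prior; some choice of \<open>\<delta>\<close> makes the sum \<open>o(\<surd>n)\<close> because \<open>a > \<alpha>/2 + d/4\<close>.\<close>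

section \<open>Quadratic forms of ridge regression\<close>

text \<open>The covariance matrix may be singular: design points may repeat, and the process is only
  known to have normal linear combinations. So there is no joint density in which to perform the
  shift. Instead the Gaussian factors of the likelihood become mixtures of characters, for which
  exponential tilting is an identity between characteristic functions; analytic continuation
  supplies the real exponent. The other obstacle is the boundary of the cube. The Hoelder condition
  holds inside only, the Sobolev condition concerns an extension that need not be Hoelder outside,
  and one approximation has to use both. Averaging along segments towards points of the cube,
  instead of around \<open>x\<close>, reconciles them; it dilates the frequencies, which costs a
  factor \<open>2 ^ CARD('d)\<close>. The trace needs no rate: a finite net of the cube gives
  \<open>tr S \<le> e n + Q\<close> for each \<open>e > 0\<close>, with \<open>Q\<close> independent
  of the design. All bounds thus hold for every design in the cube, and the sampling of
  \<open>W\<close> enters only through the null sets on which versions of conditional laws and of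
  regression functions differ.\<close>

text \<open>Gram matrices are functions of two indices, of which only those below \<open>n\<close> matter.\<close>

definition dotp :: "nat \<Rightarrow> (nat \<Rightarrow> real) \<Rightarrow> (nat \<Rightarrow> real) \<Rightarrow> real" where
  "dotp n u v = (\<Sum>i<n. u i * v i)"

definition mat_app :: "nat \<Rightarrow> (nat \<Rightarrow> nat \<Rightarrow> real) \<Rightarrow> (nat \<Rightarrow> real) \<Rightarrow> nat \<Rightarrow> real" where
  "mat_app n K b i = (\<Sum>j<n. K i j * b j)"

definition psd_mat :: "nat \<Rightarrow> (nat \<Rightarrow> nat \<Rightarrow> real) \<Rightarrow> bool" where
  "psd_mat n K \<longleftrightarrow> (\<forall>i<n. \<forall>j<n. K i j = K j i) \<and> (\<forall>b. 0 \<le> dotp n b (mat_app n K b))"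

lemma dotp_commute: "dotp n u v = dotp n v u"
  by (simp add: dotp_def mult.commute)

lemma dotp_cong: "(\<And>i. i < n \<Longrightarrow> u i = u' i) \<Longrightarrow> (\<And>i. i < n \<Longrightarrow> v i = v' i) \<Longrightarrow> dotp n u v = dotp n u' v'"
  by (simp add: dotp_def)

lemma dotp_add_left: "dotp n (\<lambda>i. u i + v i) w = dotp n u w + dotp n v w"
  and dotp_add_right: "dotp n w (\<lambda>i. u i + v i) = dotp n w u + dotp n w v"
  and dotp_diff_left: "dotp n (\<lambda>i. u i - v i) w = dotp n u w - dotp n v w"
  and dotp_diff_right: "dotp n w (\<lambda>i. u i - v i) = dotp n w u - dotp n w v"
  and dotp_scale_left: "dotp n (\<lambda>i. c * u i) w = c * dotp n u w"
  and dotp_scale_right: "dotp n w (\<lambda>i. c * u i) = c * dotp n w u"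
  by (simp_all add: dotp_def algebra_simps sum.distrib sum_subtractf sum_distrib_left)

lemmas dotp_simps = dotp_add_left dotp_add_right dotp_diff_left dotp_diff_right dotp_scale_left dotp_scale_right

lemma dotp_self_nonneg: "0 \<le> dotp n u u"
  by (simp add: dotp_def sum_nonneg)

lemma dotp_Cauchy_Schwarz: "(dotp n u v)\<^sup>2 \<le> dotp n u u * dotp n v v"
  using Cauchy_Schwarz_ineq_sum[of u v "{..<n}"] by (simp add: dotp_def power2_eq_square)

lemma mat_app_add: "mat_app n K (\<lambda>i. u i + v i) j = mat_app n K u j + mat_app n K v j"
  and mat_app_diff: "mat_app n K (\<lambda>i. u i - v i) j = mat_app n K u j - mat_app n K v j"
  and mat_app_scale: "mat_app n K (\<lambda>i. c * u i) j = c * mat_app n K u j"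
  by (simp_all add: mat_app_def algebra_simps sum.distrib sum_subtractf sum_distrib_left)

lemma dotp_mat_app_sym:
  assumes "psd_mat n K"
  shows "dotp n u (mat_app n K v) = dotp n v (mat_app n K u)"
proof -
  have "dotp n u (mat_app n K v) = (\<Sum>i<n. \<Sum>j<n. u i * K i j * v j)"
    by (simp add: dotp_def mat_app_def sum_distrib_left mult.assoc)
  also have "\<dots> = (\<Sum>j<n. \<Sum>i<n. u i * K i j * v j)"
    by (rule sum.swap)
  also have "\<dots> = (\<Sum>j<n. \<Sum>i<n. v j * (K j i * u i))"
    using assms by (auto simp: psd_mat_def intro!: sum.cong)
  finally show ?thesis
    by (simp add: dotp_def mat_app_def sum_distrib_left)
qed

lemma psd_mat_nonneg: "psd_mat n K \<Longrightarrow> 0 \<le> dotp n b (mat_app n K b)"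
  by (simp add: psd_mat_def)

lemma psd_mat_Suc:
  assumes "psd_mat (Suc n) K"
  shows "psd_mat n K"
proof -
  have "0 \<le> dotp n b (mat_app n K b)" for b
    using psd_mat_nonneg[OF assms, of "\<lambda>i. if i = n then 0 else b i"] by (simp add: dotp_def mat_app_def)
  moreover have "\<forall>i<n. \<forall>j<n. K i j = K j i"
    using assms less_SucI[of _ n] unfolding psd_mat_def by blast
  ultimately show ?thesis unfolding psd_mat_def by blast
qed

text \<open>Bordering: by induction the leading block is solvable for every right-hand side, in
  particular for the last column of \<open>K\<close>, and the last unknown is then determined by a
  Schur complement. Positive semidefiniteness makes that complement at least
  \<open>s\<close>.\<close>

lemma ridge_solvable:
  assumes "psd_mat n K" "0 < s"
  shows "\<exists>b. \<forall>i<n. s * b i + mat_app n K b i = y i"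
  using assms(1)
proof (induction n arbitrary: y)
  case (Suc n)
  note IH = Suc.IH[OF psd_mat_Suc[OF Suc.prems]]
  obtain d where d: "\<And>i. i < n \<Longrightarrow> s * d i + mat_app n K d i = K i n"
    using IH[of "\<lambda>i. K i n"] by metis
  obtain b0 where b0: "\<And>i. i < n \<Longrightarrow> s * b0 i + mat_app n K b0 i = y i"
    using IH[of y] by metis
  \<comment> \<open>\<open>c\<close> solves the first \<open>n\<close> rows of the homogeneous
    system, so adding a multiple of it to \<open>b0\<close> changes only the last row.\<close>
  define c where "c = (\<lambda>i. if i = n then 1 else - d i)"
  have mc: "mat_app (Suc n) K c i = K i n - mat_app n K d i" for i
    by (simp add: mat_app_def c_def sum_negf)
  \<comment> \<open>The value of row \<open>n\<close> at \<open>c\<close>, equal to \<open>s\<close>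
    plus the form of \<open>K\<close> at \<open>c\<close> plus \<open>s\<close> times the squared
    length of \<open>d\<close>.\<close>
  define r where "r = s + mat_app (Suc n) K c n"
  have "dotp (Suc n) c (mat_app (Suc n) K c) = (\<Sum>i<n. - d i * (s * d i)) + mat_app (Suc n) K c n"
  proof -
    have "s * d i = mat_app (Suc n) K c i" if "i < n" for i
      using d[OF that] by (simp add: mc)
    then show ?thesis by (simp add: dotp_def c_def)
  qed
  moreover have "(\<Sum>i<n. - d i * (s * d i)) \<le> 0"
    using assms(2) by (intro sum_nonpos) (simp add: mult_nonneg_nonneg mult.left_commute)
  moreover have "0 \<le> dotp (Suc n) c (mat_app (Suc n) K c)"
    using Suc.prems psd_mat_nonneg by blast
  ultimately have r: "r > 0" using assms(2) unfolding r_def by linarith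
  define t where "t = (y n - mat_app n K b0 n) / r"
  define b where "b = (\<lambda>i. (if i = n then 0 else b0 i) + t * c i)"
  have mb: "mat_app (Suc n) K b i = mat_app n K b0 i + t * mat_app (Suc n) K c i" for i
    unfolding b_def mat_app_add mat_app_scale by (simp add: mat_app_def)
  have "s * b i + mat_app (Suc n) K b i = y i" if "i < Suc n" for i
  proof (cases "i = n")
    case True
    have "b n = t" by (simp add: b_def c_def)
    moreover have "t * r = y n - mat_app n K b0 n" using r by (simp add: t_def)
    ultimately show ?thesis unfolding True mb by (simp add: r_def algebra_simps)
  next
    case False
    then have "i < n" using that by simp
    then have "s * b i + mat_app (Suc n) K b i = (s * b0 i + mat_app n K b0 i) + t * (K i n - (s * d i + mat_app n K d i))"
      unfolding mb mc by (simp add: b_def c_def algebra_simps)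
    then show ?thesis using b0[OF \<open>i < n\<close>] d[OF \<open>i < n\<close>] by simp
  qed
  then show ?case by blast
qed simp

text \<open>\<open>ridge_app n K s\<close> is multiplication by \<open>(s I + K)\<^sup>-\<^sup>1\<close>.\<close>

definition ridge_inv :: "nat \<Rightarrow> (nat \<Rightarrow> nat \<Rightarrow> real) \<Rightarrow> real \<Rightarrow> nat \<Rightarrow> nat \<Rightarrow> real" where
  "ridge_inv n K s i j =
     (SOME b. \<forall>i<n. s * b i + mat_app n K b i = (if i = j then 1 else 0)) i"

abbreviation ridge_app :: "nat \<Rightarrow> (nat \<Rightarrow> nat \<Rightarrow> real) \<Rightarrow> real \<Rightarrow> (nat \<Rightarrow> real) \<Rightarrow> nat \<Rightarrow> real" where
  "ridge_app n K s \<equiv> mat_app n (ridge_inv n K s)"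

locale ridge =
  fixes n :: nat and K :: "nat \<Rightarrow> nat \<Rightarrow> real" and s :: real
  assumes psd: "psd_mat n K" and s_pos: "0 < s"
begin

lemma inv_column:
  "i < n \<Longrightarrow> s * ridge_inv n K s i j + mat_app n K (\<lambda>i. ridge_inv n K s i j) i = (if i = j then 1 else 0)"
  using someI_ex[OF ridge_solvable[OF psd s_pos, of "\<lambda>i. if i = j then 1 else 0"]]
  unfolding ridge_inv_def by blast

lemma app_solves:
  assumes "i < n"
  shows "s * ridge_app n K s y i + mat_app n K (ridge_app n K s y) i = y i"
proof -
  have "mat_app n K (ridge_app n K s y) i = (\<Sum>j<n. \<Sum>k<n. K i k * ridge_inv n K s k j * y j)"
    unfolding mat_app_def by (subst sum.swap) (simp add: sum_distrib_left mult.assoc)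
  also have "\<dots> = (\<Sum>j<n. mat_app n K (\<lambda>i. ridge_inv n K s i j) i * y j)"
    by (simp add: mat_app_def sum_distrib_right)
  finally have "s * ridge_app n K s y i + mat_app n K (ridge_app n K s y) i =
      (\<Sum>j<n. (s * ridge_inv n K s i j + mat_app n K (\<lambda>i. ridge_inv n K s i j) i) * y j)"
    by (simp add: mat_app_def[of n "ridge_inv n K s"] algebra_simps sum.distrib sum_distrib_left)
  also have "\<dots> = (\<Sum>j<n. if i = j then y j else 0)"
    using assms by (intro sum.cong) (simp_all add: inv_column)
  finally show ?thesis using assms by simp
qed

lemma dotp_eq: "dotp n u y = s * dotp n u (ridge_app n K s y) + dotp n u (mat_app n K (ridge_app n K s y))"
proof -
  have "dotp n u y = dotp n u (\<lambda>i. s * ridge_app n K s y i + mat_app n K (ridge_app n K s y) i)"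
    by (rule dotp_cong) (simp_all add: app_solves)
  then show ?thesis by (simp add: dotp_simps)
qed

text \<open>Writing \<open>u = s a + K a\<close> and \<open>y = s b + K b\<close> turns both sides
  into the same form in \<open>a\<close> and \<open>b\<close>, which is symmetric because
  \<open>K\<close> is.\<close>

lemma app_sym: "dotp n u (ridge_app n K s y) = dotp n y (ridge_app n K s u)"
proof -
  have "dotp n (ridge_app n K s u) y = s * dotp n (ridge_app n K s u) (ridge_app n K s y)
      + dotp n (ridge_app n K s u) (mat_app n K (ridge_app n K s y))" by (rule dotp_eq)
  moreover have "dotp n (ridge_app n K s y) u = s * dotp n (ridge_app n K s y) (ridge_app n K s u)
      + dotp n (ridge_app n K s y) (mat_app n K (ridge_app n K s u))" by (rule dotp_eq)
  ultimately show ?thesis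
    using dotp_mat_app_sym[OF psd] by (simp add: dotp_commute)
qed

lemma quad_eq:
  "dotp n y (ridge_app n K s y) =
     s * dotp n (ridge_app n K s y) (ridge_app n K s y)
     + dotp n (ridge_app n K s y) (mat_app n K (ridge_app n K s y))"
  using dotp_eq[of "ridge_app n K s y" y] by (simp add: dotp_commute)

lemma quad_nonneg: "0 \<le> dotp n y (ridge_app n K s y)"
  unfolding quad_eq using s_pos psd_mat_nonneg[OF psd] dotp_self_nonneg by simp

text \<open>With \<open>s\<close> as noise variance and \<open>R\<close> as in the overview this is
  \<open>R^2 \<le> R\<close>, and the next bound is \<open>R \<le> I\<close>. The discarded terms
  are nonnegative forms of \<open>K\<close>.\<close>

lemma quad_ge_app: "s * dotp n (ridge_app n K s y) (ridge_app n K s y) \<le> dotp n y (ridge_app n K s y)"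
  unfolding quad_eq using psd_mat_nonneg[OF psd] by simp

lemma quad_le: "s * dotp n y (ridge_app n K s y) \<le> dotp n y y"
proof -
  let ?b = "ridge_app n K s y"
  have "dotp n y y = dotp n (\<lambda>i. s * ?b i + mat_app n K ?b i) (\<lambda>i. s * ?b i + mat_app n K ?b i)"
    by (rule dotp_cong) (simp_all add: app_solves)
  also have "\<dots> = s * (s * dotp n ?b ?b + dotp n ?b (mat_app n K ?b)) + s * dotp n ?b (mat_app n K ?b)
      + dotp n (mat_app n K ?b) (mat_app n K ?b)"
    by (simp add: dotp_simps dotp_commute algebra_simps)
  finally show ?thesis
    unfolding quad_eq[of y] using s_pos psd_mat_nonneg[OF psd, of ?b] dotp_self_nonneg[of n "mat_app n K ?b"]
    by (smt (verit) mult_nonneg_nonneg)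
qed

text \<open>The form is nonnegative along the line \<open>u + t y\<close>, and the discriminant of
  the resulting quadratic in \<open>t\<close> gives the bound. If the form vanishes at
  \<open>y\<close> the quadratic is affine, and then it must be constant.\<close>

lemma app_Cauchy_Schwarz:
  "(dotp n u (ridge_app n K s y))\<^sup>2 \<le> dotp n u (ridge_app n K s u) * dotp n y (ridge_app n K s y)"
proof -
  let ?p = "dotp n u (ridge_app n K s u)" and ?q = "dotp n y (ridge_app n K s y)"
    and ?r = "dotp n u (ridge_app n K s y)"
  have *: "0 \<le> ?p + 2 * t * ?r + t\<^sup>2 * ?q" for t
  proof -
    have "dotp n (\<lambda>i. u i + t * y i) (ridge_app n K s (\<lambda>i. u i + t * y i)) =
        dotp n (\<lambda>i. u i + t * y i) (\<lambda>i. ridge_app n K s u i + t * ridge_app n K s y i)"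
      by (rule dotp_cong) (simp_all add: mat_app_add mat_app_scale)
    also have "\<dots> = ?p + 2 * t * ?r + t\<^sup>2 * ?q"
      using app_sym[of u y] by (simp add: dotp_simps power2_eq_square algebra_simps)
    finally show ?thesis using quad_nonneg by metis
  qed
  show ?thesis
  proof (cases "?q = 0")
    case True
    have "?r = 0"
    proof (rule ccontr)
      assume "?r \<noteq> 0"
      then show False using *[of "- (?p + 1) / (2 * ?r)"] True by (simp add: field_simps)
    qed
    then show ?thesis using True by simp
  next
    case False
    then have q: "?q > 0" using quad_nonneg[of y] by simp
    have "?p + 2 * (- ?r / ?q) * ?r + (- ?r / ?q)\<^sup>2 * ?q = ?p - ?r\<^sup>2 / ?q"
      using q by (simp add: power2_eq_square field_simps)
    then have "?r\<^sup>2 / ?q \<le> ?p" using *[of "- ?r / ?q"] by linarith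
    then show ?thesis using q by (simp add: pos_divide_le_eq)
  qed
qed

text \<open>The minimum of \<open>|f - h|\<^sup>2 / s + \<parallel>h\<parallel>\<^sup>2\<close> over the reproducing kernel space is the quadratic form on
  the left; the number \<open>N\<close> bounds the norm of \<open>h\<close>.\<close>

lemma quad_le_approx:
  assumes "\<And>b. \<bar>dotp n b h\<bar> \<le> N * sqrt (dotp n b (mat_app n K b))" "0 \<le> N"
  shows "dotp n f (ridge_app n K s f) \<le> dotp n (\<lambda>i. f i - h i) (\<lambda>i. f i - h i) / s + N\<^sup>2"
proof -
  let ?b = "ridge_app n K s f"
  define d where "d = dotp n (\<lambda>i. f i - h i) (\<lambda>i. f i - h i)"
  define bb where "bb = dotp n ?b ?b"
  define k where "k = dotp n ?b (mat_app n K ?b)"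
  define q where "q = dotp n f ?b"
  have nn: "0 \<le> d" "0 \<le> bb" "0 \<le> k"
    unfolding d_def bb_def k_def using dotp_self_nonneg psd_mat_nonneg[OF psd] by auto
  have q: "q = s * bb + k" unfolding q_def bb_def k_def by (rule quad_eq)
  have q2: "q = dotp n (\<lambda>i. f i - h i) ?b + dotp n ?b h"
    unfolding q_def by (simp add: dotp_simps dotp_commute)
  have "dotp n (\<lambda>i. f i - h i) ?b \<le> sqrt d * sqrt bb"
    using dotp_Cauchy_Schwarz[of n "\<lambda>i. f i - h i" ?b]
    by (metis bb_def d_def real_le_rsqrt real_sqrt_mult)
  moreover have "dotp n ?b h \<le> N * sqrt k" using assms(1)[of ?b] k_def by simp
  \<comment> \<open>The weights in this use of the arithmetic-geometric mean inequality and in the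
    next one produce \<open>s * bb / 2 + k / 2\<close>, which is half of \<open>q\<close> and is
    absorbed on the left.\<close>
  moreover have "sqrt d * sqrt bb \<le> d / (2 * s) + s * bb / 2"
  proof -
    have "0 \<le> (sqrt d / sqrt s - sqrt s * sqrt bb)\<^sup>2" by simp
    also have "\<dots> = d / s - 2 * (sqrt d * sqrt bb) + s * bb"
      using nn s_pos by (simp add: power2_diff power_divide power_mult_distrib)
    finally show ?thesis by (simp add: field_simps)
  qed
  moreover have "N * sqrt k \<le> N\<^sup>2 / 2 + k / 2"
  proof -
    have "0 \<le> (N - sqrt k)\<^sup>2" by simp
    also have "\<dots> = N\<^sup>2 - 2 * (N * sqrt k) + k"
      using nn by (simp add: power2_diff)
    finally show ?thesis by (simp add: field_simps)
  qed
  ultimately have "q \<le> d / (2 * s) + s * bb / 2 + N\<^sup>2 / 2 + k / 2" unfolding q2 by linarith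
  then have "q \<le> d / s + N\<^sup>2" using q by (simp add: field_simps)
  then show ?thesis by (simp add: q_def d_def)
qed

text \<open>The matrix \<open>S\<close> of the overview, equal to \<open>K (s I + K)^-1\<close>. It
  maps noisy observations with noise variance \<open>s\<close> to the conditional mean of a Gaussian
  vector with covariance \<open>K\<close>.\<close>

definition smoother :: "nat \<Rightarrow> nat \<Rightarrow> real" where
  "smoother i j = (if i = j then 1 else 0) - s * ridge_inv n K s i j"

lemma smoother_app: "i < n \<Longrightarrow> mat_app n smoother y i = y i - s * ridge_app n K s y i"
  by (simp add: mat_app_def smoother_def algebra_simps sum_subtractf sum_distrib_left if_distrib[of "(*) _"] cong: if_cong)

lemma dotp_smoother_app: "dotp n u (mat_app n smoother y) = dotp n u y - s * dotp n u (ridge_app n K s y)"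
proof -
  have "dotp n u (mat_app n smoother y) = dotp n u (\<lambda>i. y i - s * ridge_app n K s y i)"
    by (rule dotp_cong) (simp_all add: smoother_app)
  then show ?thesis by (simp add: dotp_simps)
qed

lemma smoother_psd: "0 \<le> dotp n y (mat_app n smoother y)"
  unfolding dotp_smoother_app using quad_le by simp

lemma app_unit: "j < n \<Longrightarrow> ridge_app n K s (\<lambda>i. if i = j then 1 else 0) i = ridge_inv n K s i j"
  by (simp add: mat_app_def if_distrib[of "(*) _"] cong: if_cong)

text \<open>The left side is the trace of \<open>S^2\<close>, and \<open>S^2 \<le> S\<close> because
  \<open>S\<close> lies between 0 and the identity. The argument runs column by column, by testing
  the bound for \<open>R\<close> on unit vectors.\<close>

lemma smoother_square_sum_le: "(\<Sum>i<n. \<Sum>j<n. (smoother i j)\<^sup>2) \<le> (\<Sum>j<n. smoother j j)"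
proof -
  have "(\<Sum>i<n. (smoother i j)\<^sup>2) \<le> smoother j j" if "j < n" for j
  proof -
    let ?e = "\<lambda>i. if i = j then 1 else 0 :: real"
    have 1: "dotp n ?e (ridge_app n K s ?e) = ridge_inv n K s j j"
      using that by (simp add: dotp_def app_unit if_distrib[of "\<lambda>x. x * _"] cong: if_cong)
    have 2: "dotp n (ridge_app n K s ?e) (ridge_app n K s ?e) = (\<Sum>i<n. (ridge_inv n K s i j)\<^sup>2)"
      using that by (simp add: dotp_def app_unit power2_eq_square)
    have "(\<Sum>i<n. (smoother i j)\<^sup>2) = (\<Sum>i<n. (if i = j then 1 - 2 * s * ridge_inv n K s j j else 0) + s\<^sup>2 * (ridge_inv n K s i j)\<^sup>2)"
      by (intro sum.cong) (auto simp: smoother_def power2_eq_square algebra_simps)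
    also have "\<dots> = 1 - 2 * s * ridge_inv n K s j j + s\<^sup>2 * (\<Sum>i<n. (ridge_inv n K s i j)\<^sup>2)"
      using that by (simp add: sum.distrib sum_distrib_left)
    finally have 3: "(\<Sum>i<n. (smoother i j)\<^sup>2) = 1 - 2 * s * ridge_inv n K s j j + s\<^sup>2 * (\<Sum>i<n. (ridge_inv n K s i j)\<^sup>2)" .
    have "s * (\<Sum>i<n. (ridge_inv n K s i j)\<^sup>2) \<le> ridge_inv n K s j j"
      using quad_ge_app[of ?e] unfolding 1 2 .
    then have "s * (s * (\<Sum>i<n. (ridge_inv n K s i j)\<^sup>2)) \<le> s * ridge_inv n K s j j"
      using s_pos by simp
    then show ?thesis unfolding 3 by (simp add: smoother_def power2_eq_square mult.assoc)
  qed
  then show ?thesis by (subst sum.swap) (intro sum_mono, simp)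
qed

text \<open>Kriging: \<open>s * smoother j j\<close> is the conditional variance of coordinate
  \<open>j\<close> given all noisy observations, hence the least mean squared error of a linear
  predictor. The right side is the error of the predictor with weights \<open>a\<close>, so a
  convenient choice of \<open>a\<close> bounds the diagonal.\<close>

lemma smoother_diag_le:
  fixes a :: "nat \<Rightarrow> real"
  assumes j: "j < n"
  defines "c \<equiv> \<lambda>i. (if i = j then 1 else 0) - a i"
  shows "s * smoother j j \<le> dotp n c (mat_app n K c) + s * dotp n a a"
proof -
  let ?e = "\<lambda>i. if i = j then 1 else 0 :: real"
  let ?b = "ridge_app n K s ?e"
  \<comment> \<open>For the optimal weights \<open>c\<close> equals \<open>s * ?b\<close>; hence
    \<open>?d\<close> is the deviation from the optimum, and the form of \<open>s I + K\<close> at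
    \<open>?d\<close> is the excess error.\<close>
  let ?d = "\<lambda>i. c i - s * ?b i"
  have ej: "dotp n u ?e = u j" for u
    using j by (simp add: dotp_def if_distrib[of "(*) _"] cong: if_cong)
  have aa: "dotp n a a = dotp n c c - 2 * c j + 1"
  proof -
    have "dotp n a a = dotp n (\<lambda>i. ?e i - c i) (\<lambda>i. ?e i - c i)"
      by (rule dotp_cong) (simp_all add: c_def)
    then show ?thesis unfolding dotp_diff_left dotp_diff_right using dotp_commute[of n ?e c] ej[of c] ej[of ?e] by simp
  qed
  have 1: "s * dotp n u ?b + dotp n u (mat_app n K ?b) = u j" for u
    using dotp_eq[of u ?e] ej by simp
  have bj: "?b j = ridge_inv n K s j j" using app_unit[OF j] .
  have Kd: "dotp n ?d (mat_app n K ?d) = dotp n c (mat_app n K c) - 2 * s * dotp n c (mat_app n K ?b) + s\<^sup>2 * dotp n ?b (mat_app n K ?b)"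
  proof -
    have "dotp n ?d (mat_app n K ?d) = dotp n ?d (\<lambda>i. mat_app n K c i - s * mat_app n K ?b i)"
      by (rule dotp_cong) (simp_all add: mat_app_diff mat_app_scale)
    then show ?thesis
      using dotp_mat_app_sym[OF psd, of ?b c] by (simp add: dotp_simps power2_eq_square algebra_simps)
  qed
  have dd: "dotp n ?d ?d = dotp n c c - 2 * s * dotp n c ?b + s\<^sup>2 * dotp n ?b ?b"
    unfolding dotp_diff_left dotp_diff_right dotp_scale_left dotp_scale_right
    using dotp_commute[of n c ?b] by (simp add: power2_eq_square algebra_simps)
  have "0 \<le> s * dotp n ?d ?d + dotp n ?d (mat_app n K ?d)"
    using s_pos psd_mat_nonneg[OF psd] dotp_self_nonneg by simp
  also have "\<dots> = s * dotp n c c + dotp n c (mat_app n K c)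
      - 2 * s * (s * dotp n c ?b + dotp n c (mat_app n K ?b))
      + s\<^sup>2 * (s * dotp n ?b ?b + dotp n ?b (mat_app n K ?b))"
    unfolding dd Kd by (simp add: algebra_simps power2_eq_square)
  also have "\<dots> = s * dotp n c c + dotp n c (mat_app n K c) - 2 * s * c j + s\<^sup>2 * ridge_inv n K s j j"
    unfolding 1 bj ..
  finally show ?thesis unfolding aa smoother_def by (simp add: algebra_simps power2_eq_square)
qed

end

section \<open>Gaussian marginal likelihoods\<close>

abbreviation std_normal :: "real measure" where
  "std_normal \<equiv> density lborel (\<lambda>x. ennreal (std_normal_density x))"

interpretation std_normal: real_distribution std_normal
  by (rule real_dist_normal_dist)

lemma normal_law_eq_distr:
  assumes "0 \<le> v"
  shows "normal_law m v = distr std_normal borel (\<lambda>z. m + sqrt v * z)"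
proof (cases "v = 0")
  case True
  then show ?thesis by (simp add: normal_law_def std_normal.distr_const)
next
  case False
  then have v: "sqrt v > 0" using assms by simp
  have "distributed std_normal lborel (\<lambda>x. x) (normal_density 0 1)"
    by (auto simp: distributed_def distr_id2)
  from std_normal.normal_density_affine[OF this zero_less_one, of "sqrt v" m]
  have "distributed std_normal lborel (\<lambda>z. m + sqrt v * z) (normal_density m (sqrt v))"
    using v by simp
  then have "distr std_normal lborel (\<lambda>z. m + sqrt v * z) = density lborel (\<lambda>x. ennreal (normal_density m (sqrt v) x))"
    by (simp add: distributed_def)
  moreover have "distr std_normal lborel (\<lambda>z. m + sqrt v * z) = distr std_normal borel (\<lambda>z. m + sqrt v * z)"
    by (rule distr_cong) auto
  ultimately show ?thesis using False by (simp add: normal_law_def)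
qed

lemma sets_normal_law [simp, measurable_cong]: "sets (normal_law m v) = sets borel"
  by (simp add: normal_law_def)

lemma prob_space_normal_law: "0 \<le> v \<Longrightarrow> prob_space (normal_law m v)"
  by (simp add: normal_law_eq_distr std_normal.prob_space_distr)

lemma std_normal_moments:
  "integrable std_normal (\<lambda>z. z)" "integrable std_normal (\<lambda>z. z\<^sup>2)"
  "(LINT z|std_normal. z) = 0" "(LINT z|std_normal. z\<^sup>2) = 1"
proof -
  show "integrable std_normal (\<lambda>z. z)" "integrable std_normal (\<lambda>z. z\<^sup>2)"
    using integrable_std_normal_distribution_moment[of 1] integrable_std_normal_distribution_moment[of 2]
    by simp_all
  show "(LINT z|std_normal. z) = 0"
    using integral_std_normal_distribution_moment_odd[of 1] by simp
  show "(LINT z|std_normal. z\<^sup>2) = 1"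
    using std_normal_distribution_even_moments(1)[of 1] by simp
qed

lemma normal_law_moments:
  assumes "0 \<le> v"
  shows "integrable (normal_law m v) (\<lambda>x. x)" "integrable (normal_law m v) (\<lambda>x. x\<^sup>2)"
    "(LINT x|normal_law m v. x) = m" "(LINT x|normal_law m v. x\<^sup>2) = m\<^sup>2 + v"
proof -
  note [simp] = std_normal_moments std_normal.prob_space[simplified]
  have sq: "(m + sqrt v * z)\<^sup>2 = m\<^sup>2 + (2 * m * sqrt v * z + v * z\<^sup>2)" for z
    using assms by (simp add: power2_sum power_mult_distrib)
  show "integrable (normal_law m v) (\<lambda>x. x)" "integrable (normal_law m v) (\<lambda>x. x\<^sup>2)"
    using assms by (simp_all add: normal_law_eq_distr integrable_distr_eq sq)
  show "(LINT x|normal_law m v. x) = m" "(LINT x|normal_law m v. x\<^sup>2) = m\<^sup>2 + v"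
    using assms by (simp_all add: normal_law_eq_distr integral_distr sq std_normal.prob_space)
qed

lemma normal_law_integrable_exp:
  assumes "0 \<le> v"
  shows "integrable (normal_law m v) (\<lambda>x. exp (t * x))"
proof -
  have "exp (t * z) * std_normal_density z = exp (t\<^sup>2 / 2) * normal_density t 1 z" for t z :: real
  proof -
    have "exp (t * z) * exp (- (z\<^sup>2 / 2)) = exp (t\<^sup>2 / 2) * exp (- ((z - t)\<^sup>2 / 2))"
      by (simp add: exp_add[symmetric] power2_eq_square field_simps)
    then show ?thesis by (simp add: normal_density_def)
  qed
  then have "integrable lborel (\<lambda>z. std_normal_density z * exp (t * z))" for t :: real
    by (subst mult.commute) simp
  then have *: "integrable std_normal (\<lambda>z. exp (t * z))" for t :: real
    by (subst integrable_density) auto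
  have "exp (t * (m + sqrt v * z)) = exp (t * m) * exp (t * sqrt v * z)" for z
    by (simp add: exp_add[symmetric] algebra_simps)
  then show ?thesis using assms *[of "t * sqrt v"]
    by (simp add: normal_law_eq_distr integrable_distr_eq)
qed

lemma char_normal_law:
  assumes "0 \<le> v"
  shows "(LINT x|normal_law m v. iexp (t * x)) = iexp (t * m) * of_real (exp (- (t\<^sup>2 * v / 2)))"
proof -
  have "(LINT x|normal_law m v. iexp (t * x)) = (LINT z|std_normal. iexp (t * m) * iexp (t * sqrt v * z))"
    using assms by (simp add: normal_law_eq_distr integral_distr exp_add[symmetric] algebra_simps)
  also have "\<dots> = iexp (t * m) * char std_normal (t * sqrt v)"
    by (simp add: char_def)
  also have "\<dots> = iexp (t * m) * of_real (exp (- (t\<^sup>2 * v / 2)))"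
    using assms by (simp add: char_std_normal_distribution power_mult_distrib)
  finally show ?thesis .
qed

text \<open>Both sides, with \<open>V\<close> replaced by \<open>z V\<close>, are entire in \<open>z\<close> and agree on the imaginary axis.\<close>

lemma (in prob_space) gaussian_pair_exp:
  fixes U V :: "'a \<Rightarrow> real"
  assumes [measurable]: "random_variable borel U" "random_variable borel V"
    and law: "\<And>r t. \<exists>v\<ge>0. v = r\<^sup>2 * a + 2 * r * t * b + t\<^sup>2 * c \<and> distr M borel (\<lambda>\<omega>. r * U \<omega> + t * V \<omega>) = normal_law 0 v"
  shows "integrable M (\<lambda>\<omega>. exp (V \<omega>))"
    "(LINT \<omega>|M. iexp (U \<omega>) * of_real (exp (V \<omega>))) = exp (of_real (c / 2 - a / 2) + \<i> * of_real b)"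
proof -
  have V: "integrable M (\<lambda>\<omega>. exp (t * V \<omega>))" for t
  proof -
    obtain v where "v \<ge> 0" "distr M borel (\<lambda>\<omega>. 0 * U \<omega> + 1 * V \<omega>) = normal_law 0 v"
      using law[of 0 1] by blast
    then have "integrable (distr M borel V) (\<lambda>x. exp (t * x))"
      using normal_law_integrable_exp by simp
    then show ?thesis by (simp add: integrable_distr_eq)
  qed
  from V[of 1] show "integrable M (\<lambda>\<omega>. exp (V \<omega>))" by simp
  have Vabs: "integrable M (\<lambda>\<omega>. exp (r * \<bar>V \<omega>\<bar>))" if "0 \<le> r" for r
  proof (rule Bochner_Integration.integrable_bound[OF Bochner_Integration.integrable_add[OF V[of r] V[of "- r"]]])
    show "AE \<omega> in M. norm (exp (r * \<bar>V \<omega>\<bar>)) \<le> norm (exp (r * V \<omega>) + exp (- r * V \<omega>))"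
    proof (rule AE_I2)
      fix \<omega>
      have "exp (r * \<bar>V \<omega>\<bar>) \<le> exp (r * V \<omega>) + exp (- r * V \<omega>)" by (auto simp: abs_if)
      then show "norm (exp (r * \<bar>V \<omega>\<bar>)) \<le> norm (exp (r * V \<omega>) + exp (- r * V \<omega>))"
        by (simp del: exp_le_cancel_iff)
    qed
  qed measurable
  \<comment> \<open>Terms of the expansion of \<open>iexp U * exp (z V)\<close> in powers of
    \<open>z\<close>. Their absolute sums are dominated by
    \<open>exp (norm z * \<bar>V\<bar>)\<close>, integrable because a normal variable has all
    exponential moments; integration term by term makes \<open>H\<close> entire.\<close>
  define f where "f = (\<lambda>z::complex. \<lambda>k \<omega>. iexp (U \<omega>) * (z * of_real (V \<omega>)) ^ k / fact k)"
  have fn: "norm (f z k \<omega>) = (norm z * \<bar>V \<omega>\<bar>) ^ k / fact k" for z k \<omega>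
    by (simp add: f_def norm_mult norm_divide norm_power)
  have fs: "f z k \<omega> = iexp (U \<omega>) * ((z * of_real (V \<omega>)) ^ k /\<^sub>R fact k)" for z k \<omega>
    by (simp add: f_def scaleR_conv_of_real field_simps)
  have [measurable]: "f z k \<in> borel_measurable M" for z k
    unfolding f_def by measurable
  have le: "(\<Sum>k<m. norm (f z k \<omega>)) \<le> exp (norm z * \<bar>V \<omega>\<bar>)" for m z \<omega>
  proof -
    have "(\<Sum>k<m. (norm z * \<bar>V \<omega>\<bar>) ^ k /\<^sub>R fact k) \<le> exp (norm z * \<bar>V \<omega>\<bar>)"
      unfolding exp_def by (intro sum_le_suminf summable_exp_generic) auto
    then show ?thesis by (simp add: fn field_simps)
  qed
  have fi: "integrable M (f z k)" for z k
  proof (rule Bochner_Integration.integrable_bound[OF Vabs[of "norm z"]])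
    show "AE \<omega> in M. norm (f z k \<omega>) \<le> norm (exp (norm z * \<bar>V \<omega>\<bar>))"
    proof (rule AE_I2)
      fix \<omega>
      have "norm (f z k \<omega>) \<le> (\<Sum>k<Suc k. norm (f z k \<omega>))" by (simp add: sum_nonneg)
      then show "norm (f z k \<omega>) \<le> norm (exp (norm z * \<bar>V \<omega>\<bar>))" using le[of z \<omega> "Suc k"] by simp
    qed
  qed auto
  define H where "H = (\<lambda>z. LINT \<omega>|M. iexp (U \<omega>) * exp (z * of_real (V \<omega>)))"
  have sums: "(\<lambda>k. (LINT \<omega>|M. iexp (U \<omega>) * of_real (V \<omega>) ^ k / fact k) * z ^ k) sums H z" for z
  proof -
    have "(\<lambda>k. integral\<^sup>L M (f z k)) sums (\<integral>\<omega>. (\<Sum>k. f z k \<omega>) \<partial>M)"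
    proof (rule sums_integral)
      show "AE \<omega> in M. summable (\<lambda>k. norm (f z k \<omega>))"
        by (intro AE_I2 summableI_nonneg_bounded[OF norm_ge_zero le])
      show "summable (\<lambda>k. \<integral>\<omega>. norm (f z k \<omega>) \<partial>M)"
      proof (rule summableI_nonneg_bounded)
        fix m
        have "(\<Sum>k<m. \<integral>\<omega>. norm (f z k \<omega>) \<partial>M) = (\<integral>\<omega>. (\<Sum>k<m. norm (f z k \<omega>)) \<partial>M)"
          using fi by (subst Bochner_Integration.integral_sum) auto
        also have "\<dots> \<le> (\<integral>\<omega>. exp (norm z * \<bar>V \<omega>\<bar>) \<partial>M)"
          using le fi Vabs[of "norm z"] by (intro integral_mono) auto
        finally show "(\<Sum>k<m. \<integral>\<omega>. norm (f z k \<omega>) \<partial>M) \<le> (\<integral>\<omega>. exp (norm z * \<bar>V \<omega>\<bar>) \<partial>M)" .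
      qed auto
    qed (rule fi)
    moreover have "(\<Sum>k. f z k \<omega>) = iexp (U \<omega>) * exp (z * of_real (V \<omega>))" for \<omega>
      unfolding fs exp_def by (rule suminf_mult[OF summable_exp_generic])
    moreover have "integral\<^sup>L M (f z k) = (LINT \<omega>|M. iexp (U \<omega>) * of_real (V \<omega>) ^ k / fact k) * z ^ k" for k
      by (subst integral_mult_left_zero[symmetric]) (simp add: f_def power_mult_distrib field_simps)
    ultimately show ?thesis by (simp add: H_def)
  qed
  \<comment> \<open>At \<open>z = \<i> t\<close> the integral is the characteristic function at 1 of
    \<open>U + t V\<close>, whose variance is \<open>a + 2 t b + t\<^sup>2 c\<close>; rewriting the
    result in terms of \<open>z\<close> gives this expression.\<close>
  define G where "G = (\<lambda>z::complex. exp (of_real (- (a / 2)) + \<i> * of_real b * z + of_real (c / 2) * z\<^sup>2))"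
  have "H holomorphic_on ball 0 2"
    by (rule power_series_holomorphic, unfold diff_zero, rule sums)
  moreover have "G holomorphic_on ball 0 2"
    unfolding G_def by (intro holomorphic_intros)
  ultimately have hol: "(\<lambda>z. H z - G z) holomorphic_on ball 0 2"
    by (intro holomorphic_intros)
  have HG: "H (\<i> * of_real t) = G (\<i> * of_real t)" for t
  proof -
    obtain v where v: "v \<ge> 0" "v = a + 2 * t * b + t\<^sup>2 * c"
      "distr M borel (\<lambda>\<omega>. U \<omega> + t * V \<omega>) = normal_law 0 v"
      using law[of 1 t] by auto
    have "H (\<i> * of_real t) = (LINT \<omega>|M. iexp (U \<omega> + t * V \<omega>))"
      unfolding H_def by (simp add: exp_add algebra_simps)
    also have "\<dots> = (LINT x|distr M borel (\<lambda>\<omega>. U \<omega> + t * V \<omega>). iexp (1 * x))"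
      by (subst integral_distr) auto
    also have "\<dots> = exp (of_real (- (v / 2)))"
      unfolding v(3) char_normal_law[OF v(1)] by (simp flip: exp_of_real)
    also have "of_real (- (v / 2)) = of_real (- (a / 2)) + \<i> * of_real b * (\<i> * of_real t) + of_real (c / 2) * (\<i> * of_real t)\<^sup>2"
      unfolding v(2) by (simp add: power_mult_distrib algebra_simps add_divide_distrib)
    finally show ?thesis unfolding G_def .
  qed
  \<comment> \<open>The points \<open>\<i> / (n + 1)\<close> accumulate at 0 inside a disc that also
    contains the point 1, where the identity is wanted.\<close>
  have lim: "0 islimpt range (\<lambda>n. \<i> * complex_of_real (inverse (Suc n)))"
    unfolding islimpt_sequential
  proof (intro exI[of _ "\<lambda>n. \<i> * complex_of_real (inverse (Suc n))"] conjI)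
    have "(\<lambda>n. \<i> * complex_of_real (inverse (Suc n))) \<longlonglongrightarrow> \<i> * of_real 0"
      by (intro tendsto_mult tendsto_const tendsto_of_real LIMSEQ_inverse_real_of_nat)
    then show "(\<lambda>n. \<i> * complex_of_real (inverse (Suc n))) \<longlonglongrightarrow> 0"
      by (simp only: of_real_0 mult_zero_right)
  qed (auto simp del: of_nat_Suc)
  have sub: "range (\<lambda>n. \<i> * complex_of_real (inverse (Suc n))) \<subseteq> ball 0 2"
  proof clarify
    fix n
    have "norm (\<i> * complex_of_real (inverse (real (Suc n)))) = inverse (real (Suc n))"
      by (simp only: norm_mult norm_ii norm_of_real) simp
    also have "\<dots> < 2" by (simp add: inverse_eq_divide pos_divide_less_eq)
    finally show "\<i> * complex_of_real (inverse (real (Suc n))) \<in> ball 0 2"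
      by (simp del: of_nat_Suc of_real_inverse of_real_of_nat_eq)
  qed
  have "H 1 - G 1 = 0"
  proof (rule analytic_continuation[OF hol _ _ sub _ lim])
    fix z assume "z \<in> range (\<lambda>n. \<i> * complex_of_real (inverse (Suc n)))"
    then obtain n where "z = \<i> * complex_of_real (inverse (real (Suc n)))" by blast
    then show "H z - G z = 0" by (simp only: HG diff_self)
  qed auto
  then have "H 1 = G 1" by simp
  then show "(LINT \<omega>|M. iexp (U \<omega>) * of_real (exp (V \<omega>))) = exp (of_real (c / 2 - a / 2) + \<i> * of_real b)"
    by (simp add: H_def G_def exp_of_real algebra_simps)
qed

text \<open>The unnormalised Gaussian is its own Fourier transform up to scaling: the factor is the
  characteristic function of the standard normal law at \<open>(y - f) / \<sigma>\<close>. Its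
  dependence on \<open>f\<close> is thereby moved into characters.\<close>

lemma gaussian_factor_mixture:
  assumes "0 < \<sigma>"
  shows "(LINT z|std_normal. iexp ((y - f) * z / \<sigma>)) = of_real (exp (- (1 / (2 * \<sigma>\<^sup>2)) * (y - f)\<^sup>2))"
proof -
  have "(LINT z|std_normal. iexp ((y - f) * z / \<sigma>)) = char std_normal ((y - f) / \<sigma>)"
    by (simp add: char_def)
  then show ?thesis by (simp add: char_std_normal_distribution power_divide)
qed

lemma (in pair_sigma_finite) integrable_pair_bound:
  fixes f :: "'a \<times> 'b \<Rightarrow> 'c::{banach, second_countable_topology}"
  assumes [measurable]: "f \<in> borel_measurable (M1 \<Otimes>\<^sub>M M2)" and g: "integrable M1 g" "finite_measure M2"
    and le: "\<And>x y. norm (f (x, y)) \<le> g x"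
  shows "integrable (M1 \<Otimes>\<^sub>M M2) f"
proof -
  interpret M2: finite_measure M2 by fact
  have int2: "integrable M2 (\<lambda>y. f (x, y))" if "x \<in> space M1" for x
    using that by (intro M2.integrable_const_bound[where B="g x"]) (auto simp: le)
  show ?thesis
  proof (rule Fubini_integrable)
    show "integrable M1 (\<lambda>x. \<integral>y. norm (f (x, y)) \<partial>M2)"
    proof (rule Bochner_Integration.integrable_bound)
      show "integrable M1 (\<lambda>x. measure M2 (space M2) * g x)" using g by simp
      show "AE x in M1. norm (\<integral>y. norm (f (x, y)) \<partial>M2) \<le> norm (measure M2 (space M2) * g x)"
      proof (rule AE_I2)
        fix x assume x: "x \<in> space M1"
        have "(\<integral>y. norm (f (x, y)) \<partial>M2) \<le> (\<integral>y. g x \<partial>M2)"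
          using int2[OF x] le by (intro integral_mono) auto
        moreover have "0 \<le> (\<integral>y. norm (f (x, y)) \<partial>M2)" by (rule integral_nonneg_AE) simp
        ultimately show "norm (\<integral>y. norm (f (x, y)) \<partial>M2) \<le> norm (measure M2 (space M2) * g x)"
          by simp
      qed
    qed simp
  qed (auto intro: int2)
qed

text \<open>The number \<open>k\<close> of factors is kept apart from the dimension of the Gaussian
  vector, so that an induction can add the factors one at a time.\<close>

definition gauss_prod :: "real \<Rightarrow> nat \<Rightarrow> (nat \<Rightarrow> real) \<Rightarrow> (nat \<Rightarrow> real) \<Rightarrow> real" where
  "gauss_prod \<sigma> k y f = (\<Prod>i<k. exp (- (1 / (2 * \<sigma>\<^sup>2)) * (y i - f i)\<^sup>2))"

lemma gauss_prod_nonneg: "0 \<le> gauss_prod \<sigma> k y f"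
  unfolding gauss_prod_def by (intro prod_nonneg) auto

lemma gauss_prod_le_1: "gauss_prod \<sigma> k y f \<le> 1"
  unfolding gauss_prod_def by (intro prod_le_1) auto

lemma gauss_prod_pos: "0 < gauss_prod \<sigma> k y f"
  unfolding gauss_prod_def by (intro prod_pos) auto

locale gaussian_vector = prob_space M for M :: "'a measure" +
  fixes n :: nat and F :: "nat \<Rightarrow> 'a \<Rightarrow> real" and K :: "nat \<Rightarrow> nat \<Rightarrow> real"
  assumes F_meas [measurable]: "\<And>i. i < n \<Longrightarrow> F i \<in> borel_measurable M"
    and K: "psd_mat n K"
    and F_law: "\<And>a. distr M borel (\<lambda>\<omega>. dotp n a (\<lambda>i. F i \<omega>)) = normal_law 0 (dotp n a (mat_app n K a))"
begin

lemma dotp_F_meas [measurable]: "(\<lambda>\<omega>. dotp n a (\<lambda>i. F i \<omega>)) \<in> borel_measurable M"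
  unfolding dotp_def by measurable

text \<open>Tilting a centred Gaussian vector by \<open>exp (a F)\<close> shifts it by
  \<open>K a\<close>. Both sides evaluate to the exponential of
  \<open>a' K a / 2 - c' K c / 2 + \<i> c' K a\<close>.\<close>

lemma tilt_iexp:
  shows "integrable M (\<lambda>\<omega>. exp (dotp n a (\<lambda>i. F i \<omega>)))"
    "(LINT \<omega>|M. iexp (dotp n c (\<lambda>i. F i \<omega>)) * of_real (exp (dotp n a (\<lambda>i. F i \<omega>)))) =
      of_real (exp (dotp n a (mat_app n K a) / 2)) *
      (LINT \<omega>|M. iexp (dotp n c (\<lambda>i. F i \<omega> + mat_app n K a i)))"
proof -
  let ?q = "\<lambda>u v. dotp n u (mat_app n K v)"
  have law: "\<exists>v\<ge>0. v = r\<^sup>2 * ?q c c + 2 * r * t * ?q c a + t\<^sup>2 * ?q a a \<and>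
      distr M borel (\<lambda>\<omega>. r * dotp n c (\<lambda>i. F i \<omega>) + t * dotp n a (\<lambda>i. F i \<omega>)) = normal_law 0 v" for r t
  proof (intro exI[of _ "?q (\<lambda>i. r * c i + t * a i) (\<lambda>i. r * c i + t * a i)"] conjI)
    show "0 \<le> ?q (\<lambda>i. r * c i + t * a i) (\<lambda>i. r * c i + t * a i)"
      using K by (rule psd_mat_nonneg)
    have "?q (\<lambda>i. r * c i + t * a i) (\<lambda>i. r * c i + t * a i) =
      dotp n (\<lambda>i. r * c i + t * a i) (\<lambda>i. r * mat_app n K c i + t * mat_app n K a i)"
      by (rule dotp_cong) (simp_all add: mat_app_add mat_app_scale)
    then show "?q (\<lambda>i. r * c i + t * a i) (\<lambda>i. r * c i + t * a i) = r\<^sup>2 * ?q c c + 2 * r * t * ?q c a + t\<^sup>2 * ?q a a"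
      using dotp_mat_app_sym[OF K, of a c]
      by (simp add: dotp_simps power2_eq_square algebra_simps)
    show "distr M borel (\<lambda>\<omega>. r * dotp n c (\<lambda>i. F i \<omega>) + t * dotp n a (\<lambda>i. F i \<omega>)) =
        normal_law 0 (?q (\<lambda>i. r * c i + t * a i) (\<lambda>i. r * c i + t * a i))"
      unfolding F_law[symmetric] by (simp add: dotp_simps)
  qed
  show "integrable M (\<lambda>\<omega>. exp (dotp n a (\<lambda>i. F i \<omega>)))"
    by (rule gaussian_pair_exp(1)[OF dotp_F_meas dotp_F_meas law])
  have "(LINT \<omega>|M. iexp (dotp n c (\<lambda>i. F i \<omega>))) = (LINT x|normal_law 0 (?q c c). iexp (1 * x))"
    unfolding F_law[symmetric] by (subst integral_distr) auto
  also have "\<dots> = exp (- of_real (?q c c / 2))"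
    unfolding char_normal_law[OF psd_mat_nonneg[OF K]] by (simp flip: exp_of_real)
  finally have "(LINT \<omega>|M. iexp (dotp n c (\<lambda>i. F i \<omega> + mat_app n K a i))) = exp (\<i> * ?q c a) * exp (- of_real (?q c c / 2))"
    by (simp add: dotp_simps exp_add algebra_simps)
  then show "(LINT \<omega>|M. iexp (dotp n c (\<lambda>i. F i \<omega>)) * of_real (exp (dotp n a (\<lambda>i. F i \<omega>)))) =
      of_real (exp (?q a a / 2)) * (LINT \<omega>|M. iexp (dotp n c (\<lambda>i. F i \<omega> + mat_app n K a i)))"
    unfolding gaussian_pair_exp(2)[OF dotp_F_meas dotp_F_meas law]
    by (simp add: algebra_simps flip: exp_of_real exp_add)
qed

lemma gauss_prod_meas: "k \<le> n \<Longrightarrow> (\<lambda>\<omega>. gauss_prod \<sigma> k y (\<lambda>i. F i \<omega> + h i)) \<in> borel_measurable M"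
  unfolding gauss_prod_def by (intro borel_measurable_prod) auto

text \<open>A Cameron--Martin shift. It holds for characters by the previous lemma, and each Gaussian factor
  is a mixture of characters.\<close>

lemma tilt_gauss_prod:
  assumes "0 < \<sigma>" "k \<le> n"
  shows "(LINT \<omega>|M. iexp (dotp n c (\<lambda>i. F i \<omega>)) * of_real (gauss_prod \<sigma> k y (\<lambda>i. F i \<omega>) * exp (dotp n a (\<lambda>i. F i \<omega>)))) =
      of_real (exp (dotp n a (mat_app n K a) / 2)) *
      (LINT \<omega>|M. iexp (dotp n c (\<lambda>i. F i \<omega> + mat_app n K a i)) *
        of_real (gauss_prod \<sigma> k y (\<lambda>i. F i \<omega> + mat_app n K a i)))"
  using assms(2)
proof (induction k arbitrary: c)
  case 0
  then show ?case using tilt_iexp(2) by (simp add: gauss_prod_def)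
next
  case (Suc k)
  have k: "k < n" using Suc.prems by simp
  interpret P: pair_prob_space M std_normal
    by (simp add: pair_prob_space_def pair_sigma_finite_def prob_space_axioms std_normal.prob_space_axioms
        prob_space_imp_sigma_finite)
  note [measurable] = gauss_prod_meas[OF less_imp_le[OF k]] gauss_prod_meas[OF less_imp_le[OF k], of _ _ "\<lambda>_. 0", simplified]
  have [measurable]: "F k \<in> borel_measurable M" using k by simp
  \<comment> \<open>Replacing factor \<open>k\<close> by its mixture and exchanging the integrals
    only alters coordinate \<open>k\<close> of the frequency vector \<open>c\<close>. This is why
    the induction is over all \<open>c\<close>.\<close>
  have mix: "(LINT \<omega>|M. iexp (dotp n c (\<lambda>i. F i \<omega> + h i)) * of_real (gauss_prod \<sigma> (Suc k) y (\<lambda>i. F i \<omega> + h i) * w \<omega>)) =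
      (LINT z|std_normal. iexp (y k * z / \<sigma>) * (LINT \<omega>|M. iexp (dotp n (\<lambda>i. c i - (if i = k then z / \<sigma> else 0)) (\<lambda>i. F i \<omega> + h i)) *
         of_real (gauss_prod \<sigma> k y (\<lambda>i. F i \<omega> + h i) * w \<omega>)))"
    (is "?L = ?R")
    if w: "integrable M w" "\<And>\<omega>. 0 \<le> w \<omega>" for w :: "'a \<Rightarrow> real" and h :: "nat \<Rightarrow> real"
  proof -
    have [measurable]: "w \<in> borel_measurable M" using w by auto
    have dc: "(\<lambda>\<omega>. dotp n c (\<lambda>i. F i \<omega> + h i)) \<in> borel_measurable M" for c
      unfolding dotp_def by measurable
    note [measurable] = dc
    define G where "G = (\<lambda>\<omega>. iexp (dotp n c (\<lambda>i. F i \<omega> + h i)) * complex_of_real (gauss_prod \<sigma> k y (\<lambda>i. F i \<omega> + h i) * w \<omega>))"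
    have [measurable]: "G \<in> borel_measurable M" unfolding G_def by measurable
    have G_le: "norm (G \<omega>) \<le> w \<omega>" for \<omega>
      using w(2)[of \<omega>] gauss_prod_nonneg gauss_prod_le_1
      by (simp add: G_def norm_mult abs_mult mult_left_le_one_le)
    have int: "integrable (M \<Otimes>\<^sub>M std_normal) (\<lambda>(\<omega>, z). G \<omega> * iexp ((y k - (F k \<omega> + h k)) * z / \<sigma>))"
    proof (rule P.integrable_pair_bound[OF _ w(1)])
      show "finite_measure std_normal" by (rule std_normal.finite_measure_axioms)
    qed (use G_le in \<open>auto simp: norm_mult\<close>)
    have "?L = (LINT \<omega>|M. LINT z|std_normal. G \<omega> * iexp ((y k - (F k \<omega> + h k)) * z / \<sigma>))"
      unfolding integral_mult_right_zero gaussian_factor_mixture[OF assms(1)]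
      by (simp add: G_def gauss_prod_def algebra_simps)
    also have "\<dots> = (LINT z|std_normal. LINT \<omega>|M. G \<omega> * iexp ((y k - (F k \<omega> + h k)) * z / \<sigma>))"
      by (rule P.Fubini_integral[OF int, symmetric])
    also have "\<dots> = ?R"
      unfolding integral_mult_right_zero[symmetric]
    proof (intro Bochner_Integration.integral_cong refl)
      fix z \<omega>
      have "dotp n (\<lambda>i. c i - (if i = k then z / \<sigma> else 0)) (\<lambda>i. F i \<omega> + h i) = dotp n c (\<lambda>i. F i \<omega> + h i) - z / \<sigma> * (F k \<omega> + h k)"
        unfolding dotp_diff_left using k by (simp add: dotp_def if_distrib[of "\<lambda>x. x * _"] cong: if_cong)
      moreover have "iexp (dotp n c (\<lambda>i. F i \<omega> + h i)) * iexp ((y k - (F k \<omega> + h k)) * z / \<sigma>) =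
          iexp (y k * z / \<sigma>) * iexp (dotp n c (\<lambda>i. F i \<omega> + h i) - z / \<sigma> * (F k \<omega> + h k))"
        unfolding exp_add[symmetric] by (simp add: algebra_simps add_divide_distrib diff_divide_distrib)
      moreover have "A * B = C * D \<Longrightarrow> A * u * B = C * (D * u)" for A B C D u :: complex
        by (metis mult.assoc mult.commute)
      ultimately show "G \<omega> * iexp ((y k - (F k \<omega> + h k)) * z / \<sigma>) = iexp (y k * z / \<sigma>) *
         (iexp (dotp n (\<lambda>i. c i - (if i = k then z / \<sigma> else 0)) (\<lambda>i. F i \<omega> + h i)) *
         of_real (gauss_prod \<sigma> k y (\<lambda>i. F i \<omega> + h i) * w \<omega>))"
        unfolding G_def by simp
    qed
    finally show ?thesis .
  qed
  \<comment> \<open>The left side is taken with weight \<open>exp (a F)\<close> and no shift, the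
    right side with weight 1 and shift \<open>K a\<close>. Once factor \<open>k\<close> is removed,
    both are mixtures over \<open>z\<close> of instances of the induction hypothesis.\<close>
  show ?case
    using mix[OF tilt_iexp(1)[of a], of "\<lambda>_. 0"] mix[of "\<lambda>_. 1" "mat_app n K a"]
    by (simp add: Suc.IH[OF less_imp_le[OF k]] mult.left_commute[of _ "of_real _"] flip: of_real_mult)
qed

text \<open>Since \<open>x = \<sigma>\<^sup>2 a + K a\<close>, the residual
  \<open>y - \<beta> x - f\<close> equals
  \<open>(y - \<beta> \<sigma>\<^sup>2 a) - (f + K (\<beta> a))\<close>. The part
  \<open>K (\<beta> a)\<close> is a Cameron--Martin shift and is traded for the tilt
  \<open>exp (\<beta> a f)\<close>; the part \<open>\<beta> \<sigma>\<^sup>2 a\<close> contributes,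
  on expanding the square, exactly the cross term that cancels this tilt. What remains does not
  depend on \<open>f\<close>.\<close>

lemma marginal_likelihood_quadratic:
  assumes "0 < \<sigma>" and a: "\<And>i. i < n \<Longrightarrow> \<sigma>\<^sup>2 * a i + mat_app n K a i = x i"
  shows "(LINT \<omega>|M. gauss_prod \<sigma> n (\<lambda>i. y i - \<beta> * x i) (\<lambda>i. F i \<omega>)) =
    (LINT \<omega>|M. gauss_prod \<sigma> n y (\<lambda>i. F i \<omega>)) * exp (\<beta> * dotp n a y - \<beta>\<^sup>2 / 2 * dotp n a x)"
proof -
  let ?b = "\<lambda>i. \<beta> * a i"
  let ?y = "\<lambda>i. y i - \<beta> * \<sigma>\<^sup>2 * a i"
  have x: "dotp n a x = \<sigma>\<^sup>2 * dotp n a a + dotp n a (mat_app n K a)"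
  proof -
    have "dotp n a x = dotp n a (\<lambda>i. \<sigma>\<^sup>2 * a i + mat_app n K a i)" by (rule dotp_cong) (simp_all add: a)
    then show ?thesis by (simp add: dotp_simps)
  qed
  have Kb: "mat_app n K ?b i = \<beta> * mat_app n K a i" for i by (rule mat_app_scale)
  have bKb: "dotp n ?b (mat_app n K ?b) = \<beta>\<^sup>2 * dotp n a (mat_app n K a)"
    unfolding ext[of "mat_app n K ?b", OF Kb] by (simp add: dotp_simps power2_eq_square)
  have 1: "gauss_prod \<sigma> n (\<lambda>i. y i - \<beta> * x i) f = gauss_prod \<sigma> n ?y (\<lambda>i. f i + mat_app n K ?b i)" for f
    unfolding gauss_prod_def using a by (intro prod.cong refl) (simp add: Kb flip: a, simp add: algebra_simps)
  have 2: "gauss_prod \<sigma> n ?y f * exp (dotp n ?b f) = gauss_prod \<sigma> n y f * exp (\<beta> * dotp n a y - \<beta>\<^sup>2 * \<sigma>\<^sup>2 / 2 * dotp n a a)" for f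
  proof -
    have "- (1 / (2 * \<sigma>\<^sup>2)) * (?y i - f i)\<^sup>2 + \<beta> * a i * f i =
      - (1 / (2 * \<sigma>\<^sup>2)) * (y i - f i)\<^sup>2 + (\<beta> * (a i * y i) - \<beta>\<^sup>2 * \<sigma>\<^sup>2 / 2 * (a i * a i))" for i
      using assms(1) by (simp add: power2_eq_square field_simps)
    then have "(\<Sum>i<n. - (1 / (2 * \<sigma>\<^sup>2)) * (?y i - f i)\<^sup>2 + \<beta> * a i * f i) =
      (\<Sum>i<n. - (1 / (2 * \<sigma>\<^sup>2)) * (y i - f i)\<^sup>2 + (\<beta> * (a i * y i) - \<beta>\<^sup>2 * \<sigma>\<^sup>2 / 2 * (a i * a i)))"
      by simp
    then have "(\<Sum>i<n. - (1 / (2 * \<sigma>\<^sup>2)) * (?y i - f i)\<^sup>2) + dotp n ?b f =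
      (\<Sum>i<n. - (1 / (2 * \<sigma>\<^sup>2)) * (y i - f i)\<^sup>2) + (\<beta> * dotp n a y - \<beta>\<^sup>2 * \<sigma>\<^sup>2 / 2 * dotp n a a)"
      unfolding dotp_def sum.distrib sum_subtractf sum_distrib_left .
    then show ?thesis unfolding gauss_prod_def exp_sum[OF finite_lessThan, symmetric] exp_add[symmetric] by simp
  qed
  have "complex_of_real (LINT \<omega>|M. gauss_prod \<sigma> n ?y (\<lambda>i. F i \<omega>) * exp (dotp n ?b (\<lambda>i. F i \<omega>))) =
    of_real (exp (dotp n ?b (mat_app n K ?b) / 2) * (LINT \<omega>|M. gauss_prod \<sigma> n ?y (\<lambda>i. F i \<omega> + mat_app n K ?b i)))"
    using tilt_gauss_prod[OF assms(1) order_refl, of "\<lambda>_. 0" ?y ?b]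
    by (simp add: dotp_def[of n "\<lambda>_. 0"] flip: of_real_mult)
  then have "(LINT \<omega>|M. gauss_prod \<sigma> n ?y (\<lambda>i. F i \<omega>) * exp (dotp n ?b (\<lambda>i. F i \<omega>))) =
    exp (dotp n ?b (mat_app n K ?b) / 2) * (LINT \<omega>|M. gauss_prod \<sigma> n (\<lambda>i. y i - \<beta> * x i) (\<lambda>i. F i \<omega>))"
    unfolding of_real_eq_iff 1 .
  then have "(LINT \<omega>|M. gauss_prod \<sigma> n (\<lambda>i. y i - \<beta> * x i) (\<lambda>i. F i \<omega>)) =
    exp (- (dotp n ?b (mat_app n K ?b) / 2)) * ((LINT \<omega>|M. gauss_prod \<sigma> n y (\<lambda>i. F i \<omega>)) * exp (\<beta> * dotp n a y - \<beta>\<^sup>2 * \<sigma>\<^sup>2 / 2 * dotp n a a))"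
    unfolding 2 by (simp add: exp_minus field_simps)
  also have "\<dots> = (LINT \<omega>|M. gauss_prod \<sigma> n y (\<lambda>i. F i \<omega>)) * (exp (- (dotp n ?b (mat_app n K ?b) / 2)) * exp (\<beta> * dotp n a y - \<beta>\<^sup>2 * \<sigma>\<^sup>2 / 2 * dotp n a a))"
    by (simp add: mult_ac)
  also have "exp (- (dotp n ?b (mat_app n K ?b) / 2)) * exp (\<beta> * dotp n a y - \<beta>\<^sup>2 * \<sigma>\<^sup>2 / 2 * dotp n a a) =
      exp (\<beta> * dotp n a y - \<beta>\<^sup>2 / 2 * dotp n a x)"
    unfolding exp_add[symmetric] bKb x by (simp add: algebra_simps)
  finally show ?thesis .
qed

lemma marginal_likelihood_pos: "0 < (LINT \<omega>|M. gauss_prod \<sigma> n y (\<lambda>i. F i \<omega>))"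
  and integrable_gauss_prod: "integrable M (\<lambda>\<omega>. gauss_prod \<sigma> n y (\<lambda>i. F i \<omega>))"
proof -
  show int: "integrable M (\<lambda>\<omega>. gauss_prod \<sigma> n y (\<lambda>i. F i \<omega>))"
    using gauss_prod_meas[OF order_refl, of _ _ "\<lambda>_. 0"]
    by (intro integrable_const_bound[where B=1]) (auto simp: gauss_prod_nonneg gauss_prod_le_1)
  have "(LINT \<omega>|M. gauss_prod \<sigma> n y (\<lambda>i. F i \<omega>)) \<noteq> 0"
    using integral_nonneg_eq_0_iff_AE[OF int] gauss_prod_nonneg gauss_prod_pos[of \<sigma> n y]
    by (auto simp: order_less_le AE_False)
  moreover have "0 \<le> (LINT \<omega>|M. gauss_prod \<sigma> n y (\<lambda>i. F i \<omega>))"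
    by (intro integral_nonneg_AE) (auto simp: gauss_prod_nonneg)
  ultimately show "0 < (LINT \<omega>|M. gauss_prod \<sigma> n y (\<lambda>i. F i \<omega>))" by simp
qed

end

section \<open>Normal laws in total variation\<close>

text \<open>Otherwise some sequence of parameters tends to those of the standard normal law while
  the distance stays above \<open>e\<close>. The densities converge pointwise and all have mass 1,
  so Scheffe's lemma contradicts this.\<close>

lemma normal_density_L1_continuous:
  assumes "0 < e"
  shows "\<exists>d>0. \<forall>m r. \<bar>m\<bar> \<le> d \<longrightarrow> \<bar>r - 1\<bar> \<le> d \<longrightarrow>
    (LINT x|lborel. \<bar>normal_density m r x - std_normal_density x\<bar>) < e"
proof (rule ccontr)
  assume "\<not> ?thesis"
  then have "\<forall>d>0. \<exists>m r. \<bar>m\<bar> \<le> d \<and> \<bar>r - 1\<bar> \<le> d \<and>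
    e \<le> (LINT x|lborel. \<bar>normal_density m r x - std_normal_density x\<bar>)"
    by (meson not_le)
  \<comment> \<open>The radii \<open>1 / (k + 2)\<close> are at most 1/2, which keeps the standard
    deviations positive.\<close>
  then have "\<forall>k. \<exists>m r. \<bar>m\<bar> \<le> 1 / real (k + 2) \<and> \<bar>r - 1\<bar> \<le> 1 / real (k + 2) \<and>
    e \<le> (LINT x|lborel. \<bar>normal_density m r x - std_normal_density x\<bar>)"
    by (metis divide_pos_pos of_nat_0_less_iff zero_less_one add_gr_0 zero_less_numeral)
  then obtain m r where mr: "\<And>k::nat. \<bar>m k\<bar> \<le> 1 / real (k + 2)" "\<And>k. \<bar>r k - 1\<bar> \<le> 1 / real (k + 2)"
    and big: "\<And>k. e \<le> (LINT x|lborel. \<bar>normal_density (m k) (r k) x - std_normal_density x\<bar>)"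
    by metis
  have lim0: "(\<lambda>k. 1 / real (k + 2)) \<longlonglongrightarrow> 0" by real_asymp
  have m: "m \<longlonglongrightarrow> 0"
    by (rule Lim_null_comparison[OF _ lim0]) (use mr in auto)
  have "(\<lambda>k. r k - 1) \<longlonglongrightarrow> 0"
    by (rule Lim_null_comparison[OF _ lim0]) (use mr in auto)
  then have r: "r \<longlonglongrightarrow> 1" by (simp add: LIM_zero_iff)
  have rpos: "0 < r k" for k
  proof -
    have "1 / real (k + 2) \<le> 1 / 2" by (rule divide_left_mono) auto
    then show ?thesis using mr(2)[of k] by linarith
  qed
  have "(\<lambda>k. \<integral>\<^sup>+x. norm (normal_density (m k) (r k) x - std_normal_density x) \<partial>lborel) \<longlonglongrightarrow> 0"
  proof (rule Scheffe_lemma2)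
    show "AE x in lborel. (\<lambda>k. normal_density (m k) (r k) x) \<longlonglongrightarrow> std_normal_density x"
    proof (rule AE_I2)
      fix x
      have "(\<lambda>k. 1 / sqrt (2 * pi * (r k)\<^sup>2) * exp (- (x - m k)\<^sup>2 / (2 * (r k)\<^sup>2))) \<longlonglongrightarrow>
        1 / sqrt (2 * pi * 1\<^sup>2) * exp (- (x - 0)\<^sup>2 / (2 * 1\<^sup>2))"
        by (intro tendsto_intros m r) auto
      then show "(\<lambda>k. normal_density (m k) (r k) x) \<longlonglongrightarrow> std_normal_density x"
        by (simp add: normal_density_def)
    qed
    show "(\<integral>\<^sup>+ x. norm (normal_density (m k) (r k) x) \<partial>lborel) \<le> (\<integral>\<^sup>+ x. norm (std_normal_density x) \<partial>lborel)" for k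
      using rpos[of k] by (simp add: nn_integral_eq_integral)
  qed auto
  then have "(\<lambda>k. enn2real (\<integral>\<^sup>+x. norm (normal_density (m k) (r k) x - std_normal_density x) \<partial>lborel)) \<longlonglongrightarrow> enn2real 0"
    by (intro tendsto_enn2real) auto
  moreover have "enn2real (\<integral>\<^sup>+x. norm (normal_density (m k) (r k) x - std_normal_density x) \<partial>lborel) =
      (LINT x|lborel. \<bar>normal_density (m k) (r k) x - std_normal_density x\<bar>)" for k
    using rpos[of k] by (subst nn_integral_eq_integral) (auto intro!: integral_nonneg_AE)
  ultimately have "(\<lambda>k. LINT x|lborel. \<bar>normal_density (m k) (r k) x - std_normal_density x\<bar>) \<longlonglongrightarrow> 0"
    by simp
  then have "e \<le> 0" by (rule LIMSEQ_le_const) (use big in auto)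
  then show False using assms by simp
qed

lemma normal_density_rescale:
  assumes "0 < s1"
  shows "s1 * normal_density m2 s2 (m1 + s1 * z) = normal_density ((m2 - m1) / s1) (s2 / s1) z"
proof -
  have "(m1 + s1 * z - m2)\<^sup>2 / (2 * s2\<^sup>2) = (z - (m2 - m1) / s1)\<^sup>2 / (2 * (s2 / s1)\<^sup>2)"
  proof -
    have "m1 + s1 * z - m2 = s1 * (z - (m2 - m1) / s1)" using assms by (simp add: field_simps)
    then have "(m1 + s1 * z - m2)\<^sup>2 = s1\<^sup>2 * (z - (m2 - m1) / s1)\<^sup>2" by (simp add: power_mult_distrib)
    then show ?thesis using assms by (simp add: power_divide)
  qed
  moreover have "s1 / sqrt (2 * pi * s2\<^sup>2) = 1 / sqrt (2 * pi * (s2 / s1)\<^sup>2)"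
    using assms by (simp add: power_divide real_sqrt_mult real_sqrt_divide)
  moreover have "s1 * normal_density m2 s2 (m1 + s1 * z) = (s1 / sqrt (2 * pi * s2\<^sup>2)) * exp (- ((m1 + s1 * z - m2)\<^sup>2 / (2 * s2\<^sup>2)))"
    by (simp add: normal_density_def)
  ultimately show ?thesis by (simp add: normal_density_def)
qed

text \<open>The distance is invariant under affine maps, so only the standardised difference of the
  means and the ratio of the standard deviations matter. This allows bounds that are uniform while
  both variances shrink with the sample size.\<close>

lemma normal_density_L1_rescale:
  assumes "0 < s1" "0 < s2"
  shows "(LINT x|lborel. \<bar>normal_density m2 s2 x - normal_density m1 s1 x\<bar>) =
    (LINT x|lborel. \<bar>normal_density ((m2 - m1) / s1) (s2 / s1) x - std_normal_density x\<bar>)"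
proof -
  have "(LINT x|lborel. \<bar>normal_density m2 s2 x - normal_density m1 s1 x\<bar>) =
    s1 * (LINT z|lborel. \<bar>normal_density m2 s2 (m1 + s1 * z) - normal_density m1 s1 (m1 + s1 * z)\<bar>)"
    using assms by (subst lborel_integral_real_affine[of s1 _ m1]) auto
  also have "\<dots> = (LINT z|lborel. \<bar>s1 * normal_density m2 s2 (m1 + s1 * z) - s1 * normal_density m1 s1 (m1 + s1 * z)\<bar>)"
    using assms by (subst integral_mult_right_zero[symmetric]) (simp add: abs_mult flip: right_diff_distrib)
  finally show ?thesis using assms by (simp add: normal_density_rescale)
qed

lemma normal_law_density: "0 < v \<Longrightarrow> normal_law m v = density lborel (\<lambda>x. ennreal (normal_density m (sqrt v) x))"
  by (simp add: normal_law_def)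

lemma measure_normal_law:
  assumes "0 < v" and [measurable]: "A \<in> sets borel"
  shows "measure (normal_law m v) A = (LINT x|lborel. normal_density m (sqrt v) x * indicator A x)"
proof -
  have "emeasure (normal_law m v) A = (\<integral>\<^sup>+x. ennreal (normal_density m (sqrt v) x * indicator A x) \<partial>lborel)"
    using assms by (simp add: normal_law_density emeasure_density ennreal_mult' ennreal_indicator)
  also have "\<dots> = ennreal (LINT x|lborel. normal_density m (sqrt v) x * indicator A x)"
    using assms by (intro nn_integral_eq_integral integrable_real_mult_indicator integrable_normal_density) auto
  finally show ?thesis by (simp add: measure_def integral_nonneg_AE)
qed

lemma normal_law_measure_diff:
  assumes "0 < v1" "0 < v2" and A: "A \<in> sets borel"
  shows "\<bar>measure (normal_law m2 v2) A - measure (normal_law m1 v1) A\<bar> \<le>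
    (LINT x|lborel. \<bar>normal_density m2 (sqrt v2) x - normal_density m1 (sqrt v1) x\<bar>)"
proof -
  have int: "integrable lborel (\<lambda>x. normal_density m (sqrt v) x * indicator A x)" if "0 < v" for m v
    using that A by (intro integrable_real_mult_indicator integrable_normal_density) auto
  have "measure (normal_law m2 v2) A - measure (normal_law m1 v1) A =
    (LINT x|lborel. normal_density m2 (sqrt v2) x * indicator A x - normal_density m1 (sqrt v1) x * indicator A x)"
    using assms int by (simp add: measure_normal_law)
  also have "\<bar>\<dots>\<bar> \<le> (LINT x|lborel. \<bar>normal_density m2 (sqrt v2) x * indicator A x - normal_density m1 (sqrt v1) x * indicator A x\<bar>)"
    by (rule integral_abs_bound)
  also have "\<dots> \<le> (LINT x|lborel. \<bar>normal_density m2 (sqrt v2) x - normal_density m1 (sqrt v1) x\<bar>)"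
    using int assms by (intro integral_mono integrable_abs Bochner_Integration.integrable_diff integrable_normal_density)
       (auto simp: indicator_def)
  finally show ?thesis .
qed

lemma normal_law_tail:
  assumes "0 < v" "0 < r"
  shows "measure (normal_law m v) {x. r \<le> \<bar>x - m\<bar>} \<le> v / r\<^sup>2"
proof -
  interpret prob_space "normal_law m v" using assms by (simp add: prob_space_normal_law)
  note mom = normal_law_moments[of v m]
  have sp: "space (normal_law m v) = UNIV"
    by (simp add: normal_law_density[OF assms(1)])
  have "measure (normal_law m v) {x \<in> space (normal_law m v). r \<le> \<bar>x - expectation (\<lambda>x. x)\<bar>} \<le> variance (\<lambda>x. x) / r\<^sup>2"
    using assms mom by (intro Chebyshev_inequality) auto
  then show ?thesis
    using mom assms variance_eq[of "\<lambda>x. x"] by (simp add: sp)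
qed

text \<open>Conditioning on \<open>I\<close> increases the probability of an event by at most the
  mass outside \<open>I\<close> and decreases it by at most as much; the triangle inequality adds
  the distance between the two normal laws.\<close>

lemma tv_dist_truncated_normal:
  assumes v: "0 < v1" "0 < v2" and P: "sets P = sets borel" and I: "I \<in> sets borel"
    and Pm: "\<And>A. A \<in> sets borel \<Longrightarrow>
      measure P A = measure (normal_law m2 v2) (A \<inter> I) / measure (normal_law m2 v2) I"
    and pos: "0 < measure (normal_law m2 v2) I"
  shows "tv_dist P (normal_law m1 v1) \<le> measure (normal_law m2 v2) (- I) +
    (LINT x|lborel. \<bar>normal_density m2 (sqrt v2) x - normal_density m1 (sqrt v1) x\<bar>)"
  unfolding tv_dist_def
proof (rule cSUP_least)
  show "sets P \<noteq> {}" by auto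
  fix A assume "A \<in> sets P"
  then have A: "A \<in> sets borel" using P by simp
  interpret N: prob_space "normal_law m2 v2" using v by (simp add: prob_space_normal_law)
  have sp: "space (normal_law m2 v2) = UNIV" using v by (simp add: normal_law_density)
  have AI: "measure (normal_law m2 v2) A = measure (normal_law m2 v2) (A \<inter> I) + measure (normal_law m2 v2) (A \<inter> - I)"
    using A I N.finite_measure_Union[of "A \<inter> I" "A \<inter> - I"] by (simp add: Int_Un_distrib[symmetric] Int_commute disjoint_eq_subset_Compl)
  have C: "measure (normal_law m2 v2) I = 1 - measure (normal_law m2 v2) (- I)"
    using N.prob_compl[of I] I by (simp add: sp Compl_eq_Diff_UNIV)
  have le1: "measure (normal_law m2 v2) (A \<inter> I) \<le> measure (normal_law m2 v2) I"
    using A I by (intro N.finite_measure_mono) auto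
  have le2: "measure (normal_law m2 v2) (A \<inter> - I) \<le> measure (normal_law m2 v2) (- I)"
    using A I by (intro N.finite_measure_mono) auto
  define a where "a = measure (normal_law m2 v2) (A \<inter> I)"
  define i where "i = measure (normal_law m2 v2) I"
  have "a / i - a = (a / i) * (1 - i)" using pos by (simp add: i_def field_simps)
  moreover have "0 \<le> a / i" "a / i \<le> 1" "0 \<le> 1 - i"
    using le1 pos by (simp_all add: a_def i_def)
  ultimately have "0 \<le> a / i - a" "a / i - a \<le> 1 - i"
    by (metis mult_nonneg_nonneg, metis mult_left_le_one_le)
  then have "\<bar>measure P A - measure (normal_law m2 v2) A\<bar> \<le> measure (normal_law m2 v2) (- I)"
    unfolding Pm[OF A] AI using le2 C measure_nonneg[of "normal_law m2 v2" "A \<inter> - I"] unfolding a_def i_def by linarith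
  then show "\<bar>measure P A - measure (normal_law m1 v1) A\<bar> \<le> measure (normal_law m2 v2) (- I) +
    (LINT x|lborel. \<bar>normal_density m2 (sqrt v2) x - normal_density m1 (sqrt v1) x\<bar>)"
    using normal_law_measure_diff[OF v A, of m2 m1] by linarith
qed

text \<open>In the application \<open>q\<close> and \<open>u\<close> are the quadratic and bilinear error terms of a sample of size \<open>n\<close>,
  and \<open>D1\<close>, \<open>D2\<close> are the perturbations caused by the nonparametric nuisance.\<close>

lemma tv_dist_posterior_small:
  assumes e: "0 < e" and c: "0 < c" and M: "0 < M" and \<sigma>: "0 < \<sigma>" and b: "- B < b" "b < B"
  obtains d n0 where "0 < d" "0 < n0"
    "\<And>q u D1 D2 n P. real n \<ge> n0 \<Longrightarrow> c * real n \<le> q \<Longrightarrow> \<bar>u\<bar> \<le> M * sqrt (real n) \<Longrightarrow>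
      \<bar>D1\<bar> \<le> d * real n \<Longrightarrow> \<bar>D2\<bar> \<le> d * sqrt (real n) \<Longrightarrow> sets P = sets borel \<Longrightarrow>
      (\<And>A. A \<in> sets borel \<Longrightarrow> measure P A =
         measure (normal_law (b + (u + D2) / (q + D1)) (\<sigma>\<^sup>2 / (q + D1))) (A \<inter> {- B..B}) /
         measure (normal_law (b + (u + D2) / (q + D1)) (\<sigma>\<^sup>2 / (q + D1))) {- B..B}) \<Longrightarrow>
      tv_dist P (normal_law (b + u / q) (\<sigma>\<^sup>2 / q)) \<le> e"
proof -
  obtain d0 where d0: "d0 > 0" and L1: "\<And>m r. \<bar>m\<bar> \<le> d0 \<Longrightarrow> \<bar>r - 1\<bar> \<le> d0 \<Longrightarrow>
    (LINT x|lborel. \<bar>normal_density m r x - std_normal_density x\<bar>) < e / 2"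
    using normal_density_L1_continuous[of "e / 2"] e by auto
  \<comment> \<open>Half the distance from the true parameter to the boundary: the posterior centre
    may move by \<open>r\<close> and still keeps the margin \<open>r\<close> to the complement of
    the interval.\<close>
  define r where "r = min (B - b) (B + b) / 2"
  have r: "r > 0" using b by (simp add: r_def)
  \<comment> \<open>The cap at 1 makes the tail at most 1/2, so that the interval on which the law
    is conditioned has positive mass.\<close>
  define e' where "e' = min e 1"
  have e': "0 < e'" "e' \<le> e" "e' \<le> 1" using e by (auto simp: e'_def)
  \<comment> \<open>In this order the bounds keep the precision \<open>q + D1\<close> above
    \<open>q / 2\<close>, the ratio of standard deviations within \<open>d0\<close> of 1, the shift
    \<open>D2\<close> below \<open>sqrt n\<close>, and the standardised difference of the means
    below \<open>d0\<close>.\<close>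
  define d where "d = min (min (c / 2) (d0 * c / 2)) (min 1 (d0 * \<sigma> * sqrt c / (2 * (1 + M / c))))"
  have d: "0 < d" "d \<le> c / 2" "d \<le> d0 * c / 2" "d \<le> 1" "d * (2 * (1 + M / c)) \<le> d0 * \<sigma> * sqrt c"
  proof -
    have p: "0 < 2 * (1 + M / c)" using c M by (simp add: add_pos_pos)
    show "0 < d" unfolding d_def using c d0 \<sigma> p by auto
    show "d \<le> c / 2" "d \<le> d0 * c / 2" "d \<le> 1" unfolding d_def by (meson min.cobounded1 min.cobounded2 order_trans)+
    have "d \<le> d0 * \<sigma> * sqrt c / (2 * (1 + M / c))" unfolding d_def by (meson min.cobounded2 order_trans)
    then show "d * (2 * (1 + M / c)) \<le> d0 * \<sigma> * sqrt c" using p by (simp add: pos_le_divide_eq)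
  qed
  \<comment> \<open>The second entry keeps the posterior centre within \<open>r\<close> of
    \<open>b\<close>; the third makes the Chebyshev bound for the mass outside the interval at most
    \<open>e' / 2\<close>.\<close>
  define n0 where "n0 = max 1 (max (((M + 1) * 2 / (c * r))\<^sup>2) (4 * \<sigma>\<^sup>2 / (c * r\<^sup>2 * e')))"
  have n0: "n0 > 0" by (simp add: n0_def)
  show thesis
  proof (rule that[OF d(1) n0])
    fix q u D1 D2 :: real and n :: nat and P :: "real measure"
    assume n: "real n \<ge> n0" and q: "c * real n \<le> q" and u: "\<bar>u\<bar> \<le> M * sqrt (real n)"
      and D1: "\<bar>D1\<bar> \<le> d * real n" and D2: "\<bar>D2\<bar> \<le> d * sqrt (real n)" and P: "sets P = sets borel"
      and Pm: "\<And>A. A \<in> sets borel \<Longrightarrow> measure P A =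
         measure (normal_law (b + (u + D2) / (q + D1)) (\<sigma>\<^sup>2 / (q + D1))) (A \<inter> {- B..B}) /
         measure (normal_law (b + (u + D2) / (q + D1)) (\<sigma>\<^sup>2 / (q + D1))) {- B..B}"
    define N where "N = real n"
    have N: "N > 0" "sqrt N > 0" "sqrt N * sqrt N = N" using n n0 by (auto simp: N_def)
    have qpos: "q > 0" using q c N by (smt (verit) N_def mult_pos_pos)
    have D1q: "\<bar>D1\<bar> \<le> q / 2"
    proof -
      have "d * N \<le> c / 2 * N" using d N by (intro mult_right_mono) auto
      then show ?thesis using D1 q by (simp add: N_def)
    qed
    define p where "p = q + D1"
    have p: "p \<ge> q / 2" "p > 0" using D1q qpos by (auto simp: p_def)
    have pc: "p \<ge> c * N / 2" using p q by (simp add: N_def)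
    have half: "\<bar>(u + D2) / p\<bar> \<le> r"
    proof -
      have "\<bar>u + D2\<bar> \<le> (M + 1) * sqrt N"
      proof -
        have "d * sqrt N \<le> 1 * sqrt N" using d N by (intro mult_right_mono) auto
        then show ?thesis using u D2 by (simp add: N_def algebra_simps)
      qed
      moreover have "(M + 1) * sqrt N \<le> r * p"
      proof -
        have "((M + 1) * 2 / (c * r))\<^sup>2 \<le> N" using n by (simp add: n0_def N_def)
        then have "(M + 1) * 2 / (c * r) \<le> sqrt N" by (rule real_le_rsqrt)
        then have "(M + 1) * 2 \<le> sqrt N * (c * r)" using c r by (simp add: pos_divide_le_eq)
        then have "(M + 1) * 2 * sqrt N \<le> sqrt N * (c * r) * sqrt N" using N by (intro mult_right_mono) auto
        also have "\<dots> = (c * N) * r" using N(3) by (simp add: algebra_simps)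
        also have "\<dots> \<le> (2 * p) * r" using pc r by (intro mult_right_mono) auto
        finally show ?thesis by (simp add: algebra_simps)
      qed
      ultimately show ?thesis using p by (simp add: abs_mult pos_divide_le_eq)
    qed
    define m2 where "m2 = b + (u + D2) / p"
    define v2 where "v2 = \<sigma>\<^sup>2 / p"
    define m1 where "m1 = b + u / q"
    define v1 where "v1 = \<sigma>\<^sup>2 / q"
    have v: "v1 > 0" "v2 > 0" using \<sigma> p qpos by (simp_all add: v1_def v2_def)
    interpret N2: prob_space "normal_law m2 v2" using v by (simp add: prob_space_normal_law)
    have sp: "space (normal_law m2 v2) = UNIV" using v by (simp add: normal_law_density)
    have "r \<le> \<bar>x - m2\<bar>" if "x \<in> - {- B..B}" for x
    proof -
      have "2 * r \<le> B - b" "2 * r \<le> B + b" by (auto simp: r_def)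
      moreover have "\<bar>m2 - b\<bar> \<le> r" using half by (simp add: m2_def)
      ultimately show ?thesis using that by auto
    qed
    then have "measure (normal_law m2 v2) (- {- B..B}) \<le> measure (normal_law m2 v2) {x. r \<le> \<bar>x - m2\<bar>}"
      by (intro N2.finite_measure_mono) auto
    also have "\<dots> \<le> v2 / r\<^sup>2" by (rule normal_law_tail[OF v(2) r])
    also have "\<dots> \<le> e' / 2"
    proof -
      have "4 * \<sigma>\<^sup>2 / (c * r\<^sup>2 * e') \<le> N" using n by (simp add: n0_def N_def)
      then have "4 * \<sigma>\<^sup>2 \<le> N * (c * r\<^sup>2 * e')" using c r e' by (simp add: pos_divide_le_eq)
      also have "\<dots> = (c * N) * (r\<^sup>2 * e')" by (simp add: algebra_simps)
      also have "\<dots> \<le> (2 * p) * (r\<^sup>2 * e')" using pc r e' by (intro mult_right_mono) auto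
      finally have "\<sigma>\<^sup>2 \<le> (e' / 2) * r\<^sup>2 * p" by (simp add: algebra_simps)
      then show ?thesis using p r by (simp add: v2_def pos_divide_le_eq mult_ac)
    qed
    finally have tail: "measure (normal_law m2 v2) (- {- B..B}) \<le> e' / 2" .
    then have pos: "0 < measure (normal_law m2 v2) {- B..B}"
      using N2.prob_compl[of "{- B..B}"] e' by (simp add: sp Compl_eq_Diff_UNIV)
    have L: "(LINT x|lborel. \<bar>normal_density m2 (sqrt v2) x - normal_density m1 (sqrt v1) x\<bar>) < e / 2"
    proof -
      have "\<bar>(m2 - m1) / sqrt v1\<bar> \<le> d0"
      proof -
        \<comment> \<open>The numerator is perturbed directly by \<open>D2\<close> and indirectly by
          \<open>D1\<close> through the ratio \<open>u / q\<close>, which is of order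
          \<open>1 / sqrt n\<close>; both contributions are therefore small against
          \<open>sqrt n\<close>.\<close>
        have "m2 - m1 = (D2 - u / q * D1) / p"
          using p qpos by (simp add: m2_def m1_def field_simps p_def)
        moreover have "\<bar>D2 - u / q * D1\<bar> \<le> d * sqrt N * (1 + M / c)"
        proof -
          have "\<bar>u / q * D1\<bar> \<le> (M * sqrt N / (c * N)) * (d * N)"
            unfolding abs_mult abs_divide using u D1 q qpos c N d M
            by (intro mult_mono frac_le) (auto simp: N_def)
          also have "\<dots> = d * sqrt N * (M / c)" using c N by (simp add: field_simps)
          finally have "\<bar>u / q * D1\<bar> \<le> d * sqrt N * (M / c)" .
          moreover have "\<bar>D2\<bar> \<le> d * sqrt N" using D2 by (simp add: N_def)
          ultimately have "\<bar>D2 - u / q * D1\<bar> \<le> d * sqrt N + d * sqrt N * (M / c)" by linarith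
          then show ?thesis by (simp only: distrib_left mult_1_right)
        qed
        moreover have "\<bar>D2 - u / q * D1\<bar> / p \<le> (d * sqrt N * (1 + M / c)) / (q / 2)"
          if "\<bar>D2 - u / q * D1\<bar> \<le> d * sqrt N * (1 + M / c)"
          using that qpos p by (intro frac_le) auto
        ultimately have "\<bar>m2 - m1\<bar> \<le> d * sqrt N * (1 + M / c) / (q / 2)"
          using p by (simp add: abs_divide)
        also have "\<dots> = (d * (2 * (1 + M / c))) * sqrt N / q" by simp
        also have "\<dots> \<le> (d0 * \<sigma> * sqrt c) * sqrt N / q"
          using d N qpos by (intro divide_right_mono mult_right_mono) auto
        also have "\<dots> = d0 * \<sigma> * sqrt (c * N) / q" by (simp add: real_sqrt_mult)
        also have "\<dots> \<le> d0 * \<sigma> * sqrt q / q"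
          using d0 \<sigma> qpos q by (intro divide_right_mono mult_left_mono) (auto simp: N_def)
        also have "\<dots> = d0 * sqrt v1"
          using \<sigma> qpos by (simp add: v1_def real_sqrt_divide field_simps real_div_sqrt)
        finally show ?thesis using v by (simp add: abs_divide pos_divide_le_eq)
      qed
      moreover have "\<bar>sqrt v2 / sqrt v1 - 1\<bar> \<le> d0"
      proof -
        define t where "t = sqrt v2 / sqrt v1"
        have t: "t > 0" using v by (simp add: t_def)
        \<comment> \<open>Working with \<open>t\<^sup>2 - 1 = (t - 1) * (t + 1)\<close> and
          \<open>t + 1 \<ge> 1\<close> bounds the ratio of standard deviations by that of the
          variances.\<close>
        have "t\<^sup>2 = q / p" using v \<sigma> p qpos by (simp add: t_def power_divide v1_def v2_def)
        moreover have "(t - 1) * (t + 1) = t\<^sup>2 - 1" by (simp add: power2_eq_square algebra_simps)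
        moreover have "q / p - 1 = - D1 / p" using p(2) diff_divide_distrib[of q p p] by (simp add: p_def)
        ultimately have "(t - 1) * (t + 1) = - D1 / p" by simp
        then have "\<bar>t - 1\<bar> * (t + 1) = \<bar>D1\<bar> / p" using t p by (metis abs_divide abs_minus_cancel abs_mult abs_of_pos add_pos_pos zero_less_one)
        moreover have "\<bar>t - 1\<bar> * 1 \<le> \<bar>t - 1\<bar> * (t + 1)" using t by (intro mult_left_mono) auto
        moreover have "\<bar>D1\<bar> / p \<le> (d * N) / (c * N / 2)"
          using D1 pc p c N d by (intro frac_le) (auto simp: N_def)
        moreover have "(d * N) / (c * N / 2) \<le> d0" using d(3) c N by (simp add: field_simps)
        ultimately show ?thesis by (simp add: t_def)
      qed
      ultimately show ?thesis
        using L1 v by (subst normal_density_L1_rescale) auto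
    qed
    have "tv_dist P (normal_law m1 v1) \<le> measure (normal_law m2 v2) (- {- B..B}) +
      (LINT x|lborel. \<bar>normal_density m2 (sqrt v2) x - normal_density m1 (sqrt v1) x\<bar>)"
      by (rule tv_dist_truncated_normal[OF v P]) (use Pm pos in \<open>auto simp: m2_def v2_def p_def\<close>)
    also have "\<dots> \<le> e" using tail L e' by simp
    finally show "tv_dist P (normal_law (b + u / q) (\<sigma>\<^sup>2 / q)) \<le> e" by (simp add: m1_def v1_def)
  qed
qed

section \<open>The marginal posterior\<close>

lemma gaussian_process_moments:
  assumes "gaussian_process M T" "t \<in> T"
  shows "integrable M (\<lambda>f. f t)" "integrable M (\<lambda>f. (f t)\<^sup>2)"
proof -
  have [measurable]: "(\<lambda>f. f t) \<in> borel_measurable M" using assms by (simp add: gaussian_process_def)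
  have "finite {t} \<and> {t} \<subseteq> T" using assms(2) by simp
  with assms(1) obtain m v where "v \<ge> 0" "distr M borel (\<lambda>f. \<Sum>s\<in>{t}. (\<lambda>_. 1) s * f s) = normal_law m v"
    unfolding gaussian_process_def by meson
  then have law: "0 \<le> v" "distr M borel (\<lambda>f. f t) = normal_law m v" by simp_all
  from normal_law_moments(1,2)[OF law(1), of m]
  show "integrable M (\<lambda>f. f t)" "integrable M (\<lambda>f. (f t)\<^sup>2)"
    unfolding law(2)[symmetric] by (simp_all add: integrable_distr_eq)
qed

text \<open>Normality of a process refers to finite sets of points, whereas design points may
  coincide: the coefficients of equal points are pooled. The mean and the variance of the resulting
  normal law are then identified by its first two moments, which also show that the covariance
  matrix is positive semidefinite.\<close>

lemma gaussian_vector_of_process: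
  fixes M :: "('a \<Rightarrow> real) measure"
  assumes gp: "centered_gaussian_process M T \<kappa>" and w: "\<And>i. i < n \<Longrightarrow> w i \<in> T"
  shows "gaussian_vector M n (\<lambda>i f. f (w i)) (\<lambda>i j. \<kappa> (w i) (w j))"
proof -
  have G: "gaussian_process M T" using gp by (simp add: centered_gaussian_process_def)
  interpret prob_space M using G by (simp add: gaussian_process_def)
  have [measurable]: "(\<lambda>f. f (w i)) \<in> borel_measurable M" if "i < n" for i
    using G w[OF that] by (simp add: gaussian_process_def)
  note int = gaussian_process_moments[OF G w]
  have intp: "integrable M (\<lambda>f. f (w i) * f (w j))" if "i < n" "j < n" for i j
  proof (rule Bochner_Integration.integrable_bound)
    show "integrable M (\<lambda>f. (f (w i))\<^sup>2 + (f (w j))\<^sup>2)" using int that by simp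
    show "AE f in M. norm (f (w i) * f (w j)) \<le> norm ((f (w i))\<^sup>2 + (f (w j))\<^sup>2)"
    proof (rule AE_I2)
      fix f :: "'a \<Rightarrow> real"
      have "2 * (\<bar>f (w i)\<bar> * \<bar>f (w j)\<bar>) \<le> (f (w i))\<^sup>2 + (f (w j))\<^sup>2"
        using sum_squares_bound[of "\<bar>f (w i)\<bar>" "\<bar>f (w j)\<bar>"] by simp
      moreover have "0 \<le> \<bar>f (w i)\<bar> * \<bar>f (w j)\<bar>" by simp
      ultimately have "\<bar>f (w i)\<bar> * \<bar>f (w j)\<bar> \<le> (f (w i))\<^sup>2 + (f (w j))\<^sup>2" by linarith
      then show "norm (f (w i) * f (w j)) \<le> norm ((f (w i))\<^sup>2 + (f (w j))\<^sup>2)"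
        by (simp add: abs_mult)
    qed
  qed (use that in measurable)
  have K: "(LINT f|M. f (w i) * f (w j)) = \<kappa> (w i) (w j)" if "i < n" "j < n" for i j
    using gp w that by (simp add: centered_gaussian_process_def)
  let ?K = "\<lambda>i j. \<kappa> (w i) (w j)"
  have sq: "(LINT f|M. (dotp n b (\<lambda>i. f (w i)))\<^sup>2) = dotp n b (mat_app n ?K b)" for b
  proof -
    have "(LINT f|M. (dotp n b (\<lambda>i. f (w i)))\<^sup>2) = (LINT f|M. (\<Sum>i<n. \<Sum>j<n. b i * (b j * (f (w i) * f (w j)))))"
      by (simp add: dotp_def power2_eq_square sum_product mult_ac)
    also have "\<dots> = (\<Sum>i<n. LINT f|M. (\<Sum>j<n. b i * (b j * (f (w i) * f (w j)))))"
      by (rule Bochner_Integration.integral_sum) (auto intro!: Bochner_Integration.integrable_sum intp)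
    also have "\<dots> = (\<Sum>i<n. \<Sum>j<n. LINT f|M. b i * (b j * (f (w i) * f (w j))))"
      by (intro sum.cong refl Bochner_Integration.integral_sum) (auto intro!: intp)
    also have "\<dots> = (\<Sum>i<n. \<Sum>j<n. b i * (b j * ?K i j))"
      by (intro sum.cong refl) (simp add: K)
    finally show ?thesis by (simp add: dotp_def mat_app_def sum_distrib_left mult_ac)
  qed
  show ?thesis
  proof (unfold_locales)
    show "psd_mat n ?K"
      unfolding psd_mat_def
    proof (intro conjI allI impI)
      show "\<kappa> (w i) (w j) = \<kappa> (w j) (w i)" if "i < n" "j < n" for i j
        using K[OF that] K[OF that(2,1)] by (simp add: mult.commute)
      show "0 \<le> dotp n b (mat_app n ?K b)" for b
        unfolding sq[symmetric] by (intro integral_nonneg_AE) simp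
    qed
    fix a :: "nat \<Rightarrow> real"
    define S where "S = w ` {..<n}"
    have "finite S \<and> S \<subseteq> T" using w by (auto simp: S_def)
    with G obtain m v where mv: "v \<ge> 0"
      "distr M borel (\<lambda>f. \<Sum>s\<in>S. (\<Sum>i\<in>{i. i \<in> {..<n} \<and> w i = s}. a i) * f s) = normal_law m v"
      unfolding gaussian_process_def by meson
    have "(\<Sum>s\<in>S. (\<Sum>i\<in>{i. i \<in> {..<n} \<and> w i = s}. a i) * f s) = dotp n a (\<lambda>i. f (w i))" for f
      unfolding S_def dotp_def
      by (subst (2) sum.image_gen[where g=w]) (auto simp: sum_distrib_right intro!: sum.cong)
    with mv have law: "distr M borel (\<lambda>f. dotp n a (\<lambda>i. f (w i))) = normal_law m v" by simp
    have meas: "(\<lambda>f. dotp n a (\<lambda>i. f (w i))) \<in> borel_measurable M"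
      unfolding dotp_def by measurable
    have "m = (LINT f|M. dotp n a (\<lambda>i. f (w i)))"
      using normal_law_moments(3)[OF mv(1), of m] meas unfolding law[symmetric] by (simp add: integral_distr)
    also have "\<dots> = (\<Sum>i<n. a i * (LINT f|M. f (w i)))"
      unfolding dotp_def using int by (simp add: Bochner_Integration.integral_sum)
    also have "\<dots> = 0" using gp w by (simp add: centered_gaussian_process_def)
    finally have m: "m = 0" .
    have "m\<^sup>2 + v = (LINT f|M. (dotp n a (\<lambda>i. f (w i)))\<^sup>2)"
      using normal_law_moments(4)[OF mv(1), of m] meas unfolding law[symmetric] by (simp add: integral_distr)
    then show "distr M borel (\<lambda>f. dotp n a (\<lambda>i. f (w i))) = normal_law 0 (dotp n a (mat_app n ?K a))"
      using law m sq by simp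
  qed auto
qed

lemma exp_quadratic_eq_normal_density:
  assumes "0 < p"
  shows "exp (t * q - t\<^sup>2 / 2 * p) = (exp (q\<^sup>2 / (2 * p)) * sqrt (2 * pi / p)) * normal_density (q / p) (sqrt (1 / p)) t"
proof -
  have "t * q - t\<^sup>2 / 2 * p = q\<^sup>2 / (2 * p) + (- (t - q / p)\<^sup>2 / (2 * (1 / p)))"
    using assms by (simp add: power2_eq_square field_simps)
  then have "exp (t * q - t\<^sup>2 / 2 * p) = exp (q\<^sup>2 / (2 * p)) * exp (- (t - q / p)\<^sup>2 / (2 * (1 / p)))"
    by (simp only: exp_add)
  then show ?thesis using assms by (simp add: normal_density_def)
qed

text \<open>Here \<open>a = (\<sigma>\<^sup>2 I + K)^-1 X\<close>, so \<open>p\<close> and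
  \<open>q\<close> are the coefficients of the quadratic log-likelihood left after integrating out
  \<open>\<eta>\<close>. As a function of \<open>\<beta>\<close> it is a multiple of a normal
  density with centre \<open>q / p\<close> and precision \<open>p\<close>; the uniform prior cuts it
  off at the ends of the interval, and the multiple cancels in the normalisation.\<close>

lemma beta_posterior_truncated_normal:
  fixes M :: "('w \<Rightarrow> real) measure" and d :: "nat \<Rightarrow> real \<times> real"
  assumes gv: "gaussian_vector M n (\<lambda>i f. f (w i)) K" and B: "0 < B" and \<sigma>: "0 < \<sigma>"
    and a: "\<And>i. i < n \<Longrightarrow> \<sigma>\<^sup>2 * a i + mat_app n K a i = snd (d i)"
  defines "p \<equiv> dotp n a (\<lambda>i. snd (d i))" and "q \<equiv> dotp n a (\<lambda>i. fst (d i))"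
    and "P \<equiv> beta_posterior \<sigma> (uniform_measure lborel {- B..B}) M n d w"
  assumes p: "0 < p"
  shows "sets P = sets borel"
    "\<And>A. A \<in> sets borel \<Longrightarrow> measure P A =
       measure (normal_law (q / p) (1 / p)) (A \<inter> {- B..B}) / measure (normal_law (q / p) (1 / p)) {- B..B}"
proof -
  interpret gaussian_vector M n "\<lambda>i f. f (w i)" K by fact
  define U where "U = uniform_measure lborel {- B..B}"
  have U: "prob_space U" unfolding U_def using B by (intro prob_space_uniform_measure) auto
  have [measurable_cong]: "sets U = sets borel" by (simp add: U_def)
  interpret U: prob_space U by fact
  interpret UM: pair_prob_space U M
    by (simp add: pair_prob_space_def pair_sigma_finite_def U prob_space_axioms prob_space_imp_sigma_finite)
  define L where "L = plm_likelihood \<sigma> n d w"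
  have L_eq: "L (\<beta>, f) = gauss_prod \<sigma> n (\<lambda>i. fst (d i) - \<beta> * snd (d i)) (\<lambda>i. f (w i))" for \<beta> f
    by (simp add: L_def plm_likelihood_def gauss_prod_def mult.commute)
  have L_pos: "0 < L z" for z using gauss_prod_pos L_eq by (cases z) simp
  have L_meas [measurable]: "L \<in> borel_measurable (U \<Otimes>\<^sub>M M)"
    unfolding L_def plm_likelihood_def case_prod_beta
    by (intro borel_measurable_prod borel_measurable_exp borel_measurable_times borel_measurable_power
        borel_measurable_diff borel_measurable_const measurable_compose[OF measurable_snd])
      (auto intro!: measurable_compose[OF measurable_fst] simp: U_def)
  define Z where "Z = (\<integral>\<^sup>+z. ennreal (L z) \<partial>(U \<Otimes>\<^sub>M M))"
  have Z0: "Z \<noteq> 0"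
  proof
    assume "Z = 0"
    then have "AE z in U \<Otimes>\<^sub>M M. ennreal (L z) = 0"
      unfolding Z_def by (subst (asm) nn_integral_0_iff_AE) auto
    then have "AE z in U \<Otimes>\<^sub>M M. False"
      by eventually_elim (use L_pos in \<open>simp add: ennreal_eq_0_iff not_le[symmetric]\<close>)
    then show False using UM.P.AE_False by simp
  qed
  define \<phi>0 where "\<phi>0 = (LINT f|M. gauss_prod \<sigma> n (\<lambda>i. fst (d i)) (\<lambda>i. f (w i)))"
  have \<phi>0: "\<phi>0 > 0" unfolding \<phi>0_def by (rule marginal_likelihood_pos)
  \<comment> \<open>The marginal likelihood at \<open>\<beta> = 0\<close> times the constant left
    over from completing the square.\<close>
  define C where "C = \<phi>0 * (exp (q\<^sup>2 / (2 * p)) * sqrt (2 * pi / p))"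
  have C: "C > 0" using \<phi>0 p by (simp add: C_def)
  let ?nd = "normal_density (q / p) (sqrt (1 / p))"
  have inner: "(\<integral>\<^sup>+f. ennreal (L (\<beta>, f)) \<partial>M) = ennreal (C * ?nd \<beta>)" for \<beta>
  proof -
    have "(\<integral>\<^sup>+f. ennreal (L (\<beta>, f)) \<partial>M) = ennreal (LINT f|M. L (\<beta>, f))"
      unfolding L_eq by (intro nn_integral_eq_integral integrable_gauss_prod) (simp add: gauss_prod_nonneg)
    also have "(LINT f|M. L (\<beta>, f)) = \<phi>0 * exp (\<beta> * q - \<beta>\<^sup>2 / 2 * p)"
      unfolding L_eq q_def p_def \<phi>0_def by (rule marginal_likelihood_quadratic[OF \<sigma> a])
    finally show ?thesis unfolding exp_quadratic_eq_normal_density[OF p] by (simp add: C_def mult_ac)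
  qed
  let ?N = "normal_law (q / p) (1 / p)"
  have N: "?N = density lborel (\<lambda>x. ennreal (?nd x))" using p by (simp add: normal_law_def)
  interpret N: prob_space ?N using p by (simp add: prob_space_normal_law)
  define k where "k = ennreal (C / (2 * B))"
  have mass: "(\<integral>\<^sup>+z. indicator A (fst z) * ennreal (L z) \<partial>(U \<Otimes>\<^sub>M M)) = k * emeasure ?N (A \<inter> {- B..B})"
    if [measurable]: "A \<in> sets borel" for A
  proof -
    have "(\<integral>\<^sup>+z. indicator A (fst z) * ennreal (L z) \<partial>(U \<Otimes>\<^sub>M M)) =
      (\<integral>\<^sup>+\<beta>. \<integral>\<^sup>+f. indicator A \<beta> * ennreal (L (\<beta>, f)) \<partial>M \<partial>U)"
      by (subst nn_integral_fst[symmetric]) auto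
    also have "\<dots> = (\<integral>\<^sup>+\<beta>. indicator A \<beta> * ennreal (C * ?nd \<beta>) \<partial>U)"
    proof (intro nn_integral_cong)
      fix \<beta> assume "\<beta> \<in> space U"
      then have "(\<lambda>f. ennreal (L (\<beta>, f))) \<in> borel_measurable M" by measurable
      then show "(\<integral>\<^sup>+f. indicator A \<beta> * ennreal (L (\<beta>, f)) \<partial>M) = indicator A \<beta> * ennreal (C * ?nd \<beta>)"
        by (simp add: nn_integral_cmult inner)
    qed
    also have "\<dots> = (\<integral>\<^sup>+\<beta>. indicator A \<beta> * ennreal (C * ?nd \<beta>) * indicator {- B..B} \<beta> \<partial>lborel) / emeasure lborel {- B..B}"
      unfolding U_def by (subst nn_integral_uniform_measure) auto
    also have "\<dots> = (\<integral>\<^sup>+\<beta>. ennreal C * (ennreal (?nd \<beta>) * indicator (A \<inter> {- B..B}) \<beta>) \<partial>lborel) / emeasure lborel {- B..B}"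
      using C by (intro arg_cong2[where f="(/)"] nn_integral_cong refl)
        (auto simp: ennreal_mult split: split_indicator)
    also have "\<dots> = ennreal C * emeasure ?N (A \<inter> {- B..B}) / ennreal (2 * B)"
      using B by (simp add: nn_integral_cmult N emeasure_density)
    also have "\<dots> = k * emeasure ?N (A \<inter> {- B..B})"
      using B C by (simp add: k_def divide_ennreal[symmetric] ennreal_divide_times ennreal_times_divide mult.commute)
    finally show ?thesis .
  qed
  show sets: "sets P = sets borel" by (simp add: P_def beta_posterior_def)
  have em: "emeasure P A = k * emeasure ?N (A \<inter> {- B..B}) / Z" if A [measurable]: "A \<in> sets borel" for A
  proof -
    have "emeasure P A = emeasure (density (U \<Otimes>\<^sub>M M) (\<lambda>z. ennreal (L z) / Z)) (fst -` A \<inter> space (U \<Otimes>\<^sub>M M))"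
      unfolding P_def beta_posterior_def posterior_def U_def[symmetric] L_def[symmetric] Z_def[symmetric]
      by (subst emeasure_distr) (auto intro: measurable_fst'' )
    also have "\<dots> = (\<integral>\<^sup>+z. ennreal (L z) / Z * indicator (fst -` A \<inter> space (U \<Otimes>\<^sub>M M)) z \<partial>(U \<Otimes>\<^sub>M M))"
      by (subst emeasure_density) auto
    also have "\<dots> = (\<integral>\<^sup>+z. indicator A (fst z) * ennreal (L z) / Z \<partial>(U \<Otimes>\<^sub>M M))"
      by (intro nn_integral_cong) (auto split: split_indicator)
    also have "\<dots> = (\<integral>\<^sup>+z. indicator A (fst z) * ennreal (L z) \<partial>(U \<Otimes>\<^sub>M M)) / Z"
      by (rule nn_integral_divide) measurable
    finally show ?thesis by (simp add: mass)
  qed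
  have Zeq: "Z = k * emeasure ?N {- B..B}"
    using mass[of UNIV] by (simp add: Z_def)
  define c where "c = C / (2 * B)"
  have c: "c > 0" using C B by (simp add: c_def)
  have Zc: "Z = ennreal (c * measure ?N {- B..B})"
    using c by (simp add: Zeq k_def N.emeasure_eq_measure c_def[symmetric] ennreal_mult')
  \<comment> \<open>The likelihood is strictly positive, hence so is the normalising constant
    \<open>Z\<close>, which is a multiple of this mass.\<close>
  have NI: "0 < measure ?N {- B..B}"
    using Z0 c unfolding Zc by (metis ennreal_0 measure_le_0_iff mult_zero_right not_le)
  fix A :: "real set" assume A: "A \<in> sets borel"
  have "emeasure P A = ennreal (c * measure ?N (A \<inter> {- B..B})) / ennreal (c * measure ?N {- B..B})"
    using c unfolding em[OF A] Zc by (simp add: k_def N.emeasure_eq_measure c_def[symmetric] ennreal_mult')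
  also have "\<dots> = ennreal ((c * measure ?N (A \<inter> {- B..B})) / (c * measure ?N {- B..B}))"
    using c NI by (intro divide_ennreal) auto
  also have "(c * measure ?N (A \<inter> {- B..B})) / (c * measure ?N {- B..B}) = measure ?N (A \<inter> {- B..B}) / measure ?N {- B..B}"
    using c by simp
  finally show "measure P A = measure ?N (A \<inter> {- B..B}) / measure ?N {- B..B}"
    by (simp add: measure_def)
qed

section \<open>Splines with a Fourier representation\<close>

abbreviation unif01 :: "real measure" where
  "unif01 \<equiv> uniform_measure lborel {0..1}"

interpretation unif01: real_distribution unif01
  by (intro real_distribution.intro prob_space_uniform_measure) (auto simp: real_distribution_axioms_def)

lemma unif01_density: "unif01 = density lborel (\<lambda>x. ennreal (indicator {0..1} x))"
proof -
  have "emeasure lborel {0..1::real} = 1" by simp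
  then show ?thesis unfolding uniform_measure_def
    by (intro density_cong) (auto simp: indicator_def divide_ennreal_def)
qed

lemma char_unif01:
  assumes "t \<noteq> 0"
  shows "char unif01 t = (iexp t - 1) / (\<i> * t)"
proof -
  have "char unif01 t = (LINT x:{0..1}|lborel. iexp (t * x))"
    unfolding char_def unfolding unif01_density by (subst integral_density) (auto simp: set_lebesgue_integral_def)
  also have "\<dots> = (CLBINT x=0..1. iexp (t * x))"
    by (simp add: interval_integral_Icc one_ereal_def zero_ereal_def)
  also have "\<dots> = iexp (t * 1) / (\<i> * t) - iexp (t * 0) / (\<i> * t)"
    unfolding one_ereal_def zero_ereal_def
  proof (rule interval_integral_FTC_finite)
    show "continuous_on {min 0 1..max 0 1} (\<lambda>x. iexp (t * x))" by (intro continuous_intros)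
    fix x :: real
    have "((\<lambda>z. exp (\<i> * (of_real t * z)) / (\<i> * of_real t)) has_field_derivative exp (\<i> * (of_real t * of_real x))) (at (of_real x))"
      using assms by (auto intro!: derivative_eq_intros simp: mult.commute[of _ \<i>])
    from has_vector_derivative_real_field[OF this]
    show "((\<lambda>x. iexp (t * x) / (\<i> * t)) has_vector_derivative iexp (t * x)) (at x within {min 0 1..max 0 1})"
      by simp
  qed
  finally show ?thesis by (simp add: diff_divide_distrib)
qed

text \<open>One order of decay is what each moving average gains in the frequency domain. The
  constant 3 covers the trivial bound 1 for \<open>\<bar>t\<bar> \<le> 2\<close> and the bound
  \<open>2 / \<bar>t\<bar>\<close> beyond.\<close>

lemma norm_char_unif01: "norm (char unif01 t) \<le> 3 / (1 + \<bar>t\<bar>)"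
proof (cases "\<bar>t\<bar> \<le> 2")
  case True
  moreover have "0 < 1 + \<bar>t\<bar>" by simp
  ultimately have "1 \<le> 3 / (1 + \<bar>t\<bar>)" by (simp add: pos_le_divide_eq)
  then show ?thesis using unif01.cmod_char_le_1[of t] by linarith
next
  case False
  then have t: "t \<noteq> 0" by auto
  have "norm (char unif01 t) = norm (iexp t - 1) / \<bar>t\<bar>"
    unfolding char_unif01[OF t] by (simp add: norm_divide norm_mult)
  also have "\<dots> \<le> 2 / \<bar>t\<bar>"
    using norm_triangle_ineq4[of "iexp t" 1] by (intro divide_right_mono) auto
  also have "\<dots> \<le> 3 / (1 + \<bar>t\<bar>)" using False by (simp add: field_simps)
  finally show ?thesis .
qed

lemma integrable_inverse_1_plus_abs_sq: "integrable lborel (\<lambda>t::real. 1 / (1 + \<bar>t\<bar>)\<^sup>2)"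
proof (rule Bochner_Integration.integrable_bound)
  show "integrable lborel (\<lambda>x::real. inverse (1 + x\<^sup>2))"
    using integrable_inverse_1_plus_square by (simp add: set_integrable_def einterval_def)
  show "AE t in (lborel::real measure). norm (1 / (1 + \<bar>t\<bar>)\<^sup>2) \<le> norm (inverse (1 + t\<^sup>2))"
  proof (rule AE_I2)
    fix t :: real
    have "1 + t\<^sup>2 \<le> (1 + \<bar>t\<bar>)\<^sup>2" by (simp add: power2_sum)
    moreover have "0 < 1 + t\<^sup>2" by (simp add: add_pos_nonneg)
    ultimately show "norm (1 / (1 + \<bar>t\<bar>)\<^sup>2) \<le> norm (inverse (1 + t\<^sup>2))"
      by (simp add: inverse_eq_divide frac_le)
  qed
qed simp

text \<open>The triangle function is \<open>a \<mapsto> \<mu>(a, a + 1]\<close> for the uniform law \<open>\<mu>\<close>; the inversion formula then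
  gives its Fourier representation.\<close>

lemma triangle_fourier:
  "complex_of_real (LINT u|unif01. indicator {- 1..<0} (a - u)) =
     (LINT t|lborel. cis (- (t * a)) * of_real ((norm (char unif01 t))\<^sup>2 / (2 * pi)))"
proof -
  let ?g = "\<lambda>t. cis (- (t * a)) * complex_of_real ((norm (char unif01 t))\<^sup>2)"
  have gm [measurable]: "?g \<in> borel_measurable borel"
    by (intro borel_measurable_times) (auto intro!: borel_measurable_continuous_onI continuous_intros)
  have null: "measure unif01 {x} = 0" for x
    by (simp add: measure_uniform_measure emeasure_lborel_countable measure_def emeasure_uniform_measure)
  \<comment> \<open>For an interval of length 1 the factor in Levy's inversion formula is, up to a
    phase, the conjugate of the characteristic function itself. The integrand becomes the square of
    its modulus, which is integrable, so the truncated integrals converge to one over the whole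
    line.\<close>
  have int: "(iexp (- (t * a)) - iexp (- (t * (a + 1)))) / (\<i> * t) * char unif01 t = ?g t" if "t \<noteq> 0" for t
  proof -
    have "iexp (- (t * (a + 1))) = cis (- (t * a)) * cnj (iexp t)"
      by (simp add: cis_conv_exp exp_cnj exp_add[symmetric] algebra_simps)
    then have "(iexp (- (t * a)) - iexp (- (t * (a + 1)))) / (\<i> * t) = cis (- (t * a)) * cnj (char unif01 t)"
      unfolding char_unif01[OF that] by (simp add: cis_conv_exp algebra_simps diff_divide_distrib)
    then show ?thesis using complex_norm_square[of "char unif01 t"] by (simp add: mult_ac)
  qed
  have "(\<lambda>T. 1 / (2 * pi) * (CLBINT t=-real T..real T. (iexp (-(t * a)) - iexp (-(t * (a + 1)))) / (\<i> * t) * char unif01 t))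
      \<longlonglongrightarrow> complex_of_real (measure unif01 {a<..a + 1})"
    using unif01.Levy_Inversion[of a "a + 1"] null by simp
  moreover have "(CLBINT t=-real T..real T. (iexp (-(t * a)) - iexp (-(t * (a + 1)))) / (\<i> * t) * char unif01 t) =
      (LINT t|lborel. indicator {- real T..real T} t *\<^sub>R ?g t)" for T
  proof -
    have "(CLBINT t=-real T..real T. (iexp (-(t * a)) - iexp (-(t * (a + 1)))) / (\<i> * t) * char unif01 t) =
      (LINT t:{- real T..real T}|lborel. (iexp (-(t * a)) - iexp (-(t * (a + 1)))) / (\<i> * t) * char unif01 t)"
      by (simp add: interval_integral_Icc)
    also have "\<dots> = (LINT t:{- real T..real T}|lborel. ?g t)"
      unfolding set_lebesgue_integral_def
    proof (rule integral_cong_AE)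
      show "AE t in lborel. indicator {- real T..real T} t *\<^sub>R ((iexp (-(t * a)) - iexp (-(t * (a + 1)))) / (\<i> * t) * char unif01 t) =
          indicator {- real T..real T} t *\<^sub>R ?g t"
        using AE_lborel_singleton[of 0] by eventually_elim (subst int, auto)
    qed measurable
    finally show ?thesis by (simp add: set_lebesgue_integral_def)
  qed
  moreover have "(\<lambda>T. LINT t|lborel. indicator {- real T..real T} t *\<^sub>R ?g t) \<longlonglongrightarrow> (LINT t|lborel. ?g t)"
  proof (rule integral_dominated_convergence)
    show "integrable lborel (\<lambda>t::real. 9 * (1 / (1 + \<bar>t\<bar>)\<^sup>2))"
      by (intro integrable_mult_right integrable_inverse_1_plus_abs_sq)
    show "AE t in lborel. (\<lambda>T. indicator {- real T..real T} t *\<^sub>R ?g t) \<longlonglongrightarrow> ?g t"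
    proof (rule AE_I2)
      fix t :: real
      have "\<forall>\<^sub>F T in sequentially. \<bar>t\<bar> \<le> real T"
        using eventually_ge_at_top[of "nat \<lceil>\<bar>t\<bar>\<rceil>"] by eventually_elim linarith
      then have "\<forall>\<^sub>F T in sequentially. indicator {- real T..real T} t *\<^sub>R ?g t = ?g t"
        by eventually_elim (auto simp: indicator_def)
      then show "(\<lambda>T. indicator {- real T..real T} t *\<^sub>R ?g t) \<longlonglongrightarrow> ?g t"
        by (rule tendsto_eventually)
    qed
    show "AE t in lborel. norm (indicator {- real T..real T} t *\<^sub>R ?g t) \<le> 9 * (1 / (1 + \<bar>t\<bar>)\<^sup>2)" for T
    proof (rule AE_I2)
      fix t :: real
      have "(norm (char unif01 t))\<^sup>2 \<le> (3 / (1 + \<bar>t\<bar>))\<^sup>2"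
        by (intro power_mono norm_char_unif01) simp
      then show "norm (indicator {- real T..real T} t *\<^sub>R ?g t) \<le> 9 * (1 / (1 + \<bar>t\<bar>)\<^sup>2)"
        by (auto simp: norm_mult power_divide norm_power indicator_def)
    qed
  qed (use gm in measurable)
  ultimately have "complex_of_real (measure unif01 {a<..a + 1}) = 1 / (2 * pi) * (LINT t|lborel. ?g t)"
    by (intro LIMSEQ_unique) (auto intro: tendsto_intros)
  \<comment> \<open>\<open>a - u\<close> lies in \<open>[-1, 0)\<close> exactly when
    \<open>u\<close> lies in \<open>(a, a + 1]\<close>.\<close>
  moreover have "(LINT u|unif01. indicator {- 1..<0} (a - u)) = measure unif01 {a<..a + 1}"
  proof -
    have "(\<lambda>u. indicator {- 1..<0} (a - u) :: real) = indicator {a<..a + 1}"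
      by (auto simp: indicator_def fun_eq_iff)
    then show ?thesis by simp
  qed
  moreover have "1 / (2 * pi) * (LINT t|lborel. ?g t) = (LINT t|lborel. cis (- (t * a)) * of_real ((norm (char unif01 t))\<^sup>2 / (2 * pi)))"
    by (subst integral_mult_right_zero[symmetric]) (simp add: field_simps)
  ultimately show ?thesis by simp
qed

definition bump :: "real \<Rightarrow> (real \<Rightarrow> real) \<Rightarrow> bool" where
  "bump M p \<longleftrightarrow> p \<in> borel_measurable borel \<and> (\<forall>x. 0 \<le> p x \<and> p x \<le> 1) \<and> (\<forall>x. M < \<bar>x\<bar> \<longrightarrow> p x = 0) \<and>
     (\<integral>\<^sup>+x. ennreal (p x) \<partial>lborel) = 1"

text \<open>Averaging over shifts from \<open>[0, 1]\<close> widens the support by 1; the total mass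
  is preserved by Fubini and translation invariance.\<close>

lemma bump_smooth:
  assumes "bump M p"
  shows "bump (M + 1) (\<lambda>x. LINT u|unif01. p (x - u))"
proof -
  have [measurable]: "p \<in> borel_measurable borel" and p: "\<And>x. 0 \<le> p x" "\<And>x. p x \<le> 1"
    "\<And>x. M < \<bar>x\<bar> \<Longrightarrow> p x = 0" and p1: "(\<integral>\<^sup>+x. ennreal (p x) \<partial>lborel) = 1"
    using assms by (auto simp: bump_def)
  have int: "integrable unif01 (\<lambda>u. p (x - u))" for x
    by (rule unif01.integrable_const_bound[where B=1]) (auto simp: p)
  have [measurable]: "(\<lambda>x. LINT u|unif01. p (x - u)) \<in> borel_measurable borel"
    by measurable
  show ?thesis unfolding bump_def
  proof (intro conjI allI impI)
    fix x
    show "0 \<le> (LINT u|unif01. p (x - u))" by (intro integral_nonneg_AE) (simp add: p)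
    have "(LINT u|unif01. p (x - u)) \<le> (LINT u|unif01. 1)" using int p by (intro integral_mono) auto
    then show "(LINT u|unif01. p (x - u)) \<le> 1" using unif01.prob_space by simp
    assume x: "M + 1 < \<bar>x\<bar>"
    have "AE u in unif01. u \<in> {0..1}" by (intro AE_uniform_measureI) auto
    then have "AE u in unif01. p (x - u) = 0"
      by eventually_elim (use x in \<open>auto intro!: p(3)\<close>)
    then show "(LINT u|unif01. p (x - u)) = 0" by (rule integral_eq_zero_AE)
  next
    interpret P: pair_sigma_finite lborel unif01
      by (intro pair_sigma_finite.intro sigma_finite_lborel unif01.sigma_finite_measure_axioms)
    have "(\<integral>\<^sup>+x. ennreal (LINT u|unif01. p (x - u)) \<partial>lborel) = (\<integral>\<^sup>+x. \<integral>\<^sup>+u. ennreal (p (x - u)) \<partial>unif01 \<partial>lborel)"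
      by (intro nn_integral_cong nn_integral_eq_integral[symmetric] int) (simp add: p)
    also have "\<dots> = (\<integral>\<^sup>+u. \<integral>\<^sup>+x. ennreal (p (x - u)) \<partial>lborel \<partial>unif01)"
      by (rule P.Fubini'[symmetric]) measurable
    also have "\<dots> = (\<integral>\<^sup>+u. 1 \<partial>unif01)"
    proof (intro nn_integral_cong)
      fix u :: real
      show "(\<integral>\<^sup>+x. ennreal (p (x - u)) \<partial>lborel) = 1"
        using nn_integral_real_affine[of "\<lambda>x. ennreal (p x)" 1 "- u"] p1 by simp
    qed
    also have "\<dots> = 1" using unif01.emeasure_space_1 by simp
    finally show "(\<integral>\<^sup>+x. ennreal (LINT u|unif01. p (x - u)) \<partial>lborel) = 1" .
  qed measurable
qed

text \<open>Iterated moving averages of the triangle function: compact support and polynomial decay of any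
  prescribed order in the frequency domain.\<close>

lemma spline_bump:
  "\<exists>p \<psi> C M. 0 < M \<and> 0 < C \<and> bump M p \<and> \<psi> \<in> borel_measurable borel \<and>
     (\<forall>t. norm (\<psi> t) \<le> C / (1 + \<bar>t\<bar>) ^ (r + 2)) \<and>
     (\<forall>x. complex_of_real (p x) = (LINT t|lborel. cis (- (t * x)) * \<psi> t))"
proof (induction r)
  case 0
  let ?\<psi> = "\<lambda>t. complex_of_real ((norm (char unif01 t))\<^sup>2 / (2 * pi))"
  \<comment> \<open>The transform of an indicator decays to order 1 only and is not integrable. One
    moving average gives the triangle function with order 2, which is the origin of the exponent
    \<open>r + 2\<close>.\<close>
  have "bump 1 (indicator {- 1..<0::real})"
    unfolding bump_def
  proof (intro conjI allI impI)
    show "(\<integral>\<^sup>+x. ennreal (indicator {- 1..<0::real} x) \<partial>lborel) = 1"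
      by (simp add: ennreal_indicator)
  qed (auto simp: indicator_def)
  from bump_smooth[OF this] have b: "bump 2 (\<lambda>x. LINT u|unif01. indicator {- 1..<0} (x - u))" by simp
  have "norm (?\<psi> t) \<le> 9 / (1 + \<bar>t\<bar>)\<^sup>2" for t
  proof -
    have "(norm (char unif01 t))\<^sup>2 \<le> (3 / (1 + \<bar>t\<bar>))\<^sup>2"
      by (intro power_mono norm_char_unif01) simp
    then have a: "(norm (char unif01 t))\<^sup>2 \<le> 9 / (1 + \<bar>t\<bar>)\<^sup>2" by (simp add: power_divide)
    have "(norm (char unif01 t))\<^sup>2 / (2 * pi) \<le> (norm (char unif01 t))\<^sup>2 / 1"
      using pi_gt3 by (intro divide_left_mono) auto
    then show ?thesis using a by (simp add: norm_divide norm_power)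
  qed
  then have n: "\<forall>t. norm (?\<psi> t) \<le> 9 / (1 + \<bar>t\<bar>) ^ (0 + 2)" unfolding add_0 by blast
  have m: "?\<psi> \<in> borel_measurable borel" by measurable
  show ?case
    by (rule exI[of _ "\<lambda>x. LINT u|unif01. indicator {- 1..<0} (x - u)"], rule exI[of _ ?\<psi>],
        rule exI[of _ 9], rule exI[of _ 2])
       (use b n m triangle_fourier in auto)
next
  case (Suc r)
  then obtain p \<psi> C M where M: "0 < M" and C: "0 < C" and b: "bump M p"
    and [measurable]: "\<psi> \<in> borel_measurable borel"
    and \<psi>: "\<And>t. norm (\<psi> t) \<le> C / (1 + \<bar>t\<bar>) ^ (r + 2)"
    and p: "\<And>x. complex_of_real (p x) = (LINT t|lborel. cis (- (t * x)) * \<psi> t)"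
    by blast
  have [measurable]: "p \<in> borel_measurable borel" using b by (simp add: bump_def)
  \<comment> \<open>A shift by \<open>u\<close> multiplies the spectral function by
    \<open>iexp (t * u)\<close>; averaging over \<open>u\<close> gives the characteristic function
    of the uniform law.\<close>
  let ?\<psi> = "\<lambda>t. \<psi> t * char unif01 t"
  have \<psi>i: "integrable lborel \<psi>"
  proof (rule Bochner_Integration.integrable_bound)
    show "integrable lborel (\<lambda>t::real. C * (1 / (1 + \<bar>t\<bar>)\<^sup>2))"
      by (intro integrable_mult_right integrable_inverse_1_plus_abs_sq)
    show "AE t in lborel. norm (\<psi> t) \<le> norm (C * (1 / (1 + \<bar>t\<bar>)\<^sup>2))"
    proof (rule AE_I2)
      fix t :: real
      have "C / (1 + \<bar>t\<bar>) ^ (r + 2) \<le> C / (1 + \<bar>t\<bar>)\<^sup>2"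
        using C by (intro divide_left_mono power_increasing) auto
      then show "norm (\<psi> t) \<le> norm (C * (1 / (1 + \<bar>t\<bar>)\<^sup>2))" using \<psi>[of t] C by simp
    qed
  qed simp
  interpret P: pair_sigma_finite lborel unif01
    by (intro pair_sigma_finite.intro sigma_finite_lborel unif01.sigma_finite_measure_axioms)
  have cism [measurable]: "cis \<in> borel_measurable borel"
    by (intro borel_measurable_continuous_onI continuous_intros)
  have "complex_of_real (LINT u|unif01. p (x - u)) = (LINT t|lborel. cis (- (t * x)) * ?\<psi> t)" for x
  proof -
    have "complex_of_real (LINT u|unif01. p (x - u)) = (LINT u|unif01. LINT t|lborel. cis (- (t * (x - u))) * \<psi> t)"
      by (simp add: integral_complex_of_real[symmetric] p)
    also have "\<dots> = (LINT t|lborel. LINT u|unif01. cis (- (t * (x - u))) * \<psi> t)"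
    proof (rule P.Fubini_integral)
      show "integrable (lborel \<Otimes>\<^sub>M unif01) (\<lambda>(t, u). cis (- (t * (x - u))) * \<psi> t)"
        by (rule P.integrable_pair_bound[OF _ integrable_norm[OF \<psi>i] unif01.finite_measure_axioms])
           (auto simp: norm_mult)
    qed
    also have "\<dots> = (LINT t|lborel. cis (- (t * x)) * ?\<psi> t)"
    proof (intro Bochner_Integration.integral_cong refl)
      fix t
      have "(LINT u|unif01. cis (- (t * (x - u))) * \<psi> t) = (LINT u|unif01. (cis (- (t * x)) * \<psi> t) * iexp (t * u))"
        by (intro Bochner_Integration.integral_cong refl)
           (simp add: cis_conv_exp exp_add[symmetric] algebra_simps exp_diff)
      also have "\<dots> = cis (- (t * x)) * ?\<psi> t" by (simp add: char_def)
      finally show "(LINT u|unif01. cis (- (t * (x - u))) * \<psi> t) = cis (- (t * x)) * ?\<psi> t" .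
    qed
    finally show ?thesis .
  qed
  moreover have "norm (?\<psi> t) \<le> (3 * C) / (1 + \<bar>t\<bar>) ^ (Suc r + 2)" for t
  proof -
    have "norm (?\<psi> t) \<le> (C / (1 + \<bar>t\<bar>) ^ (r + 2)) * (3 / (1 + \<bar>t\<bar>))"
      unfolding norm_mult using C by (intro mult_mono \<psi> norm_char_unif01) auto
    then show ?thesis by (simp add: mult_ac)
  qed
  moreover have "?\<psi> \<in> borel_measurable borel" by measurable
  ultimately show ?case
    using M C bump_smooth[OF b]
    by (intro exI[of _ "\<lambda>x. LINT u|unif01. p (x - u)"] exI[of _ ?\<psi>] exI[of _ "3 * C"] exI[of _ "M + 1"]) auto
qed

section \<open>Product splines and the Fourier representation of smoothed functions\<close>

lemma lborel_prod_Basis: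
  fixes f :: "'a::euclidean_space \<Rightarrow> real \<Rightarrow> 'b::{real_normed_field, banach, second_countable_topology}"
  assumes "\<And>b. b \<in> Basis \<Longrightarrow> integrable lborel (f b)"
  shows "integrable lborel (\<lambda>x. \<Prod>b\<in>Basis. f b (x \<bullet> b))"
    "(LINT x|lborel. (\<Prod>b\<in>Basis. f b (x \<bullet> b))) = (\<Prod>b\<in>Basis. LINT t|lborel. f b t)"
proof -
  interpret product_sigma_finite "\<lambda>b::'a. lborel :: real measure" ..
  let ?T = "\<lambda>g. \<Sum>b\<in>Basis. g b *\<^sub>R (b::'a)"
  have T: "?T g \<bullet> b = g b" if "b \<in> Basis" for g b
    using that by simp
  have Tm: "?T \<in> (\<Pi>\<^sub>M b\<in>Basis. lborel) \<rightarrow>\<^sub>M borel" by measurable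
  have eq: "(\<Prod>b\<in>Basis. f b (?T g \<bullet> b)) = (\<Prod>b\<in>Basis. f b (g b))" for g
    by (intro prod.cong refl) (simp add: T del: inner_sum_left_Basis)
  have fm [measurable]: "f b \<in> borel_measurable borel" if "b \<in> Basis" for b
    using assms[OF that] by auto
  have m: "(\<lambda>x. \<Prod>b\<in>Basis. f b (x \<bullet> b)) \<in> borel_measurable borel"
    by (intro borel_measurable_prod measurable_compose[OF _ fm]) auto
  show "integrable lborel (\<lambda>x. \<Prod>b\<in>Basis. f b (x \<bullet> b))"
    by (subst lborel_eq, subst integrable_distr_eq[OF Tm m]) (unfold eq, intro product_integrable_prod finite_Basis assms)
  show "(LINT x|lborel. (\<Prod>b\<in>Basis. f b (x \<bullet> b))) = (\<Prod>b\<in>Basis. LINT t|lborel. f b t)"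
    by (subst lborel_eq, subst integral_distr[OF Tm m]) (unfold eq, intro product_integral_prod finite_Basis assms)
qed

lemma cis_sum: "finite A \<Longrightarrow> cis (\<Sum>a\<in>A. f a) = (\<Prod>a\<in>A. cis (f a))"
  by (induction rule: finite_induct) (simp_all add: cis_mult[symmetric])

lemma cis_measurable [measurable]: "cis \<in> borel_measurable borel"
  by (intro borel_measurable_continuous_onI continuous_intros)

text \<open>Turns a product of decay factors in the coordinates into a decay factor in the
  norm.\<close>

lemma one_plus_sum_le_prod:
  fixes a :: "'i \<Rightarrow> real"
  assumes "finite A" "\<And>i. i \<in> A \<Longrightarrow> 0 \<le> a i"
  shows "1 + (\<Sum>i\<in>A. a i) \<le> (\<Prod>i\<in>A. 1 + a i)"
  using assms
proof (induction rule: finite_induct)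
  case (insert j A)
  then have IH: "1 + (\<Sum>i\<in>A. a i) \<le> (\<Prod>i\<in>A. 1 + a i)" by simp
  have "0 \<le> a j" "0 \<le> (\<Sum>i\<in>A. a i)" using insert by (auto intro: sum_nonneg)
  then have "1 + (a j + (\<Sum>i\<in>A. a i)) \<le> (1 + a j) * (1 + (\<Sum>i\<in>A. a i))"
    by (simp add: algebra_simps)
  also have "\<dots> \<le> (1 + a j) * (\<Prod>i\<in>A. 1 + a i)"
    using IH \<open>0 \<le> a j\<close> by (intro mult_left_mono) auto
  finally show ?case using insert by simp
qed simp

text \<open>Tensor products of one-dimensional splines: the Fourier representation factorises over
  the coordinates, and \<open>1 + norm l\<close> is at most the product of the factors
  \<open>1 + \<bar>l \<bullet> b\<bar>\<close>.\<close>

lemma spline_bump_euclidean: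
  "\<exists>P X C M. 0 < M \<and> 0 < C \<and>
     P \<in> borel_measurable borel \<and> (\<forall>y. 0 \<le> P y \<and> P y \<le> 1) \<and>
     (\<forall>y::'a::euclidean_space. P y \<noteq> 0 \<longrightarrow> (\<forall>b\<in>Basis. \<bar>y \<bullet> b\<bar> \<le> M)) \<and>
     integrable lborel P \<and> (LINT y|lborel. P y) = 1 \<and>
     X \<in> borel_measurable borel \<and> integrable lborel X \<and>
     (\<forall>l. norm (X l) \<le> C / (1 + norm l) ^ (r + 2)) \<and>
     (\<forall>y. complex_of_real (P y) = (LINT l|lborel. cis (- (l \<bullet> y)) * X l))"
proof -
  obtain p \<psi> C M where M: "0 < M" and C: "0 < C" and b: "bump M p"
    and [measurable]: "\<psi> \<in> borel_measurable borel"
    and \<psi>: "\<And>t. norm (\<psi> t) \<le> C / (1 + \<bar>t\<bar>) ^ (r + 2)"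
    and p: "\<And>x. complex_of_real (p x) = (LINT t|lborel. cis (- (t * x)) * \<psi> t)"
    using spline_bump[of r] by blast
  have [measurable]: "p \<in> borel_measurable borel" and p01: "\<And>x. 0 \<le> p x" "\<And>x. p x \<le> 1"
    and pM: "\<And>x. M < \<bar>x\<bar> \<Longrightarrow> p x = 0" and p1: "(\<integral>\<^sup>+x. ennreal (p x) \<partial>lborel) = 1"
    using b by (auto simp: bump_def)
  have pi: "integrable lborel p" using p1 p01 by (intro integrableI_nonneg) auto
  have pint: "(LINT x|lborel. p x) = 1" using p1 p01 by (subst integral_eq_nn_integral) auto
  have \<psi>i: "integrable lborel \<psi>"
  proof (rule Bochner_Integration.integrable_bound)
    show "integrable lborel (\<lambda>t::real. C * (1 / (1 + \<bar>t\<bar>)\<^sup>2))"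
      by (intro integrable_mult_right integrable_inverse_1_plus_abs_sq)
    show "AE t in lborel. norm (\<psi> t) \<le> norm (C * (1 / (1 + \<bar>t\<bar>)\<^sup>2))"
    proof (rule AE_I2)
      fix t :: real
      have "C / (1 + \<bar>t\<bar>) ^ (r + 2) \<le> C / (1 + \<bar>t\<bar>)\<^sup>2"
        using C by (intro divide_left_mono power_increasing) auto
      then show "norm (\<psi> t) \<le> norm (C * (1 / (1 + \<bar>t\<bar>)\<^sup>2))" using \<psi>[of t] C by simp
    qed
  qed simp
  define P where "P = (\<lambda>y::'a. \<Prod>b\<in>Basis. p (y \<bullet> b))"
  define X where "X = (\<lambda>l::'a. \<Prod>b\<in>Basis. \<psi> (l \<bullet> b))"
  define D where "D = C ^ DIM('a)"
  have "P \<in> borel_measurable borel" "X \<in> borel_measurable borel" unfolding P_def X_def by measurable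
  moreover have "0 \<le> P y \<and> P y \<le> 1" for y
    unfolding P_def by (intro conjI prod_nonneg prod_le_1) (auto simp: p01)
  moreover have "\<forall>b\<in>Basis. \<bar>y \<bullet> b\<bar> \<le> M" if "P y \<noteq> 0" for y
    using that pM unfolding P_def by (auto simp: prod_zero_iff not_less[symmetric])
  moreover have "integrable lborel P" "(LINT y|lborel. P y) = 1"
    unfolding P_def using lborel_prod_Basis[of "\<lambda>b::'a. p"] pi pint by simp_all
  moreover have "integrable lborel X"
    unfolding X_def using \<psi>i by (intro lborel_prod_Basis(1))
  moreover have "norm (X l) \<le> D / (1 + norm l) ^ (r + 2)" for l
  proof -
    have "norm (X l) \<le> (\<Prod>b\<in>Basis. C / (1 + \<bar>l \<bullet> b\<bar>) ^ (r + 2))"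
      unfolding X_def prod_norm[symmetric] by (intro prod_mono conjI norm_ge_zero \<psi>)
    also have "\<dots> = D / (\<Prod>b\<in>Basis. 1 + \<bar>l \<bullet> b\<bar>) ^ (r + 2)"
      by (simp only: prod_dividef prod_power_distrib prod_constant D_def)
    also have "\<dots> \<le> D / (1 + norm l) ^ (r + 2)"
    proof (intro divide_left_mono power_mono)
      have "1 + norm l \<le> 1 + (\<Sum>b\<in>Basis. \<bar>l \<bullet> b\<bar>)" using norm_le_l1[of l] by simp
      also have "\<dots> \<le> (\<Prod>b\<in>Basis. 1 + \<bar>l \<bullet> b\<bar>)" by (intro one_plus_sum_le_prod) auto
      finally show *: "1 + norm l \<le> (\<Prod>b\<in>Basis. 1 + \<bar>l \<bullet> b\<bar>)" .
      have "0 < 1 + norm l" by (simp add: add_pos_nonneg)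
      then show "0 < (\<Prod>b\<in>Basis. 1 + \<bar>l \<bullet> b\<bar>) ^ (r + 2) * (1 + norm l) ^ (r + 2)" using * by auto
    qed (use C in \<open>auto simp: D_def add_nonneg_nonneg\<close>)
    finally show ?thesis .
  qed
  moreover have "complex_of_real (P y) = (LINT l|lborel. cis (- (l \<bullet> y)) * X l)" for y
  proof -
    have i: "integrable lborel (\<lambda>t. cis (- (t * (y \<bullet> b))) * \<psi> t)" for b
      by (rule Bochner_Integration.integrable_bound[OF \<psi>i]) (auto simp: norm_mult)
    have "cis (- (l \<bullet> y)) * X l = (\<Prod>b\<in>Basis. cis (- ((l \<bullet> b) * (y \<bullet> b))) * \<psi> (l \<bullet> b))" for l
      unfolding X_def by (subst euclidean_inner) (simp add: sum_negf[symmetric] cis_sum prod.distrib)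
    then have "(LINT l|lborel. cis (- (l \<bullet> y)) * X l) = (\<Prod>b\<in>Basis. complex_of_real (p (y \<bullet> b)))"
      using lborel_prod_Basis(2)[of "\<lambda>b t. cis (- (t * (y \<bullet> b))) * \<psi> t"] i by (simp add: p)
    then show ?thesis by (simp add: P_def)
  qed
  moreover have "0 < D" using C by (simp add: D_def)
  ultimately show ?thesis using M
    by (intro exI[of _ P] exI[of _ X] exI[of _ D] exI[of _ M]) blast
qed

lemma lborel_integral_affine:
  fixes f :: "'a::euclidean_space \<Rightarrow> 'b::{banach, second_countable_topology}"
  assumes c: "0 < c"
  shows "(LINT x|lborel. f x) = c ^ DIM('a) *\<^sub>R (LINT x|lborel. f (t + c *\<^sub>R x))"
proof (cases "f \<in> borel_measurable borel")
  case True
  note [measurable] = True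
  show ?thesis
    using c by (subst lborel_affine[of c t])
      (simp_all add: integral_density integral_distr)
next
  \<comment> \<open>Nonmeasurability is preserved by the invertible substitution, so both integrals
    take the default value 0.\<close>
  case False
  have "f \<in> borel_measurable borel" if "(\<lambda>x. f (t + c *\<^sub>R x)) \<in> borel_measurable borel"
  proof -
    have "(\<lambda>x. f (t + c *\<^sub>R ((1 / c) *\<^sub>R (x - t)))) \<in> borel_measurable borel"
      by (rule measurable_compose[OF _ that]) measurable
    then show ?thesis using c by simp
  qed
  with False have "(\<lambda>x. f (t + c *\<^sub>R x)) \<notin> borel_measurable borel" by blast
  then have "\<not> integrable lborel f" "\<not> integrable lborel (\<lambda>x. f (t + c *\<^sub>R x))"
    using False by (auto dest: borel_measurable_integrable)
  then show ?thesis by (simp add: not_integrable_integral_eq)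
qed

lemma lborel_nn_integral_affine:
  fixes f :: "'a::euclidean_space \<Rightarrow> ennreal"
  assumes c: "0 < c" and [measurable]: "f \<in> borel_measurable borel"
  shows "(\<integral>\<^sup>+x. f x \<partial>lborel) = ennreal (c ^ DIM('a)) * (\<integral>\<^sup>+x. f (t + c *\<^sub>R x) \<partial>lborel)"
  using c by (subst lborel_affine[of c t])
    (simp_all add: nn_integral_density nn_integral_distr nn_integral_cmult)

lemma lborel_integrable_affine:
  fixes f :: "'a::euclidean_space \<Rightarrow> 'b::{banach, second_countable_topology}"
  assumes c: "0 < c" and f: "integrable lborel f"
  shows "integrable lborel (\<lambda>x. f (t + c *\<^sub>R x))"
proof -
  have [measurable]: "f \<in> borel_measurable borel" using f by auto
  have "(\<integral>\<^sup>+x. norm (f x) \<partial>lborel) = ennreal (c ^ DIM('a)) * (\<integral>\<^sup>+x. norm (f (t + c *\<^sub>R x)) \<partial>lborel)"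
    by (rule lborel_nn_integral_affine[OF c]) measurable
  moreover have "(\<integral>\<^sup>+x. norm (f x) \<partial>lborel) < \<infinity>" using f by (simp add: integrable_iff_bounded)
  ultimately show ?thesis using c
    by (auto simp: integrable_iff_bounded ennreal_mult_less_top)
qed

lemma Cauchy_Schwarz_integral:
  fixes f g :: "'a \<Rightarrow> complex"
  assumes [measurable]: "f \<in> borel_measurable M" "g \<in> borel_measurable M"
    and A: "(\<integral>\<^sup>+x. ennreal ((norm (f x))\<^sup>2) \<partial>M) \<le> ennreal A"
    and B: "(\<integral>\<^sup>+x. ennreal ((norm (g x))\<^sup>2) \<partial>M) \<le> ennreal B" and AB: "0 \<le> A" "0 \<le> B"
  shows "integrable M (\<lambda>x. f x * g x)" "norm (LINT x|M. f x * g x) \<le> sqrt (A * B)"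
proof -
  have "(\<integral>\<^sup>+x. ennreal (norm (f x)) * ennreal (norm (g x)) \<partial>M)\<^sup>2 \<le>
    (\<integral>\<^sup>+x. (ennreal (norm (f x)))\<^sup>2 \<partial>M) * (\<integral>\<^sup>+x. (ennreal (norm (g x)))\<^sup>2 \<partial>M)"
    by (rule Cauchy_Schwarz_nn_integral) measurable
  also have "\<dots> \<le> ennreal A * ennreal B"
    using A B by (intro mult_mono) (simp_all add: ennreal_power)
  also have "\<dots> = (ennreal (sqrt (A * B)))\<^sup>2"
    using AB by (simp add: ennreal_power ennreal_mult)
  finally have sq: "(\<integral>\<^sup>+x. ennreal (norm (f x)) * ennreal (norm (g x)) \<partial>M)\<^sup>2 \<le> (ennreal (sqrt (A * B)))\<^sup>2" .
  have "(\<integral>\<^sup>+x. ennreal (norm (f x)) * ennreal (norm (g x)) \<partial>M) \<le> ennreal (sqrt (A * B))"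
  proof (cases "\<integral>\<^sup>+x. ennreal (norm (f x)) * ennreal (norm (g x)) \<partial>M" rule: ennreal_cases)
    case (real i)
    then have "i\<^sup>2 \<le> (sqrt (A * B))\<^sup>2" using sq AB by (simp add: ennreal_power del: real_sqrt_pow2)
    then have "i \<le> sqrt (A * B)" using AB by (intro power2_le_imp_le[of i]) auto
    then show ?thesis using real by (simp add: ennreal_leI)
  next
    case top
    then show ?thesis using sq AB by (simp add: ennreal_power top_unique)
  qed
  then have le: "(\<integral>\<^sup>+x. ennreal (norm (f x * g x)) \<partial>M) \<le> ennreal (sqrt (A * B))"
    by (simp add: norm_mult ennreal_mult)
  show int: "integrable M (\<lambda>x. f x * g x)"
    using le by (intro integrableI_bounded) (auto simp: le_less_trans)
  have "ennreal (norm (LINT x|M. f x * g x)) \<le> (\<integral>\<^sup>+x. ennreal (norm (f x * g x)) \<partial>M)"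
    by (rule integral_norm_bound_ennreal[OF int])
  with le have "ennreal (norm (LINT x|M. f x * g x)) \<le> ennreal (sqrt (A * B))" by (rule order_trans[rotated])
  then show "norm (LINT x|M. f x * g x) \<le> sqrt (A * B)" using AB by simp
qed

text \<open>A Parseval identity for an \<open>F\<close> that is only square integrable. The
  smoothing kernel has compact support, so truncating \<open>F\<close> to a large ball does not
  change the left side, and for the truncated function Fubini applies. As the ball grows,
  Cauchy--Schwarz carries the mean-square convergence of the transforms over to the integral. The
  normalisation of Fourier inversion is contained in \<open>X\<close>.\<close>

lemma smoothing_fourier:
  fixes F :: "real ^ 'd \<Rightarrow> real"
  assumes FF: "is_fourier_L2 F Fhat" and Fhat2: "(\<integral>\<^sup>+l. ennreal ((norm (Fhat l))\<^sup>2) \<partial>lborel) < \<infinity>"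
    and [measurable]: "P \<in> borel_measurable borel" and PM: "\<And>y b. P y \<noteq> 0 \<Longrightarrow> b \<in> Basis \<Longrightarrow> \<bar>y \<bullet> b\<bar> \<le> M"
    and X: "integrable lborel X" "\<And>l. norm (X l) \<le> C"
    and PX: "\<And>y. complex_of_real (P y) = (LINT l|lborel. cis (- (l \<bullet> y)) * X l)"
    and \<rho>: "0 < \<rho>"
  shows "complex_of_real (LINT y|lborel. F (v + \<rho> *\<^sub>R y) * P y) =
      (LINT l|lborel. cis (l \<bullet> v) * (X (\<rho> *\<^sub>R l) * Fhat l))"
proof -
  have [measurable]: "F \<in> borel_measurable borel" "Fhat \<in> borel_measurable borel"
    and F2: "integrable lborel (\<lambda>x. (F x)\<^sup>2)"
    and lim: "((\<lambda>R. \<integral>\<^sup>+l. ennreal ((cmod (Fhat l - truncated_fourier F R l))\<^sup>2) \<partial>lborel) \<longlongrightarrow> 0) at_top"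
    using FF by (auto simp: is_fourier_L2_def)
  have [measurable]: "X \<in> borel_measurable borel" using X by auto
  have C: "0 \<le> C" using X(2)[of 0] norm_ge_zero[of "X 0"] by linarith
  define Y where "Y = (\<lambda>l::real^'d. X (\<rho> *\<^sub>R l))"
  have Yi: "integrable lborel Y" unfolding Y_def using lborel_integrable_affine[OF \<rho> X(1), of 0] by simp
  have [measurable]: "Y \<in> borel_measurable borel" unfolding Y_def by measurable
  \<comment> \<open>\<open>X\<close> is bounded and integrable, hence square integrable;
    \<open>A\<close> bounds the square integral of its rescaled version \<open>Y\<close>.\<close>
  define A where "A = C * (LINT l|lborel. norm (Y l))"
  have A: "0 \<le> A" unfolding A_def using C by (intro mult_nonneg_nonneg integral_nonneg_AE) auto
  have YA: "(\<integral>\<^sup>+l. ennreal ((norm (cis (l \<bullet> v) * Y l))\<^sup>2) \<partial>lborel) \<le> ennreal A"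
  proof -
    have "(\<integral>\<^sup>+l. ennreal ((norm (cis (l \<bullet> v) * Y l))\<^sup>2) \<partial>lborel) \<le> (\<integral>\<^sup>+l. ennreal (C * norm (Y l)) \<partial>lborel)"
      using X(2) by (intro nn_integral_mono ennreal_leI) (auto simp: norm_mult power2_eq_square Y_def intro!: mult_right_mono)
    also have "\<dots> = ennreal A"
      unfolding A_def using Yi C by (subst nn_integral_eq_integral) auto
    finally show ?thesis .
  qed
  define c where "c = (LINT y|lborel. F (v + \<rho> *\<^sub>R y) * P y)"
  \<comment> \<open>The smoothing kernel in the variable \<open>x = v + \<rho> y\<close>, before
    division by the volume factor.\<close>
  define S where "S = (\<lambda>x. P ((1 / \<rho>) *\<^sub>R (x - v)))"
  have [measurable]: "S \<in> borel_measurable borel" unfolding S_def by measurable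
  have S: "complex_of_real (S x) = \<rho> ^ DIM(real^'d) *\<^sub>R (LINT m|lborel. cis (- (m \<bullet> (x - v))) * Y m)" for x
    unfolding S_def PX using \<rho>
    by (subst lborel_integral_affine[OF \<rho>, where t=0]) (simp add: Y_def)
  have cS: "\<rho> ^ DIM(real^'d) * c = (LINT x|lborel. F x * S x)"
    unfolding c_def using \<rho>
    by (subst (2) lborel_integral_affine[OF \<rho>, where t=v]) (simp add: S_def)
  \<comment> \<open>The ball of this radius contains the support of \<open>S\<close>; the sum over
    the basis bounds the norm of a point by its coordinates.\<close>
  define R0 where "R0 = norm v + \<rho> * (\<Sum>b\<in>(Basis::(real^'d) set). M)"
  have S0: "S x = 0" if "R0 < norm x" for x
  proof (rule ccontr)
    assume "S x \<noteq> 0"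
    then have le: "\<bar>((1 / \<rho>) *\<^sub>R (x - v)) \<bullet> b\<bar> \<le> M" if "b \<in> Basis" for b
      using PM that unfolding S_def by blast
    have "norm ((1 / \<rho>) *\<^sub>R (x - v)) \<le> (\<Sum>b\<in>Basis. \<bar>((1 / \<rho>) *\<^sub>R (x - v)) \<bullet> b\<bar>)" by (rule norm_le_l1)
    also have "\<dots> \<le> (\<Sum>b\<in>(Basis::(real^'d) set). M)" by (intro sum_mono le)
    finally have "norm (x - v) \<le> \<rho> * (\<Sum>b\<in>(Basis::(real^'d) set). M)"
      using \<rho> by (simp add: pos_divide_le_eq mult.commute)
    then have "norm x \<le> R0" unfolding R0_def using norm_triangle_sub[of x v] by linarith
    with that show False by simp
  qed
  have trunc: "complex_of_real c = (LINT m|lborel. (cis (m \<bullet> v) * Y m) * truncated_fourier F R m)"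
      "integrable lborel (\<lambda>m. (cis (m \<bullet> v) * Y m) * truncated_fourier F R m)"
      "truncated_fourier F R \<in> borel_measurable borel" if R: "R0 \<le> R" for R
  proof -
    define f where "f = (\<lambda>x::real^'d. complex_of_real (indicator (cball 0 R) x * F x))"
    have [measurable]: "cball (0::real^'d) R \<in> sets borel" by simp
    have [measurable]: "f \<in> borel_measurable borel" unfolding f_def by measurable
    have fi: "integrable lborel f"
    proof (rule Bochner_Integration.integrable_bound)
      show "integrable lborel (\<lambda>x::real^'d. indicator (cball 0 R) x + (F x)\<^sup>2)"
        using F2 emeasure_bounded_finite[of "cball (0::real^'d) R"]
        by (intro Bochner_Integration.integrable_add integrable_real_indicator) auto
      show "AE x in lborel. norm (f x) \<le> norm (indicator (cball 0 R) x + (F x)\<^sup>2)"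
      proof (rule AE_I2)
        fix x :: "real ^ 'd"
        have "0 \<le> (\<bar>F x\<bar> - 1 / 2)\<^sup>2" by simp
        also have "\<dots> = (F x)\<^sup>2 - \<bar>F x\<bar> + 1 / 4" by (simp add: power2_diff power_divide)
        finally have le: "\<bar>F x\<bar> \<le> 1 + (F x)\<^sup>2" by linarith
        show "norm (f x) \<le> norm (indicator (cball 0 R) x + (F x)\<^sup>2)"
          using le by (simp add: f_def indicator_def abs_of_nonneg)
      qed
    qed simp
    have tf: "truncated_fourier F R m = (LINT x|lborel. cis (- (m \<bullet> x)) * f x)" for m
      unfolding truncated_fourier_def set_lebesgue_integral_def f_def
      by (intro Bochner_Integration.integral_cong) (auto simp: indicator_def)
    show tm [measurable]: "truncated_fourier F R \<in> borel_measurable borel"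
      unfolding tf[abs_def] by measurable
    have tb: "norm (truncated_fourier F R m) \<le> (LINT x|lborel. norm (f x))" for m
      unfolding tf by (rule order_trans[OF integral_norm_bound]) (simp add: norm_mult)
    show "integrable lborel (\<lambda>m. (cis (m \<bullet> v) * Y m) * truncated_fourier F R m)"
    proof (rule Bochner_Integration.integrable_bound)
      show "integrable lborel (\<lambda>m. Y m * complex_of_real (LINT x|lborel. norm (f x)))" using Yi by simp
      show "AE m in lborel. norm (cis (m \<bullet> v) * Y m * truncated_fourier F R m) \<le> norm (Y m * complex_of_real (LINT x|lborel. norm (f x)))"
        using tb by (intro AE_I2) (auto simp: norm_mult intro!: mult_left_mono order_trans[OF _ abs_ge_self])
    qed measurable
    have int: "integrable (lborel \<Otimes>\<^sub>M lborel) (\<lambda>(x, m). f x * (cis (- (m \<bullet> (x - v))) * Y m))"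
    proof (rule lborel_pair.Fubini_integrable)
      show "integrable lborel (\<lambda>x. LINT m|lborel. norm (case (x, m) of (x, m) \<Rightarrow> f x * (cis (- (m \<bullet> (x - v))) * Y m)))"
        using fi by (simp add: norm_mult)
      show "AE x in lborel. integrable lborel (\<lambda>m. case (x, m) of (x, m) \<Rightarrow> f x * (cis (- (m \<bullet> (x - v))) * Y m))"
      proof (rule AE_I2)
        fix x
        show "integrable lborel (\<lambda>m. case (x, m) of (x, m) \<Rightarrow> f x * (cis (- (m \<bullet> (x - v))) * Y m))"
        proof (rule Bochner_Integration.integrable_bound)
          show "integrable lborel (\<lambda>m. f x * Y m)" using Yi by simp
        qed (auto simp: norm_mult)
      qed
    qed measurable
    have "complex_of_real (\<rho> ^ DIM(real^'d) * c) = (LINT x|lborel. complex_of_real (F x * S x))"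
      unfolding cS by (rule integral_complex_of_real[symmetric])
    also have "\<dots> = (LINT x|lborel. \<rho> ^ DIM(real^'d) *\<^sub>R (LINT m|lborel. f x * (cis (- (m \<bullet> (x - v))) * Y m)))"
    proof (intro Bochner_Integration.integral_cong refl)
      fix x
      show "complex_of_real (F x * S x) = \<rho> ^ DIM(real^'d) *\<^sub>R (LINT m|lborel. f x * (cis (- (m \<bullet> (x - v))) * Y m))"
      proof (cases "R0 < norm x")
        case True
        then have "complex_of_real (S x) = 0" using S0 by simp
        then have "\<rho> ^ DIM(real^'d) *\<^sub>R (LINT m|lborel. cis (- (m \<bullet> (x - v))) * Y m) = 0" using S by simp
        then show ?thesis using S0[OF True] \<rho> by simp
      next
        case False
        then have "f x = complex_of_real (F x)" using R by (simp add: f_def)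
        then show ?thesis using S[of x] by simp
      qed
    qed
    also have "\<dots> = \<rho> ^ DIM(real^'d) *\<^sub>R (LINT x|lborel. LINT m|lborel. f x * (cis (- (m \<bullet> (x - v))) * Y m))"
      by simp
    also have "(LINT x|lborel. LINT m|lborel. f x * (cis (- (m \<bullet> (x - v))) * Y m)) =
      (LINT m|lborel. LINT x|lborel. f x * (cis (- (m \<bullet> (x - v))) * Y m))"
      by (rule lborel_pair.Fubini_integral[OF int, symmetric])
    also have "\<dots> = (LINT m|lborel. (cis (m \<bullet> v) * Y m) * truncated_fourier F R m)"
    proof (intro Bochner_Integration.integral_cong refl)
      fix m
      have "f x * (cis (- (m \<bullet> (x - v))) * Y m) = (cis (m \<bullet> v) * Y m) * (cis (- (m \<bullet> x)) * f x)" for x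
      proof -
        have "cis (- (m \<bullet> (x - v))) = cis (m \<bullet> v) * cis (- (m \<bullet> x))"
          unfolding cis_mult by (simp add: inner_diff_right)
        then show ?thesis by (simp add: mult_ac)
      qed
      then show "(LINT x|lborel. f x * (cis (- (m \<bullet> (x - v))) * Y m)) = (cis (m \<bullet> v) * Y m) * truncated_fourier F R m"
        unfolding tf integral_mult_right_zero[symmetric] by (simp only:)
    qed
    finally show "complex_of_real c = (LINT m|lborel. (cis (m \<bullet> v) * Y m) * truncated_fourier F R m)"
      using \<rho> by (simp add: scaleR_conv_of_real)
  qed
  define H where "H = enn2real (\<integral>\<^sup>+l. ennreal ((norm (Fhat l))\<^sup>2) \<partial>lborel)"
  have H: "0 \<le> H" "(\<integral>\<^sup>+l. ennreal ((norm (Fhat l))\<^sup>2) \<partial>lborel) = ennreal H"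
    using Fhat2 by (simp_all add: H_def)
  note YF = Cauchy_Schwarz_integral(1)[OF _ _ YA eq_refl[OF H(2)] A H(1)]
  have le: "norm (complex_of_real c - (LINT l|lborel. (cis (l \<bullet> v) * Y l) * Fhat l)) \<le> sqrt (A * e)" if "0 < e" for e
  proof -
    have "\<forall>\<^sub>F R in at_top. (\<integral>\<^sup>+l. ennreal ((cmod (Fhat l - truncated_fourier F R l))\<^sup>2) \<partial>lborel) < ennreal e"
      using that by (intro order_tendstoD[OF lim]) simp
    then have "\<forall>\<^sub>F R in at_top. R0 \<le> R \<and> (\<integral>\<^sup>+l. ennreal ((cmod (Fhat l - truncated_fourier F R l))\<^sup>2) \<partial>lborel) < ennreal e"
      using eventually_ge_at_top[of R0] by eventually_elim simp
    then obtain R where R: "R0 \<le> R" "(\<integral>\<^sup>+l. ennreal ((cmod (Fhat l - truncated_fourier F R l))\<^sup>2) \<partial>lborel) < ennreal e"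
      using eventually_happens'[OF trivial_limit_at_top_linorder] by blast
    note [measurable] = trunc(3)[OF R(1)]
    have "(LINT l|lborel. (cis (l \<bullet> v) * Y l) * Fhat l) - complex_of_real c =
      (LINT l|lborel. (cis (l \<bullet> v) * Y l) * Fhat l - (cis (l \<bullet> v) * Y l) * truncated_fourier F R l)"
      unfolding trunc(1)[OF R(1)] by (intro Bochner_Integration.integral_diff[symmetric] YF trunc(2)[OF R(1)]) measurable
    also have "\<dots> = (LINT l|lborel. (cis (l \<bullet> v) * Y l) * (Fhat l - truncated_fourier F R l))"
      by (simp add: right_diff_distrib)
    also have "norm \<dots> \<le> sqrt (A * e)"
      using that A by (intro Cauchy_Schwarz_integral(2) YA less_imp_le[OF R(2)]) auto
    finally show ?thesis by (simp add: norm_minus_commute)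
  qed
  have "norm (complex_of_real c - (LINT l|lborel. (cis (l \<bullet> v) * Y l) * Fhat l)) \<le> 0"
  proof (rule field_le_epsilon)
    fix e :: real assume e: "0 < e"
    \<comment> \<open>The denominator \<open>A + 1\<close> covers the case
      \<open>A = 0\<close>.\<close>
    have "norm (complex_of_real c - (LINT l|lborel. (cis (l \<bullet> v) * Y l) * Fhat l)) \<le> sqrt (A * (e\<^sup>2 / (A + 1)))"
      using e A by (intro le) simp
    also have "\<dots> \<le> sqrt (e\<^sup>2)"
    proof (rule real_sqrt_le_mono)
      have "A * e\<^sup>2 \<le> e\<^sup>2 * (A + 1)" by (simp add: algebra_simps)
      then show "A * (e\<^sup>2 / (A + 1)) \<le> e\<^sup>2" using A by (simp add: pos_divide_le_eq)
    qed
    finally show "norm (complex_of_real c - (LINT l|lborel. (cis (l \<bullet> v) * Y l) * Fhat l)) \<le> 0 + e" using e by simp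
  qed
  then show ?thesis by (simp add: c_def Y_def mult.assoc)
qed

section \<open>Approximation in the Matern space\<close>

text \<open>The product of the factors \<open>1 + (l \<bullet> b)\<^sup>2\<close> is at most
  \<open>(1 + (norm l)\<^sup>2) powr s\<close> once \<open>s\<close> is at least the dimension, so a
  product of one-dimensional integrable functions dominates. For the Matern density \<open>s\<close>
  is \<open>\<alpha>\<close> plus half the dimension, and \<open>\<alpha>\<close> exceeds that
  half.\<close>

lemma spectral_density_integrable:
  assumes s: "real DIM('a) \<le> s"
  shows "integrable lborel (\<lambda>l::'a::euclidean_space. (1 + (norm l)\<^sup>2) powr (- s))"
proof (rule Bochner_Integration.integrable_bound)
  have "integrable lborel (\<lambda>x::real. inverse (1 + x\<^sup>2))"
    using integrable_inverse_1_plus_square by (simp add: set_integrable_def einterval_def)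
  then show "integrable lborel (\<lambda>l::'a. \<Prod>b\<in>Basis. inverse (1 + (l \<bullet> b)\<^sup>2))"
    by (intro lborel_prod_Basis(1))
  show "AE l in (lborel::'a measure). norm ((1 + (norm l)\<^sup>2) powr (- s)) \<le> norm (\<Prod>b\<in>Basis. inverse (1 + (l \<bullet> b)\<^sup>2))"
  proof (rule AE_I2)
    fix l :: 'a
    let ?N = "1 + (norm l)\<^sup>2"
    have N: "1 \<le> ?N" by simp
    have p: "0 < (\<Prod>b\<in>Basis. 1 + (l \<bullet> b)\<^sup>2)" by (intro prod_pos) (simp add: add_pos_nonneg)
    have "(\<Prod>b\<in>Basis. 1 + (l \<bullet> b)\<^sup>2) \<le> (\<Prod>b\<in>(Basis::'a set). ?N)"
    proof (intro prod_mono conjI)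
      fix b :: 'a assume "b \<in> Basis"
      then have "\<bar>l \<bullet> b\<bar> \<le> norm l" by (rule Basis_le_norm)
      then have "\<bar>l \<bullet> b\<bar>\<^sup>2 \<le> (norm l)\<^sup>2" by (intro power_mono) auto
      then show "1 + (l \<bullet> b)\<^sup>2 \<le> ?N" by simp
    qed simp
    also have "\<dots> = ?N powr real DIM('a)" using N by (subst powr_realpow) (simp_all add: add_pos_nonneg)
    also have "\<dots> \<le> ?N powr s" using s N by (intro powr_mono) auto
    finally have le: "(\<Prod>b\<in>Basis. 1 + (l \<bullet> b)\<^sup>2) \<le> ?N powr s" .
    have "?N powr (- s) \<le> inverse (\<Prod>b\<in>Basis. 1 + (l \<bullet> b)\<^sup>2)"
      unfolding powr_minus using le p by (intro le_imp_inverse_le) auto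
    also have "\<dots> = (\<Prod>b\<in>Basis. inverse (1 + (l \<bullet> b)\<^sup>2))"
      using prod_inversef[of "\<lambda>b. 1 + (l \<bullet> b)\<^sup>2" "Basis :: 'a set"] by (simp add: comp_def)
    finally show "norm (?N powr (- s)) \<le> norm (\<Prod>b\<in>Basis. inverse (1 + (l \<bullet> b)\<^sup>2))"
      by (simp add: abs_of_nonneg prod_nonneg)
  qed
qed measurable

lemma norm_sum_cis_sq:
  "(norm (\<Sum>j<n. complex_of_real (b j) * cis (\<theta> j)))\<^sup>2 = (\<Sum>i<n. \<Sum>j<n. b i * b j * cos (\<theta> i - \<theta> j))"
proof -
  have "(norm (\<Sum>j<n. complex_of_real (b j) * cis (\<theta> j)))\<^sup>2 = (\<Sum>j<n. b j * cos (\<theta> j))\<^sup>2 + (\<Sum>j<n. b j * sin (\<theta> j))\<^sup>2"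
    by (simp add: cmod_power2)
  also have "\<dots> = (\<Sum>i<n. \<Sum>j<n. b i * b j * (cos (\<theta> i) * cos (\<theta> j) + sin (\<theta> i) * sin (\<theta> j)))"
    by (simp add: power2_eq_square sum_product sum.distrib[symmetric] algebra_simps)
  finally show ?thesis by (simp add: cos_diff)
qed

lemma matern_kernel_cos:
  fixes s t :: "real ^ 'd"
  assumes "real CARD('d) / 2 < \<alpha>"
  defines "k \<equiv> \<lambda>l::real^'d. (1 + (norm l)\<^sup>2) powr (- (\<alpha> + real CARD('d) / 2))"
  shows "integrable lborel k" "integrable lborel (\<lambda>l. cos (l \<bullet> u) * k l)"
    "matern_kernel \<alpha> s t = (LINT l|lborel. cos (l \<bullet> (s - t)) * k l)"
proof -
  show k: "integrable lborel k"
    unfolding k_def using assms(1) by (intro spectral_density_integrable) simp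
  then have [measurable]: "k \<in> borel_measurable borel" by auto
  have k0: "0 \<le> k l" for l by (simp add: k_def)
  show "integrable lborel (\<lambda>l. cos (l \<bullet> u) * k l)"
    by (rule Bochner_Integration.integrable_bound[OF k]) (auto simp: abs_mult k0 mult_left_le_one_le)
  have "integrable lborel (\<lambda>l. cis (- (l \<bullet> (s - t))) * complex_of_real (k l))"
    by (rule Bochner_Integration.integrable_bound[OF k]) (auto simp: norm_mult)
  moreover have "matern_kernel \<alpha> s t = Re (LINT l|lborel. cis (- (l \<bullet> (s - t))) * complex_of_real (k l))"
    unfolding matern_kernel_def k_def by simp
  ultimately show "matern_kernel \<alpha> s t = (LINT l|lborel. cos (l \<bullet> (s - t)) * k l)"
    by (simp add: integral_Re[symmetric])
qed

text \<open>Bochner's representation: the form of the covariance matrix is the squared norm of a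
  trigonometric polynomial in the space weighted by the spectral density. This norm is the dual norm
  of the functional with weights \<open>b\<close> at the points \<open>w\<close>.\<close>

lemma matern_gram:
  fixes w :: "nat \<Rightarrow> real ^ 'd"
  assumes \<alpha>: "real CARD('d) / 2 < \<alpha>"
  defines "k \<equiv> \<lambda>l::real^'d. (1 + (norm l)\<^sup>2) powr (- (\<alpha> + real CARD('d) / 2))"
  shows "integrable lborel (\<lambda>l. (norm (\<Sum>j<n. complex_of_real (b j) * cis (l \<bullet> w j)))\<^sup>2 * k l)"
    "dotp n b (mat_app n (\<lambda>i j. matern_kernel \<alpha> (w i) (w j)) b) =
       (LINT l|lborel. (norm (\<Sum>j<n. complex_of_real (b j) * cis (l \<bullet> w j)))\<^sup>2 * k l)"
proof -
  have eq: "(norm (\<Sum>j<n. complex_of_real (b j) * cis (l \<bullet> w j)))\<^sup>2 * k l =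
      (\<Sum>i<n. \<Sum>j<n. b i * b j * (cos (l \<bullet> (w i - w j)) * k l))" for l
    unfolding norm_sum_cis_sq sum_distrib_right by (simp add: inner_diff_right mult.assoc)
  have int: "integrable lborel (\<lambda>l. cos (l \<bullet> u) * k l)" for u
    using matern_kernel_cos(2)[OF \<alpha>] by (simp add: k_def)
  show "integrable lborel (\<lambda>l. (norm (\<Sum>j<n. complex_of_real (b j) * cis (l \<bullet> w j)))\<^sup>2 * k l)"
    unfolding eq by (intro Bochner_Integration.integrable_sum integrable_mult_right int)
  have "(LINT l|lborel. (norm (\<Sum>j<n. complex_of_real (b j) * cis (l \<bullet> w j)))\<^sup>2 * k l) =
      (\<Sum>i<n. LINT l|lborel. (\<Sum>j<n. b i * b j * (cos (l \<bullet> (w i - w j)) * k l)))"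
    unfolding eq by (intro Bochner_Integration.integral_sum Bochner_Integration.integrable_sum integrable_mult_right int)
  also have "\<dots> = (\<Sum>i<n. \<Sum>j<n. LINT l|lborel. b i * b j * (cos (l \<bullet> (w i - w j)) * k l))"
    by (intro sum.cong refl Bochner_Integration.integral_sum integrable_mult_right int)
  also have "\<dots> = (\<Sum>i<n. \<Sum>j<n. b i * b j * matern_kernel \<alpha> (w i) (w j))"
    by (simp add: matern_kernel_cos(3)[OF \<alpha>] k_def)
  finally show "dotp n b (mat_app n (\<lambda>i j. matern_kernel \<alpha> (w i) (w j)) b) =
       (LINT l|lborel. (norm (\<Sum>j<n. complex_of_real (b j) * cis (l \<bullet> w j)))\<^sup>2 * k l)"
    by (simp add: dotp_def mat_app_def sum_distrib_left mult_ac)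
qed

text \<open>The weighted integral of \<open>g\<close> is the squared reproducing kernel norm of the
  function with spectrum \<open>g\<close>, and duality bounds every linear combination of its
  values. The dilation \<open>c\<close> arises because the smoothed function is evaluated at
  contracted points; the bound survives since the spectral density decreases in the norm of the
  frequency, at the cost of a Jacobian.\<close>

lemma rkhs_functional_bound:
  fixes w :: "nat \<Rightarrow> real ^ 'd" and g :: "real ^ 'd \<Rightarrow> complex"
  assumes \<alpha>: "real CARD('d) / 2 < \<alpha>" and c: "1 / 2 \<le> c" "c \<le> 1"
    and [measurable]: "g \<in> borel_measurable borel"
    and g: "(\<integral>\<^sup>+l. ennreal ((norm (g l))\<^sup>2 * (1 + (norm l)\<^sup>2) powr (\<alpha> + real CARD('d) / 2)) \<partial>lborel) \<le> ennreal (G\<^sup>2)"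
    and G: "0 \<le> G"
    and h: "\<And>x. complex_of_real (h x) = (LINT l|lborel. cis (c * (l \<bullet> x)) * g l)"
  shows "\<bar>dotp n b (\<lambda>j. h (w j))\<bar> \<le> 2 ^ CARD('d) * G * sqrt (dotp n b (mat_app n (\<lambda>i j. matern_kernel \<alpha> (w i) (w j)) b))"
proof -
  define s where "s = \<alpha> + real CARD('d) / 2"
  have s: "0 < s" using \<alpha> by (simp add: s_def add_pos_nonneg divide_nonneg_nonneg less_le_trans)
  define k where "k = (\<lambda>l::real^'d. (1 + (norm l)\<^sup>2) powr (- s))"
  define K where "K = dotp n b (mat_app n (\<lambda>i j. matern_kernel \<alpha> (w i) (w j)) b)"
  define E where "E = (\<lambda>l::real^'d. \<Sum>j<n. complex_of_real (b j) * cis (l \<bullet> w j))"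
  have [measurable]: "k \<in> borel_measurable borel" "E \<in> borel_measurable borel"
    unfolding k_def E_def by measurable
  have kpos: "0 < k l" for l by (simp add: k_def) (smt (verit) zero_le_power2)
  have gram: "integrable lborel (\<lambda>l. (norm (E l))\<^sup>2 * k l)" "K = (LINT l|lborel. (norm (E l))\<^sup>2 * k l)"
    using matern_gram[OF \<alpha>, where n=n and b=b and w=w] by (simp_all add: E_def k_def s_def K_def)
  have K0: "0 \<le> K" unfolding gram(2) using kpos by (intro integral_nonneg_AE AE_I2) (simp add: less_imp_le)
  have c0: "0 < c" using c by simp
  \<comment> \<open>As \<open>c \<le> 1\<close>, the weight at \<open>l\<close> is at most the
    weight at \<open>c *\<^sub>R l\<close>; substituting then gives the form of the covariance
    matrix with Jacobian \<open>(1 / c) ^ CARD('d)\<close>.\<close>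
  have 1: "(\<integral>\<^sup>+l. ennreal ((norm (E (c *\<^sub>R l) * complex_of_real (sqrt (k l))))\<^sup>2) \<partial>lborel) \<le> ennreal ((1 / c) ^ CARD('d) * K)"
  proof -
    have "(\<integral>\<^sup>+l. ennreal ((norm (E (c *\<^sub>R l) * complex_of_real (sqrt (k l))))\<^sup>2) \<partial>lborel) \<le>
      (\<integral>\<^sup>+l. ennreal ((norm (E (c *\<^sub>R l)))\<^sup>2 * k (c *\<^sub>R l)) \<partial>lborel)"
    proof (intro nn_integral_mono ennreal_leI)
      fix l :: "real ^ 'd"
      have "(c * norm l)\<^sup>2 \<le> (norm l)\<^sup>2" using c by (intro power_mono mult_left_le_one_le) auto
      then have "1 + (norm (c *\<^sub>R l))\<^sup>2 \<le> 1 + (norm l)\<^sup>2" using c0 by simp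
      moreover have "0 < 1 + (norm (c *\<^sub>R l))\<^sup>2" by (simp add: add_pos_nonneg)
      ultimately have "k l \<le> k (c *\<^sub>R l)"
        unfolding k_def using s by (intro powr_mono2') auto
      then show "(norm (E (c *\<^sub>R l) * complex_of_real (sqrt (k l))))\<^sup>2 \<le> (norm (E (c *\<^sub>R l)))\<^sup>2 * k (c *\<^sub>R l)"
        using kpos[of l] by (simp add: norm_mult power_mult_distrib mult_left_mono less_imp_le)
    qed
    also have "\<dots> = ennreal ((1 / c) ^ CARD('d)) * (ennreal (c ^ DIM(real^'d)) * (\<integral>\<^sup>+l. ennreal ((norm (E (0 + c *\<^sub>R l)))\<^sup>2 * k (0 + c *\<^sub>R l)) \<partial>lborel))"
      using c0 by (simp add: mult.assoc[symmetric] ennreal_mult'[symmetric] power_mult_distrib[symmetric])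
    also have "\<dots> = ennreal ((1 / c) ^ CARD('d)) * (\<integral>\<^sup>+l. ennreal ((norm (E l))\<^sup>2 * k l) \<partial>lborel)"
      by (subst (2) lborel_nn_integral_affine[OF c0, where t=0]) auto
    also have "(\<integral>\<^sup>+l. ennreal ((norm (E l))\<^sup>2 * k l) \<partial>lborel) = ennreal K"
      unfolding gram(2) using kpos by (intro nn_integral_eq_integral gram) (simp add: less_imp_le)
    finally show ?thesis using c0 K0 by (simp add: ennreal_mult')
  qed
  have 2: "(\<integral>\<^sup>+l. ennreal ((norm (g l * complex_of_real (1 / sqrt (k l))))\<^sup>2) \<partial>lborel) \<le> ennreal (G\<^sup>2)"
  proof -
    have "(norm (g l * complex_of_real (1 / sqrt (k l))))\<^sup>2 = (norm (g l))\<^sup>2 * (1 + (norm l)\<^sup>2) powr (\<alpha> + real CARD('d) / 2)" for l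
    proof -
      have "(norm (g l * complex_of_real (1 / sqrt (k l))))\<^sup>2 = (norm (g l))\<^sup>2 * (1 / sqrt (k l))\<^sup>2"
        by (simp only: norm_mult norm_of_real power_mult_distrib power2_abs)
      also have "(1 / sqrt (k l))\<^sup>2 = inverse (k l)"
        using kpos[of l] by (simp add: power_divide inverse_eq_divide)
      also have "inverse (k l) = (1 + (norm l)\<^sup>2) powr s"
        unfolding k_def powr_minus by simp
      finally show ?thesis unfolding s_def .
    qed
    then show ?thesis using g by simp
  qed
  have prod: "E (c *\<^sub>R l) * complex_of_real (sqrt (k l)) * (g l * complex_of_real (1 / sqrt (k l))) = E (c *\<^sub>R l) * g l" for l
    using kpos[of l] by simp
  note CS = Cauchy_Schwarz_integral[OF _ _ 1 2, unfolded prod]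
  have gi: "integrable lborel (\<lambda>l. cis (c * (l \<bullet> x)) * g l)" for x
  proof -
    have kk: "(\<integral>\<^sup>+l. ennreal ((norm (cis (c * (l \<bullet> x)) * complex_of_real (sqrt (k l))))\<^sup>2) \<partial>lborel) = ennreal (LINT l|lborel. k l)"
      using kpos matern_kernel_cos(1)[OF \<alpha>]
      by (subst nn_integral_eq_integral[symmetric]) (auto simp: norm_mult k_def s_def)
    have "integrable lborel (\<lambda>l. (cis (c * (l \<bullet> x)) * complex_of_real (sqrt (k l))) * (g l * complex_of_real (1 / sqrt (k l))))"
      using kpos by (intro Cauchy_Schwarz_integral(1)[OF _ _ eq_refl[OF kk] 2] integral_nonneg_AE AE_I2) (auto simp: less_imp_le)
    moreover have "(cis (c * (l \<bullet> x)) * complex_of_real (sqrt (k l))) * (g l * complex_of_real (1 / sqrt (k l))) = cis (c * (l \<bullet> x)) * g l" for l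
      using kpos[of l] by simp
    ultimately show ?thesis by simp
  qed
  have "complex_of_real (dotp n b (\<lambda>j. h (w j))) = (\<Sum>j<n. LINT l|lborel. complex_of_real (b j) * (cis (c * (l \<bullet> w j)) * g l))"
    unfolding dotp_def by (simp add: h)
  also have "\<dots> = (LINT l|lborel. E (c *\<^sub>R l) * g l)"
    unfolding E_def sum_distrib_right
    by (subst Bochner_Integration.integral_sum[symmetric]) (auto intro!: gi simp: mult.assoc)
  finally have eq: "complex_of_real (dotp n b (\<lambda>j. h (w j))) = (LINT l|lborel. E (c *\<^sub>R l) * g l)" .
  have "\<bar>dotp n b (\<lambda>j. h (w j))\<bar> = norm (LINT l|lborel. E (c *\<^sub>R l) * g l)"
    unfolding eq[symmetric] by simp
  also have "\<dots> \<le> sqrt ((1 / c) ^ CARD('d) * K * G\<^sup>2)"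
  proof (rule CS(2))
    show "0 \<le> (1 / c) ^ CARD('d) * K" using c0 K0 by simp
    show "(\<lambda>l. E (c *\<^sub>R l) * complex_of_real (sqrt (k l))) \<in> borel_measurable lborel"
      "(\<lambda>l. g l * complex_of_real (1 / sqrt (k l))) \<in> borel_measurable lborel"
      by measurable
  qed simp
  also have "\<dots> \<le> sqrt ((2 ^ CARD('d))\<^sup>2 * K * G\<^sup>2)"
  proof (intro real_sqrt_le_mono mult_right_mono)
    \<comment> \<open>The further enlargement to a square makes the root explicit.\<close>
    have "(1 / c) ^ CARD('d) \<le> 2 ^ CARD('d)" using c by (intro power_mono) (auto simp: field_simps)
    also have "\<dots> \<le> (2 ^ CARD('d))\<^sup>2" by (simp add: self_le_power)
    finally show "(1 / c) ^ CARD('d) \<le> (2 ^ CARD('d))\<^sup>2" .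
  qed (use K0 in auto)
  also have "\<dots> = 2 ^ CARD('d) * G * sqrt K"
    using G by (simp add: real_sqrt_mult)
  finally show ?thesis by (simp add: K_def)
qed

section \<open>Finite differences of Hoelder functions\<close>

text \<open>This is the \<open>K\<close>-th power of the identity minus the shift by
  \<open>v\<close>. With this sign the term of index 0 is \<open>f x\<close> itself, so the
  negatives of the other terms form an approximation to \<open>f x\<close>.\<close>

definition fin_diff :: "nat \<Rightarrow> ('a::real_vector \<Rightarrow> real) \<Rightarrow> 'a \<Rightarrow> 'a \<Rightarrow> real" where
  "fin_diff K f x v = (\<Sum>j\<le>K. (- 1) ^ j * real (K choose j) * f (x + real j *\<^sub>R v))"

lemma fin_diff_zero_step: "0 < K \<Longrightarrow> fin_diff K f x 0 = 0"
  using choose_alternating_sum[of K, where 'a=real] by (simp add: fin_diff_def sum_distrib_right[symmetric])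

lemma convex_segment_step:
  assumes "convex S" "x \<in> S" "x + m *\<^sub>R v \<in> S" "0 \<le> t" "t \<le> m"
  shows "x + t *\<^sub>R v \<in> S"
proof (cases "m = 0")
  case False
  then have m: "0 < m" using assms by simp
  have "(1 - t / m) *\<^sub>R x + (t / m) *\<^sub>R (x + m *\<^sub>R v) \<in> S"
    using assms m by (intro convexD_alt) (auto simp: field_simps)
  moreover have "(1 - t / m) *\<^sub>R x + (t / m) *\<^sub>R (x + m *\<^sub>R v) = x + t *\<^sub>R v"
    using m by (simp add: algebra_simps)
  ultimately show ?thesis by simp
qed (use assms in simp)

text \<open>Differentiating the term of index \<open>j\<close> yields a factor \<open>j\<close>, and
  \<open>j * (Suc k choose j) = Suc k * (k choose (j - 1))\<close>. A difference of order
  \<open>k + 1\<close> thus becomes a difference of order \<open>k\<close> of the gradient, based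
  one step further along the segment.\<close>

lemma fin_diff_derivative:
  fixes f :: "real ^ 'd \<Rightarrow> real" and g :: "real ^ 'd \<Rightarrow> real ^ 'd"
  assumes f: "\<And>y. y \<in> S \<Longrightarrow> (f has_derivative (\<lambda>h. g y \<bullet> h)) (at y within S)"
    and in_S: "\<And>j t. j \<le> Suc k \<Longrightarrow> t \<in> {0..1} \<Longrightarrow> x + (real j * t) *\<^sub>R v \<in> S" and t: "t \<in> {0..1}"
  shows "((\<lambda>t. fin_diff (Suc k) f x (t *\<^sub>R v)) has_real_derivative
     - real (Suc k) * (\<Sum>c\<in>UNIV. v $ c * fin_diff k (\<lambda>y. g y $ c) (x + t *\<^sub>R v) (t *\<^sub>R v))) (at t within {0..1})"
proof -
  have d: "((\<lambda>t. f (x + real j *\<^sub>R (t *\<^sub>R v))) has_real_derivative real j * (g (x + (real j * t) *\<^sub>R v) \<bullet> v)) (at t within {0..1})"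
    if j: "j \<le> Suc k" for j
  proof -
    have 1: "((\<lambda>t. x + (real j * t) *\<^sub>R v) has_derivative (\<lambda>h. (real j * h) *\<^sub>R v)) (at t within {0..1})"
      by (auto intro!: derivative_eq_intros)
    have 2: "(f has_derivative (\<lambda>h. g (x + (real j * t) *\<^sub>R v) \<bullet> h)) (at (x + (real j * t) *\<^sub>R v) within (\<lambda>t. x + (real j * t) *\<^sub>R v) ` {0..1})"
      by (rule has_derivative_subset[OF f[OF in_S[OF j t]]]) (use in_S[OF j] in auto)
    from has_derivative_in_compose[OF 1 2]
    have "((\<lambda>t. f (x + (real j * t) *\<^sub>R v)) has_derivative (\<lambda>h. g (x + (real j * t) *\<^sub>R v) \<bullet> ((real j * h) *\<^sub>R v))) (at t within {0..1})" .
    moreover have "(\<lambda>h. g (x + (real j * t) *\<^sub>R v) \<bullet> ((real j * h) *\<^sub>R v)) = (*) (real j * (g (x + (real j * t) *\<^sub>R v) \<bullet> v))"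
      by (auto simp: fun_eq_iff)
    ultimately show ?thesis by (simp add: has_field_derivative_def)
  qed
  have "((\<lambda>t. fin_diff (Suc k) f x (t *\<^sub>R v)) has_real_derivative
      (\<Sum>j\<le>Suc k. ((- 1) ^ j * real (Suc k choose j)) * (real j * (g (x + (real j * t) *\<^sub>R v) \<bullet> v)))) (at t within {0..1})"
    unfolding fin_diff_def by (intro DERIV_sum DERIV_cmult d) simp
  also have "(\<Sum>j\<le>Suc k. ((- 1) ^ j * real (Suc k choose j)) * (real j * (g (x + (real j * t) *\<^sub>R v) \<bullet> v))) =
      (\<Sum>i\<le>k. ((- 1) ^ Suc i * real (Suc k choose Suc i)) * (real (Suc i) * (g (x + (real (Suc i) * t) *\<^sub>R v) \<bullet> v)))"
    by (subst sum.atMost_Suc_shift) simp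
  also have "\<dots> = (\<Sum>i\<le>k. - real (Suc k) * ((- 1) ^ i * real (k choose i) * (g ((x + t *\<^sub>R v) + real i *\<^sub>R (t *\<^sub>R v)) \<bullet> v)))"
  proof (intro sum.cong refl)
    fix i
    have "real (Suc i) * real (Suc k choose Suc i) = real (Suc k) * real (k choose i)"
      by (simp only: Suc_times_binomial flip: of_nat_mult)
    moreover have "x + (real (Suc i) * t) *\<^sub>R v = (x + t *\<^sub>R v) + real i *\<^sub>R (t *\<^sub>R v)"
      by (simp add: algebra_simps)
    moreover have alg: "(- 1 * p * b) * (a * e) = - c * (p * d * e)" if "a * b = c * d" for a b c d e p :: real
      using that by algebra
    ultimately show "((- 1) ^ Suc i * real (Suc k choose Suc i)) * (real (Suc i) * (g (x + (real (Suc i) * t) *\<^sub>R v) \<bullet> v)) =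
      - real (Suc k) * ((- 1) ^ i * real (k choose i) * (g ((x + t *\<^sub>R v) + real i *\<^sub>R (t *\<^sub>R v)) \<bullet> v))"
      using alg by (simp only: power_Suc)
  qed
  also have "\<dots> = - real (Suc k) * (\<Sum>c\<in>UNIV. v $ c * fin_diff k (\<lambda>y. g y $ c) (x + t *\<^sub>R v) (t *\<^sub>R v))"
    unfolding fin_diff_def sum_distrib_left inner_vec_def by (subst sum.swap) (simp add: mult_ac)
  finally show ?thesis .
qed

text \<open>Unlike a Taylor expansion, the difference of order \<open>k + 1\<close> along a segment does not need an extension
  of the function beyond the boundary of \<open>S\<close>.\<close>

lemma Ck_hoelder_fin_diff:
  fixes f :: "real ^ 'd \<Rightarrow> real"
  assumes "Ck_hoelder k \<gamma> S f" "convex S" "0 \<le> \<gamma>"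
  shows "\<exists>L\<ge>0. \<forall>x v. x \<in> S \<longrightarrow> x + real (Suc k) *\<^sub>R v \<in> S \<longrightarrow>
    \<bar>fin_diff (Suc k) f x v\<bar> \<le> L * norm v powr (real k + \<gamma>)"
  using assms(1)
proof (induction k arbitrary: f)
  case 0
  then obtain L where L: "\<And>x y. x \<in> S \<Longrightarrow> y \<in> S \<Longrightarrow> \<bar>f x - f y\<bar> \<le> L * dist x y powr \<gamma>" by auto
  have "\<bar>fin_diff (Suc 0) f x v\<bar> \<le> \<bar>L\<bar> * norm v powr \<gamma>" if "x \<in> S" "x + v \<in> S" for x v
  proof -
    have "\<bar>f x - f (x + v)\<bar> \<le> L * norm v powr \<gamma>" using L[OF that] by (simp add: dist_norm)
    also have "\<dots> \<le> \<bar>L\<bar> * norm v powr \<gamma>" by (intro mult_right_mono) auto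
    finally show ?thesis by (simp add: fin_diff_def)
  qed
  then show ?case by (intro exI[of _ "\<bar>L\<bar>"]) simp
next
  case (Suc k)
  obtain g :: "real ^ 'd \<Rightarrow> real ^ 'd" where g: "\<And>y. y \<in> S \<Longrightarrow> (f has_derivative (\<lambda>h. g y \<bullet> h)) (at y within S)"
    and gc: "\<And>c. Ck_hoelder k \<gamma> S (\<lambda>y. g y $ c)"
    using Suc.prems unfolding Ck_hoelder.simps by blast
  have "\<forall>c. \<exists>L\<ge>0. \<forall>x v. x \<in> S \<longrightarrow> x + real (Suc k) *\<^sub>R v \<in> S \<longrightarrow>
    \<bar>fin_diff (Suc k) (\<lambda>y. g y $ c) x v\<bar> \<le> L * norm v powr (real k + \<gamma>)"
    using Suc.IH[OF gc] by blast
  then obtain L where L0: "\<And>c. 0 \<le> L c" and L: "\<And>c x v. x \<in> S \<Longrightarrow> x + real (Suc k) *\<^sub>R v \<in> S \<Longrightarrow>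
    \<bar>fin_diff (Suc k) (\<lambda>y. g y $ c) x v\<bar> \<le> L c * norm v powr (real k + \<gamma>)" by metis
  define D where "D = real (Suc (Suc k)) * (\<Sum>c\<in>UNIV. L c)"
  have D0: "0 \<le> D" unfolding D_def using L0 by (intro mult_nonneg_nonneg sum_nonneg) auto
  have "\<bar>fin_diff (Suc (Suc k)) f x v\<bar> \<le> D * norm v powr (real (Suc k) + \<gamma>)"
    if x: "x \<in> S" and xv: "x + real (Suc (Suc k)) *\<^sub>R v \<in> S" for x v
  proof -
    have in_S: "x + (real j * t) *\<^sub>R v \<in> S" if "j \<le> Suc (Suc k)" "t \<in> {0..1}" for j t
    proof (rule convex_segment_step[OF assms(2) x xv])
      have "real j * t \<le> real (Suc (Suc k)) * 1" using that by (intro mult_mono) auto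
      then show "real j * t \<le> real (Suc (Suc k))" by simp
    qed (use that in auto)
    \<comment> \<open>The difference vanishes for step length 0, so the mean value inequality in the
      scaling parameter \<open>t\<close> adds one power of \<open>norm v\<close> to the bound for
      the partial derivatives. All points stay on the segment from \<open>x\<close> to the last
      node.\<close>
    have "norm (fin_diff (Suc (Suc k)) f x (1 *\<^sub>R v) - fin_diff (Suc (Suc k)) f x (0 *\<^sub>R v)) \<le>
        (D * norm v powr (real (Suc k) + \<gamma>)) * norm (1 - (0::real))"
    proof (rule field_differentiable_bound[where S="{0..1}"])
      fix t :: real assume t: "t \<in> {0..1}"
      show "((\<lambda>t. fin_diff (Suc (Suc k)) f x (t *\<^sub>R v)) has_real_derivative
        - real (Suc (Suc k)) * (\<Sum>c\<in>UNIV. v $ c * fin_diff (Suc k) (\<lambda>y. g y $ c) (x + t *\<^sub>R v) (t *\<^sub>R v))) (at t within {0..1})"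
        by (rule fin_diff_derivative[OF g in_S t])
      have "\<bar>v $ c * fin_diff (Suc k) (\<lambda>y. g y $ c) (x + t *\<^sub>R v) (t *\<^sub>R v)\<bar> \<le> L c * norm v powr (real (Suc k) + \<gamma>)" for c
      proof -
        have "\<bar>fin_diff (Suc k) (\<lambda>y. g y $ c) (x + t *\<^sub>R v) (t *\<^sub>R v)\<bar> \<le> L c * norm (t *\<^sub>R v) powr (real k + \<gamma>)"
        proof (rule L)
          show "x + t *\<^sub>R v \<in> S" using in_S[of 1 t] t by simp
          show "x + t *\<^sub>R v + real (Suc k) *\<^sub>R t *\<^sub>R v \<in> S"
            using in_S[of "Suc (Suc k)" t] t
            by (simp only: order_refl of_nat_Suc[of "Suc k"] distrib_right scaleR_add_left mult_1_left scaleR_scaleR add.assoc)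
        qed
        also have "\<dots> \<le> L c * norm v powr (real k + \<gamma>)"
          using t L0[of c] assms(3) by (intro mult_left_mono powr_mono2) (auto simp: mult_left_le_one_le)
        finally have "\<bar>v $ c * fin_diff (Suc k) (\<lambda>y. g y $ c) (x + t *\<^sub>R v) (t *\<^sub>R v)\<bar> \<le> norm v * (L c * norm v powr (real k + \<gamma>))"
          unfolding abs_mult by (intro mult_mono component_le_norm_cart) auto
        also have "\<dots> = L c * (norm v powr 1 * norm v powr (real k + \<gamma>))" by simp
        also have "\<dots> = L c * norm v powr (real (Suc k) + \<gamma>)"
          unfolding powr_add[symmetric] by (simp add: add_ac)
        finally show ?thesis .
      qed
      then have "\<bar>\<Sum>c\<in>UNIV. v $ c * fin_diff (Suc k) (\<lambda>y. g y $ c) (x + t *\<^sub>R v) (t *\<^sub>R v)\<bar> \<le> (\<Sum>c\<in>UNIV. L c * norm v powr (real (Suc k) + \<gamma>))"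
        by (intro order_trans[OF sum_abs] sum_mono)
      then have "real (Suc (Suc k)) * \<bar>\<Sum>c\<in>UNIV. v $ c * fin_diff (Suc k) (\<lambda>y. g y $ c) (x + t *\<^sub>R v) (t *\<^sub>R v)\<bar>
          \<le> real (Suc (Suc k)) * (\<Sum>c\<in>UNIV. L c * norm v powr (real (Suc k) + \<gamma>))"
        by (intro mult_left_mono) auto
      then show "norm (- real (Suc (Suc k)) * (\<Sum>c\<in>UNIV. v $ c * fin_diff (Suc k) (\<lambda>y. g y $ c) (x + t *\<^sub>R v) (t *\<^sub>R v))) \<le>
          D * norm v powr (real (Suc k) + \<gamma>)"
        by (simp only: D_def real_norm_def abs_mult abs_minus_cancel abs_of_nat mult.assoc sum_distrib_right)
    qed auto
    then show ?thesis by (simp add: fin_diff_zero_step)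
  qed
  then show ?case using D0 by blast
qed

section \<open>Construction of the approximation\<close>

lemma Ck_hoelder_continuous:
  fixes f :: "real ^ 'd \<Rightarrow> real"
  shows "Ck_hoelder k \<gamma> S f \<Longrightarrow> continuous_on S f"
  by (cases k) (auto intro: has_derivative_continuous_on)

lemma unit_cube_shrink:
  fixes x u :: "real ^ 'd"
  assumes "x \<in> unit_cube" "u \<in> unit_cube" "0 \<le> t" "t \<le> 1"
  shows "x + t *\<^sub>R (u - x) \<in> unit_cube"
proof -
  have "(1 - t) *\<^sub>R x + t *\<^sub>R u \<in> unit_cube"
    using assms by (intro convexD_alt convex_box) auto
  then show ?thesis by (simp add: algebra_simps)
qed

lemma norm_unit_cube_diff:
  fixes x u :: "real ^ 'd"
  assumes "x \<in> unit_cube" "u \<in> unit_cube"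
  shows "norm (u - x) \<le> real CARD('d)"
proof -
  have "norm (u - x) \<le> (\<Sum>i\<in>UNIV. \<bar>(u - x) $ i\<bar>)" by (rule norm_le_l1_cart)
  also have "\<dots> \<le> (\<Sum>i\<in>(UNIV :: 'd set). 1)"
  proof (intro sum_mono)
    fix i
    have "0 \<le> x $ i" "x $ i \<le> 1" "0 \<le> u $ i" "u $ i \<le> 1"
      using assms by (auto simp: mem_box_cart)
    then show "\<bar>(u - x) $ i\<bar> \<le> 1" unfolding vector_minus_component by linarith
  qed
  finally show ?thesis by simp
qed

text \<open>Raising the weight from exponent \<open>a\<close> to exponent \<open>s\<close> costs at
  most \<open>(1 + t) powr (2 * e)\<close>. Because \<open>\<rho> \<le> 1\<close>,
  \<open>1 + t\<close> is at most \<open>(1 + \<rho> * t) / \<rho>\<close>; the decay of order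
  \<open>m \<ge> e\<close> absorbs the numerator, and the powers of \<open>1 / \<rho>\<close> are
  the price of smoothing at scale \<open>\<rho>\<close>.\<close>

lemma spectral_decay:
  assumes \<rho>: "0 < \<rho>" "\<rho> \<le> 1" and e: "0 \<le> e" "e \<le> real m" and C: "0 \<le> C" and s: "s - a \<le> e"
    and t: "0 \<le> t" and X: "X \<le> C / (1 + \<rho> * t) ^ m" "0 \<le> X"
  shows "X\<^sup>2 * (1 + t\<^sup>2) powr s \<le> (C * \<rho> powr (- e))\<^sup>2 * (1 + t\<^sup>2) powr a"
proof -
  have p: "1 \<le> 1 + t\<^sup>2" "0 < 1 + t\<^sup>2" by (auto simp: add_pos_nonneg)
  have q: "1 \<le> 1 + \<rho> * t" using \<rho> t by simp
  have "(1 + t\<^sup>2) powr (s - a) \<le> (1 + t\<^sup>2) powr e" using s p by (intro powr_mono) auto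
  also have "\<dots> \<le> ((1 + t)\<^sup>2) powr e"
    using e t p by (intro powr_mono2) (auto simp: power2_sum)
  also have "\<dots> \<le> ((\<rho> powr (- 1) * (1 + \<rho> * t))\<^sup>2) powr e"
  proof (intro powr_mono2 power_mono)
    have "\<rho> powr (- 1) * (1 + \<rho> * t) = 1 / \<rho> + t" using \<rho> by (simp add: powr_minus field_simps)
    moreover have "1 \<le> 1 / \<rho>" using \<rho> by simp
    ultimately show "1 + t \<le> \<rho> powr (- 1) * (1 + \<rho> * t)" by linarith
  qed (use e t in auto)
  also have "\<dots> = (\<rho> powr (- e) * (1 + \<rho> * t) powr e)\<^sup>2"
  proof -
    have "(A\<^sup>2) powr e = (A powr e)\<^sup>2" if "0 \<le> A" for A :: real
      using that by (simp add: power2_eq_square powr_mult)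
    moreover have "0 \<le> \<rho> powr (- 1) * (1 + \<rho> * t)" using q by (intro mult_nonneg_nonneg powr_ge_zero) linarith
    moreover have "(\<rho> powr (- 1) * (1 + \<rho> * t)) powr e = \<rho> powr (- e) * (1 + \<rho> * t) powr e"
      using q by (subst powr_mult) (auto simp only: powr_ge_zero powr_powr mult_minus1)
    ultimately show ?thesis by (simp only:)
  qed
  finally have 1: "(1 + t\<^sup>2) powr (s - a) \<le> (\<rho> powr (- e) * (1 + \<rho> * t) powr e)\<^sup>2" .
  have "X * (1 + \<rho> * t) powr e \<le> C"
  proof -
    have "X * (1 + \<rho> * t) powr e \<le> C / (1 + \<rho> * t) ^ m * (1 + \<rho> * t) powr real m"
      using X q e C by (intro mult_mono powr_mono) auto
    then show ?thesis using q by (simp add: powr_realpow)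
  qed
  then have 2: "X * (\<rho> powr (- e) * (1 + \<rho> * t) powr e) \<le> C * \<rho> powr (- e)"
    by (metis mult.left_commute mult.commute mult_left_mono powr_ge_zero)
  have "X\<^sup>2 * (1 + t\<^sup>2) powr s = X\<^sup>2 * (1 + t\<^sup>2) powr (s - a) * (1 + t\<^sup>2) powr a"
    using p by (simp add: powr_add[symmetric] mult.assoc)
  also have "\<dots> \<le> X\<^sup>2 * (\<rho> powr (- e) * (1 + \<rho> * t) powr e)\<^sup>2 * (1 + t\<^sup>2) powr a"
    using 1 by (intro mult_right_mono mult_left_mono) auto
  also have "\<dots> = (X * (\<rho> powr (- e) * (1 + \<rho> * t) powr e))\<^sup>2 * (1 + t\<^sup>2) powr a"
    by (simp add: power_mult_distrib)
  also have "\<dots> \<le> (C * \<rho> powr (- e))\<^sup>2 * (1 + t\<^sup>2) powr a"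
    using 2 X by (intro mult_right_mono power_mono) auto
  finally show ?thesis .
qed

text \<open>The approximation is \<open>f\<close> minus a difference of order \<open>K\<close> along the segment from \<open>x\<close> to \<open>u\<close>, averaged
  over \<open>u\<close> with a smooth density on the cube. All evaluation points stay in the cube, where the Hoelder
  condition is available; the extension of \<open>f\<close> only serves to compute Fourier transforms.\<close>

lemma rkhs_approximation:
  fixes f :: "real ^ 'd \<Rightarrow> real"
  assumes f: "f \<in> hoelder_space \<alpha>0 \<inter> sobolev_space \<alpha>0" and \<alpha>0: "0 < \<alpha>0" and \<alpha>: "real CARD('d) / 2 < \<alpha>"
  defines "e \<equiv> max 0 (\<alpha> + real CARD('d) / 2 - \<alpha>0)"
  obtains C \<delta>0 where "0 \<le> C" "0 < \<delta>0"
    "\<And>\<delta>. 0 < \<delta> \<Longrightarrow> \<delta> \<le> \<delta>0 \<Longrightarrow> \<exists>h. (\<forall>x\<in>unit_cube. \<bar>f x - h x\<bar> \<le> C * \<delta> powr \<alpha>0) \<and>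
      (\<forall>n w b. \<bar>dotp n b (\<lambda>j. h (w j))\<bar> \<le>
         C * \<delta> powr (- e) * sqrt (dotp n b (mat_app n (\<lambda>i j. matern_kernel \<alpha> (w i) (w j)) b)))"
proof -
  define k where "k = nat \<lfloor>\<alpha>0\<rfloor>"
  \<comment> \<open>The integer part of \<open>\<alpha>0\<close> counts derivatives and the rest is
    the Hoelder exponent, so a difference of order \<open>k + 1\<close> has size
    \<open>\<alpha>0\<close> in the step length.\<close>
  define \<gamma> where "\<gamma> = \<alpha>0 - of_int \<lfloor>\<alpha>0\<rfloor>"
  define K where "K = Suc k"
  have \<gamma>: "0 \<le> \<gamma>" "real k + \<gamma> = \<alpha>0" using \<alpha>0 by (auto simp: \<gamma>_def k_def)
  have ck: "Ck_hoelder k \<gamma> unit_cube f" using f by (simp add: hoelder_space_def k_def \<gamma>_def)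
  obtain L where L0: "0 \<le> L" and L: "\<And>x v. x \<in> unit_cube \<Longrightarrow> x + real K *\<^sub>R v \<in> unit_cube \<Longrightarrow>
      \<bar>fin_diff K f x v\<bar> \<le> L * norm v powr \<alpha>0"
    using Ck_hoelder_fin_diff[OF ck convex_box(1) \<gamma>(1)] unfolding K_def \<gamma>(2) by blast
  have "continuous_on unit_cube f" using Ck_hoelder_continuous[OF ck] .
  then have "compact (f ` unit_cube)" by (intro compact_continuous_image compact_cbox)
  then obtain Bf where Bf: "\<And>x. x \<in> unit_cube \<Longrightarrow> \<bar>f x\<bar> \<le> Bf"
    using compact_imp_bounded[of "f ` unit_cube"] by (auto simp: bounded_iff)
  obtain F Fhat where Ff: "\<And>x. x \<in> unit_cube \<Longrightarrow> F x = f x" and FF: "is_fourier_L2 F Fhat"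
    and FH: "(\<integral>\<^sup>+l. ennreal ((cmod (Fhat l))\<^sup>2 * (1 + (norm l)\<^sup>2) powr \<alpha>0) \<partial>lborel) < \<infinity>"
    using f unfolding sobolev_space_def by blast
  have [measurable]: "F \<in> borel_measurable borel" "Fhat \<in> borel_measurable borel"
    using FF by (auto simp: is_fourier_L2_def)
  define H where "H = enn2real (\<integral>\<^sup>+l. ennreal ((cmod (Fhat l))\<^sup>2 * (1 + (norm l)\<^sup>2) powr \<alpha>0) \<partial>lborel)"
  have H: "0 \<le> H" "(\<integral>\<^sup>+l. ennreal ((cmod (Fhat l))\<^sup>2 * (1 + (norm l)\<^sup>2) powr \<alpha>0) \<partial>lborel) = ennreal H"
    using FH by (simp_all add: H_def)
  have Fhat2: "(\<integral>\<^sup>+l. ennreal ((norm (Fhat l))\<^sup>2) \<partial>lborel) < \<infinity>"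
  proof (rule le_less_trans[OF _ FH], intro nn_integral_mono ennreal_leI)
    fix l :: "real ^ 'd"
    have "(1::real) \<le> (1 + (norm l)\<^sup>2) powr \<alpha>0" using \<alpha>0 by (intro ge_one_powr_ge_zero) auto
    then show "(norm (Fhat l))\<^sup>2 \<le> (norm (Fhat l))\<^sup>2 * (1 + (norm l)\<^sup>2) powr \<alpha>0"
      by (simp add: mult_le_cancel_left1)
  qed
  \<comment> \<open>The kernel must decay at least to order \<open>e\<close>, the number of
    derivatives by which \<open>f\<close> may fall short of the reproducing kernel space.\<close>
  define r where "r = nat \<lceil>e\<rceil>"
  have e: "0 \<le> e" "e \<le> real (r + 2)" by (auto simp: e_def r_def) linarith+
  obtain P X CX M0 where M0: "0 < M0" and CX: "0 < CX"
    and Pm [measurable]: "P \<in> borel_measurable borel" and P01': "\<forall>y. 0 \<le> P y \<and> P y \<le> 1"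
    and PM': "\<forall>y::real^'d. P y \<noteq> 0 \<longrightarrow> (\<forall>b\<in>Basis. \<bar>y \<bullet> b\<bar> \<le> M0)"
    and Pi: "integrable lborel P" and P1: "(LINT y|lborel. P y) = 1"
    and Xm [measurable]: "X \<in> borel_measurable borel" and Xi: "integrable lborel X"
    and Xd': "\<forall>l. norm (X l) \<le> CX / (1 + norm l) ^ (r + 2)"
    and PX': "\<forall>y. complex_of_real (P y) = (LINT l|lborel. cis (- (l \<bullet> y)) * X l)"
    using spline_bump_euclidean[of r, where 'a="real ^ 'd"] by (elim exE conjE) (rule that)
  note P01 = P01'[rule_format, THEN conjunct1] P01'[rule_format, THEN conjunct2]
    and PM = PM'[rule_format] and Xd = Xd'[rule_format] and PX = PX'[rule_format]
  define M where "M = max 1 M0"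
  have M: "1 \<le> M" "0 < M" by (auto simp: M_def)
  define c0 where "c0 = (1 / 2) *\<^sub>R (1 :: real ^ 'd)"
  \<comment> \<open>Maps the support of \<open>P\<close> into the cube: each coordinate of
    \<open>y\<close> is at most \<open>M\<close> in modulus, hence moves the centre 1/2 by at most
    1/2.\<close>
  define u where "u = (\<lambda>y. c0 + (1 / (2 * M)) *\<^sub>R y)"
  have u_cube: "u y \<in> unit_cube" if "P y \<noteq> 0" for y
    unfolding mem_box_cart
  proof (intro allI)
    fix i :: 'd
    have "\<bar>y $ i\<bar> \<le> M0" using PM[OF that, of "axis i 1"] by (simp add: inner_axis axis_in_Basis_iff)
    then have "\<bar>y $ i\<bar> \<le> M" by (simp add: M_def)
    then have "\<bar>y $ i / (2 * M)\<bar> \<le> 1 / 2" using M by (simp add: abs_divide divide_le_eq)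
    then have "- (1 / 2) \<le> y $ i / (2 * M)" "y $ i / (2 * M) \<le> 1 / 2" by linarith+
    moreover have "u y $ i = 1 / 2 + y $ i / (2 * M)" by (simp add: u_def c0_def)
    ultimately show "(0::real^'d) $ i \<le> u y $ i \<and> u y $ i \<le> (1::real^'d) $ i"
      unfolding zero_index one_index by linarith
  qed
  have Xb: "norm (X l) \<le> CX" for l
  proof -
    have "CX / (1 + norm l) ^ (r + 2) \<le> CX / 1"
    proof (rule frac_le)
      show "1 \<le> (1 + norm l) ^ (r + 2)" by (rule one_le_power) simp
    qed (use CX in auto)
    then show ?thesis using Xd[of l] by simp
  qed
  \<comment> \<open>The decay constant of the kernel, the effect of the bandwidth
    \<open>t / (2 * M)\<close> in place of \<open>t\<close>, and the Sobolev norm of the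
    extension.\<close>
  define G0 where "G0 = CX * (2 * M) powr e * sqrt H"
  have G0: "0 \<le> G0" using CX H M by (simp add: G0_def)
  \<comment> \<open>The average of \<open>F\<close> over the points
    \<open>x + t *\<^sub>R (u y - x)\<close>, read as a smoothing with bandwidth
    \<open>t / (2 * M)\<close> around the contracted point
    \<open>(1 - t) *\<^sub>R x + t *\<^sub>R c0\<close>. The first reading keeps the points in the
    cube, the second gives the spectrum: frequencies dilated by \<open>1 - t\<close>, and a phase
    from the centre.\<close>
  define hh where "hh = (\<lambda>t x. LINT y|lborel. F (((1 - t) *\<^sub>R x + t *\<^sub>R c0) + (t / (2 * M)) *\<^sub>R y) * P y)"
  have hh_bound: "\<bar>dotp n b (\<lambda>j. hh t (w j))\<bar> \<le> 2 ^ CARD('d) * (G0 * t powr (- e)) *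
      sqrt (dotp n b (mat_app n (\<lambda>i j. matern_kernel \<alpha> (w i) (w j)) b))"
    if t: "0 < t" "t \<le> 1 / 2" for t n w b
  proof (rule rkhs_functional_bound[OF \<alpha>, where c="1 - t" and g="\<lambda>l. cis (t * (l \<bullet> c0)) * (X ((t / (2 * M)) *\<^sub>R l) * Fhat l)"])
    show "1 / 2 \<le> 1 - t" "1 - t \<le> 1" using t by auto
    have \<rho>: "0 < t / (2 * M)" "t / (2 * M) \<le> 1" using t M by (auto simp: divide_le_eq)
    show "0 \<le> G0 * t powr (- e)" using G0 by simp
    show "complex_of_real (hh t x) = (LINT l|lborel. cis ((1 - t) * (l \<bullet> x)) * (cis (t * (l \<bullet> c0)) * (X ((t / (2 * M)) *\<^sub>R l) * Fhat l)))" for x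
    proof -
      have "cis (l \<bullet> ((1 - t) *\<^sub>R x + t *\<^sub>R c0)) = cis ((1 - t) * (l \<bullet> x)) * cis (t * (l \<bullet> c0))" for l
        unfolding cis_mult by (simp add: inner_add_right)
      moreover have "complex_of_real (hh t x) =
          (LINT l|lborel. cis (l \<bullet> ((1 - t) *\<^sub>R x + t *\<^sub>R c0)) * (X ((t / (2 * M)) *\<^sub>R l) * Fhat l))"
        unfolding hh_def by (rule smoothing_fourier[OF FF Fhat2 Pm PM Xi Xb PX \<rho>(1)])
      ultimately show ?thesis by (simp only: mult.assoc)
    qed
    have "(norm (cis (t * (l \<bullet> c0)) * (X ((t / (2 * M)) *\<^sub>R l) * Fhat l)))\<^sup>2 * (1 + (norm l)\<^sup>2) powr (\<alpha> + real CARD('d) / 2)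
      \<le> (CX * (t / (2 * M)) powr (- e))\<^sup>2 * ((cmod (Fhat l))\<^sup>2 * (1 + (norm l)\<^sup>2) powr \<alpha>0)" for l
    proof -
      have "norm (X ((t / (2 * M)) *\<^sub>R l)) \<le> CX / (1 + (t / (2 * M)) * norm l) ^ (r + 2)"
        using Xd[of "(t / (2 * M)) *\<^sub>R l"] unfolding norm_scaleR abs_of_pos[OF \<rho>(1)] .
      from spectral_decay[OF \<rho> e less_imp_le[OF CX] _ norm_ge_zero this norm_ge_zero, of "\<alpha> + real CARD('d) / 2" \<alpha>0]
      have "(norm (X ((t / (2 * M)) *\<^sub>R l)))\<^sup>2 * (1 + (norm l)\<^sup>2) powr (\<alpha> + real CARD('d) / 2) \<le>
        (CX * (t / (2 * M)) powr (- e))\<^sup>2 * (1 + (norm l)\<^sup>2) powr \<alpha>0" by (simp add: e_def)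
      then have "(norm (Fhat l))\<^sup>2 * ((norm (X ((t / (2 * M)) *\<^sub>R l)))\<^sup>2 * (1 + (norm l)\<^sup>2) powr (\<alpha> + real CARD('d) / 2)) \<le>
        (norm (Fhat l))\<^sup>2 * ((CX * (t / (2 * M)) powr (- e))\<^sup>2 * (1 + (norm l)\<^sup>2) powr \<alpha>0)"
        by (rule mult_left_mono) simp
      then show ?thesis by (simp only: norm_mult norm_cis power_mult_distrib mult_ac mult_1_left)
    qed
    then have "(\<integral>\<^sup>+l. ennreal ((norm (cis (t * (l \<bullet> c0)) * (X ((t / (2 * M)) *\<^sub>R l) * Fhat l)))\<^sup>2 * (1 + (norm l)\<^sup>2) powr (\<alpha> + real CARD('d) / 2)) \<partial>lborel)
      \<le> (\<integral>\<^sup>+l. ennreal ((CX * (t / (2 * M)) powr (- e))\<^sup>2) * ennreal ((cmod (Fhat l))\<^sup>2 * (1 + (norm l)\<^sup>2) powr \<alpha>0) \<partial>lborel)"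
      by (intro nn_integral_mono) (simp add: ennreal_leI flip: ennreal_mult)
    also have "\<dots> = ennreal ((CX * (t / (2 * M)) powr (- e))\<^sup>2) * ennreal H"
      by (subst nn_integral_cmult) (auto simp: H)
    also have "\<dots> = ennreal ((G0 * t powr (- e))\<^sup>2)"
    proof -
      have "(t / (2 * M)) powr (- e) = t powr (- e) * (2 * M) powr e"
        using t M by (simp add: powr_divide powr_minus field_simps)
      then have "(CX * (t / (2 * M)) powr (- e))\<^sup>2 * H = (G0 * t powr (- e))\<^sup>2"
        using H by (simp add: G0_def power_mult_distrib mult_ac)
      then show ?thesis using H by (simp flip: ennreal_mult)
    qed
    finally show "(\<integral>\<^sup>+l. ennreal ((norm (cis (t * (l \<bullet> c0)) * (X ((t / (2 * M)) *\<^sub>R l) * Fhat l)))\<^sup>2 * (1 + (norm l)\<^sup>2) powr (\<alpha> + real CARD('d) / 2)) \<partial>lborel)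
      \<le> ennreal ((G0 * t powr (- e))\<^sup>2)" .
  qed measurable
  have arg: "((1 - t) *\<^sub>R x + t *\<^sub>R c0) + (t / (2 * M)) *\<^sub>R y = x + t *\<^sub>R (u y - x)" for t x y
    unfolding u_def by (simp add: algebra_simps)
  have hh_eq: "hh t x = (LINT y|lborel. F (x + t *\<^sub>R (u y - x)) * P y)" for t x
    unfolding hh_def arg ..
  have um [measurable]: "u \<in> borel_measurable borel" unfolding u_def by measurable
  have hh_int: "integrable lborel (\<lambda>y. F (x + t *\<^sub>R (u y - x)) * P y)" if "x \<in> unit_cube" "0 \<le> t" "t \<le> 1" for t x
  proof (rule Bochner_Integration.integrable_bound)
    show "integrable lborel (\<lambda>y. Bf * P y)" using Pi by simp
    show "AE y in lborel. norm (F (x + t *\<^sub>R (u y - x)) * P y) \<le> norm (Bf * P y)"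
    proof (rule AE_I2)
      fix y
      show "norm (F (x + t *\<^sub>R (u y - x)) * P y) \<le> norm (Bf * P y)"
      proof (cases "P y = 0")
        case False
        have in_c: "x + t *\<^sub>R (u y - x) \<in> unit_cube" using that u_cube[OF False] by (intro unit_cube_shrink)
        then have "\<bar>F (x + t *\<^sub>R (u y - x))\<bar> \<le> \<bar>Bf\<bar>" using Ff[OF in_c] Bf[OF in_c] by simp
        then show ?thesis by (simp add: abs_mult mult_right_mono)
      qed simp
    qed
  qed measurable
  define D where "D = real CARD('d)"
  define C where "C = max (L * D powr \<alpha>0) (2 ^ K * (2 ^ CARD('d) * G0))"
  \<comment> \<open>With \<open>\<delta>\<close> at most \<open>1 / (2 * real K)\<close> every
    contraction \<open>j * \<delta>\<close> for \<open>j \<le> K\<close> is at most 1/2, as the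
    bound for dilated frequencies requires.\<close>
  show thesis
  proof (rule that[of C "1 / (2 * real K)"])
    show "0 \<le> C" using G0 by (simp add: C_def le_max_iff_disj)
    show "0 < 1 / (2 * real K)" by (simp add: K_def)
    fix \<delta> :: real assume \<delta>: "0 < \<delta>" "\<delta> \<le> 1 / (2 * real K)"
    have j\<delta>: "0 < real j * \<delta>" "real j * \<delta> \<le> 1 / 2" "\<delta> \<le> real j * \<delta>" if "1 \<le> j" "j \<le> K" for j
    proof -
      show "0 < real j * \<delta>" using that \<delta> by simp
      have "real j * \<delta> \<le> real K * (1 / (2 * real K))" using that \<delta> by (intro mult_mono) auto
      moreover have "0 < real K" by (simp add: K_def)
      ultimately show "real j * \<delta> \<le> 1 / 2" by simp
      show "\<delta> \<le> real j * \<delta>" using that \<delta> by (simp add: mult_le_cancel_right1)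
    qed
    \<comment> \<open>The index 0 is left out because \<open>hh 0 x\<close> is \<open>f x\<close>.
      Hence \<open>f - h\<close> is an averaged difference of order \<open>K\<close>, while
      \<open>h\<close> contains smoothed terms only.\<close>
    define h where "h = (\<lambda>x. \<Sum>j=1..K. - ((- 1) ^ j * real (K choose j)) * hh (real j * \<delta>) x)"
    have "\<bar>f x - h x\<bar> \<le> C * \<delta> powr \<alpha>0" if x: "x \<in> unit_cube" for x
    proof -
      have int: "integrable lborel (\<lambda>y. F (x + (real j * \<delta>) *\<^sub>R (u y - x)) * P y)" if "j \<le> K" for j
        using j\<delta>[of j] that x Pi by (cases "j = 0") (auto intro!: hh_int)
      have diff: "(\<Sum>j\<le>K. (- 1) ^ j * real (K choose j) * (F (x + (real j * \<delta>) *\<^sub>R (u y - x)) * P y)) =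
          fin_diff K f x (\<delta> *\<^sub>R (u y - x)) * P y" for y
      proof (cases "P y = 0")
        case False
        have "F (x + (real j * \<delta>) *\<^sub>R (u y - x)) = f (x + (real j * \<delta>) *\<^sub>R (u y - x))" if "j \<le> K" for j
          using j\<delta>[of j] that x u_cube[OF False] by (cases "j = 0") (auto intro!: Ff unit_cube_shrink)
        then show ?thesis unfolding fin_diff_def sum_distrib_right
          by (intro sum.cong refl) (simp add: mult.assoc)
      qed simp
      have "f x - h x = (\<Sum>j\<le>K. (- 1) ^ j * real (K choose j) * hh (real j * \<delta>) x)"
      proof -
        have "hh 0 x = f x" using x Ff P1 by (simp add: hh_eq)
        moreover have "{..K} = insert 0 {1..K}" by auto
        ultimately show ?thesis by (simp add: h_def sum_negf)
      qed
      also have "\<dots> = (LINT y|lborel. (\<Sum>j\<le>K. (- 1) ^ j * real (K choose j) * (F (x + (real j * \<delta>) *\<^sub>R (u y - x)) * P y)))"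
        unfolding hh_eq by (subst Bochner_Integration.integral_sum) (auto intro!: int)
      also have "\<dots> = (LINT y|lborel. fin_diff K f x (\<delta> *\<^sub>R (u y - x)) * P y)"
        unfolding diff ..
      also have "\<bar>\<dots>\<bar> \<le> (LINT y|lborel. (L * D powr \<alpha>0 * \<delta> powr \<alpha>0) * P y)"
      proof (rule integral_abs_bound_integral)
        show "integrable lborel (\<lambda>y. fin_diff K f x (\<delta> *\<^sub>R (u y - x)) * P y)"
          unfolding diff[symmetric] by (intro Bochner_Integration.integrable_sum integrable_mult_right int) auto
        show "integrable lborel (\<lambda>y. (L * D powr \<alpha>0 * \<delta> powr \<alpha>0) * P y)" using Pi by simp
        fix y
        show "\<bar>fin_diff K f x (\<delta> *\<^sub>R (u y - x)) * P y\<bar> \<le> (L * D powr \<alpha>0 * \<delta> powr \<alpha>0) * P y"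
        proof (cases "P y = 0")
          case False
          have "x + (real K * \<delta>) *\<^sub>R (u y - x) \<in> unit_cube"
            using j\<delta>[of K] x u_cube[OF False] by (intro unit_cube_shrink) (auto simp: K_def)
          then have "\<bar>fin_diff K f x (\<delta> *\<^sub>R (u y - x))\<bar> \<le> L * norm (\<delta> *\<^sub>R (u y - x)) powr \<alpha>0"
            using x by (intro L) auto
          also have "\<dots> \<le> L * (\<delta> * D) powr \<alpha>0"
            using norm_unit_cube_diff[OF x u_cube[OF False]] \<delta> L0 \<alpha>0
            by (intro mult_left_mono powr_mono2) (auto simp: D_def mult_left_mono)
          also have "\<dots> = L * D powr \<alpha>0 * \<delta> powr \<alpha>0"
            using \<delta> by (simp add: powr_mult D_def mult_ac)
          finally show ?thesis using P01(1)[of y] by (simp add: abs_mult mult_right_mono)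
        qed simp
      qed
      also have "\<dots> = L * D powr \<alpha>0 * \<delta> powr \<alpha>0" using P1 by simp
      also have "\<dots> \<le> C * \<delta> powr \<alpha>0" by (intro mult_right_mono) (auto simp: C_def)
      finally show ?thesis .
    qed
    moreover have "\<bar>dotp n b (\<lambda>j. h (w j))\<bar> \<le> C * \<delta> powr (- e) * sqrt (dotp n b (mat_app n (\<lambda>i j. matern_kernel \<alpha> (w i) (w j)) b))"
      for n w b
    proof -
      let ?Q = "sqrt (dotp n b (mat_app n (\<lambda>i j. matern_kernel \<alpha> (w i) (w j)) b))"
      have "0 \<le> dotp n b (mat_app n (\<lambda>i j. matern_kernel \<alpha> (w i) (w j)) b)"
        unfolding matern_gram(2)[OF \<alpha>] by (intro integral_nonneg_AE AE_I2) simp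
      then have Q: "0 \<le> ?Q" by simp
      have "dotp n b (\<lambda>j. h (w j)) = (\<Sum>i=1..K. - ((- 1) ^ i * real (K choose i)) * dotp n b (\<lambda>j. hh (real i * \<delta>) (w j)))"
        unfolding dotp_def h_def sum_distrib_left by (subst sum.swap) (simp add: mult_ac)
      also have "\<bar>\<dots>\<bar> \<le> (\<Sum>i=1..K. real (K choose i) * (2 ^ CARD('d) * (G0 * \<delta> powr (- e)) * ?Q))"
      proof (intro order_trans[OF sum_abs] sum_mono)
        fix i assume i: "i \<in> {1..K}"
        then have i': "1 \<le> i" "i \<le> K" by auto
        have "\<bar>dotp n b (\<lambda>j. hh (real i * \<delta>) (w j))\<bar> \<le> 2 ^ CARD('d) * (G0 * (real i * \<delta>) powr (- e)) * ?Q"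
          by (rule hh_bound[OF j\<delta>(1,2)[OF i']])
        \<comment> \<open>As \<open>j \<ge> 1\<close>, the bandwidth of each term is at least that
          for \<open>\<delta>\<close>, and a larger bandwidth has the smaller norm.\<close>
        also have "\<dots> \<le> 2 ^ CARD('d) * (G0 * \<delta> powr (- e)) * ?Q"
          using Q G0 \<delta> e j\<delta>[OF i'] by (intro mult_right_mono mult_left_mono powr_mono2') auto
        finally show "\<bar>- ((- 1) ^ i * real (K choose i)) * dotp n b (\<lambda>j. hh (real i * \<delta>) (w j))\<bar> \<le>
            real (K choose i) * (2 ^ CARD('d) * (G0 * \<delta> powr (- e)) * ?Q)"
          by (simp add: abs_mult power_abs mult_left_mono)
      qed
      also have "\<dots> = (\<Sum>i=1..K. real (K choose i)) * (2 ^ CARD('d) * (G0 * \<delta> powr (- e)) * ?Q)"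
        by (simp add: sum_distrib_right)
      also have "\<dots> \<le> 2 ^ K * (2 ^ CARD('d) * (G0 * \<delta> powr (- e)) * ?Q)"
      proof (rule mult_right_mono)
        have "(\<Sum>i=1..K. real (K choose i)) \<le> (\<Sum>i\<le>K. real (K choose i))"
          by (intro sum_mono2) auto
        also have "\<dots> = 2 ^ K"
          using choose_row_sum[of K] by (simp flip: of_nat_sum)
        finally show "(\<Sum>i=1..K. real (K choose i)) \<le> 2 ^ K" .
      qed (use Q G0 in simp)
      also have "\<dots> = (2 ^ K * (2 ^ CARD('d) * G0)) * \<delta> powr (- e) * ?Q" by (simp add: mult_ac)
      also have "\<dots> \<le> C * \<delta> powr (- e) * ?Q"
        using Q by (intro mult_right_mono) (auto simp: C_def)
      finally show ?thesis .
    qed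
    ultimately show "\<exists>h. (\<forall>x\<in>unit_cube. \<bar>f x - h x\<bar> \<le> C * \<delta> powr \<alpha>0) \<and>
      (\<forall>n w b. \<bar>dotp n b (\<lambda>j. h (w j))\<bar> \<le> C * \<delta> powr (- e) * sqrt (dotp n b (mat_app n (\<lambda>i j. matern_kernel \<alpha> (w i) (w j)) b)))"
      by (intro exI[of _ h]) blast
  qed
qed

section \<open>Moments of the partially linear model\<close>

text \<open>The law of a pair \<open>(Y, X)\<close> at a design point where the nuisance functions
  take the values \<open>h\<close> and \<open>m\<close>. Generating it from two independent standard
  normal variables makes both error terms explicit.\<close>

definition plm_law :: "real \<Rightarrow> real \<Rightarrow> real \<Rightarrow> real \<Rightarrow> real \<Rightarrow> (real \<times> real) measure" where
  "plm_law \<beta> \<sigma>1 \<sigma>2 h m = distr (std_normal \<Otimes>\<^sub>M std_normal) (borel \<Otimes>\<^sub>M borel)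
     (\<lambda>(x, y). ((m + \<sigma>2 * x) * \<beta> + h + \<sigma>1 * y, m + \<sigma>2 * x))"

lemma sets_plm_law [simp, measurable_cong]: "sets (plm_law \<beta> \<sigma>1 \<sigma>2 h m) = sets (borel \<Otimes>\<^sub>M borel)"
  by (simp add: plm_law_def)

interpretation std_normal2: pair_prob_space std_normal std_normal
  by (simp add: pair_prob_space_def pair_sigma_finite_def std_normal.prob_space_axioms prob_space_imp_sigma_finite)

lemma plm_law_map_measurable [measurable]:
  "(\<lambda>(x, y). ((m + \<sigma>2 * x) * \<beta> + h + \<sigma>1 * y, m + \<sigma>2 * x)) \<in> (std_normal \<Otimes>\<^sub>M std_normal) \<rightarrow>\<^sub>M (borel \<Otimes>\<^sub>M borel)"
  by measurable

lemma prob_space_plm_law: "prob_space (plm_law \<beta> \<sigma>1 \<sigma>2 h m)"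
  unfolding plm_law_def by (rule std_normal2.P.prob_space_distr) measurable

definition std_moment :: "nat \<Rightarrow> real" where
  "std_moment k = (LINT z|std_normal. z ^ k)"

lemma std_moment_simps: "std_moment 0 = 1" "std_moment (Suc 0) = 0" "std_moment 2 = 1" "std_moment 4 = 3"
  using std_normal_distribution_even_moments(1)[of 0] std_normal_distribution_even_moments(1)[of 1]
    std_normal_distribution_even_moments(1)[of 2] integral_std_normal_distribution_moment_odd[of 1]
  by (simp_all add: std_moment_def fact_numeral)

lemma plm_law_moment:
  shows "integrable (plm_law \<beta> \<sigma>1 \<sigma>2 h m) (\<lambda>d. (snd d - m) ^ a * (fst d - snd d * \<beta> - h) ^ b)"
    "(LINT d|plm_law \<beta> \<sigma>1 \<sigma>2 h m. (snd d - m) ^ a * (fst d - snd d * \<beta> - h) ^ b) =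
       (\<sigma>2 ^ a * std_moment a) * (\<sigma>1 ^ b * std_moment b)"
proof -
  let ?f = "\<lambda>d. (snd d - m) ^ a * (fst d - snd d * \<beta> - h) ^ b"
  let ?T = "\<lambda>(x, y). ((m + \<sigma>2 * x) * \<beta> + h + \<sigma>1 * y, m + \<sigma>2 * x)"
  have fT: "?f (?T z) = (\<sigma>2 ^ a * \<sigma>1 ^ b) * (fst z ^ a * snd z ^ b)" for z
    by (cases z) (simp add: power_mult_distrib mult_ac)
  have fm: "?f \<in> borel_measurable (borel \<Otimes>\<^sub>M borel)" by measurable
  have i: "integrable (std_normal \<Otimes>\<^sub>M std_normal) (\<lambda>z. fst z ^ a * snd z ^ b)"
  proof (rule std_normal2.Fubini_integrable)
    have "integrable std_normal (\<lambda>x. norm (x ^ a) * (LINT y|std_normal. norm (y ^ b)))"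
      by (intro integrable_mult_left integrable_norm integrable_std_normal_distribution_moment)
    then show "integrable std_normal (\<lambda>x. LINT y|std_normal. norm (fst (x, y) ^ a * snd (x, y) ^ b))"
      unfolding norm_mult fst_conv snd_conv by (subst integral_mult_right_zero)
    show "AE x in std_normal. integrable std_normal (\<lambda>y. fst (x, y) ^ a * snd (x, y) ^ b)"
      by (intro AE_I2) (simp add: integrable_std_normal_distribution_moment)
  qed measurable
  show "integrable (plm_law \<beta> \<sigma>1 \<sigma>2 h m) ?f"
    unfolding plm_law_def by (subst integrable_distr_eq[OF plm_law_map_measurable fm]) (simp only: fT integrable_mult_right i)
  have "(LINT d|plm_law \<beta> \<sigma>1 \<sigma>2 h m. ?f d) = (LINT z|(std_normal \<Otimes>\<^sub>M std_normal). (\<sigma>2 ^ a * \<sigma>1 ^ b) * (fst z ^ a * snd z ^ b))"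
    unfolding plm_law_def by (subst integral_distr[OF plm_law_map_measurable fm]) (simp only: fT)
  also have "\<dots> = (\<sigma>2 ^ a * \<sigma>1 ^ b) * (LINT x|std_normal. LINT y|std_normal. x ^ a * y ^ b)"
    using std_normal2.integral_fst'[OF i] by simp
  also have "\<dots> = (\<sigma>2 ^ a * std_moment a) * (\<sigma>1 ^ b * std_moment b)"
    by (simp add: std_moment_def)
  finally show "(LINT d|plm_law \<beta> \<sigma>1 \<sigma>2 h m. ?f d) = (\<sigma>2 ^ a * std_moment a) * (\<sigma>1 ^ b * std_moment b)" .
qed

text \<open>Pythagoras. It serves the orthogonal families \<open>v i\<close>, \<open>e i\<close>,
  \<open>v i * e j\<close> and \<open>(v i)\<^sup>2 - \<sigma>2\<^sup>2\<close>.\<close>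

lemma orthogonal_sum_square:
  fixes f :: "'i \<Rightarrow> 'a \<Rightarrow> real"
  assumes "finite I" and i: "\<And>p q. p \<in> I \<Longrightarrow> q \<in> I \<Longrightarrow> integrable M (\<lambda>x. f p x * f q x)"
    and o: "\<And>p q. p \<in> I \<Longrightarrow> q \<in> I \<Longrightarrow> (LINT x|M. f p x * f q x) = (if p = q then c else 0)"
  shows "integrable M (\<lambda>x. (\<Sum>p\<in>I. a p * f p x)\<^sup>2)"
    "(LINT x|M. (\<Sum>p\<in>I. a p * f p x)\<^sup>2) = c * (\<Sum>p\<in>I. (a p)\<^sup>2)"
proof -
  have eq: "(\<Sum>p\<in>I. a p * f p x)\<^sup>2 = (\<Sum>p\<in>I. \<Sum>q\<in>I. (a p * a q) * (f p x * f q x))" for x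
    by (simp add: power2_eq_square sum_product mult_ac)
  show "integrable M (\<lambda>x. (\<Sum>p\<in>I. a p * f p x)\<^sup>2)"
    unfolding eq by (intro Bochner_Integration.integrable_sum integrable_mult_right i)
  have "(LINT x|M. (\<Sum>p\<in>I. a p * f p x)\<^sup>2) = (\<Sum>p\<in>I. LINT x|M. (\<Sum>q\<in>I. (a p * a q) * (f p x * f q x)))"
    unfolding eq by (intro Bochner_Integration.integral_sum Bochner_Integration.integrable_sum integrable_mult_right i)
  also have "\<dots> = (\<Sum>p\<in>I. \<Sum>q\<in>I. LINT x|M. (a p * a q) * (f p x * f q x))"
    by (intro sum.cong refl Bochner_Integration.integral_sum integrable_mult_right i)
  also have "\<dots> = (\<Sum>p\<in>I. \<Sum>q\<in>I. if p = q then a p * a p * c else 0)"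
    by (intro sum.cong refl) (auto simp: o)
  also have "\<dots> = c * (\<Sum>p\<in>I. (a p)\<^sup>2)"
    using assms(1) by (simp add: sum_distrib_left power2_eq_square mult_ac)
  finally show "(LINT x|M. (\<Sum>p\<in>I. a p * f p x)\<^sup>2) = c * (\<Sum>p\<in>I. (a p)\<^sup>2)" .
qed

lemma prod_pow_unit: "i < (n::nat) \<Longrightarrow> (\<Prod>t<n. (x t :: real) ^ (c * of_bool (t = i))) = x i ^ c"
proof -
  assume "i < n"
  have "(\<Prod>t<n. x t ^ (c * of_bool (t = i))) = (\<Prod>t<n. if t = i then x t ^ c else 1)"
    by (intro prod.cong) auto
  then show ?thesis using \<open>i < n\<close> by simp
qed

lemma prod_unit_pair:
  fixes g :: "nat \<Rightarrow> real"
  assumes "i < (n::nat)" "j < n" and g: "g 0 = 1"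
  shows "(\<Prod>t<n. g (c * of_bool (t = i) + c * of_bool (t = j))) = (if i = j then g (c + c) else g c * g c)"
proof (cases "i = j")
  case True
  have "(\<Prod>t<n. g (c * of_bool (t = i) + c * of_bool (t = j))) = (\<Prod>t<n. if t = i then g (c + c) else 1)"
    using True g by (intro prod.cong) auto
  then show ?thesis using True assms by simp
next
  case False
  have "(\<Prod>t<n. g (c * of_bool (t = i) + c * of_bool (t = j))) =
      (\<Prod>t<n. (if t = i then g c else 1) * (if t = j then g c else 1))"
    using False g by (intro prod.cong) auto
  then show ?thesis using False assms by (simp add: prod.distrib)
qed

locale plm_sample =
  fixes \<beta> \<sigma>1 \<sigma>2 :: real and h m :: "nat \<Rightarrow> real" and n :: nat
begin

abbreviation law :: "(nat \<Rightarrow> real \<times> real) measure" where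
  "law \<equiv> \<Pi>\<^sub>M i\<in>{..<n}. plm_law \<beta> \<sigma>1 \<sigma>2 (h i) (m i)"

definition v :: "(nat \<Rightarrow> real \<times> real) \<Rightarrow> nat \<Rightarrow> real" where
  "v d i = snd (d i) - m i"

definition e :: "(nat \<Rightarrow> real \<times> real) \<Rightarrow> nat \<Rightarrow> real" where
  "e d i = fst (d i) - snd (d i) * \<beta> - h i"

lemma v_measurable [measurable]: "i < n \<Longrightarrow> (\<lambda>d. v d i) \<in> borel_measurable law"
  and e_measurable [measurable]: "i < n \<Longrightarrow> (\<lambda>d. e d i) \<in> borel_measurable law"
proof -
  assume "i < n"
  then have m [measurable]: "(\<lambda>d. d i) \<in> law \<rightarrow>\<^sub>M (borel \<Otimes>\<^sub>M borel)"
    using measurable_component_singleton[of i "{..<n}" "\<lambda>i. plm_law \<beta> \<sigma>1 \<sigma>2 (h i) (m i)"]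
    by (simp cong: measurable_cong_sets)
  show "(\<lambda>d. v d i) \<in> borel_measurable law" "(\<lambda>d. e d i) \<in> borel_measurable law"
    unfolding v_def e_def by measurable
qed

lemma product_moment:
  shows "integrable law (\<lambda>d. \<Prod>i<n. v d i ^ a i * e d i ^ b i)"
    "(LINT d|law. (\<Prod>i<n. v d i ^ a i * e d i ^ b i)) =
      (\<Prod>i<n. \<sigma>2 ^ a i * std_moment (a i)) * (\<Prod>i<n. \<sigma>1 ^ b i * std_moment (b i))"
proof -
  interpret product_prob_space "\<lambda>i. plm_law \<beta> \<sigma>1 \<sigma>2 (h i) (m i)" "{..<n}"
    by (intro product_prob_spaceI prob_space_plm_law)
  show "integrable law (\<lambda>d. \<Prod>i<n. v d i ^ a i * e d i ^ b i)"
    unfolding v_def e_def by (rule product_integrable_prod) (auto intro: plm_law_moment)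
  show "(LINT d|law. (\<Prod>i<n. v d i ^ a i * e d i ^ b i)) =
      (\<Prod>i<n. \<sigma>2 ^ a i * std_moment (a i)) * (\<Prod>i<n. \<sigma>1 ^ b i * std_moment (b i))"
  proof -
    have "(LINT d|law. (\<Prod>i<n. v d i ^ a i * e d i ^ b i)) =
      (\<Prod>i<n. LINT d|plm_law \<beta> \<sigma>1 \<sigma>2 (h i) (m i). (snd d - m i) ^ a i * (fst d - snd d * \<beta> - h i) ^ b i)"
      unfolding v_def e_def by (rule product_integral_prod) (auto intro: plm_law_moment)
    then show ?thesis by (simp only: plm_law_moment(2) prod.distrib)
  qed
qed

lemma prob_space_law: "prob_space law"
  by (intro prob_space_PiM prob_space_plm_law)

text \<open>Each second-moment computation involves at most four coordinates. Writing the monomial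
  as a product over all indices, with exponents that vanish off those coordinates, lets the moment
  formula for product measures apply; coinciding indices merge their exponents.\<close>

lemma pair_moment:
  assumes "i < n" "j < n" "k < n" "l < n"
  shows "integrable law (\<lambda>d. v d i ^ c * v d j ^ c * (e d k ^ c' * e d l ^ c'))"
    "(LINT d|law. v d i ^ c * v d j ^ c * (e d k ^ c' * e d l ^ c')) =
      (if i = j then \<sigma>2 ^ (c + c) * std_moment (c + c) else (\<sigma>2 ^ c * std_moment c)\<^sup>2) *
      (if k = l then \<sigma>1 ^ (c' + c') * std_moment (c' + c') else (\<sigma>1 ^ c' * std_moment c')\<^sup>2)"
proof -
  let ?a = "\<lambda>t. c * of_bool (t = i) + c * of_bool (t = j)" and ?b = "\<lambda>t. c' * of_bool (t = k) + c' * of_bool (t = l)"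
  have eq: "v d i ^ c * v d j ^ c * (e d k ^ c' * e d l ^ c') = (\<Prod>t<n. v d t ^ ?a t * e d t ^ ?b t)" for d
    unfolding power_add prod.distrib using assms by (simp add: prod_pow_unit)
  show "integrable law (\<lambda>d. v d i ^ c * v d j ^ c * (e d k ^ c' * e d l ^ c'))"
    unfolding eq by (rule product_moment)
  show "(LINT d|law. v d i ^ c * v d j ^ c * (e d k ^ c' * e d l ^ c')) =
      (if i = j then \<sigma>2 ^ (c + c) * std_moment (c + c) else (\<sigma>2 ^ c * std_moment c)\<^sup>2) *
      (if k = l then \<sigma>1 ^ (c' + c') * std_moment (c' + c') else (\<sigma>1 ^ c' * std_moment c')\<^sup>2)"
  proof -
    have "(\<Prod>t<n. \<sigma>2 ^ ?a t * std_moment (?a t)) =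
        (if i = j then \<sigma>2 ^ (c + c) * std_moment (c + c) else (\<sigma>2 ^ c * std_moment c) * (\<sigma>2 ^ c * std_moment c))"
      by (rule prod_unit_pair[OF assms(1,2), of "\<lambda>t. \<sigma>2 ^ t * std_moment t"]) (simp add: std_moment_simps)
    moreover have "(\<Prod>t<n. \<sigma>1 ^ ?b t * std_moment (?b t)) =
        (if k = l then \<sigma>1 ^ (c' + c') * std_moment (c' + c') else (\<sigma>1 ^ c' * std_moment c') * (\<sigma>1 ^ c' * std_moment c'))"
      by (rule prod_unit_pair[OF assms(3,4), of "\<lambda>t. \<sigma>1 ^ t * std_moment t"]) (simp add: std_moment_simps)
    ultimately show ?thesis unfolding eq product_moment(2) power2_eq_square by (simp only:)
  qed
qed

lemma linear_v_moment:
  shows "integrable law (\<lambda>d. (dotp n a (v d))\<^sup>2)"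
    "(LINT d|law. (dotp n a (v d))\<^sup>2) = \<sigma>2\<^sup>2 * dotp n a a"
proof -
  have 1: "integrable law (\<lambda>d. v d i * v d j)" if "i < n" "j < n" for i j
    using pair_moment(1)[OF that that, of 1 0] by simp
  have 2: "(LINT d|law. v d i * v d j) = (if i = j then \<sigma>2\<^sup>2 else 0)" if "i < n" "j < n" for i j
    using pair_moment(2)[OF that that, of 1 0] by (simp add: std_moment_simps numeral_2_eq_2[symmetric] split: if_splits)
  show "integrable law (\<lambda>d. (dotp n a (v d))\<^sup>2)" "(LINT d|law. (dotp n a (v d))\<^sup>2) = \<sigma>2\<^sup>2 * dotp n a a"
    using orthogonal_sum_square[of "{..<n}" law "\<lambda>i d. v d i" "\<sigma>2\<^sup>2" a] 1 2
    by (simp_all add: dotp_def power2_eq_square)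
qed

lemma linear_e_moment:
  shows "integrable law (\<lambda>d. (dotp n a (e d))\<^sup>2)"
    "(LINT d|law. (dotp n a (e d))\<^sup>2) = \<sigma>1\<^sup>2 * dotp n a a"
proof -
  have 1: "integrable law (\<lambda>d. e d i * e d j)" if "i < n" "j < n" for i j
    using pair_moment(1)[OF that that, of 0 1] by simp
  have 2: "(LINT d|law. e d i * e d j) = (if i = j then \<sigma>1\<^sup>2 else 0)" if "i < n" "j < n" for i j
    using pair_moment(2)[OF that that, of 0 1] by (simp add: std_moment_simps numeral_2_eq_2[symmetric] split: if_splits)
  show "integrable law (\<lambda>d. (dotp n a (e d))\<^sup>2)" "(LINT d|law. (dotp n a (e d))\<^sup>2) = \<sigma>1\<^sup>2 * dotp n a a"
    using orthogonal_sum_square[of "{..<n}" law "\<lambda>i d. e d i" "\<sigma>1\<^sup>2" a] 1 2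
    by (simp_all add: dotp_def power2_eq_square)
qed

lemma bilinear_moment:
  shows "integrable law (\<lambda>d. (dotp n (v d) (mat_app n S (e d)))\<^sup>2)"
    "(LINT d|law. (dotp n (v d) (mat_app n S (e d)))\<^sup>2) = \<sigma>1\<^sup>2 * \<sigma>2\<^sup>2 * (\<Sum>i<n. \<Sum>j<n. (S i j)\<^sup>2)"
proof -
  let ?I = "{..<n} \<times> {..<n}" and ?f = "\<lambda>(i, j) d. v d i * e d j"
  have 1: "integrable law (\<lambda>d. ?f p d * ?f q d)" if "p \<in> ?I" "q \<in> ?I" for p q
    using pair_moment(1)[of "fst p" "fst q" "snd p" "snd q" 1 1] that by (auto simp: split_beta mult_ac)
  have 2: "(LINT d|law. ?f p d * ?f q d) = (if p = q then \<sigma>1\<^sup>2 * \<sigma>2\<^sup>2 else 0)" if "p \<in> ?I" "q \<in> ?I" for p q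
    using pair_moment(2)[of "fst p" "fst q" "snd p" "snd q" 1 1] that
    by (auto simp: split_beta mult_ac std_moment_simps numeral_2_eq_2[symmetric] prod_eq_iff split: if_splits)
  have eq: "dotp n (v d) (mat_app n S (e d)) = (\<Sum>p\<in>?I. (case p of (i, j) \<Rightarrow> S i j) * ?f p d)" for d
  proof -
    have "dotp n (v d) (mat_app n S (e d)) = (\<Sum>i<n. \<Sum>j<n. S i j * (v d i * e d j))"
      by (simp add: dotp_def mat_app_def sum_distrib_left mult_ac)
    then show ?thesis by (simp add: sum.cartesian_product split_beta)
  qed
  have fin: "finite ?I" by simp
  show "integrable law (\<lambda>d. (dotp n (v d) (mat_app n S (e d)))\<^sup>2)"
    unfolding eq by (rule orthogonal_sum_square(1)[OF fin 1 2])
  show "(LINT d|law. (dotp n (v d) (mat_app n S (e d)))\<^sup>2) = \<sigma>1\<^sup>2 * \<sigma>2\<^sup>2 * (\<Sum>i<n. \<Sum>j<n. (S i j)\<^sup>2)"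
    unfolding eq by (subst orthogonal_sum_square(2)[OF fin 1 2])
      (simp_all add: sum.cartesian_product split_beta)
qed

text \<open>A first moment suffices: the form of the smoother is nonnegative, so Markov's inequality
  applies to it.\<close>

lemma quadratic_moment:
  shows "integrable law (\<lambda>d. dotp n (v d) (mat_app n S (v d)))"
    "(LINT d|law. dotp n (v d) (mat_app n S (v d))) = \<sigma>2\<^sup>2 * (\<Sum>i<n. S i i)"
proof -
  have 1: "integrable law (\<lambda>d. v d i * v d j)" if "i < n" "j < n" for i j
    using pair_moment(1)[OF that that, of 1 0] by simp
  have 2: "(LINT d|law. v d i * v d j) = (if i = j then \<sigma>2\<^sup>2 else 0)" if "i < n" "j < n" for i j
    using pair_moment(2)[OF that that, of 1 0] by (simp add: std_moment_simps numeral_2_eq_2[symmetric] split: if_splits)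
  have eq: "dotp n (v d) (mat_app n S (v d)) = (\<Sum>i<n. \<Sum>j<n. S i j * (v d i * v d j))" for d
    by (simp add: dotp_def mat_app_def sum_distrib_left mult_ac)
  show "integrable law (\<lambda>d. dotp n (v d) (mat_app n S (v d)))"
    unfolding eq by (intro Bochner_Integration.integrable_sum integrable_mult_right 1) auto
  have "(LINT d|law. dotp n (v d) (mat_app n S (v d))) = (\<Sum>i<n. LINT d|law. (\<Sum>j<n. S i j * (v d i * v d j)))"
    unfolding eq by (intro Bochner_Integration.integral_sum Bochner_Integration.integrable_sum integrable_mult_right 1) auto
  also have "\<dots> = (\<Sum>i<n. \<Sum>j<n. LINT d|law. S i j * (v d i * v d j))"
    by (intro sum.cong refl Bochner_Integration.integral_sum integrable_mult_right 1) auto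
  also have "\<dots> = (\<Sum>i<n. \<Sum>j<n. if i = j then S i j * \<sigma>2\<^sup>2 else 0)"
    by (intro sum.cong refl) (simp add: 2)
  finally show "(LINT d|law. dotp n (v d) (mat_app n S (v d))) = \<sigma>2\<^sup>2 * (\<Sum>i<n. S i i)"
    by (simp add: sum_distrib_left mult_ac)
qed

text \<open>The factor 2 is the fourth moment 3 of a standard normal variable minus its squared
  second moment.\<close>

lemma square_sum_moment:
  shows "integrable law (\<lambda>d. (dotp n (v d) (v d) - real n * \<sigma>2\<^sup>2)\<^sup>2)"
    "(LINT d|law. (dotp n (v d) (v d) - real n * \<sigma>2\<^sup>2)\<^sup>2) = 2 * \<sigma>2 ^ 4 * real n"
proof -
  interpret prob_space law by (rule prob_space_law)
  have 1: "integrable law (\<lambda>d. (v d i)\<^sup>2 * (v d j)\<^sup>2)" if "i < n" "j < n" for i j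
    using pair_moment(1)[OF that that, of 2 0] by simp
  have 2: "(LINT d|law. (v d i)\<^sup>2 * (v d j)\<^sup>2) = (if i = j then 3 * \<sigma>2 ^ 4 else \<sigma>2 ^ 4)" if "i < n" "j < n" for i j
    using pair_moment(2)[OF that that, of 2 0] by (simp add: std_moment_simps split: if_splits)
  have 3: "integrable law (\<lambda>d. (v d i)\<^sup>2)" "(LINT d|law. (v d i)\<^sup>2) = \<sigma>2\<^sup>2" if "i < n" for i
    using pair_moment[OF that that that that, of 1 0] by (simp_all add: std_moment_simps power2_eq_square numeral_2_eq_2[symmetric])
  have eq: "((v d i)\<^sup>2 - \<sigma>2\<^sup>2) * ((v d j)\<^sup>2 - \<sigma>2\<^sup>2) = ((v d i)\<^sup>2 * (v d j)\<^sup>2 - \<sigma>2\<^sup>2 * (v d i)\<^sup>2) - (\<sigma>2\<^sup>2 * (v d j)\<^sup>2 - \<sigma>2 ^ 4)" for d i j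
    by (simp add: algebra_simps power4_eq_xxxx power2_eq_square)
  have 4: "integrable law (\<lambda>d. ((v d i)\<^sup>2 - \<sigma>2\<^sup>2) * ((v d j)\<^sup>2 - \<sigma>2\<^sup>2))" if "i < n" "j < n" for i j
    unfolding eq using 1 3 that by (intro Bochner_Integration.integrable_diff integrable_mult_right integrable_const) auto
  have 5: "(LINT d|law. ((v d i)\<^sup>2 - \<sigma>2\<^sup>2) * ((v d j)\<^sup>2 - \<sigma>2\<^sup>2)) = (if i = j then 2 * \<sigma>2 ^ 4 else 0)" if "i < n" "j < n" for i j
  proof -
    have "(LINT d|law. ((v d i)\<^sup>2 - \<sigma>2\<^sup>2) * ((v d j)\<^sup>2 - \<sigma>2\<^sup>2)) =
       ((LINT d|law. (v d i)\<^sup>2 * (v d j)\<^sup>2) - \<sigma>2\<^sup>2 * \<sigma>2\<^sup>2) - (\<sigma>2\<^sup>2 * \<sigma>2\<^sup>2 - \<sigma>2 ^ 4)"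
      unfolding eq using 1[OF that] 3[OF that(1)] 3[OF that(2)] by (simp add: prob_space)
    then show ?thesis using 2[OF that] by (simp add: power4_eq_xxxx power2_eq_square)
  qed
  have s: "dotp n (v d) (v d) - real n * \<sigma>2\<^sup>2 = (\<Sum>i<n. 1 * ((v d i)\<^sup>2 - \<sigma>2\<^sup>2))" for d
    by (simp add: dotp_def sum_subtractf power2_eq_square)
  show "integrable law (\<lambda>d. (dotp n (v d) (v d) - real n * \<sigma>2\<^sup>2)\<^sup>2)"
    unfolding s by (rule orthogonal_sum_square(1)[OF finite_lessThan 4 5]) auto
  show "(LINT d|law. (dotp n (v d) (v d) - real n * \<sigma>2\<^sup>2)\<^sup>2) = 2 * \<sigma>2 ^ 4 * real n"
    unfolding s by (subst orthogonal_sum_square(2)[OF finite_lessThan 4 5]) auto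
qed

end

section \<open>The trace of the smoother\<close>

context ridge
begin

text \<open>The diagonal entry of the smoother is at most the mean squared error of predicting an observation by
  the average over its cell.\<close>

lemma trace_smoother_le:
  fixes g :: "nat \<Rightarrow> 'z"
  assumes Z: "finite Z" and g: "\<And>i. i < n \<Longrightarrow> g i \<in> Z"
    and up: "\<And>i j. i < n \<Longrightarrow> j < n \<Longrightarrow> K i j \<le> \<kappa>0"
    and low: "\<And>i j. i < n \<Longrightarrow> j < n \<Longrightarrow> g i = g j \<Longrightarrow> \<kappa>0 - e \<le> K i j"
  shows "s * (\<Sum>j<n. smoother j j) \<le> 2 * e * real n + s * real (card Z)"
proof -
  define cell where "cell = (\<lambda>j. {i. i < n \<and> g i = g j})"
  have fin: "finite (cell j)" for j by (simp add: cell_def)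
  have N0: "0 < real (card (cell j))" if "j < n" for j
    using that fin by (auto simp: card_gt_0_iff cell_def)
  have diag: "s * smoother j j \<le> 2 * e + s * (1 / real (card (cell j)))" if j: "j < n" for j
  proof -
    define N where "N = real (card (cell j))"
    have N: "0 < N" unfolding N_def by (rule N0[OF j])
    \<comment> \<open>Uniform weights on the cell of \<open>j\<close>; their squared length
      \<open>1 / N\<close> is the contribution of the observation noise.\<close>
    define a where "a = (\<lambda>i. if i \<in> cell j then 1 / N else 0)"
    have sum_a: "(\<Sum>i<n. a i * f i) = (\<Sum>i\<in>cell j. f i) / N" for f
    proof -
      have "(\<Sum>i<n. a i * f i) = (\<Sum>i\<in>{..<n}. if i \<in> cell j then f i / N else 0)"
        by (intro sum.cong) (auto simp: a_def)
      also have "\<dots> = (\<Sum>i\<in>{..<n} \<inter> cell j. f i / N)" by (simp add: sum.inter_restrict)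
      also have "{..<n} \<inter> cell j = cell j" by (auto simp: cell_def)
      finally show ?thesis by (simp add: sum_divide_distrib)
    qed
    have a1: "(\<Sum>i\<in>cell j. c) / N = c" for c using N by (simp add: N_def)
    let ?e = "\<lambda>i. if i = j then 1 else 0 :: real"
    have ee: "dotp n ?e (mat_app n K ?e) = K j j"
      using j by (simp add: dotp_def mat_app_def if_distrib[of "\<lambda>x. x * _"] if_distrib[of "(*) _"] cong: if_cong)
    have ae: "dotp n a (mat_app n K ?e) = (\<Sum>i\<in>cell j. K i j) / N"
      using j by (simp add: dotp_def mat_app_def sum_a if_distrib[of "(*) _"] cong: if_cong)
    have aa: "dotp n a (mat_app n K a) = (\<Sum>i\<in>cell j. (\<Sum>k\<in>cell j. K i k) / N) / N"
      unfolding dotp_def mat_app_def sum_a by (simp add: mult.commute[of _ "a _"] sum_a)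
    have "dotp n a a = (\<Sum>i\<in>cell j. a i) / N" unfolding dotp_def sum_a ..
    also have "(\<Sum>i\<in>cell j. a i) = 1" using N by (simp add: a_def N_def)
    finally have an: "dotp n a a = 1 / N" .
    have "dotp n (\<lambda>i. ?e i - a i) (mat_app n K (\<lambda>i. ?e i - a i)) =
       dotp n (\<lambda>i. ?e i - a i) (\<lambda>i. mat_app n K ?e i - mat_app n K a i)"
      by (rule dotp_cong) (simp_all only: mat_app_diff)
    also have "\<dots> = K j j - 2 * ((\<Sum>i\<in>cell j. K i j) / N) + (\<Sum>i\<in>cell j. (\<Sum>k\<in>cell j. K i k) / N) / N"
      unfolding dotp_diff_left dotp_diff_right ee ae aa dotp_mat_app_sym[OF psd, of ?e a] by simp
    \<comment> \<open>Only the middle average needs the lower bound for points of one cell; the two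
      other terms are bounded above by \<open>\<kappa>0\<close>.\<close>
    also have "\<dots> \<le> \<kappa>0 - 2 * (\<kappa>0 - e) + \<kappa>0"
    proof -
      have "K j j \<le> \<kappa>0" using up j by simp
      moreover have "\<kappa>0 - e \<le> (\<Sum>i\<in>cell j. K i j) / N"
        using low j N by (subst a1[of "\<kappa>0 - e", symmetric]) (intro divide_right_mono sum_mono, auto simp: cell_def)
      moreover have "(\<Sum>i\<in>cell j. (\<Sum>k\<in>cell j. K i k) / N) / N \<le> \<kappa>0"
      proof -
        have "(\<Sum>k\<in>cell j. K i k) / N \<le> \<kappa>0" if "i \<in> cell j" for i
          using up that N by (subst a1[of \<kappa>0, symmetric]) (intro divide_right_mono sum_mono, auto simp: cell_def)
        then have "(\<Sum>i\<in>cell j. (\<Sum>k\<in>cell j. K i k) / N) / N \<le> (\<Sum>i\<in>cell j. \<kappa>0) / N"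
          using N by (intro divide_right_mono sum_mono) auto
        then show ?thesis unfolding a1 .
      qed
      moreover have "x - 2 * y + z \<le> \<kappa>0 - 2 * (\<kappa>0 - e) + \<kappa>0" if "x \<le> \<kappa>0" "\<kappa>0 - e \<le> y" "z \<le> \<kappa>0" for x y z
        using that by simp
      ultimately show ?thesis by blast
    qed
    finally have "dotp n (\<lambda>i. ?e i - a i) (mat_app n K (\<lambda>i. ?e i - a i)) \<le> 2 * e" by simp
    with smoother_diag_le[OF j, of a] show ?thesis by (simp add: an N_def)
  qed
  \<comment> \<open>Each nonempty cell contributes its size times the reciprocal of its size, so the
    sum counts cells. This number does not grow with \<open>n\<close>.\<close>
  have cells: "(\<Sum>j<n. 1 / real (card (cell j))) \<le> real (card Z)"
  proof -
    have "(\<Sum>j<n. 1 / real (card (cell j))) = (\<Sum>z\<in>g ` {..<n}. \<Sum>j\<in>{x. x \<in> {..<n} \<and> g x = z}. 1 / real (card (cell j)))"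
      by (rule sum.image_gen) simp
    also have "\<dots> \<le> (\<Sum>z\<in>g ` {..<n}. 1)"
    proof (intro sum_mono)
      fix z assume "z \<in> g ` {..<n}"
      have "(\<Sum>j\<in>{x. x \<in> {..<n} \<and> g x = z}. 1 / real (card (cell j))) =
        (\<Sum>j\<in>{x. x \<in> {..<n} \<and> g x = z}. 1 / real (card {x. x \<in> {..<n} \<and> g x = z}))"
        by (intro sum.cong refl) (auto simp: cell_def)
      then show "(\<Sum>j\<in>{x. x \<in> {..<n} \<and> g x = z}. 1 / real (card (cell j))) \<le> 1" by simp
    qed
    also have "\<dots> \<le> real (card Z)"
      using Z g by (auto intro!: card_mono)
    finally show ?thesis .
  qed
  have "s * (\<Sum>j<n. smoother j j) \<le> (\<Sum>j<n. 2 * e + s * (1 / real (card (cell j))))"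
    unfolding sum_distrib_left by (intro sum_mono diag) simp
  also have "\<dots> = 2 * e * real n + s * (\<Sum>j<n. 1 / real (card (cell j)))"
    by (simp only: sum.distrib sum_constant card_lessThan sum_distrib_left mult.commute)
  also have "\<dots> \<le> 2 * e * real n + s * real (card Z)"
    using cells s_pos by simp
  finally show ?thesis .
qed

end

lemma matern_kernel_le:
  assumes "real CARD('d) / 2 < \<alpha>"
  shows "matern_kernel \<alpha> (x :: real ^ 'd) y \<le> matern_kernel \<alpha> 0 (0 :: real ^ 'd)"
  unfolding matern_kernel_cos(3)[OF assms]
  by (intro integral_mono matern_kernel_cos(2)[OF assms] mult_right_mono) auto

text \<open>The kernel depends on \<open>x - y\<close> only, so continuity at 0 is already uniform;
  it follows by dominated convergence from the integrable spectral density.\<close>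

lemma matern_kernel_near_diagonal:
  assumes \<alpha>: "real CARD('d) / 2 < \<alpha>" and e: "0 < e"
  obtains \<delta> where "0 < \<delta>"
    "\<And>x y :: real ^ 'd. dist x y < \<delta> \<Longrightarrow> matern_kernel \<alpha> 0 (0 :: real ^ 'd) - e \<le> matern_kernel \<alpha> x y"
proof -
  define k where "k = (\<lambda>l::real^'d. (1 + (norm l)\<^sup>2) powr (- (\<alpha> + real CARD('d) / 2)))"
  define \<rho> where "\<rho> = (\<lambda>u. LINT l|lborel. cos (l \<bullet> u) * k l)"
  have ker: "matern_kernel \<alpha> x y = \<rho> (x - y)" for x y :: "real ^ 'd"
    unfolding \<rho>_def k_def by (rule matern_kernel_cos(3)[OF \<alpha>])
  have [measurable]: "k \<in> borel_measurable borel" unfolding k_def by measurable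
  have "\<exists>\<delta>>0. \<forall>x y :: real ^ 'd. dist x y < \<delta> \<longrightarrow> matern_kernel \<alpha> 0 (0 :: real ^ 'd) - e \<le> matern_kernel \<alpha> x y"
  proof (rule ccontr)
    assume "\<not> ?thesis"
    then have "\<forall>\<delta>>0. \<exists>x y :: real ^ 'd. dist x y < \<delta> \<and> matern_kernel \<alpha> x y < matern_kernel \<alpha> 0 (0 :: real ^ 'd) - e"
      by (meson not_le)
    then have "\<forall>m. \<exists>x y :: real ^ 'd. dist x y < inverse (real (Suc m)) \<and> matern_kernel \<alpha> x y < matern_kernel \<alpha> 0 (0 :: real ^ 'd) - e"
      by (meson inverse_positive_iff_positive of_nat_0_less_iff zero_less_Suc)
    then obtain x y :: "nat \<Rightarrow> real ^ 'd" where xy: "\<And>m. dist (x m) (y m) < inverse (real (Suc m))"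
      and lt: "\<And>m. matern_kernel \<alpha> (x m) (y m) < matern_kernel \<alpha> 0 (0 :: real ^ 'd) - e" by metis
    have u: "(\<lambda>m. x m - y m) \<longlonglongrightarrow> 0"
      by (rule Lim_null_comparison[OF _ LIMSEQ_inverse_real_of_nat])
         (use xy in \<open>auto simp: dist_norm intro!: always_eventually less_imp_le\<close>)
    have "(\<lambda>m. \<rho> (x m - y m)) \<longlonglongrightarrow> \<rho> 0"
      unfolding \<rho>_def
    proof (rule integral_dominated_convergence)
      show "integrable lborel k" unfolding k_def by (rule matern_kernel_cos(1)[OF \<alpha>])
      show "AE l in lborel. (\<lambda>m. cos (l \<bullet> (x m - y m)) * k l) \<longlonglongrightarrow> cos (l \<bullet> 0) * k l"
        by (intro AE_I2 tendsto_intros u)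
      show "AE l in lborel. norm (cos (l \<bullet> (x m - y m)) * k l) \<le> k l" for m
        by (intro AE_I2) (auto simp: abs_mult k_def intro!: mult_left_le_one_le)
    qed measurable
    then have "\<rho> 0 \<le> \<rho> 0 - e"
      by (rule LIMSEQ_le_const2) (use lt less_imp_le in \<open>auto simp: ker\<close>)
    then show False using e by simp
  qed
  then show thesis using that by blast
qed

text \<open>The cube is totally bounded, so finitely many cells of small diameter serve all sample
  sizes and all designs at once. Their number is \<open>Q\<close>.\<close>

lemma trace_smoother_matern:
  assumes \<alpha>: "real CARD('d) / 2 < \<alpha>" and s: "0 < s" and e: "0 < e"
  obtains Q :: nat where
    "\<And>n (w :: nat \<Rightarrow> real ^ 'd). (\<And>i. w i \<in> unit_cube) \<Longrightarrow> psd_mat n (\<lambda>i j. matern_kernel \<alpha> (w i) (w j)) \<Longrightarrow>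
      (\<Sum>j<n. ridge.smoother n (\<lambda>i j. matern_kernel \<alpha> (w i) (w j)) s j j) \<le> e * real n + real Q"
proof -
  \<comment> \<open>The trace bound doubles the kernel tolerance and divides it by \<open>s\<close>;
    this choice leaves \<open>e\<close>.\<close>
  have e2: "0 < e * s / 2" using e s by simp
  obtain \<delta> where \<delta>: "0 < \<delta>" and near: "\<And>x y :: real ^ 'd. dist x y < \<delta> \<Longrightarrow>
      matern_kernel \<alpha> 0 (0 :: real ^ 'd) - e * s / 2 \<le> matern_kernel \<alpha> x y"
    using matern_kernel_near_diagonal[OF \<alpha> e2] by blast
  obtain Z :: "(real ^ 'd) set" where Z: "finite Z" "unit_cube \<subseteq> (\<Union>z\<in>Z. ball z (\<delta> / 2))"
    using compact_cbox[of 0 "1 :: real ^ 'd"] \<delta> unfolding compact_eq_totally_bounded by (meson half_gt_zero)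
  then have "\<forall>x\<in>unit_cube. \<exists>z\<in>Z. dist z x < \<delta> / 2" by (auto simp: subset_eq)
  then obtain c where c: "\<And>x. x \<in> unit_cube \<Longrightarrow> c x \<in> Z \<and> dist (c x) x < \<delta> / 2" by metis
  show thesis
  proof (rule that[of "card Z"])
    fix n and w :: "nat \<Rightarrow> real ^ 'd"
    assume w: "\<And>i. w i \<in> unit_cube" and psd: "psd_mat n (\<lambda>i j. matern_kernel \<alpha> (w i) (w j))"
    interpret ridge n "\<lambda>i j. matern_kernel \<alpha> (w i) (w j)" s by standard fact+
    have "s * (\<Sum>j<n. smoother j j) \<le> 2 * (e * s / 2) * real n + s * real (card Z)"
    proof (rule trace_smoother_le[OF Z(1), where g="\<lambda>i. c (w i)"])
      fix i j assume "c (w i) = c (w j)"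
      then have "dist (w i) (w j) < \<delta>"
        using c[OF w[of i]] c[OF w[of j]] dist_triangle_half_r[of "c (w i)" "w i" \<delta> "w j"] by simp
      then show "matern_kernel \<alpha> 0 (0 :: real ^ 'd) - e * s / 2 \<le> matern_kernel \<alpha> (w i) (w j)" by (rule near)
    qed (use c w matern_kernel_le[OF \<alpha>] in auto)
    also have "\<dots> = s * (e * real n + real (card Z))" by (simp add: algebra_simps)
    finally show "(\<Sum>j<n. smoother j j) \<le> e * real n + real (card Z)" using s by simp
  qed
qed

section \<open>Conditional laws of the population\<close>

text \<open>A conditional law is specified on rectangles. These generate the product sigma-algebra
  and are closed under intersection, so the joint law is the composition of the marginal law with
  the kernel, and integrals disintegrate accordingly.\<close>

lemma nn_integral_cond_law:
  assumes M: "prob_space M" and cl: "cond_law M S Z T U K" and g [measurable]: "g \<in> borel_measurable (T \<Otimes>\<^sub>M S)"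
  shows "(\<integral>\<^sup>+\<omega>. g (U \<omega>, Z \<omega>) \<partial>M) = (\<integral>\<^sup>+u. \<integral>\<^sup>+z. g (u, z) \<partial>K u \<partial>distr M T U)"
proof -
  interpret prob_space M by fact
  have [measurable]: "Z \<in> M \<rightarrow>\<^sub>M S" "U \<in> M \<rightarrow>\<^sub>M T" and K: "K \<in> T \<rightarrow>\<^sub>M prob_algebra S"
    and rect: "\<And>A B. A \<in> sets T \<Longrightarrow> B \<in> sets S \<Longrightarrow>
        emeasure M {\<omega>\<in>space M. U \<omega> \<in> A \<and> Z \<omega> \<in> B} = (\<integral>\<^sup>+u\<in>A. emeasure (K u) B \<partial>distr M T U)"
    using cl by (auto simp: cond_law_def)
  note Ks [measurable] = measurable_prob_algebraD[OF K]
  have Kset: "sets (K u) = sets S" if "u \<in> space T" for u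
    using measurable_space[OF K that] by (simp add: space_prob_algebra)
  let ?k = "\<lambda>u. distr (K u) (T \<Otimes>\<^sub>M S) (\<lambda>z. (u, z))"
  have k: "?k \<in> T \<rightarrow>\<^sub>M subprob_algebra (T \<Otimes>\<^sub>M S)"
    by (rule measurable_distr2[OF _ Ks]) (simp add: case_prod_beta')
  have k': "?k \<in> distr M T U \<rightarrow>\<^sub>M subprob_algebra (T \<Otimes>\<^sub>M S)"
    using k by simp
  have ne: "space T \<noteq> {}" using measurable_space[of U M T] not_empty by fastforce
  let ?L = "distr M (T \<Otimes>\<^sub>M S) (\<lambda>\<omega>. (U \<omega>, Z \<omega>))" and ?N = "distr M T U \<bind> ?k"
  have "?L = ?N"
  proof (rule measure_eqI_generator_eq[OF Int_stable_pair_measure_generator[of T S], where \<Omega>="space T \<times> space S" and A="\<lambda>_. space T \<times> space S"])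
    show "sets ?L = sigma_sets (space T \<times> space S) {a \<times> b |a b. a \<in> sets T \<and> b \<in> sets S}"
      by (simp add: sets_pair_measure)
    show "sets ?N = sigma_sets (space T \<times> space S) {a \<times> b |a b. a \<in> sets T \<and> b \<in> sets S}"
      using ne by (subst sets_bind[where N="T \<Otimes>\<^sub>M S"]) (auto simp: sets_pair_measure)
    fix X assume "X \<in> {a \<times> b |a b. a \<in> sets T \<and> b \<in> sets S}"
    then obtain A B where X: "X = A \<times> B" and [measurable]: "A \<in> sets T" "B \<in> sets S" by auto
    have "emeasure ?L X = emeasure M {\<omega>\<in>space M. U \<omega> \<in> A \<and> Z \<omega> \<in> B}"
      unfolding X by (subst emeasure_distr) (auto intro!: arg_cong[where f="emeasure M"])
    also have "\<dots> = (\<integral>\<^sup>+u\<in>A. emeasure (K u) B \<partial>distr M T U)" by (rule rect) fact+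
    also have "\<dots> = (\<integral>\<^sup>+u. emeasure (?k u) X \<partial>distr M T U)"
    proof (rule nn_integral_cong)
      fix u assume "u \<in> space (distr M T U)"
      then have u: "u \<in> space T" by simp
      have "Pair u \<in> K u \<rightarrow>\<^sub>M T \<Otimes>\<^sub>M S" using u Kset[OF u] by (simp cong: measurable_cong_sets)
      then have "emeasure (?k u) X = emeasure (K u) (Pair u -` X \<inter> space (K u))"
        unfolding X by (subst emeasure_distr) auto
      also have "Pair u -` X \<inter> space (K u) = (if u \<in> A then B else {})"
        using sets.sets_into_space[of B S] sets_eq_imp_space_eq[OF Kset[OF u]] unfolding X by auto
      finally show "emeasure (K u) B * indicator A u = emeasure (?k u) X" by (simp split: split_indicator)
    qed
    also have "\<dots> = emeasure ?N X"
      unfolding X using ne by (subst emeasure_bind[OF _ k']) auto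
    finally show "emeasure ?L X = emeasure ?N X" .
  next
    show "emeasure ?L (space T \<times> space S) \<noteq> \<infinity>" for i :: nat
      using prob_space.prob_space_distr[THEN prob_space.emeasure_space_1] emeasure_finite
      by (subst emeasure_distr) (auto simp: space_pair_measure)
  qed (auto dest: sets.sets_into_space)
  have "(\<integral>\<^sup>+\<omega>. g (U \<omega>, Z \<omega>) \<partial>M) = integral\<^sup>N ?L g"
    by (subst nn_integral_distr) auto
  also have "\<dots> = (\<integral>\<^sup>+u. integral\<^sup>N (?k u) g \<partial>distr M T U)"
    unfolding \<open>?L = ?N\<close> by (rule nn_integral_bind[OF g k'])
  also have "\<dots> = (\<integral>\<^sup>+u. \<integral>\<^sup>+z. g (u, z) \<partial>K u \<partial>distr M T U)"
  proof (rule nn_integral_cong)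
    fix u assume "u \<in> space (distr M T U)"
    then have u: "u \<in> space T" by simp
    have "Pair u \<in> K u \<rightarrow>\<^sub>M T \<Otimes>\<^sub>M S" using u Kset[OF u] by (simp cong: measurable_cong_sets)
    then show "integral\<^sup>N (?k u) g = (\<integral>\<^sup>+z. g (u, z) \<partial>K u)" by (subst nn_integral_distr) auto
  qed
  finally show ?thesis .
qed

lemma nn_integral_normal_law:
  assumes "0 \<le> s" and g [measurable]: "g \<in> borel_measurable borel"
  shows "(\<integral>\<^sup>+x. g x \<partial>normal_law m (s\<^sup>2)) = (\<integral>\<^sup>+z. g (m + s * z) \<partial>std_normal)"
  using assms by (simp add: normal_law_eq_distr nn_integral_distr)

lemma nn_integral_plm_law:
  assumes [measurable]: "g \<in> borel_measurable (borel \<Otimes>\<^sub>M borel)"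
  shows "(\<integral>\<^sup>+d. g d \<partial>plm_law \<beta> \<sigma>1 \<sigma>2 h m) =
    (\<integral>\<^sup>+x. \<integral>\<^sup>+y. g ((m + \<sigma>2 * x) * \<beta> + h + \<sigma>1 * y, m + \<sigma>2 * x) \<partial>std_normal \<partial>std_normal)"
proof -
  have "(\<integral>\<^sup>+d. g d \<partial>plm_law \<beta> \<sigma>1 \<sigma>2 h m) =
    (\<integral>\<^sup>+z. g ((m + \<sigma>2 * fst z) * \<beta> + h + \<sigma>1 * snd z, m + \<sigma>2 * fst z) \<partial>(std_normal \<Otimes>\<^sub>M std_normal))"
    unfolding plm_law_def by (subst nn_integral_distr) (auto simp: split_beta)
  also have "\<dots> = (\<integral>\<^sup>+x. \<integral>\<^sup>+y. g ((m + \<sigma>2 * fst (x, y)) * \<beta> + h + \<sigma>1 * snd (x, y), m + \<sigma>2 * fst (x, y)) \<partial>std_normal \<partial>std_normal)"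
    by (rule std_normal.nn_integral_fst[symmetric]) measurable
  finally show ?thesis by simp
qed

locale plm_population =
  fixes P0 :: "(real \<times> real \<times> 'w) measure" and T :: "'w measure" and \<beta> \<sigma>1 \<sigma>2 :: real and h m :: "'w \<Rightarrow> real"
  assumes P0: "prob_space P0" and sets_P0: "sets P0 = sets (borel \<Otimes>\<^sub>M (borel \<Otimes>\<^sub>M T))"
    and h_meas [measurable]: "h \<in> borel_measurable T" and m_meas [measurable]: "m \<in> borel_measurable T"
    and \<sigma>: "0 < \<sigma>1" "0 < \<sigma>2"
    and Y_law: "cond_law P0 borel obs_Y (borel \<Otimes>\<^sub>M T) (\<lambda>\<omega>. (obs_X \<omega>, obs_W \<omega>))
                  (\<lambda>(x, w). normal_law (x * \<beta> + h w) (\<sigma>1\<^sup>2))"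
    and X_law: "cond_law P0 borel obs_X T obs_W (\<lambda>w. normal_law (m w) (\<sigma>2\<^sup>2))"
begin

abbreviation "PW \<equiv> distr P0 T obs_W"

sublocale P0: prob_space P0 by (rule P0)

lemma obs_measurable [measurable]: "obs_Y \<in> borel_measurable P0" "obs_X \<in> borel_measurable P0" "obs_W \<in> P0 \<rightarrow>\<^sub>M T"
  using Y_law X_law by (auto simp: cond_law_def)

lemma prob_space_PW: "prob_space PW"
  by (rule P0.prob_space_distr) measurable

text \<open>The conditional laws of \<open>Y\<close> given \<open>(X, W)\<close> and of
  \<open>X\<close> given \<open>W\<close> are composed; an affine substitution turns both into
  standard normal integrals.\<close>

lemma joint_law:
  assumes [measurable]: "g \<in> borel_measurable (T \<Otimes>\<^sub>M (borel \<Otimes>\<^sub>M borel))"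
  shows "(\<integral>\<^sup>+\<omega>. g (obs_W \<omega>, (obs_Y \<omega>, obs_X \<omega>)) \<partial>P0) = (\<integral>\<^sup>+w. \<integral>\<^sup>+d. g (w, d) \<partial>plm_law \<beta> \<sigma>1 \<sigma>2 (h w) (m w) \<partial>PW)"
proof -
  have "(\<integral>\<^sup>+\<omega>. g (obs_W \<omega>, (obs_Y \<omega>, obs_X \<omega>)) \<partial>P0) =
    (\<integral>\<^sup>+\<omega>. (\<lambda>(u, y). g (snd u, (y, fst u))) ((obs_X \<omega>, obs_W \<omega>), obs_Y \<omega>) \<partial>P0)"
    by simp
  also have "\<dots> = (\<integral>\<^sup>+u. \<integral>\<^sup>+y. g (snd u, (y, fst u)) \<partial>(case u of (x, w) \<Rightarrow> normal_law (x * \<beta> + h w) (\<sigma>1\<^sup>2))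
      \<partial>distr P0 (borel \<Otimes>\<^sub>M T) (\<lambda>\<omega>. (obs_X \<omega>, obs_W \<omega>)))"
    by (subst nn_integral_cond_law[OF P0 Y_law]) auto
  also have "\<dots> = (\<integral>\<^sup>+u. \<integral>\<^sup>+z. g (snd u, (fst u * \<beta> + h (snd u) + \<sigma>1 * z, fst u)) \<partial>std_normal
      \<partial>distr P0 (borel \<Otimes>\<^sub>M T) (\<lambda>\<omega>. (obs_X \<omega>, obs_W \<omega>)))"
  proof (rule nn_integral_cong)
    fix u assume "u \<in> space (distr P0 (borel \<Otimes>\<^sub>M T) (\<lambda>\<omega>. (obs_X \<omega>, obs_W \<omega>)))"
    then have u: "snd u \<in> space T" by (auto simp: space_pair_measure)
    have "(\<lambda>y. g (snd u, (y, fst u))) \<in> borel_measurable borel"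
      using u by measurable
    then show "(\<integral>\<^sup>+y. g (snd u, (y, fst u)) \<partial>(case u of (x, w) \<Rightarrow> normal_law (x * \<beta> + h w) (\<sigma>1\<^sup>2))) =
      (\<integral>\<^sup>+z. g (snd u, (fst u * \<beta> + h (snd u) + \<sigma>1 * z, fst u)) \<partial>std_normal)"
      using \<sigma> by (simp add: split_beta nn_integral_normal_law)
  qed
  also have "\<dots> = (\<integral>\<^sup>+\<omega>. (\<lambda>(w, x). \<integral>\<^sup>+z. g (w, (x * \<beta> + h w + \<sigma>1 * z, x)) \<partial>std_normal) (obs_W \<omega>, obs_X \<omega>) \<partial>P0)"
    by (subst nn_integral_distr) (auto intro!: std_normal.borel_measurable_nn_integral)
  also have "\<dots> = (\<integral>\<^sup>+w. \<integral>\<^sup>+x. (\<lambda>(w, x). \<integral>\<^sup>+z. g (w, (x * \<beta> + h w + \<sigma>1 * z, x)) \<partial>std_normal) (w, x) \<partial>normal_law (m w) (\<sigma>2\<^sup>2) \<partial>PW)"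
    by (rule nn_integral_cond_law[OF P0 X_law]) measurable
  also have "\<dots> = (\<integral>\<^sup>+w. \<integral>\<^sup>+d. g (w, d) \<partial>plm_law \<beta> \<sigma>1 \<sigma>2 (h w) (m w) \<partial>PW)"
  proof (rule nn_integral_cong)
    fix w assume "w \<in> space PW"
    then have [simp]: "w \<in> space T" by simp
    have [measurable]: "(\<lambda>d. g (w, d)) \<in> borel_measurable (borel \<Otimes>\<^sub>M borel)" by measurable
    have "(\<lambda>x. \<integral>\<^sup>+z. g (w, (x * \<beta> + h w + \<sigma>1 * z, x)) \<partial>std_normal) \<in> borel_measurable borel"
      by measurable
    then show "(\<integral>\<^sup>+x. (\<lambda>(w, x). \<integral>\<^sup>+z. g (w, (x * \<beta> + h w + \<sigma>1 * z, x)) \<partial>std_normal) (w, x) \<partial>normal_law (m w) (\<sigma>2\<^sup>2)) =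
      (\<integral>\<^sup>+d. g (w, d) \<partial>plm_law \<beta> \<sigma>1 \<sigma>2 (h w) (m w))"
      using \<sigma> by (simp add: nn_integral_normal_law nn_integral_plm_law)
  qed
  finally show ?thesis .
qed

lemma plm_law_emeasure_measurable:
  assumes [measurable]: "B \<in> sets (borel \<Otimes>\<^sub>M borel)"
  shows "(\<lambda>w. emeasure (plm_law \<beta> \<sigma>1 \<sigma>2 (h w) (m w)) B) \<in> borel_measurable T"
proof -
  have "emeasure (plm_law \<beta> \<sigma>1 \<sigma>2 (h w) (m w)) B =
    (\<integral>\<^sup>+x. \<integral>\<^sup>+y. indicator B ((m w + \<sigma>2 * x) * \<beta> + h w + \<sigma>1 * y, m w + \<sigma>2 * x) \<partial>std_normal \<partial>std_normal)" for w
    by (subst nn_integral_plm_law[symmetric]) (auto simp: nn_integral_indicator)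
  then show ?thesis by simp
qed

text \<open>\<open>PYX\<close> is an arbitrary version. For each single event it agrees almost
  everywhere with the normal model; a countable generator closed under intersection makes the
  exceptional null set common to all events.\<close>

lemma conditional_law_unique:
  assumes YX: "cond_law P0 (borel \<Otimes>\<^sub>M borel) (\<lambda>\<omega>. (obs_Y \<omega>, obs_X \<omega>)) T obs_W PYX"
  shows "AE w in PW. PYX w = plm_law \<beta> \<sigma>1 \<sigma>2 (h w) (m w)"
proof -
  interpret PW: prob_space PW by (rule prob_space_PW)
  have K: "PYX \<in> T \<rightarrow>\<^sub>M prob_algebra (borel \<Otimes>\<^sub>M borel)" using YX by (simp add: cond_law_def)
  note Ks [measurable] = measurable_prob_algebraD[OF K]
  have AE_B: "AE w in PW. emeasure (PYX w) B = emeasure (plm_law \<beta> \<sigma>1 \<sigma>2 (h w) (m w)) B"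
    if B [measurable]: "B \<in> sets (borel \<Otimes>\<^sub>M borel)" for B
  proof (rule PW.density_unique_finite_measure)
    note [measurable] = plm_law_emeasure_measurable[OF B]
    show "(\<lambda>w. emeasure (PYX w) B) \<in> borel_measurable PW" by simp
    show "(\<lambda>w. emeasure (plm_law \<beta> \<sigma>1 \<sigma>2 (h w) (m w)) B) \<in> borel_measurable PW" by simp
    fix A assume "A \<in> sets PW"
    then have [measurable]: "A \<in> sets T" by simp
    let ?g = "\<lambda>(w, d). indicator A w * indicator B d :: ennreal"
    have "(\<integral>\<^sup>+w. emeasure (PYX w) B * indicator A w \<partial>PW) = (\<integral>\<^sup>+w. \<integral>\<^sup>+d. ?g (w, d) \<partial>PYX w \<partial>PW)"
    proof (rule nn_integral_cong)
      fix w assume "w \<in> space PW"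
      then have "sets (PYX w) = sets (borel \<Otimes>\<^sub>M borel)"
        using measurable_space[OF K, of w] by (simp add: space_prob_algebra)
      then show "emeasure (PYX w) B * indicator A w = (\<integral>\<^sup>+d. ?g (w, d) \<partial>PYX w)"
        using B by (simp add: nn_integral_cmult_indicator mult.commute)
    qed
    also have "\<dots> = (\<integral>\<^sup>+\<omega>. ?g (obs_W \<omega>, (obs_Y \<omega>, obs_X \<omega>)) \<partial>P0)"
      by (rule nn_integral_cond_law[OF P0 YX, symmetric]) measurable
    also have "\<dots> = (\<integral>\<^sup>+w. \<integral>\<^sup>+d. ?g (w, d) \<partial>plm_law \<beta> \<sigma>1 \<sigma>2 (h w) (m w) \<partial>PW)"
      by (rule joint_law) measurable
    also have "\<dots> = (\<integral>\<^sup>+w. emeasure (plm_law \<beta> \<sigma>1 \<sigma>2 (h w) (m w)) B * indicator A w \<partial>PW)"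
      using B by (intro nn_integral_cong) (simp add: nn_integral_cmult_indicator mult.commute)
    finally show "(\<integral>\<^sup>+w. emeasure (PYX w) B * indicator A w \<partial>PW) =
      (\<integral>\<^sup>+w. emeasure (plm_law \<beta> \<sigma>1 \<sigma>2 (h w) (m w)) B * indicator A w \<partial>PW)" .
  qed auto
  obtain D :: "(real \<times> real) set set" where D: "countable D" "topological_basis D"
    using ex_countable_basis by blast
  \<comment> \<open>Finite intersections of a countable base form a countable intersection-stable
    generator; the empty intersection contributes the whole space.\<close>
  define E where "E = Inter ` {F. finite F \<and> F \<subseteq> D}"
  have E: "countable E" unfolding E_def
    using D(1) by (intro countable_image countable_Collect_finite_subset)
  have Eopen: "open X" if XE: "X \<in> E" for X
  proof -
    obtain F where F: "X = \<Inter>F" "finite F" "F \<subseteq> D" using XE unfolding E_def by auto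
    have "\<forall>Y\<in>F. open Y" using F(3) topological_basis_open[OF D(2)] by blast
    with F(1,2) show ?thesis by (simp add: open_Inter)
  qed
  have DE: "D \<subseteq> E" unfolding E_def by (auto intro!: image_eqI[of _ _ "{_}"])
  have sE: "sets (borel \<Otimes>\<^sub>M borel :: (real \<times> real) measure) = sigma_sets UNIV E"
  proof -
    have "sigma_sets UNIV E = sigma_sets UNIV D"
    proof (rule sigma_sets_eqI)
      fix X assume "X \<in> D" then show "X \<in> sigma_sets UNIV E" using DE by (auto intro: sigma_sets.Basic)
    next
      fix X assume "X \<in> E"
      then have "X \<in> sets (borel :: (real \<times> real) measure)" using Eopen by simp
      then show "X \<in> sigma_sets UNIV D" using borel_eq_countable_basis[OF D] by (metis sets_measure_of top_greatest Pow_UNIV)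
    qed
    then show ?thesis
      unfolding borel_prod using borel_eq_countable_basis[OF D] by (metis sets_measure_of top_greatest Pow_UNIV)
  qed
  have "AE w in PW. \<forall>X\<in>E. emeasure (PYX w) X = emeasure (plm_law \<beta> \<sigma>1 \<sigma>2 (h w) (m w)) X"
  proof (subst AE_ball_countable[OF E], intro ballI AE_B)
    fix X assume "X \<in> E"
    then show "X \<in> sets (borel \<Otimes>\<^sub>M borel)" unfolding borel_prod using Eopen by simp
  qed
  with AE_space show ?thesis
  proof eventually_elim
    case (elim w)
    then have w: "w \<in> space T" by simp
    have sp: "sets (PYX w) = sets (borel \<Otimes>\<^sub>M borel)" "prob_space (PYX w)"
      using measurable_space[OF K w] by (simp_all add: space_prob_algebra)
    show ?case
    proof (rule measure_eqI_generator_eq[where E=E and \<Omega>=UNIV and A="\<lambda>_. UNIV"])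
      show "Int_stable E" unfolding E_def
      proof (rule Int_stableI)
        fix a b assume "a \<in> Inter ` {F. finite F \<and> F \<subseteq> D}" "b \<in> Inter ` {F. finite F \<and> F \<subseteq> D}"
        then obtain F G where "a = \<Inter>F" "b = \<Inter>G" "finite F" "F \<subseteq> D" "finite G" "G \<subseteq> D" by auto
        then show "a \<inter> b \<in> Inter ` {F. finite F \<and> F \<subseteq> D}"
          by (intro image_eqI[of _ _ "F \<union> G"]) auto
      qed
      show "range (\<lambda>_. UNIV) \<subseteq> E" unfolding E_def by (auto intro!: image_eqI[of _ _ "{}"])
      show "emeasure (PYX w) UNIV \<noteq> \<infinity>" for i :: nat
        using prob_space.emeasure_space_1[OF sp(2)] sets_eq_imp_space_eq[OF sp(1)] by (simp add: space_pair_measure)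
    qed (use elim sE sp in auto)
  qed
qed

text \<open>The regression function of \<open>Y\<close> is likewise a version. The candidate
  \<open>h + \<beta> m\<close> is integrable because it is bounded, and it has the right integrals
  over events determined by \<open>W\<close> because both noise terms have mean 0; uniqueness of
  conditional expectations concludes.\<close>

lemma regression_function_eq:
  assumes reg: "regression_function P0 obs_Y T obs_W m1"
    and bnd: "\<And>w. w \<in> space T \<Longrightarrow> \<bar>h w\<bar> \<le> B" "\<And>w. w \<in> space T \<Longrightarrow> \<bar>m w\<bar> \<le> B"
  shows "AE w in PW. m1 w = h w + \<beta> * m w"
proof -
  interpret PW: prob_space PW by (rule prob_space_PW)
  have Yi: "integrable P0 obs_Y" and m1m [measurable]: "m1 \<in> borel_measurable T"
    and m1: "AE \<omega> in P0. m1 (obs_W \<omega>) = real_cond_exp P0 (vimage_algebra (space P0) obs_W T) obs_Y \<omega>"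
    using reg by (auto simp: regression_function_def)
  let ?F = "vimage_algebra (space P0) obs_W T"
  let ?\<mu> = "\<lambda>w. h w + \<beta> * m w"
  have wsp: "obs_W \<in> space P0 \<rightarrow> space T" using measurable_space[OF obs_measurable(3)] by auto
  have subalg: "subalgebra P0 ?F"
    unfolding subalgebra_def using measurable_sets[OF obs_measurable(3)] wsp
    by (auto simp: sets_vimage_algebra2)
  interpret F: finite_measure_subalgebra P0 ?F
    by unfold_locales (rule subalg)
  let ?S = "std_normal \<Otimes>\<^sub>M std_normal"
  \<comment> \<open>Generates an observation from a design point and two independent standard normal
    variables, so that integrals of signed functions can be computed by Fubini.\<close>
  let ?\<Phi> = "\<lambda>(w, z). (w, ((m w + \<sigma>2 * fst z) * \<beta> + h w + \<sigma>1 * snd z, m w + \<sigma>2 * fst z))"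
  interpret S: pair_prob_space PW ?S
    by (simp add: pair_prob_space_def pair_sigma_finite_def prob_space_PW std_normal2.P.prob_space_axioms prob_space_imp_sigma_finite)
  have \<Phi> [measurable]: "?\<Phi> \<in> PW \<Otimes>\<^sub>M ?S \<rightarrow>\<^sub>M T \<Otimes>\<^sub>M (borel \<Otimes>\<^sub>M borel)" by measurable
  have obsm: "(\<lambda>\<omega>. (obs_W \<omega>, (obs_Y \<omega>, obs_X \<omega>))) \<in> P0 \<rightarrow>\<^sub>M T \<Otimes>\<^sub>M (borel \<Otimes>\<^sub>M borel)"
    by (intro measurable_Pair obs_measurable)
  have eq: "distr P0 (T \<Otimes>\<^sub>M (borel \<Otimes>\<^sub>M borel)) (\<lambda>\<omega>. (obs_W \<omega>, (obs_Y \<omega>, obs_X \<omega>))) = distr (PW \<Otimes>\<^sub>M ?S) (T \<Otimes>\<^sub>M (borel \<Otimes>\<^sub>M borel)) ?\<Phi>"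
    (is "?A = ?B")
  proof (rule measure_eqI)
    fix X assume "X \<in> sets ?A"
    then have X [measurable]: "X \<in> sets (T \<Otimes>\<^sub>M (borel \<Otimes>\<^sub>M borel))" by simp
    have "emeasure ?A X = (\<integral>\<^sup>+p. indicator X p \<partial>?A)" by simp
    also have "\<dots> = (\<integral>\<^sup>+\<omega>. indicator X (obs_W \<omega>, (obs_Y \<omega>, obs_X \<omega>)) \<partial>P0)"
      by (rule nn_integral_distr[OF obsm]) (rule borel_measurable_indicator, unfold sets_distr, rule X)
    also have "\<dots> = (\<integral>\<^sup>+w. \<integral>\<^sup>+d. indicator X (w, d) \<partial>plm_law \<beta> \<sigma>1 \<sigma>2 (h w) (m w) \<partial>PW)"
      by (rule joint_law) measurable
    also have "\<dots> = (\<integral>\<^sup>+w. \<integral>\<^sup>+z. indicator X (?\<Phi> (w, z)) \<partial>?S \<partial>PW)"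
    proof (rule nn_integral_cong)
      fix w assume "w \<in> space PW"
      then have w: "w \<in> space T" by simp
      have Xw: "(\<lambda>d. indicator X (w, d) :: ennreal) \<in> borel_measurable (borel \<Otimes>\<^sub>M borel)"
        by (rule measurable_compose[OF measurable_Pair1'[OF w] borel_measurable_indicator[OF X]])
      have "(\<integral>\<^sup>+d. indicator X (w, d) \<partial>plm_law \<beta> \<sigma>1 \<sigma>2 (h w) (m w)) =
        (\<integral>\<^sup>+z. indicator X (w, (case z of (x, y) \<Rightarrow> ((m w + \<sigma>2 * x) * \<beta> + h w + \<sigma>1 * y, m w + \<sigma>2 * x))) \<partial>?S)"
        unfolding plm_law_def by (rule nn_integral_distr[OF plm_law_map_measurable]) (simp only: measurable_distr_eq1 Xw)
      then show "(\<integral>\<^sup>+d. indicator X (w, d) \<partial>plm_law \<beta> \<sigma>1 \<sigma>2 (h w) (m w)) = (\<integral>\<^sup>+z. indicator X (?\<Phi> (w, z)) \<partial>?S)"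
        by (simp only: split_beta fst_conv snd_conv)
    qed
    also have "\<dots> = (\<integral>\<^sup>+p. indicator X (?\<Phi> p) \<partial>(PW \<Otimes>\<^sub>M ?S))"
      by (rule std_normal2.P.nn_integral_fst) measurable
    also have "\<dots> = (\<integral>\<^sup>+p. indicator X p \<partial>?B)"
      by (rule nn_integral_distr[OF \<Phi>, symmetric]) (rule borel_measurable_indicator, unfold sets_distr, rule X)
    also have "\<dots> = emeasure ?B X" by simp
    finally show "emeasure ?A X = emeasure ?B X" .
  qed simp
  have \<mu>i: "integrable P0 (\<lambda>\<omega>. ?\<mu> (obs_W \<omega>))"
  proof (rule P0.integrable_const_bound[where B="B + \<bar>\<beta>\<bar> * B"])
    show "AE \<omega> in P0. norm (?\<mu> (obs_W \<omega>)) \<le> B + \<bar>\<beta>\<bar> * B"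
    proof (rule AE_I2)
      fix \<omega> assume "\<omega> \<in> space P0"
      then have "obs_W \<omega> \<in> space T" using wsp by auto
      note b = bnd(1)[OF this] bnd(2)[OF this]
      have "\<bar>\<beta> * m (obs_W \<omega>)\<bar> \<le> \<bar>\<beta>\<bar> * B" unfolding abs_mult using b by (intro mult_left_mono) auto
      with b show "norm (?\<mu> (obs_W \<omega>)) \<le> B + \<bar>\<beta>\<bar> * B" by simp
    qed
  qed (intro borel_measurable_add borel_measurable_times borel_measurable_const
      measurable_compose[OF obs_measurable(3) h_meas] measurable_compose[OF obs_measurable(3) m_meas])
  have "AE \<omega> in P0. real_cond_exp P0 ?F obs_Y \<omega> = ?\<mu> (obs_W \<omega>)"
  proof (rule F.real_cond_exp_charact[OF _ Yi \<mu>i])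
    show "(\<lambda>\<omega>. ?\<mu> (obs_W \<omega>)) \<in> borel_measurable ?F"
      by (rule measurable_compose[OF measurable_vimage_algebra1[OF wsp], of ?\<mu>]) simp
    fix A assume "A \<in> sets ?F"
    then obtain C where C [measurable]: "C \<in> sets T" and A: "A = obs_W -` C \<inter> space P0"
      using wsp by (auto simp: sets_vimage_algebra2)
    have ind: "indicator A \<omega> = (indicator C (obs_W \<omega>) :: real)" if "\<omega> \<in> space P0" for \<omega>
      using that by (simp add: A indicator_def)
    let ?G = "\<lambda>p. indicator C (fst p) * fst (snd p) :: real"
    have "integrable ?A ?G"
    proof (subst integrable_distr_eq[OF obsm])
      have "integrable P0 (\<lambda>\<omega>. indicator A \<omega> *\<^sub>R obs_Y \<omega>)"
        using Yi by (intro integrable_mult_indicator) (simp_all only: A measurable_sets[OF obs_measurable(3) C])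
      then show "integrable P0 (\<lambda>\<omega>. indicator C (fst (obs_W \<omega>, obs_Y \<omega>, obs_X \<omega>)) * fst (snd (obs_W \<omega>, obs_Y \<omega>, obs_X \<omega>)))"
        by (rule Bochner_Integration.integrable_cong[THEN iffD1, rotated 2]) (auto simp: ind)
    qed measurable
    then have Gi: "integrable (PW \<Otimes>\<^sub>M ?S) (\<lambda>p. ?G (?\<Phi> p))"
      unfolding eq by (subst (asm) integrable_distr_eq) auto
    have inner: "(LINT z|?S. ?G (?\<Phi> (w, z))) = indicator C w * ?\<mu> w" for w
    proof -
      have z1: "integrable ?S (\<lambda>z. fst z)" "(LINT z|?S. fst z) = 0"
        and z2: "integrable ?S (\<lambda>z. snd z)" "(LINT z|?S. snd z) = 0"
      proof -
        show "integrable ?S (\<lambda>z. fst z)" "(LINT z|?S. fst z) = 0" "integrable ?S (\<lambda>z. snd z)" "(LINT z|?S. snd z) = 0"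
          using plm_law_moment[of 0 0 1 0 0 1 0] plm_law_moment[of 0 1 0 0 0 0 1]
          by (simp_all add: plm_law_def integrable_distr_eq integral_distr split_beta std_moment_simps)
      qed
      have "(LINT z|?S. ?G (?\<Phi> (w, z))) = (LINT z|?S. indicator C w * (?\<mu> w + (\<sigma>2 * \<beta>) * fst z + \<sigma>1 * snd z))"
        by (simp add: algebra_simps)
      also have "\<dots> = indicator C w * (?\<mu> w + (\<sigma>2 * \<beta>) * 0 + \<sigma>1 * 0)"
        using z1 z2 by (simp add: std_normal2.P.prob_space[simplified])
      finally show ?thesis by simp
    qed
    have "(\<integral>\<omega>\<in>A. obs_Y \<omega> \<partial>P0) = (LINT \<omega>|P0. ?G (obs_W \<omega>, (obs_Y \<omega>, obs_X \<omega>)))"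
      unfolding set_lebesgue_integral_def by (intro Bochner_Integration.integral_cong) (auto simp: ind)
    also have "\<dots> = integral\<^sup>L ?A ?G" by (rule integral_distr[OF obsm, symmetric]) measurable
    also have "\<dots> = (LINT p|(PW \<Otimes>\<^sub>M ?S). ?G (?\<Phi> p))" unfolding eq by (rule integral_distr[OF \<Phi>]) measurable
    also have "\<dots> = (LINT w|PW. LINT z|?S. ?G (?\<Phi> (w, z)))"
      by (rule S.integral_fst'[symmetric, OF Gi])
    also have "\<dots> = (LINT w|PW. indicator C w * ?\<mu> w)" unfolding inner ..
    also have "\<dots> = (LINT \<omega>|P0. indicator C (obs_W \<omega>) * ?\<mu> (obs_W \<omega>))"
      by (rule integral_distr[OF obs_measurable(3)]) measurable
    also have "\<dots> = (\<integral>\<omega>\<in>A. ?\<mu> (obs_W \<omega>) \<partial>P0)"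
      unfolding set_lebesgue_integral_def by (intro Bochner_Integration.integral_cong) (auto simp: ind)
    finally show "(\<integral>\<omega>\<in>A. obs_Y \<omega> \<partial>P0) = (\<integral>\<omega>\<in>A. ?\<mu> (obs_W \<omega>) \<partial>P0)" .
  qed
  with m1 have *: "AE \<omega> in P0. m1 (obs_W \<omega>) = ?\<mu> (obs_W \<omega>)" by eventually_elim simp
  have "{w \<in> space T. m1 w = ?\<mu> w} \<in> sets T"
    by (rule borel_measurable_eq[OF m1m])
       (intro borel_measurable_add borel_measurable_times borel_measurable_const h_meas m_meas)
  from AE_distr_iff[OF obs_measurable(3) this, THEN iffD2, OF *] show ?thesis .
qed

end

section \<open>Asymptotic normality\<close>

text \<open>Let \<open>s = \<alpha> + real CARD('d) / 2\<close> and
  \<open>\<delta> = real n powr (- (1 / (2 * s)))\<close>. The approximation error is of order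
  \<open>n * \<delta> powr (2 * \<alpha>0) = n powr (1 - \<alpha>0 / s)\<close>, and the squared
  norm is of order \<open>n powr \<kappa>\<close> with \<open>\<kappa>\<close> the positive part of
  the same exponent. Both are \<open>o(sqrt n)\<close> since \<open>\<alpha>0 > s / 2\<close>, which
  is the rate assumption.\<close>

lemma matern_quadratic_form_small:
  fixes f :: "real ^ 'd \<Rightarrow> real"
  assumes f: "f \<in> hoelder_space \<alpha>0 \<inter> sobolev_space \<alpha>0" and \<alpha>0: "0 < \<alpha>0" and \<alpha>: "real CARD('d) / 2 < \<alpha>"
    and rate: "\<alpha> / 2 + real CARD('d) / 4 < \<alpha>0" and s0: "0 < s0" and e: "0 < e"
  obtains n0 :: nat where
    "\<And>n w. n0 \<le> n \<Longrightarrow> (\<And>i. w i \<in> unit_cube) \<Longrightarrow> psd_mat n (\<lambda>i j. matern_kernel \<alpha> (w i) (w j)) \<Longrightarrow>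
       s0 * dotp n (\<lambda>i. f (w i)) (ridge_app n (\<lambda>i j. matern_kernel \<alpha> (w i) (w j)) s0 (\<lambda>i. f (w i))) \<le> e * sqrt (real n)"
proof -
  define s where "s = \<alpha> + real CARD('d) / 2"
  have s: "0 < s" using \<alpha> by (simp add: s_def add_pos_nonneg divide_nonneg_nonneg less_le_trans)
  define x where "x = max 0 (s - \<alpha>0)"
  define \<kappa> where "\<kappa> = max 0 (1 - \<alpha>0 / s)"
  have \<kappa>: "x / s = \<kappa>" using s by (auto simp: x_def \<kappa>_def max_def field_simps)
  have "s / 2 < \<alpha>0" using rate by (simp add: s_def)
  then have "1 - \<alpha>0 / s < 1 / 2" using s by (simp add: field_simps)
  then have \<kappa>2: "\<kappa> - 1 / 2 < 0" unfolding \<kappa>_def by linarith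
  obtain C \<delta>0 where C: "0 \<le> C" and \<delta>0: "0 < \<delta>0" and approx:
    "\<And>\<delta>. 0 < \<delta> \<Longrightarrow> \<delta> \<le> \<delta>0 \<Longrightarrow> \<exists>h. (\<forall>x\<in>unit_cube. \<bar>f x - h x\<bar> \<le> C * \<delta> powr \<alpha>0) \<and>
      (\<forall>n w b. \<bar>dotp n b (\<lambda>j. h (w j))\<bar> \<le>
         C * \<delta> powr (- x) * sqrt (dotp n b (mat_app n (\<lambda>i j. matern_kernel \<alpha> (w i) (w j)) b)))"
    using rkhs_approximation[OF f \<alpha>0 \<alpha>] unfolding x_def s_def by metis
  define A where "A = s0 * (C\<^sup>2 / s0 + C\<^sup>2)"
  have "(\<lambda>n. A * real n powr (\<kappa> - 1 / 2)) \<longlonglongrightarrow> A * 0"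
    by (intro tendsto_intros tendsto_neg_powr[OF \<kappa>2 filterlim_real_sequentially])
  then have "(\<lambda>n. A * real n powr (\<kappa> - 1 / 2)) \<longlonglongrightarrow> 0" by simp
  from order_tendstoD(2)[OF this e] have ev1: "\<forall>\<^sub>F n in sequentially. A * real n powr (\<kappa> - 1 / 2) < e" .
  have neg: "- (1 / (2 * s)) < 0" using s by simp
  have ev2: "\<forall>\<^sub>F n in sequentially. real n powr (- (1 / (2 * s))) < \<delta>0"
    by (rule order_tendstoD(2)[OF tendsto_neg_powr[OF neg filterlim_real_sequentially] \<delta>0])
  have "\<forall>\<^sub>F n in sequentially. A * real n powr (\<kappa> - 1 / 2) < e \<and> real n powr (- (1 / (2 * s))) < \<delta>0 \<and> 0 < n"
    using ev1 ev2 eventually_gt_at_top[of 0] by eventually_elim simp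
  then obtain n0 where n0: "\<And>n. n0 \<le> n \<Longrightarrow> A * real n powr (\<kappa> - 1 / 2) < e \<and> real n powr (- (1 / (2 * s))) < \<delta>0 \<and> 0 < n"
    unfolding eventually_sequentially by blast
  show thesis
  proof (rule that[of n0])
    fix n :: nat and w :: "nat \<Rightarrow> real ^ 'd"
    assume n: "n0 \<le> n" and w: "\<And>i. w i \<in> unit_cube" and psd: "psd_mat n (\<lambda>i j. matern_kernel \<alpha> (w i) (w j))"
    interpret ridge n "\<lambda>i j. matern_kernel \<alpha> (w i) (w j)" s0 by standard fact+
    define \<delta> where "\<delta> = real n powr (- (1 / (2 * s)))"
    have npos: "0 < real n" using n0[OF n] by simp
    have \<delta>: "0 < \<delta>" "\<delta> \<le> \<delta>0" using n0[OF n] npos by (auto simp: \<delta>_def)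
    obtain h where h1: "\<And>x. x \<in> unit_cube \<Longrightarrow> \<bar>f x - h x\<bar> \<le> C * \<delta> powr \<alpha>0"
      and h2: "\<And>n w b. \<bar>dotp n b (\<lambda>j. h (w j))\<bar> \<le> C * \<delta> powr (- x) * sqrt (dotp n b (mat_app n (\<lambda>i j. matern_kernel \<alpha> (w i) (w j)) b))"
      using approx[OF \<delta>] by blast
    have "dotp n (\<lambda>i. f (w i)) (ridge_app n (\<lambda>i j. matern_kernel \<alpha> (w i) (w j)) s0 (\<lambda>i. f (w i)))
      \<le> dotp n (\<lambda>i. f (w i) - h (w i)) (\<lambda>i. f (w i) - h (w i)) / s0 + (C * \<delta> powr (- x))\<^sup>2"
      by (rule quad_le_approx) (use h2[of n _ w] C in auto)
    also have "\<dots> \<le> (real n * (C * \<delta> powr \<alpha>0)\<^sup>2) / s0 + (C * \<delta> powr (- x))\<^sup>2"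
    proof (intro add_right_mono divide_right_mono)
      have "dotp n (\<lambda>i. f (w i) - h (w i)) (\<lambda>i. f (w i) - h (w i)) \<le> (\<Sum>i<n. (C * \<delta> powr \<alpha>0)\<^sup>2)"
        unfolding dotp_def
      proof (rule sum_mono)
        fix i
        have "\<bar>f (w i) - h (w i)\<bar>\<^sup>2 \<le> (C * \<delta> powr \<alpha>0)\<^sup>2" using h1[OF w[of i]] by (intro power_mono) auto
        then show "(f (w i) - h (w i)) * (f (w i) - h (w i)) \<le> (C * \<delta> powr \<alpha>0)\<^sup>2" by (simp add: power2_eq_square)
      qed
      then show "dotp n (\<lambda>i. f (w i) - h (w i)) (\<lambda>i. f (w i) - h (w i)) \<le> real n * (C * \<delta> powr \<alpha>0)\<^sup>2" by simp
    qed (use s0 in simp)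
    also have "\<dots> \<le> (C\<^sup>2 / s0 + C\<^sup>2) * real n powr \<kappa>"
    proof -
      have pw: "(\<delta> powr t)\<^sup>2 = real n powr (- t / s)" for t
      proof -
        have "(\<delta> powr t)\<^sup>2 = \<delta> powr t * \<delta> powr t" by (simp add: power2_eq_square)
        also have "\<dots> = real n powr (- (1 / (2 * s)) * (t + t))" by (simp only: \<delta>_def powr_add[symmetric] powr_powr distrib_left)
        also have "- (1 / (2 * s)) * (t + t) = - t / s" using s by (simp add: field_simps)
        finally show ?thesis .
      qed
      have "real n * (\<delta> powr \<alpha>0)\<^sup>2 = real n powr (1 - \<alpha>0 / s)"
        unfolding pw using npos by (simp add: powr_diff powr_minus field_simps)
      also have "\<dots> \<le> real n powr \<kappa>" using npos by (intro powr_mono) (auto simp: \<kappa>_def)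
      finally have "C\<^sup>2 / s0 * (real n * (\<delta> powr \<alpha>0)\<^sup>2) \<le> C\<^sup>2 / s0 * real n powr \<kappa>" using s0 by (intro mult_left_mono) auto
      moreover have "(\<delta> powr (- x))\<^sup>2 = real n powr \<kappa>" unfolding pw using \<kappa> by simp
      ultimately show ?thesis by (simp add: power_mult_distrib algebra_simps)
    qed
    finally have "s0 * dotp n (\<lambda>i. f (w i)) (ridge_app n (\<lambda>i j. matern_kernel \<alpha> (w i) (w j)) s0 (\<lambda>i. f (w i)))
        \<le> s0 * ((C\<^sup>2 / s0 + C\<^sup>2) * real n powr \<kappa>)" using s0 by (intro mult_left_mono) auto
    also have "\<dots> = (A * real n powr (\<kappa> - 1 / 2)) * sqrt (real n)"
      using npos by (simp add: A_def powr_diff powr_half_sqrt)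
    also have "\<dots> \<le> e * sqrt (real n)"
      using n0[OF n] by (intro mult_right_mono) auto
    finally show "s0 * dotp n (\<lambda>i. f (w i)) (ridge_app n (\<lambda>i j. matern_kernel \<alpha> (w i) (w j)) s0 (\<lambda>i. f (w i))) \<le> e * sqrt (real n)" .
  qed
qed

lemma (in prob_space) second_moment_tail:
  assumes "random_variable borel f" "integrable M (\<lambda>x. (f x)\<^sup>2)" "expectation (\<lambda>x. (f x)\<^sup>2) \<le> c" "0 < t"
  shows "{x \<in> space M. t \<le> \<bar>f x\<bar>} \<in> events" "prob {x \<in> space M. t \<le> \<bar>f x\<bar>} \<le> c / t\<^sup>2"
proof -
  note [measurable] = assms(1)
  show "{x \<in> space M. t \<le> \<bar>f x\<bar>} \<in> events" by measurable
  have "prob {x \<in> space M. t \<le> \<bar>f x\<bar>} \<le> expectation (\<lambda>x. (f x)\<^sup>2) / t\<^sup>2"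
    using second_moment_method[OF assms(1,2,4)] .
  also have "\<dots> \<le> c / t\<^sup>2" using assms by (intro divide_right_mono) auto
  finally show "prob {x \<in> space M. t \<le> \<bar>f x\<bar>} \<le> c / t\<^sup>2" .
qed

section \<open>Deviation bounds for a fixed design\<close>

locale plm_design = plm_sample \<beta> \<sigma>1 \<sigma>2 h m n + gaussian_vector M n "\<lambda>i f. f (w i)" K
  for \<beta> \<sigma>1 \<sigma>2 :: real and h m :: "nat \<Rightarrow> real" and n :: nat
    and M :: "('w \<Rightarrow> real) measure" and w :: "nat \<Rightarrow> 'w" and K :: "nat \<Rightarrow> nat \<Rightarrow> real" +
  assumes \<sigma>: "0 < \<sigma>1" "0 < \<sigma>2" and n: "0 < n"
begin

sublocale ridge n K "\<sigma>1\<^sup>2"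
  by unfold_locales (use K \<sigma> in auto)

abbreviation "A \<equiv> ridge_app n K (\<sigma>1\<^sup>2)"

text \<open>The forms \<open>m' R m\<close> and \<open>h' R h\<close> of the overview, with
  \<open>h\<close> the vector of values of \<open>\<eta>\<^sub>0\<close>.\<close>

definition "rough_m = \<sigma>1\<^sup>2 * dotp n m (A m)"
definition "rough_h = \<sigma>1\<^sup>2 * dotp n h (A h)"
definition "smoother_trace = (\<Sum>j<n. smoother j j)"

lemma residual_norm_le: "dotp n (\<lambda>i. \<sigma>1\<^sup>2 * A f i) (\<lambda>i. \<sigma>1\<^sup>2 * A f i) \<le> \<sigma>1\<^sup>2 * dotp n f (A f)"
proof -
  have "dotp n (\<lambda>i. \<sigma>1\<^sup>2 * A f i) (\<lambda>i. \<sigma>1\<^sup>2 * A f i) = \<sigma>1\<^sup>2 * (\<sigma>1\<^sup>2 * dotp n (A f) (A f))"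
    by (simp add: dotp_simps)
  also have "\<dots> \<le> \<sigma>1\<^sup>2 * dotp n f (A f)" using quad_ge_app[of f] by (intro mult_left_mono) auto
  finally show ?thesis .
qed

text \<open>The excess of \<open>X' R X\<close> over \<open>v' v\<close>, obtained by inserting
  \<open>X = m + v\<close> and \<open>R = I - S\<close>.\<close>

definition D1 :: "(nat \<Rightarrow> real \<times> real) \<Rightarrow> real" where
  "D1 d = rough_m + 2 * dotp n (\<lambda>i. \<sigma>1\<^sup>2 * A m i) (v d) - dotp n (v d) (mat_app n smoother (v d))"

text \<open>The excess of \<open>X' R (Y - \<beta> X)\<close> over \<open>v' e\<close>, obtained by
  inserting \<open>Y - \<beta> X = h + e\<close>. The first term is deterministic: it is the
  bias.\<close>

definition D2 :: "(nat \<Rightarrow> real \<times> real) \<Rightarrow> real" where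
  "D2 d = \<sigma>1\<^sup>2 * dotp n m (A h) + dotp n (\<lambda>i. \<sigma>1\<^sup>2 * A m i) (e d) + dotp n (\<lambda>i. \<sigma>1\<^sup>2 * A h i) (v d)
     - dotp n (v d) (mat_app n smoother (e d))"

lemma posterior_precision:
  "\<sigma>1\<^sup>2 * dotp n (A (\<lambda>i. snd (d i))) (\<lambda>i. snd (d i)) = dotp n (v d) (v d) + D1 d"
proof -
  have X: "(\<lambda>i. snd (d i)) = (\<lambda>i. m i + v d i)" by (simp add: v_def)
  have AX: "A (\<lambda>i. m i + v d i) = (\<lambda>i. A m i + A (v d) i)" by (simp add: mat_app_add fun_eq_iff)
  have sw: "dotp n (A m) (v d) = dotp n m (A (v d))" "dotp n (A (v d)) m = dotp n m (A (v d))"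
    "dotp n (A m) m = dotp n m (A m)" "dotp n (A (v d)) (v d) = dotp n (v d) (A (v d))"
    using app_sym[of m "v d"] by (simp_all add: dotp_commute)
  show ?thesis
    unfolding X AX D1_def rough_m_def dotp_smoother_app dotp_add_left dotp_add_right dotp_scale_left sw
    by (simp add: algebra_simps)
qed

lemma posterior_center:
  "\<sigma>1\<^sup>2 * (dotp n (A (\<lambda>i. snd (d i))) (\<lambda>i. fst (d i)) - \<beta> * dotp n (A (\<lambda>i. snd (d i))) (\<lambda>i. snd (d i))) =
    dotp n (v d) (e d) + D2 d"
proof -
  have X: "(\<lambda>i. snd (d i)) = (\<lambda>i. m i + v d i)" by (simp add: v_def)
  have Y: "(\<lambda>i. fst (d i)) = (\<lambda>i. \<beta> * (m i + v d i) + (h i + e d i))" by (simp add: v_def e_def fun_eq_iff algebra_simps)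
  have AX: "A (\<lambda>i. m i + v d i) = (\<lambda>i. A m i + A (v d) i)" by (simp add: mat_app_add fun_eq_iff)
  have sw: "dotp n (A (v d)) h = dotp n (A h) (v d)" "dotp n (A m) h = dotp n m (A h)"
    "dotp n (A (v d)) (e d) = dotp n (v d) (A (e d))"
    using app_sym[of "v d" h] app_sym[of m h] app_sym[of "v d" "e d"] by (simp_all add: dotp_commute)
  show ?thesis
    unfolding X Y AX D2_def dotp_smoother_app dotp_add_left dotp_add_right dotp_scale_left dotp_scale_right sw
    by (simp add: algebra_simps)
qed

lemma bias_le: "\<bar>\<sigma>1\<^sup>2 * dotp n m (A h)\<bar> \<le> sqrt (rough_m * rough_h)"
proof -
  have "(\<sigma>1\<^sup>2 * dotp n m (A h))\<^sup>2 \<le> rough_m * rough_h"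
    using mult_left_mono[OF app_Cauchy_Schwarz[of m h] zero_le_power2[of "\<sigma>1\<^sup>2"]]
    by (simp add: rough_m_def rough_h_def power_mult_distrib power2_eq_square mult_ac)
  then have "sqrt ((\<sigma>1\<^sup>2 * dotp n m (A h))\<^sup>2) \<le> sqrt (rough_m * rough_h)" by (rule real_sqrt_le_mono)
  then show ?thesis by simp
qed

lemma e_v_dotp_measurable [measurable]:
  "(\<lambda>d. dotp n a (v d)) \<in> borel_measurable law" "(\<lambda>d. dotp n a (e d)) \<in> borel_measurable law"
  "(\<lambda>d. dotp n (v d) (mat_app n S (v d))) \<in> borel_measurable law"
  "(\<lambda>d. dotp n (v d) (mat_app n S (e d))) \<in> borel_measurable law"
  "(\<lambda>d. dotp n (v d) (v d)) \<in> borel_measurable law" "(\<lambda>d. dotp n (v d) (e d)) \<in> borel_measurable law"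
  unfolding dotp_def mat_app_def
  by (auto intro!: borel_measurable_sum borel_measurable_times)

text \<open>The first two events control the target parameters. The others allot shares of the
  allowed deviation: thirds of \<open>t * real n\<close> to the terms of \<open>D1\<close>, whose
  linear term occurs twice, and quarters of \<open>t * sqrt (real n)\<close> to those of
  \<open>D2\<close>. The deterministic terms receive the remaining third and quarter. A list permits
  a union bound by index.\<close>

definition bad :: "real \<Rightarrow> real \<Rightarrow> (nat \<Rightarrow> real \<times> real) set list" where
  "bad L t =
    [{d \<in> space law. real n * \<sigma>2\<^sup>2 / 2 \<le> \<bar>dotp n (v d) (v d) - real n * \<sigma>2\<^sup>2\<bar>},
     {d \<in> space law. L * sqrt (real n) \<le> \<bar>dotp n (v d) (e d)\<bar>},
     {d \<in> space law. t * real n / 3 \<le> dotp n (v d) (mat_app n smoother (v d))},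
     {d \<in> space law. t * real n / 6 \<le> \<bar>dotp n (\<lambda>i. \<sigma>1\<^sup>2 * A m i) (v d)\<bar>},
     {d \<in> space law. t * sqrt (real n) / 4 \<le> \<bar>dotp n (v d) (mat_app n smoother (e d))\<bar>},
     {d \<in> space law. t * sqrt (real n) / 4 \<le> \<bar>dotp n (\<lambda>i. \<sigma>1\<^sup>2 * A m i) (e d)\<bar>},
     {d \<in> space law. t * sqrt (real n) / 4 \<le> \<bar>dotp n (\<lambda>i. \<sigma>1\<^sup>2 * A h i) (v d)\<bar>}]"

lemma bad_sets: "X \<in> set (bad L t) \<Longrightarrow> X \<in> sets law"
  unfolding bad_def list.set insert_iff empty_iff by (elim disjE FalseE) (simp_all only:, measurable)

text \<open>Markov's inequality for the form of the smoother in \<open>v\<close>, Chebyshev's for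
  the rest. The variances of the linear terms are governed by \<open>|R f|^2 \<le> f' R f\<close>,
  that of the bilinear term by the trace of \<open>S^2\<close>, which is at most the trace of
  \<open>S\<close>.\<close>

lemma bad_measure:
  assumes L: "0 < L" and t: "0 < t"
  shows "measure law (\<Union>(set (bad L t))) \<le> 8 / real n + \<sigma>1\<^sup>2 * \<sigma>2\<^sup>2 / L\<^sup>2
    + (3 * \<sigma>2\<^sup>2 / t + 16 * \<sigma>1\<^sup>2 * \<sigma>2\<^sup>2 / t\<^sup>2) * (smoother_trace / real n)
    + (36 * \<sigma>2\<^sup>2 * rough_m / (t * real n)\<^sup>2 + 16 * \<sigma>1\<^sup>2 * rough_m / (t\<^sup>2 * real n) + 16 * \<sigma>2\<^sup>2 * rough_h / (t\<^sup>2 * real n))"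
proof -
  interpret L: prob_space law by (rule prob_space_law)
  have n0: "0 < real n" "0 < sqrt (real n)" "(sqrt (real n))\<^sup>2 = real n" using n by auto
  have b1: "measure law (bad L t ! 0) \<le> 8 / real n"
  proof -
    have "measure law (bad L t ! 0) \<le> (2 * \<sigma>2 ^ 4 * real n) / (real n * \<sigma>2\<^sup>2 / 2)\<^sup>2"
      unfolding bad_def nth_Cons_0 using n0 \<sigma>
      by (intro L.second_moment_tail(2) square_sum_moment(1) eq_refl[OF square_sum_moment(2)]) auto
    also have "\<dots> = 8 / real n" using n0 \<sigma> by (simp add: field_simps power2_eq_square power4_eq_xxxx)
    finally show ?thesis .
  qed
  have b2: "measure law (bad L t ! 1) \<le> \<sigma>1\<^sup>2 * \<sigma>2\<^sup>2 / L\<^sup>2"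
  proof -
    \<comment> \<open>\<open>v' e\<close> is the bilinear form of the identity matrix, so its
      variance comes from the general formula.\<close>
    let ?I = "\<lambda>i j. of_bool (i = j) :: real"
    have id: "dotp n (v d) (e d) = dotp n (v d) (mat_app n ?I (e d))" for d
      by (rule dotp_cong) (auto simp: mat_app_def of_bool_def if_distrib[of "\<lambda>x. x * _"] cong: if_cong)
    have sq: "(\<Sum>i<n. \<Sum>j<n. (?I i j)\<^sup>2) = real n"
      by (simp add: of_bool_def if_distrib[of "\<lambda>x. x\<^sup>2"] cong: if_cong)
    have "measure law (bad L t ! 1) \<le> (\<sigma>1\<^sup>2 * \<sigma>2\<^sup>2 * real n) / (L * sqrt (real n))\<^sup>2"
    proof -
      have eq: "bad L t ! 1 = {d \<in> space law. L * sqrt (real n) \<le> \<bar>dotp n (v d) (mat_app n ?I (e d))\<bar>}"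
        by (simp add: bad_def id)
      show ?thesis unfolding eq
      proof (rule L.second_moment_tail(2))
        show "(LINT d|law. (dotp n (v d) (mat_app n ?I (e d)))\<^sup>2) \<le> \<sigma>1\<^sup>2 * \<sigma>2\<^sup>2 * real n"
          unfolding bilinear_moment(2) sq ..
      qed (use n0 t L in \<open>simp_all add: bilinear_moment(1)\<close>)
    qed
    also have "\<dots> = \<sigma>1\<^sup>2 * \<sigma>2\<^sup>2 / L\<^sup>2" using n0 by (simp add: power_mult_distrib)
    finally show ?thesis .
  qed
  have b3: "measure law (bad L t ! 2) \<le> 3 * \<sigma>2\<^sup>2 / t * (smoother_trace / real n)"
  proof -
    have "measure law (bad L t ! 2) \<le> (LINT d|law. dotp n (v d) (mat_app n smoother (v d))) / (t * real n / 3)"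
    proof -
      have "bad L t ! 2 = {d \<in> space law. t * real n / 3 \<le> dotp n (v d) (mat_app n smoother (v d))}"
        by (simp add: bad_def)
      moreover have "measure law {d \<in> space law. t * real n / 3 \<le> dotp n (v d) (mat_app n smoother (v d))}
          \<le> (LINT d|law. dotp n (v d) (mat_app n smoother (v d))) / (t * real n / 3)"
        using n0 t by (intro integral_Markov_inequality_measure[OF quadratic_moment(1), of "{}"]) (auto intro: smoother_psd)
      ultimately show ?thesis by simp
    qed
    also have "\<dots> = 3 * \<sigma>2\<^sup>2 / t * (smoother_trace / real n)" using n0 t by (simp add: quadratic_moment(2) smoother_trace_def)
    finally show ?thesis .
  qed
  have b4: "measure law (bad L t ! 3) \<le> 36 * \<sigma>2\<^sup>2 * rough_m / (t * real n)\<^sup>2"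
  proof -
    have "measure law (bad L t ! 3) \<le> (\<sigma>2\<^sup>2 * rough_m) / (t * real n / 6)\<^sup>2"
    proof -
      have eq: "bad L t ! 3 = {d \<in> space law. t * real n / 6 \<le> \<bar>dotp n (\<lambda>i. \<sigma>1\<^sup>2 * A m i) (v d)\<bar>}"
        by (simp add: bad_def)
      show ?thesis unfolding eq
      proof (rule L.second_moment_tail(2))
        show "(LINT d|law. (dotp n (\<lambda>i. \<sigma>1\<^sup>2 * A m i) (v d))\<^sup>2) \<le> \<sigma>2\<^sup>2 * rough_m" unfolding linear_v_moment(2) rough_m_def by (intro mult_left_mono residual_norm_le) simp
      qed (use n0 t L in \<open>simp_all add: linear_v_moment(1)\<close>)
    qed
    also have "\<dots> = 36 * \<sigma>2\<^sup>2 * rough_m / (t * real n)\<^sup>2" by (simp add: power_divide)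
    finally show ?thesis .
  qed
  have b5: "measure law (bad L t ! 4) \<le> 16 * \<sigma>1\<^sup>2 * \<sigma>2\<^sup>2 / t\<^sup>2 * (smoother_trace / real n)"
  proof -
    have "measure law (bad L t ! 4) \<le> (\<sigma>1\<^sup>2 * \<sigma>2\<^sup>2 * smoother_trace) / (t * sqrt (real n) / 4)\<^sup>2"
    proof -
      have eq: "bad L t ! 4 = {d \<in> space law. t * sqrt (real n) / 4 \<le> \<bar>dotp n (v d) (mat_app n smoother (e d))\<bar>}"
        by (simp add: bad_def)
      show ?thesis unfolding eq
      proof (rule L.second_moment_tail(2))
        show "(LINT d|law. (dotp n (v d) (mat_app n smoother (e d)))\<^sup>2) \<le> \<sigma>1\<^sup>2 * \<sigma>2\<^sup>2 * smoother_trace" unfolding bilinear_moment(2) smoother_trace_def by (intro mult_left_mono smoother_square_sum_le) simp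
      qed (use n0 t L in \<open>simp_all add: bilinear_moment(1)\<close>)
    qed
    also have "\<dots> = 16 * \<sigma>1\<^sup>2 * \<sigma>2\<^sup>2 / t\<^sup>2 * (smoother_trace / real n)" using n0 by (simp add: power_divide power_mult_distrib)
    finally show ?thesis .
  qed
  have b6: "measure law (bad L t ! 5) \<le> 16 * \<sigma>1\<^sup>2 * rough_m / (t\<^sup>2 * real n)"
  proof -
    have "measure law (bad L t ! 5) \<le> (\<sigma>1\<^sup>2 * rough_m) / (t * sqrt (real n) / 4)\<^sup>2"
    proof -
      have eq: "bad L t ! 5 = {d \<in> space law. t * sqrt (real n) / 4 \<le> \<bar>dotp n (\<lambda>i. \<sigma>1\<^sup>2 * A m i) (e d)\<bar>}"
        by (simp add: bad_def)
      show ?thesis unfolding eq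
      proof (rule L.second_moment_tail(2))
        show "(LINT d|law. (dotp n (\<lambda>i. \<sigma>1\<^sup>2 * A m i) (e d))\<^sup>2) \<le> \<sigma>1\<^sup>2 * rough_m" unfolding linear_e_moment(2) rough_m_def by (intro mult_left_mono residual_norm_le) simp
      qed (use n0 t L in \<open>simp_all add: linear_e_moment(1)\<close>)
    qed
    also have "\<dots> = 16 * \<sigma>1\<^sup>2 * rough_m / (t\<^sup>2 * real n)" using n0 by (simp add: power_divide power_mult_distrib)
    finally show ?thesis .
  qed
  have b7: "measure law (bad L t ! 6) \<le> 16 * \<sigma>2\<^sup>2 * rough_h / (t\<^sup>2 * real n)"
  proof -
    have "measure law (bad L t ! 6) \<le> (\<sigma>2\<^sup>2 * rough_h) / (t * sqrt (real n) / 4)\<^sup>2"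
    proof -
      have eq: "bad L t ! 6 = {d \<in> space law. t * sqrt (real n) / 4 \<le> \<bar>dotp n (\<lambda>i. \<sigma>1\<^sup>2 * A h i) (v d)\<bar>}"
        by (simp add: bad_def)
      show ?thesis unfolding eq
      proof (rule L.second_moment_tail(2))
        show "(LINT d|law. (dotp n (\<lambda>i. \<sigma>1\<^sup>2 * A h i) (v d))\<^sup>2) \<le> \<sigma>2\<^sup>2 * rough_h" unfolding linear_v_moment(2) rough_h_def by (intro mult_left_mono residual_norm_le) simp
      qed (use n0 t L in \<open>simp_all add: linear_v_moment(1)\<close>)
    qed
    also have "\<dots> = 16 * \<sigma>2\<^sup>2 * rough_h / (t\<^sup>2 * real n)" using n0 by (simp add: power_divide power_mult_distrib)
    finally show ?thesis .
  qed
  have len: "length (bad L t) = 7" by (simp add: bad_def)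
  then have un: "\<Union>(set (bad L t)) = (\<Union>i\<in>{..<7}. bad L t ! i)" by (auto simp: set_conv_nth)
  have sub: "(\<lambda>i. bad L t ! i) ` {..<7} \<subseteq> L.events"
  proof clarify
    fix i :: nat assume "i < 7"
    then show "bad L t ! i \<in> L.events" by (intro bad_sets[of _ L t] nth_mem) (simp add: len)
  qed
  have "measure law (\<Union>(set (bad L t))) \<le> (\<Sum>i<7. measure law (bad L t ! i))"
    unfolding un by (rule L.finite_measure_subadditive_finite[OF finite_lessThan sub])
  also have "\<dots> = measure law (bad L t ! 0) + measure law (bad L t ! 1) + measure law (bad L t ! 2) + measure law (bad L t ! 3)
      + measure law (bad L t ! 4) + measure law (bad L t ! 5) + measure law (bad L t ! 6)"
    by (simp add: eval_nat_numeral)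
  also have "\<dots> \<le> 8 / real n + \<sigma>1\<^sup>2 * \<sigma>2\<^sup>2 / L\<^sup>2
    + (3 * \<sigma>2\<^sup>2 / t * (smoother_trace / real n) + 16 * \<sigma>1\<^sup>2 * \<sigma>2\<^sup>2 / t\<^sup>2 * (smoother_trace / real n))
    + (36 * \<sigma>2\<^sup>2 * rough_m / (t * real n)\<^sup>2 + 16 * \<sigma>1\<^sup>2 * rough_m / (t\<^sup>2 * real n) + 16 * \<sigma>2\<^sup>2 * rough_h / (t\<^sup>2 * real n))"
    using b1 b2 b3 b4 b5 b6 b7 by linarith
  finally show ?thesis by (simp only: distrib_right)
qed

lemma good_event:
  assumes d: "d \<in> space law" "d \<notin> \<Union>(set (bad L t))" and t: "0 < t"
    and rm: "rough_m \<le> t * real n / 3" and mh: "sqrt (rough_m * rough_h) \<le> t * sqrt (real n) / 4"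
  shows "\<sigma>2\<^sup>2 / 2 * real n \<le> dotp n (v d) (v d)" "\<bar>dotp n (v d) (e d)\<bar> \<le> L * sqrt (real n)"
    "\<bar>D1 d\<bar> \<le> t * real n" "\<bar>D2 d\<bar> \<le> t * sqrt (real n)"
proof -
  have g: "\<bar>dotp n (v d) (v d) - real n * \<sigma>2\<^sup>2\<bar> < real n * \<sigma>2\<^sup>2 / 2"
    "\<bar>dotp n (v d) (e d)\<bar> < L * sqrt (real n)"
    "dotp n (v d) (mat_app n smoother (v d)) < t * real n / 3"
    "\<bar>dotp n (\<lambda>i. \<sigma>1\<^sup>2 * A m i) (v d)\<bar> < t * real n / 6"
    "\<bar>dotp n (v d) (mat_app n smoother (e d))\<bar> < t * sqrt (real n) / 4"
    "\<bar>dotp n (\<lambda>i. \<sigma>1\<^sup>2 * A m i) (e d)\<bar> < t * sqrt (real n) / 4"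
    "\<bar>dotp n (\<lambda>i. \<sigma>1\<^sup>2 * A h i) (v d)\<bar> < t * sqrt (real n) / 4"
    using d unfolding bad_def list.set Union_insert Un_iff mem_Collect_eq by (meson not_le)+
  show "\<sigma>2\<^sup>2 / 2 * real n \<le> dotp n (v d) (v d)"
  proof -
    have "real n * \<sigma>2\<^sup>2 / 2 \<le> dotp n (v d) (v d)" using g(1) by linarith
    then show ?thesis by (simp add: mult.commute)
  qed
  show "\<bar>dotp n (v d) (e d)\<bar> \<le> L * sqrt (real n)" using g(2) by simp
  have "0 \<le> dotp n (v d) (mat_app n smoother (v d))" by (rule smoother_psd)
  moreover have "0 \<le> rough_m" unfolding rough_m_def using quad_nonneg by simp
  ultimately show "\<bar>D1 d\<bar> \<le> t * real n" using g(3,4) rm unfolding D1_def by linarith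
  show "\<bar>D2 d\<bar> \<le> t * sqrt (real n)" using g(5-7) bias_le mh unfolding D2_def by linarith
qed

text \<open>At the design points \<open>m1 - \<beta> m2\<close> equals \<open>h\<close>, so the
  score is \<open>v' e\<close> and the information \<open>v' v\<close>, up to factors; all powers of
  \<open>n\<close> cancel in the centre and in the variance of the target.\<close>

lemma target_parameters:
  assumes m2: "\<And>i. i < n \<Longrightarrow> m2 (w i) = m i" and m1: "\<And>i. i < n \<Longrightarrow> m1 (w i) = h i + \<beta> * m i"
    and Q: "0 < dotp n (v d) (v d)"
  shows "\<beta> + efficient_shift \<sigma>1 \<beta> m1 m2 n d w / sqrt (real n) = \<beta> + dotp n (v d) (e d) / dotp n (v d) (v d)"
    "1 / real n * inverse (information \<sigma>1 m2 n d w) = \<sigma>1\<^sup>2 / dotp n (v d) (v d)"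
proof -
  have info: "information \<sigma>1 m2 n d w = dotp n (v d) (v d) / (real n * \<sigma>1\<^sup>2)"
    unfolding information_def dotp_def using m2
    by (simp add: v_def power_divide power2_eq_square sum_divide_distrib[symmetric])
  have sc: "score \<sigma>1 \<beta> m1 m2 n d w = dotp n (v d) (e d) / \<sigma>1\<^sup>2"
  proof -
    have "(\<Sum>i<n. (fst (d i) - m1 (w i) - (snd (d i) - m2 (w i)) * \<beta>) * (snd (d i) - m2 (w i))) = dotp n (v d) (e d)"
      unfolding dotp_def
    proof (intro sum.cong refl)
      fix i assume "i \<in> {..<n}"
      then have "i < n" by simp
      then show "(fst (d i) - m1 (w i) - (snd (d i) - m2 (w i)) * \<beta>) * (snd (d i) - m2 (w i)) = v d i * e d i"
        by (simp add: m1 m2 v_def e_def algebra_simps)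
    qed
    then show ?thesis by (simp add: score_def)
  qed
  define r where "r = sqrt (real n)"
  have r: "0 < r" "real n = r * r" using n by (simp_all add: r_def)
  have "efficient_shift \<sigma>1 \<beta> m1 m2 n d w / r = inverse (dotp n (v d) (v d) / (r * r * \<sigma>1\<^sup>2)) * (1 / r) * (dotp n (v d) (e d) / \<sigma>1\<^sup>2) / r"
    unfolding efficient_shift_def info sc unfolding r_def[symmetric] unfolding r(2) ..
  also have "\<dots> = dotp n (v d) (e d) / dotp n (v d) (v d)"
    using r(1) \<sigma> Q by (simp add: field_simps)
  finally have "efficient_shift \<sigma>1 \<beta> m1 m2 n d w / r = dotp n (v d) (e d) / dotp n (v d) (v d)" .
  then show "\<beta> + efficient_shift \<sigma>1 \<beta> m1 m2 n d w / sqrt (real n) = \<beta> + dotp n (v d) (e d) / dotp n (v d) (v d)"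
    by (simp add: r_def)
  show "1 / real n * inverse (information \<sigma>1 m2 n d w) = \<sigma>1\<^sup>2 / dotp n (v d) (v d)"
    unfolding info using n \<sigma> Q by simp
qed

text \<open>Rewrites the centre \<open>q / p\<close> and the variance \<open>1 / p\<close> as
  perturbations of the target parameters, using \<open>\<sigma>1\<^sup>2 * p = v' v + D1\<close> and
  \<open>\<sigma>1\<^sup>2 * (q - \<beta> * p) = v' e + D2\<close>.\<close>

lemma posterior_form:
  assumes B: "0 < B" and pos: "0 < dotp n (v d) (v d) + D1 d"
  defines "P \<equiv> beta_posterior \<sigma>1 (uniform_measure lborel {- B..B}) M n d w"
    and "N \<equiv> normal_law (\<beta> + (dotp n (v d) (e d) + D2 d) / (dotp n (v d) (v d) + D1 d)) (\<sigma>1\<^sup>2 / (dotp n (v d) (v d) + D1 d))"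
  shows "sets P = sets borel" "\<And>X. X \<in> sets borel \<Longrightarrow> measure P X = measure N (X \<inter> {- B..B}) / measure N {- B..B}"
proof -
  let ?a = "A (\<lambda>i. snd (d i))"
  define p where "p = dotp n ?a (\<lambda>i. snd (d i))"
  define q where "q = dotp n ?a (\<lambda>i. fst (d i))"
  have gv: "gaussian_vector M n (\<lambda>i f. f (w i)) K" by unfold_locales
  have s2: "0 < \<sigma>1\<^sup>2" using \<sigma> by simp
  have prec: "\<sigma>1\<^sup>2 * p = dotp n (v d) (v d) + D1 d" unfolding p_def by (rule posterior_precision)
  have center: "\<sigma>1\<^sup>2 * (q - \<beta> * p) = dotp n (v d) (e d) + D2 d" unfolding p_def q_def by (rule posterior_center)
  have p: "0 < p" using pos s2 unfolding prec[symmetric] by (simp add: zero_less_mult_iff)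
  have "\<beta> + (\<sigma>1\<^sup>2 * (q - \<beta> * p)) / (\<sigma>1\<^sup>2 * p) = q / p" using p s2 by (simp add: field_simps)
  then have mean: "\<beta> + (dotp n (v d) (e d) + D2 d) / (dotp n (v d) (v d) + D1 d) = q / p"
    unfolding center prec .
  have "\<sigma>1\<^sup>2 / (\<sigma>1\<^sup>2 * p) = 1 / p" using s2 by simp
  then have var: "\<sigma>1\<^sup>2 / (dotp n (v d) (v d) + D1 d) = 1 / p" unfolding prec .
  note post = beta_posterior_truncated_normal[OF gv B \<sigma>(1), of ?a d, folded p_def q_def P_def, OF app_solves p]
  show "sets P = sets borel" by (rule post(1))
  show "measure P X = measure N (X \<inter> {- B..B}) / measure N {- B..B}" if "X \<in> sets borel" for X
    unfolding N_def mean var by (rule post(2)[OF _ that])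
qed

end

lemma tv_dist_nonneg:
  assumes "\<And>A. A \<in> sets P \<Longrightarrow> measure P A \<le> 1" "\<And>A. A \<in> sets P \<Longrightarrow> measure Q A \<le> 1"
  shows "0 \<le> tv_dist P Q"
  unfolding tv_dist_def
proof (rule cSUP_upper2[where x="{}"])
  show "bdd_above ((\<lambda>A. \<bar>measure P A - measure Q A\<bar>) ` sets P)"
  proof (rule bdd_aboveI2[of _ _ 1])
    fix A assume "A \<in> sets P"
    from assms(1)[OF this] assms(2)[OF this] measure_nonneg[of P A] measure_nonneg[of Q A]
    show "\<bar>measure P A - measure Q A\<bar> \<le> 1" by linarith
  qed
qed auto

lemma tendsto_zero_ennrealI:
  fixes f :: "nat \<Rightarrow> ennreal"
  assumes "\<And>\<tau>::real. 0 < \<tau> \<Longrightarrow> \<forall>\<^sub>F n in sequentially. f n \<le> ennreal \<tau>"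
  shows "f \<longlonglongrightarrow> 0"
proof (rule order_tendstoI)
  fix a :: ennreal assume "0 < a"
  then obtain b where b: "0 < b" "b < a" using dense by blast
  then obtain \<tau> where \<tau>: "b = ennreal \<tau>" "0 \<le> \<tau>" by (cases b rule: ennreal_cases) (auto simp: top_unique)
  then have "0 < \<tau>" using b by (simp add: ennreal_less_zero_iff)
  from assms[OF this] show "\<forall>\<^sub>F n in sequentially. f n < a"
    by eventually_elim (use b \<tau> in auto)
qed (simp add: not_less_zero)

text \<open>The event of a large total variation distance is covered by measurable bad events, so
  its own measurability is not an issue.\<close>

lemma outer_measure_of_le_measure:
  assumes "finite_measure M" "B \<in> sets M" "A \<subseteq> B"
  shows "outer_measure_of M A \<le> ennreal (measure M B)"
proof -
  interpret finite_measure M by fact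
  have "outer_measure_of M A \<le> outer_measure_of M B" by (rule outer_measure_of_mono) fact
  then show ?thesis using assms(2) by (simp add: outer_measure_of_eq emeasure_eq_measure)
qed

lemma hoelder_space_regular:
  fixes f :: "real ^ 'd \<Rightarrow> real"
  assumes "f \<in> hoelder_space \<alpha>"
  shows "f \<in> borel_measurable cube_borel" "\<exists>B. \<forall>x\<in>unit_cube. \<bar>f x\<bar> \<le> B"
proof -
  have c: "continuous_on unit_cube f"
    using assms Ck_hoelder_continuous by (auto simp: hoelder_space_def)
  then show "f \<in> borel_measurable cube_borel" by (rule borel_measurable_continuous_on_restrict)
  have "bounded (f ` unit_cube)" by (intro compact_imp_bounded compact_continuous_image c compact_cbox)
  then show "\<exists>B. \<forall>x\<in>unit_cube. \<bar>f x\<bar> \<le> B" by (auto simp: bounded_iff)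
qed

text \<open>For a given error probability \<open>\<tau>\<close>, the bad events receive
  \<open>\<tau> / 4\<close> from \<open>v' e\<close>, \<open>\<tau> / 8\<close> from the linear part
  of the trace bound, and \<open>\<tau> / 4\<close> from remainders that vanish as \<open>n\<close>
  grows. Outside them the distance is at most \<open>\<epsilon>\<close>.\<close>

lemma bernstein_von_mises_fixed_design:
  fixes w :: "nat \<Rightarrow> real ^ 'd"
  assumes w: "\<And>i. w i \<in> unit_cube" and m1: "\<And>i. m01 (w i) = \<eta>0 (w i) + \<beta>0 * m02 (w i)"
    and B: "B > 0" and \<beta>0: "- B < \<beta>0" "\<beta>0 < B"
    and \<sigma>01: "\<sigma>01 > 0" and \<sigma>02: "\<sigma>02 > 0"
    and \<alpha>0\<eta>: "\<alpha>0\<eta> > 0" and \<eta>0: "\<eta>0 \<in> hoelder_space \<alpha>0\<eta> \<inter> sobolev_space \<alpha>0\<eta>"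
    and \<alpha>02: "\<alpha>02 > 0" and m02: "m02 \<in> hoelder_space \<alpha>02 \<inter> sobolev_space \<alpha>02"
    and prior: "matern_prior \<alpha>\<eta> prior\<eta>"
    and rates: "\<alpha>\<eta> > real CARD('d) / 2"
      "\<alpha>0\<eta> > \<alpha>\<eta> / 2 + real CARD('d) / 4"
      "\<alpha>02 > \<alpha>\<eta> / 2 + real CARD('d) / 4"
  shows "tendsto_zero_in_prob
             (\<lambda>n. \<Pi>\<^sub>M i\<in>{..<n}. plm_law \<beta>0 \<sigma>01 \<sigma>02 (\<eta>0 (w i)) (m02 (w i)))
             (\<lambda>n d. tv_dist
                (beta_posterior \<sigma>01 (uniform_measure lborel {- B..B}) prior\<eta> n d w)
                (normal_law
                  (\<beta>0 + efficient_shift \<sigma>01 \<beta>0 m01 m02 n d w / sqrt (real n))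
                  (1 / real n * inverse (information \<sigma>01 m02 n d w))))"
  unfolding tendsto_zero_in_prob_def
proof (intro allI impI tendsto_zero_ennrealI)
  fix \<epsilon> \<tau> :: real assume \<epsilon>: "0 < \<epsilon>" and \<tau>: "0 < \<tau>"
  let ?law = "\<lambda>n. \<Pi>\<^sub>M i\<in>{..<n}. plm_law \<beta>0 \<sigma>01 \<sigma>02 (\<eta>0 (w i)) (m02 (w i))"
  let ?K = "\<lambda>i j. matern_kernel \<alpha>\<eta> (w i) (w j)"
  have gv: "gaussian_vector prior\<eta> n (\<lambda>i f. f (w i)) ?K" for n
    using prior w by (intro gaussian_vector_of_process[of prior\<eta> unit_cube]) (simp_all add: matern_prior_def)
  have psd: "psd_mat n ?K" for n using gv by (rule gaussian_vector.K)
  have s1: "0 < \<sigma>01\<^sup>2" using \<sigma>01 by simp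
  \<comment> \<open>Makes the Chebyshev bound for \<open>v' e\<close> equal to
    \<open>\<tau> / 4\<close>.\<close>
  define L where "L = 2 * \<sigma>01 * \<sigma>02 / sqrt \<tau>"
  have L: "0 < L" "\<sigma>01\<^sup>2 * \<sigma>02\<^sup>2 / L\<^sup>2 = \<tau> / 4"
    using \<sigma>01 \<sigma>02 \<tau> by (simp_all add: L_def power_divide power_mult_distrib)
  have c: "0 < \<sigma>02\<^sup>2 / 2" using \<sigma>02 by simp
  obtain t n0 where t: "0 < t" and n0: "0 < n0" and small:
    "\<And>q u D1 D2 n P. real n \<ge> n0 \<Longrightarrow> \<sigma>02\<^sup>2 / 2 * real n \<le> q \<Longrightarrow> \<bar>u\<bar> \<le> L * sqrt (real n) \<Longrightarrow>
      \<bar>D1\<bar> \<le> t * real n \<Longrightarrow> \<bar>D2\<bar> \<le> t * sqrt (real n) \<Longrightarrow> sets P = sets borel \<Longrightarrow>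
      (\<And>A. A \<in> sets borel \<Longrightarrow> measure P A =
         measure (normal_law (\<beta>0 + (u + D2) / (q + D1)) (\<sigma>01\<^sup>2 / (q + D1))) (A \<inter> {- B..B}) /
         measure (normal_law (\<beta>0 + (u + D2) / (q + D1)) (\<sigma>01\<^sup>2 / (q + D1))) {- B..B}) \<Longrightarrow>
      tv_dist P (normal_law (\<beta>0 + u / q) (\<sigma>01\<^sup>2 / q)) \<le> \<epsilon>"
  proof (rule tv_dist_posterior_small[OF \<epsilon> c L(1) \<sigma>01 \<beta>0], goal_cases)
    case (1 d n0)
    show ?case using 1(2-) by (rule 1(1))
  qed
  \<comment> \<open>Off the bad events \<open>v' v\<close> is at least
    \<open>\<sigma>02\<^sup>2 / 2 * real n\<close>; the second bound keeps \<open>D1\<close> at half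
    of that, so the posterior precision is positive.\<close>
  define t' where "t' = min t (\<sigma>02\<^sup>2 / 4)"
  have t': "0 < t'" "t' \<le> t" "t' \<le> \<sigma>02\<^sup>2 / 4" using t \<sigma>02 by (auto simp: t'_def)
  define k1 where "k1 = 3 * \<sigma>02\<^sup>2 / t' + 16 * \<sigma>01\<^sup>2 * \<sigma>02\<^sup>2 / t'\<^sup>2"
  have k1: "0 < k1" unfolding k1_def using \<sigma>01 \<sigma>02 t'(1) by (intro add_pos_pos divide_pos_pos) auto
  define e1 where "e1 = \<tau> / (8 * k1)"
  have e1: "0 < e1" "k1 * e1 = \<tau> / 8" using \<tau> k1 by (simp_all add: e1_def)
  obtain Q :: nat where "\<And>n (w :: nat \<Rightarrow> real ^ 'd). (\<And>i. w i \<in> unit_cube) \<Longrightarrow>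
      psd_mat n (\<lambda>i j. matern_kernel \<alpha>\<eta> (w i) (w j)) \<Longrightarrow>
      (\<Sum>j<n. ridge.smoother n (\<lambda>i j. matern_kernel \<alpha>\<eta> (w i) (w j)) (\<sigma>01\<^sup>2) j j) \<le> e1 * real n + real Q"
  proof (rule trace_smoother_matern[OF rates(1) s1 e1(1)], goal_cases)
    case (1 Q)
    show ?case using 1(2-) by (rule 1(1))
  qed
  note Q = this[OF w psd]
  \<comment> \<open>The bound \<open>t' / 4\<close> serves the bias and the deterministic part of
    \<open>D1\<close>; the bound 1 leaves \<open>sqrt n\<close> in the variance terms, which are
    divided by at least \<open>n\<close>.\<close>
  define e2 where "e2 = min 1 (t' / 4)"
  have e2: "0 < e2" "e2 \<le> 1" "e2 \<le> t' / 4" using t'(1) by (auto simp: e2_def)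
  obtain n1 where "\<And>n (w :: nat \<Rightarrow> real ^ 'd). n1 \<le> n \<Longrightarrow> (\<And>i. w i \<in> unit_cube) \<Longrightarrow>
      psd_mat n (\<lambda>i j. matern_kernel \<alpha>\<eta> (w i) (w j)) \<Longrightarrow>
      \<sigma>01\<^sup>2 * dotp n (\<lambda>i. m02 (w i)) (ridge_app n (\<lambda>i j. matern_kernel \<alpha>\<eta> (w i) (w j)) (\<sigma>01\<^sup>2) (\<lambda>i. m02 (w i))) \<le> e2 * sqrt (real n)"
  proof (rule matern_quadratic_form_small[OF m02 \<alpha>02 rates(1,3) s1 e2(1)], goal_cases)
    case (1 n0)
    show ?case using 1(2-) by (rule 1(1))
  qed
  note n1 = this[OF _ w psd]
  obtain n2 where "\<And>n (w :: nat \<Rightarrow> real ^ 'd). n2 \<le> n \<Longrightarrow> (\<And>i. w i \<in> unit_cube) \<Longrightarrow>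
      psd_mat n (\<lambda>i j. matern_kernel \<alpha>\<eta> (w i) (w j)) \<Longrightarrow>
      \<sigma>01\<^sup>2 * dotp n (\<lambda>i. \<eta>0 (w i)) (ridge_app n (\<lambda>i j. matern_kernel \<alpha>\<eta> (w i) (w j)) (\<sigma>01\<^sup>2) (\<lambda>i. \<eta>0 (w i))) \<le> e2 * sqrt (real n)"
  proof (rule matern_quadratic_form_small[OF \<eta>0 \<alpha>0\<eta> rates(1,2) s1 e2(1)], goal_cases)
    case (1 n0)
    show ?case using 1(2-) by (rule 1(1))
  qed
  note n2 = this[OF _ w psd]
  define k2 where "k2 = (36 * \<sigma>02\<^sup>2 + 16 * \<sigma>01\<^sup>2 + 16 * \<sigma>02\<^sup>2) / t'\<^sup>2"
  have "(\<lambda>n. (8 + k1 * real Q) / real n + k2 / sqrt (real n)) \<longlonglongrightarrow> 0 + 0"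
  proof (intro tendsto_add)
    show "(\<lambda>n. (8 + k1 * real Q) / real n) \<longlonglongrightarrow> 0" by (rule lim_const_over_n)
    show "(\<lambda>n. k2 / sqrt (real n)) \<longlonglongrightarrow> 0"
      by (intro tendsto_divide_0[OF tendsto_const] filterlim_at_top_imp_at_infinity
          filterlim_compose[OF sqrt_at_top filterlim_real_sequentially])
  qed
  then have "(\<lambda>n. (8 + k1 * real Q) / real n + k2 / sqrt (real n)) \<longlonglongrightarrow> 0" by simp
  from order_tendstoD(2)[OF this, of "\<tau> / 4"]
  have "\<forall>\<^sub>F n in sequentially. (8 + k1 * real Q) / real n + k2 / sqrt (real n) < \<tau> / 4" using \<tau> by simp
  moreover have "\<forall>\<^sub>F n in sequentially. n0 \<le> real n"
    using filterlim_real_sequentially by (simp add: filterlim_at_top)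
  ultimately show "\<forall>\<^sub>F n in sequentially. outer_measure_of (?law n) {\<omega> \<in> space (?law n). \<epsilon> <
      \<bar>tv_dist (beta_posterior \<sigma>01 (uniform_measure lborel {- B..B}) prior\<eta> n \<omega> w)
        (normal_law (\<beta>0 + efficient_shift \<sigma>01 \<beta>0 m01 m02 n \<omega> w / sqrt (real n))
          (1 / real n * inverse (information \<sigma>01 m02 n \<omega> w)))\<bar>} \<le> ennreal \<tau>"
    using eventually_ge_at_top[of n1] eventually_ge_at_top[of n2] eventually_gt_at_top[of 0]
  proof eventually_elim
    case (elim n)
    interpret gvn: gaussian_vector prior\<eta> n "\<lambda>i f. f (w i)" ?K by (rule gv)
    interpret D: plm_design \<beta>0 \<sigma>01 \<sigma>02 "\<lambda>i. \<eta>0 (w i)" "\<lambda>i. m02 (w i)" n prior\<eta> w ?K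
      by unfold_locales (use \<sigma>01 \<sigma>02 elim in auto)
    have N: "0 < real n" "1 \<le> sqrt (real n)" "sqrt (real n) * sqrt (real n) = real n" "sqrt (real n) \<le> real n"
    proof -
      show "0 < real n" "1 \<le> sqrt (real n)" "sqrt (real n) * sqrt (real n) = real n" using elim by auto
      then show "sqrt (real n) \<le> real n" by (metis mult_left_mono mult_1_right order_trans zero_le_one)
    qed
    have rm: "D.rough_m \<le> e2 * sqrt (real n)" "0 \<le> D.rough_m"
      using n1[OF elim(3)] D.quad_nonneg by (simp_all add: D.rough_m_def)
    have rh: "D.rough_h \<le> e2 * sqrt (real n)" "0 \<le> D.rough_h"
      using n2[OF elim(4)] D.quad_nonneg by (simp_all add: D.rough_h_def)
    have "e2 * sqrt (real n) \<le> (t' / 4) * real n" using e2 N by (intro mult_mono) auto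
    moreover have "0 \<le> t' * real n" using t'(1) by simp
    ultimately have rm': "D.rough_m \<le> t' * real n / 3" using rm by linarith
    have mh: "sqrt (D.rough_m * D.rough_h) \<le> t' * sqrt (real n) / 4"
    proof -
      have "D.rough_m * D.rough_h \<le> (e2 * sqrt (real n)) * (e2 * sqrt (real n))"
        using rm rh e2 by (intro mult_mono) auto
      then have "sqrt (D.rough_m * D.rough_h) \<le> sqrt ((e2 * sqrt (real n))\<^sup>2)"
        unfolding power2_eq_square by (rule real_sqrt_le_mono)
      also have "\<dots> = e2 * sqrt (real n)" using e2 by simp
      also have "\<dots> \<le> (t' / 4) * sqrt (real n)" using e2 by (intro mult_right_mono) auto
      finally show ?thesis by simp
    qed
    have sub: "{\<omega> \<in> space (?law n). \<epsilon> <
      \<bar>tv_dist (beta_posterior \<sigma>01 (uniform_measure lborel {- B..B}) prior\<eta> n \<omega> w)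
        (normal_law (\<beta>0 + efficient_shift \<sigma>01 \<beta>0 m01 m02 n \<omega> w / sqrt (real n))
          (1 / real n * inverse (information \<sigma>01 m02 n \<omega> w)))\<bar>} \<subseteq> \<Union>(set (D.bad L t'))"
    proof (rule subsetI, rule ccontr)
      fix d assume d: "d \<in> {\<omega> \<in> space (?law n). \<epsilon> <
        \<bar>tv_dist (beta_posterior \<sigma>01 (uniform_measure lborel {- B..B}) prior\<eta> n \<omega> w)
          (normal_law (\<beta>0 + efficient_shift \<sigma>01 \<beta>0 m01 m02 n \<omega> w / sqrt (real n))
            (1 / real n * inverse (information \<sigma>01 m02 n \<omega> w)))\<bar>}" and good: "d \<notin> \<Union>(set (D.bad L t'))"
      then have dsp: "d \<in> space (?law n)" by simp
      let ?q = "dotp n (D.v d) (D.v d)" and ?u = "dotp n (D.v d) (D.e d)"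
      let ?P = "beta_posterior \<sigma>01 (uniform_measure lborel {- B..B}) prior\<eta> n d w"
      note g = D.good_event[OF dsp good t'(1) rm' mh]
      have "\<sigma>02\<^sup>2 / 2 * real n > 0" using \<sigma>02 N by simp
      then have q: "0 < ?q" using g(1) by linarith
      have "t' * real n \<le> (\<sigma>02\<^sup>2 / 4) * real n" using t' N by (intro mult_right_mono) auto
      moreover have "0 < (\<sigma>02\<^sup>2 / 4) * real n" using \<sigma>02 N by simp
      ultimately have qD: "0 < ?q + D.D1 d" using g(1,3) by linarith
      note form = D.posterior_form[OF B qD]
      have "t' * real n \<le> t * real n" "t' * sqrt (real n) \<le> t * sqrt (real n)"
        using t' by (auto intro!: mult_right_mono)
      then have g': "\<bar>D.D1 d\<bar> \<le> t * real n" "\<bar>D.D2 d\<bar> \<le> t * sqrt (real n)" using g(3,4) by linarith+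
      have "tv_dist ?P (normal_law (\<beta>0 + ?u / ?q) (\<sigma>01\<^sup>2 / ?q)) \<le> \<epsilon>"
        by (rule small[OF elim(2) g(1,2) g' form])
      moreover have "0 \<le> tv_dist ?P (normal_law (\<beta>0 + ?u / ?q) (\<sigma>01\<^sup>2 / ?q))"
      proof (rule tv_dist_nonneg)
        fix X assume "X \<in> sets ?P"
        then have X: "X \<in> sets borel" using form(1) by simp
        let ?N = "normal_law (\<beta>0 + (?u + D.D2 d) / (?q + D.D1 d)) (\<sigma>01\<^sup>2 / (?q + D.D1 d))"
        interpret N: prob_space ?N using qD by (intro prob_space_normal_law) simp
        have "measure ?N (X \<inter> {- B..B}) \<le> measure ?N {- B..B}"
          using X by (intro N.finite_measure_mono) auto
        then show "measure ?P X \<le> 1"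
          unfolding form(2)[OF X] by (simp add: divide_le_eq_1 measure_nonneg zero_less_measure_iff)
        show "measure (normal_law (\<beta>0 + ?u / ?q) (\<sigma>01\<^sup>2 / ?q)) X \<le> 1"
          using q by (intro prob_space.prob_le_1 prob_space_normal_law) simp
      qed
      ultimately show False
        using d D.target_parameters[of m02 m01, OF refl m1 q] by simp
    qed
    have "measure (?law n) (\<Union>(set (D.bad L t'))) \<le> 8 / real n + \<tau> / 4
      + k1 * (D.smoother_trace / real n)
      + (36 * \<sigma>02\<^sup>2 * D.rough_m / (t' * real n)\<^sup>2 + 16 * \<sigma>01\<^sup>2 * D.rough_m / (t'\<^sup>2 * real n) + 16 * \<sigma>02\<^sup>2 * D.rough_h / (t'\<^sup>2 * real n))"
      using D.bad_measure[OF L(1) t'(1)] unfolding L(2) k1_def .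
    also have "\<dots> \<le> 8 / real n + \<tau> / 4 + (\<tau> / 8 + k1 * real Q / real n) + k2 / sqrt (real n)"
    proof (intro add_mono order_refl)
      have "D.smoother_trace / real n \<le> (e1 * real n + real Q) / real n"
        using Q[of n] N by (intro divide_right_mono) (simp_all add: D.smoother_trace_def)
      then have "k1 * (D.smoother_trace / real n) \<le> k1 * ((e1 * real n + real Q) / real n)"
        using k1 by (intro mult_left_mono) auto
      also have "\<dots> = k1 * e1 + k1 * real Q / real n" using N by (simp add: field_simps)
      finally show "k1 * (D.smoother_trace / real n) \<le> \<tau> / 8 + k1 * real Q / real n" unfolding e1(2) .
      have le: "D.rough_m \<le> sqrt (real n)" "D.rough_h \<le> sqrt (real n)"
        using rm rh e2 N by (auto intro: order_trans[OF _ mult_left_le_one_le])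
      define x where "x = 1 / (t'\<^sup>2 * sqrt (real n))"
      have sx: "sqrt (real n) / (t'\<^sup>2 * real n) = x" unfolding x_def using N(3) t'(1) N(2)
        by (simp add: field_simps)
      have m1: "D.rough_m / (t'\<^sup>2 * real n) \<le> x" "D.rough_h / (t'\<^sup>2 * real n) \<le> x"
        unfolding sx[symmetric] using le t'(1) N by (auto intro!: divide_right_mono)
      have m2: "D.rough_m / (t' * real n)\<^sup>2 \<le> x"
      proof -
        have "D.rough_m / (t' * real n)\<^sup>2 \<le> D.rough_m / (t'\<^sup>2 * real n)"
          using rm t'(1) N elim(5) by (intro divide_left_mono) (auto simp: power_mult_distrib self_le_power)
        then show ?thesis using m1 by linarith
      qed
      have "36 * \<sigma>02\<^sup>2 * D.rough_m / (t' * real n)\<^sup>2 + 16 * \<sigma>01\<^sup>2 * D.rough_m / (t'\<^sup>2 * real n) + 16 * \<sigma>02\<^sup>2 * D.rough_h / (t'\<^sup>2 * real n)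
        = 36 * \<sigma>02\<^sup>2 * (D.rough_m / (t' * real n)\<^sup>2) + 16 * \<sigma>01\<^sup>2 * (D.rough_m / (t'\<^sup>2 * real n)) + 16 * \<sigma>02\<^sup>2 * (D.rough_h / (t'\<^sup>2 * real n))"
        by simp
      also have "\<dots> \<le> 36 * \<sigma>02\<^sup>2 * x + 16 * \<sigma>01\<^sup>2 * x + 16 * \<sigma>02\<^sup>2 * x"
        using m1 m2 by (intro add_mono mult_left_mono) auto
      also have "\<dots> = k2 / sqrt (real n)" by (simp add: k2_def x_def add_divide_distrib algebra_simps)
      finally show "36 * \<sigma>02\<^sup>2 * D.rough_m / (t' * real n)\<^sup>2 + 16 * \<sigma>01\<^sup>2 * D.rough_m / (t'\<^sup>2 * real n) + 16 * \<sigma>02\<^sup>2 * D.rough_h / (t'\<^sup>2 * real n)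
        \<le> k2 / sqrt (real n)" .
    qed
    also have "\<dots> = \<tau> / 4 + \<tau> / 8 + ((8 + k1 * real Q) / real n + k2 / sqrt (real n))"
      by (simp add: add_divide_distrib)
    also have "\<dots> \<le> \<tau>" using elim(1) \<tau> by linarith
    finally have le: "measure (?law n) (\<Union>(set (D.bad L t'))) \<le> \<tau>" .
    have "\<Union>(set (D.bad L t')) \<in> sets (?law n)"
      by (intro sets.finite_Union) (use D.bad_sets in auto)
    from outer_measure_of_le_measure[OF prob_space.finite_measure[OF D.prob_space_law] this sub] le
    show ?case by (meson ennreal_leI order_trans)
  qed
qed

theorem proposition5:
  fixes P0 :: "(real \<times> real \<times> (real ^ 'd)) measure"
    and PYX :: "real ^ 'd \<Rightarrow> (real \<times> real) measure"
    and \<eta>0 m01 m02 :: "real ^ 'd \<Rightarrow> real"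
    and B \<beta>0 \<sigma>01 \<sigma>02 \<alpha>0\<eta> \<alpha>02 \<alpha>\<eta> :: real
    and prior\<eta> :: "(real ^ 'd \<Rightarrow> real) measure"
  assumes P0: "prob_space P0"
      "sets P0 = sets (borel \<Otimes>\<^sub>M (borel \<Otimes>\<^sub>M (cube_borel :: (real ^ 'd) measure)))"
    and Y_law: "cond_law P0 borel obs_Y (borel \<Otimes>\<^sub>M cube_borel) (\<lambda>\<omega>. (obs_X \<omega>, obs_W \<omega>))
                  (\<lambda>(x, w). normal_law (x * \<beta>0 + \<eta>0 w) (\<sigma>01\<^sup>2))"
    and X_law: "cond_law P0 borel obs_X cube_borel obs_W (\<lambda>w. normal_law (m02 w) (\<sigma>02\<^sup>2))"
    and YX_law: "cond_law P0 (borel \<Otimes>\<^sub>M borel) (\<lambda>\<omega>. (obs_Y \<omega>, obs_X \<omega>)) cube_borel obs_W PYX"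
    and m01: "regression_function P0 obs_Y cube_borel obs_W m01"
    and B: "B > 0" and \<beta>0: "- B < \<beta>0" "\<beta>0 < B"
    and \<sigma>01: "\<sigma>01 > 0" and \<sigma>02: "\<sigma>02 > 0"
    and \<alpha>0\<eta>: "\<alpha>0\<eta> > 0" and \<eta>0: "\<eta>0 \<in> hoelder_space \<alpha>0\<eta> \<inter> sobolev_space \<alpha>0\<eta>"
    and \<alpha>02: "\<alpha>02 > 0" and m02: "m02 \<in> hoelder_space \<alpha>02 \<inter> sobolev_space \<alpha>02"
    and \<alpha>\<eta>: "\<alpha>\<eta> > 0" and prior: "matern_prior \<alpha>\<eta> prior\<eta>"
    and rates: "\<alpha>\<eta> > real CARD('d) / 2"
      "\<alpha>0\<eta> > \<alpha>\<eta> / 2 + real CARD('d) / 4"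
      "\<alpha>02 > \<alpha>\<eta> / 2 + real CARD('d) / 4"
  shows "AE w in (\<Pi>\<^sub>M i\<in>(UNIV :: nat set). distr P0 cube_borel obs_W).
           tendsto_zero_in_prob
             (\<lambda>n. \<Pi>\<^sub>M i\<in>{..<n}. PYX (w i))
             (\<lambda>n d. tv_dist
                (beta_posterior \<sigma>01 (uniform_measure lborel {- B..B}) prior\<eta> n d w)
                (normal_law
                  (\<beta>0 + efficient_shift \<sigma>01 \<beta>0 m01 m02 n d w / sqrt (real n))
                  (1 / real n * inverse (information \<sigma>01 m02 n d w))))"
proof -
  let ?T = "cube_borel :: (real ^ 'd) measure"
  obtain B\<eta> where B\<eta>: "\<And>x. x \<in> unit_cube \<Longrightarrow> \<bar>\<eta>0 x\<bar> \<le> B\<eta>"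
    using hoelder_space_regular(2) \<eta>0 by blast
  obtain Bm where Bm: "\<And>x. x \<in> unit_cube \<Longrightarrow> \<bar>m02 x\<bar> \<le> Bm"
    using hoelder_space_regular(2) m02 by blast
  interpret pop: plm_population P0 ?T \<beta>0 \<sigma>01 \<sigma>02 \<eta>0 m02
    by (rule plm_population.intro[OF P0 hoelder_space_regular(1)[OF IntD1[OF \<eta>0]]
        hoelder_space_regular(1)[OF IntD1[OF m02]] \<sigma>01 \<sigma>02 Y_law X_law])
  have sp: "space ?T = unit_cube" by (simp add: space_restrict_space)
  \<comment> \<open>For almost every single design point both versions, of the conditional law and
    of the regression function, take their model values.\<close>
  have "AE w in pop.PW. w \<in> unit_cube \<and> PYX w = plm_law \<beta>0 \<sigma>01 \<sigma>02 (\<eta>0 w) (m02 w) \<and> m01 w = \<eta>0 w + \<beta>0 * m02 w"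
  proof -
    have "AE w in pop.PW. m01 w = \<eta>0 w + \<beta>0 * m02 w"
      by (rule pop.regression_function_eq[OF m01, where B="max B\<eta> Bm"]) (use B\<eta> Bm sp in \<open>auto simp: le_max_iff_disj\<close>)
    with AE_space pop.conditional_law_unique[OF YX_law] show ?thesis
      by eventually_elim (use sp in simp)
  qed
  \<comment> \<open>A countable union of null sets, one per coordinate, is null; off it the whole
    sequence satisfies the assumptions of the fixed-design statement.\<close>
  then have "AE w in (\<Pi>\<^sub>M i\<in>(UNIV :: nat set). pop.PW). \<forall>i. w i \<in> unit_cube \<and>
      PYX (w i) = plm_law \<beta>0 \<sigma>01 \<sigma>02 (\<eta>0 (w i)) (m02 (w i)) \<and> m01 (w i) = \<eta>0 (w i) + \<beta>0 * m02 (w i)"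
    unfolding AE_all_countable by (intro allI AE_PiM_component pop.prob_space_PW) auto
  then show ?thesis
  proof eventually_elim
    case (elim w)
    have "(\<Pi>\<^sub>M i\<in>{..<n}. PYX (w i)) = (\<Pi>\<^sub>M i\<in>{..<n}. plm_law \<beta>0 \<sigma>01 \<sigma>02 (\<eta>0 (w i)) (m02 (w i)))" for n
      using elim by (intro PiM_cong) auto
    then show ?case
      using bernstein_von_mises_fixed_design[of w m01 \<eta>0 \<beta>0 m02 B \<sigma>01 \<sigma>02 \<alpha>0\<eta> \<alpha>02 \<alpha>\<eta> prior\<eta>] elim
        B \<beta>0 \<sigma>01 \<sigma>02 \<alpha>0\<eta> \<eta>0 \<alpha>02 m02 prior rates by simp
  qed
qed

end
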